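(* Let $\Phi$ be a field of characteristic $0$. Let $\mathcal F_{\mathcal V_0}[X]$ be the free algebra of countable rank, on a countable set $X$ of free generators, in the variety $\mathcal V_0=\mathrm{Var}\,A_0$, and let $J[X]$ be the subalgebra generated by the set $X$ in the algebra $(\mathcal F_{\mathcal V_0}[X])^{(+)}$. Then $J[X]$ is isomorphic to the free algebra $\mathcal F_{J\mathcal V_0}[X]$ of the variety $J\mathcal V_0$ on the set $X$.
   Context: $(x,y,z)=(xy)z-x(yz)$, $[x,y]=xy-yx$. A strongly $(-1,1)$-algebra is an algebra satisfying $(x,y,y)=0$, $(x,y,z)+(y,z,x)+(z,x,y)=0$ and $[[x,y],z]=0$. For an algebra $A$, $A^{(+)}$ is the same vector space with product $\frac12(xy+yx)$. A Jordan algebra is a commutative algebra satisfying $(x^2,y,x)=0$. $\mathrm{Var}\,A$ denotes the variety generated by $A$. $A_0$ is the strongly $(-1,1)$-algebra over $\Phi$ defined (in the variety of strongly $(-1,1)$-algebras) by generators $z,e_1,e_2,\dots$ and relations $e_ie_j+e_je_i=0$, $(e_i,e_j,e_p)=0$, $([e_i,e_j],e_p,e_q)=0$, $((z,e_i,e_j),e_p,e_q)=0$ for all $i,j,p,q$, and $[z,f]=0$ for every nonassociative polynomial $f$ in the generators. The Grassmann envelope of a superalgebra $X=X_0\oplus X_1$ is $G(X)=X_0\otimes G_0\oplus X_1\otimes G_1$, $G=G_0\oplus G_1$ being the associative Grassmann algebra on countably many generators; a Jordan superalgebra is a superalgebra whose Grassmann envelope is a Jordan algebra. $J[z;x]$ is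 the quotient of the free Jordan superalgebra $Jord[z;x]$ over $\Phi$ on one even generator $z$ and one odd generator $x$ by the ideal generated by all $(z,a,b)+(-1)^{|a||b|}(z,b,a)$ with homogeneous $a,b\in Jord[z;x]$. $JF_0$ is the quotient of $J[z;x]$ by the ideal generated by $((z,x,x),x,x)$. $J\mathcal V_0$ is the variety of Jordan algebras generated by $G(JF_0)$. *)

theory Defs
  imports
    "HOL-Algebra.QuotRing"
    "HOL-Algebra.Module"
    "HOL-Algebra.Algebraic_Closure_Type"
    "HOL-Library.Poly_Mapping"
    "HOL-Library.Countable_Set"
    "HOL-Library.Z2"
begin

section \<open>Nonassociative algebras\<close>

text \<open>
  A nonassociative algebra over the field \<open>'k\<close> is carried by a record of type
  \<^typ>\<open>('k, 'a) module\<close>. Algebras are not assumed to have a unit: the field \<^const>\<open>one\<close> of the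
  record is a dummy, and homomorphisms ignore it.
\<close>

locale nonassoc_algebra = module "ring_of_type_algebra :: 'k::field ring" A
  for A :: "('k::field, 'a, 'm) module_scheme" (structure) +
  assumes mult_closed: "\<lbrakk>x \<in> carrier A; y \<in> carrier A\<rbrakk> \<Longrightarrow> x \<otimes> y \<in> carrier A"
    and mult_add_left: "\<lbrakk>x \<in> carrier A; y \<in> carrier A; w \<in> carrier A\<rbrakk>
          \<Longrightarrow> (x \<oplus> y) \<otimes> w = x \<otimes> w \<oplus> y \<otimes> w"
    and mult_add_right: "\<lbrakk>x \<in> carrier A; y \<in> carrier A; w \<in> carrier A\<rbrakk>
          \<Longrightarrow> w \<otimes> (x \<oplus> y) = w \<otimes> x \<oplus> w \<otimes> y"
    and mult_smult_left: "\<lbrakk>x \<in> carrier A; y \<in> carrier A\<rbrakk> \<Longrightarrow> (c \<odot> x) \<otimes> y = c \<odot> (x \<otimes> y)"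
    and mult_smult_right: "\<lbrakk>x \<in> carrier A; y \<in> carrier A\<rbrakk> \<Longrightarrow> x \<otimes> (c \<odot> y) = c \<odot> (x \<otimes> y)"

definition associator :: "('a, 'm) ring_scheme \<Rightarrow> 'a \<Rightarrow> 'a \<Rightarrow> 'a \<Rightarrow> 'a" where
  "associator A x y z = ((x \<otimes>\<^bsub>A\<^esub> y) \<otimes>\<^bsub>A\<^esub> z) \<ominus>\<^bsub>A\<^esub> (x \<otimes>\<^bsub>A\<^esub> (y \<otimes>\<^bsub>A\<^esub> z))"

definition commutator :: "('a, 'm) ring_scheme \<Rightarrow> 'a \<Rightarrow> 'a \<Rightarrow> 'a" where
  "commutator A x y = (x \<otimes>\<^bsub>A\<^esub> y) \<ominus>\<^bsub>A\<^esub> (y \<otimes>\<^bsub>A\<^esub> x)"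

definition alg_hom ::
  "('k::field, 'a, 'm) module_scheme \<Rightarrow> ('k, 'b, 'n) module_scheme \<Rightarrow> ('a \<Rightarrow> 'b) set" where
  "alg_hom A B = {h. h \<in> carrier A \<rightarrow> carrier B
     \<and> (\<forall>x\<in>carrier A. \<forall>y\<in>carrier A. h (x \<oplus>\<^bsub>A\<^esub> y) = h x \<oplus>\<^bsub>B\<^esub> h y)
     \<and> (\<forall>x\<in>carrier A. \<forall>y\<in>carrier A. h (x \<otimes>\<^bsub>A\<^esub> y) = h x \<otimes>\<^bsub>B\<^esub> h y)
     \<and> (\<forall>c. \<forall>x\<in>carrier A. h (c \<odot>\<^bsub>A\<^esub> x) = c \<odot>\<^bsub>B\<^esub> h x)}"

definition alg_isomorphic ::
  "('k::field, 'a, 'm) module_scheme \<Rightarrow> ('k, 'b, 'n) module_scheme \<Rightarrow> bool" where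
  "alg_isomorphic A B \<longleftrightarrow> (\<exists>h\<in>alg_hom A B. bij_betw h (carrier A) (carrier B))"

definition alg_ideal :: "'a set \<Rightarrow> ('k::field, 'a, 'm) module_scheme \<Rightarrow> bool" where
  "alg_ideal I A \<longleftrightarrow> submodule I ring_of_type_algebra A
     \<and> (\<forall>a\<in>carrier A. \<forall>x\<in>I. a \<otimes>\<^bsub>A\<^esub> x \<in> I \<and> x \<otimes>\<^bsub>A\<^esub> a \<in> I)"

definition alg_ideal_gen :: "('k::field, 'a, 'm) module_scheme \<Rightarrow> 'a set \<Rightarrow> 'a set" where
  "alg_ideal_gen A S = \<Inter>{I. alg_ideal I A \<and> S \<subseteq> I}"

definition alg_quot :: "('k::field, 'a, 'm) module_scheme \<Rightarrow> 'a set \<Rightarrow> ('k, 'a set) module" where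
  "alg_quot A I = ring.extend (A Quot I)
     (module.fields (\<lambda>c U. \<Union>u\<in>U. I +>\<^bsub>A\<^esub> (c \<odot>\<^bsub>A\<^esub> u)))"

definition subalgebra :: "'a set \<Rightarrow> ('k::field, 'a, 'm) module_scheme \<Rightarrow> bool" where
  "subalgebra B A \<longleftrightarrow> submodule B ring_of_type_algebra A
     \<and> (\<forall>x\<in>B. \<forall>y\<in>B. x \<otimes>\<^bsub>A\<^esub> y \<in> B)"

definition subalgebra_gen ::
  "('k::field, 'a, 'm) module_scheme \<Rightarrow> 'a set \<Rightarrow> ('k, 'a, 'm) module_scheme" where
  "subalgebra_gen A S = A\<lparr>carrier := \<Inter>{B. subalgebra B A \<and> S \<subseteq> B}\<rparr>"

definition plus_algebra ::
  "('k::field, 'a, 'm) module_scheme \<Rightarrow> ('k, 'a, 'm) module_scheme" where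
  "plus_algebra A =
     A\<lparr>monoid.mult := \<lambda>x y. (1 / 2) \<odot>\<^bsub>A\<^esub> ((x \<otimes>\<^bsub>A\<^esub> y) \<oplus>\<^bsub>A\<^esub> (y \<otimes>\<^bsub>A\<^esub> x))\<rparr>"

definition jordan_algebra :: "('k::field, 'a, 'm) module_scheme \<Rightarrow> bool" where
  "jordan_algebra A \<longleftrightarrow> nonassoc_algebra A
     \<and> (\<forall>x\<in>carrier A. \<forall>y\<in>carrier A. x \<otimes>\<^bsub>A\<^esub> y = y \<otimes>\<^bsub>A\<^esub> x)
     \<and> (\<forall>x\<in>carrier A. \<forall>y\<in>carrier A. associator A (x \<otimes>\<^bsub>A\<^esub> x) y x = \<zero>\<^bsub>A\<^esub>)"


section \<open>Free algebras, identities and varieties\<close>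

datatype (letters: 'x) word = Gen 'x | Mul "'x word" "'x word"

text \<open>
  Nonassociative polynomials without constant term: \<open>'k\<close>-linear combinations of nonassociative
  (parenthesized, nonempty) words.
\<close>

type_synonym ('x, 'k) napoly = "'x word \<Rightarrow>\<^sub>0 'k"

definition napoly_mult ::
  "('x, 'k::field) napoly \<Rightarrow> ('x, 'k) napoly \<Rightarrow> ('x, 'k) napoly" where
  "napoly_mult p q = (\<Sum>u\<in>Poly_Mapping.keys p. \<Sum>v\<in>Poly_Mapping.keys q.
     Poly_Mapping.single (Mul u v) (Poly_Mapping.lookup p u * Poly_Mapping.lookup q v))"

definition free_algebra :: "'x set \<Rightarrow> ('k::field, ('x, 'k) napoly) module" where
  "free_algebra \<X> =
     \<lparr>carrier = {p. \<forall>w\<in>Poly_Mapping.keys p. letters w \<subseteq> \<X>}, monoid.mult = napoly_mult, one = 0,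
      ring.zero = 0, add = (+), module.smult = \<lambda>c. Poly_Mapping.map ((*) c)\<rparr>"

definition gen :: "'x \<Rightarrow> ('x, 'k::field) napoly" where
  "gen x = Poly_Mapping.single (Gen x) 1"

text \<open>
  Homomorphisms from the free algebra on the variables \<open>0, 1, 2, \<dots>\<close> to an algebra are exactly the
  substitutions of elements of the algebra for the variables. A variety is presented by a set of
  identities in these variables; \<^term>\<open>identities A\<close> presents the variety \<open>Var A\<close> generated by
  \<open>A\<close>, which consists of all algebras satisfying every identity of \<open>A\<close>.
\<close>

definition identities :: "('k::field, 'a, 'm) module_scheme \<Rightarrow> (nat, 'k) napoly set" where
  "identities A = {f. \<forall>h\<in>alg_hom (free_algebra UNIV) A. h f = \<zero>\<^bsub>A\<^esub>}"

definition verbal_ideal :: "(nat, 'k::field) napoly set \<Rightarrow> 'x set \<Rightarrow> ('x, 'k) napoly set" where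
  "verbal_ideal T \<X> = alg_ideal_gen (free_algebra \<X>)
     {h f | h f. f \<in> T \<and> h \<in> alg_hom (free_algebra UNIV) (free_algebra \<X>)}"

definition relatively_free ::
  "(nat, 'k::field) napoly set \<Rightarrow> 'x set \<Rightarrow> ('k, ('x, 'k) napoly set) module" where
  "relatively_free T \<X> = alg_quot (free_algebra \<X>) (verbal_ideal T \<X>)"

definition relatively_free_gen ::
  "(nat, 'k::field) napoly set \<Rightarrow> 'x set \<Rightarrow> 'x \<Rightarrow> ('x, 'k) napoly set" where
  "relatively_free_gen T \<X> x = verbal_ideal T \<X> +>\<^bsub>free_algebra \<X>\<^esub> gen x"


section \<open>The algebra \<open>A\<^sub>0\<close> and the variety \<open>\<V>\<^sub>0\<close>\<close>

definition strongly_m11 :: "(nat, 'k::field) napoly set" where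
  "strongly_m11 =
     (let F = free_algebra UNIV; x = gen 0; y = gen 1; z = gen 2
      in {associator F x y y,
          associator F x y z \<oplus>\<^bsub>F\<^esub> associator F y z x \<oplus>\<^bsub>F\<^esub> associator F z x y,
          commutator F (commutator F x y) z})"

text \<open>The generator \<open>e\<^sub>i\<close>, \<open>i = 1, 2, \<dots>\<close>, is \<open>E (i - 1)\<close>.\<close>

datatype A0_generator = Z | E nat

definition A0_relations :: "(A0_generator, 'k::field) napoly set set" where
  "A0_relations =
     (let F = relatively_free strongly_m11 UNIV;
          z = relatively_free_gen strongly_m11 UNIV Z;
          e = (\<lambda>i. relatively_free_gen strongly_m11 UNIV (E i))
      in {(e i \<otimes>\<^bsub>F\<^esub> e j) \<oplus>\<^bsub>F\<^esub> (e j \<otimes>\<^bsub>F\<^esub> e i) | i j. True}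
       \<union> {associator F (e i) (e j) (e p) | i j p. True}
       \<union> {associator F (commutator F (e i) (e j)) (e p) (e q) | i j p q. True}
       \<union> {associator F (associator F z (e i) (e j)) (e p) (e q) | i j p q. True}
       \<union> {commutator F z f | f. f \<in> carrier F})"

definition A0 :: "('k::field, (A0_generator, 'k) napoly set set) module" where
  "A0 = alg_quot (relatively_free strongly_m11 UNIV)
          (alg_ideal_gen (relatively_free strongly_m11 UNIV) A0_relations)"

definition V0 :: "(nat, 'k::field) napoly set" where
  "V0 = identities A0"


section \<open>Superalgebras\<close>

record ('k, 'a) superalg = "('k, 'a) module" +
  part :: "bit \<Rightarrow> 'a set"

locale superalgebra = nonassoc_algebra A
  for A :: "('k::field, 'a, 'm) superalg_scheme" (structure) +
  assumes part_submodule: "submodule (part A i) ring_of_type_algebra A"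
    and part_sum: "carrier A = part A 0 <+> part A 1"
    and part_disjoint: "part A 0 \<inter> part A 1 = {\<zero>}"
    and part_mult: "\<lbrakk>x \<in> part A i; y \<in> part A j\<rbrakk> \<Longrightarrow> x \<otimes> y \<in> part A (i + j)"

text \<open>
  The Grassmann algebra \<open>G\<close> (with unit) on the generators \<open>\<xi>\<^sub>0, \<xi>\<^sub>1, \<dots>\<close> has the basis of all
  \<open>\<xi>\<^sub>S = \<xi>\<^sub>s\<^sub>1 \<cdots> \<xi>\<^sub>s\<^sub>n\<close>, where \<open>S = {s\<^sub>1 < \<cdots> < s\<^sub>n}\<close> is a finite set, with \<open>\<xi>\<^sub>S\<close> of parity
  \<open>n\<close>. If \<open>S\<close> and \<open>T\<close> are disjoint then \<open>\<xi>\<^sub>S \<xi>\<^sub>T = \<plusminus> \<xi>\<^sub>S\<^sub>\<union>\<^sub>T\<close>, with sign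
  \<open>grassmann_sign S T\<close>, and otherwise \<open>\<xi>\<^sub>S \<xi>\<^sub>T = 0\<close>.
\<close>

definition grassmann_sign :: "nat set \<Rightarrow> nat set \<Rightarrow> 'k::field" where
  "grassmann_sign S T = (- 1) ^ card {(s, t). s \<in> S \<and> t \<in> T \<and> t < s}"

text \<open>
  The even and odd components of a superalgebra \<open>A\<close> are \<open>part A 0\<close> and \<open>part A 1\<close>. Its Grassmann
  envelope is \<open>part A 0 \<otimes> G\<^sub>0 \<oplus> part A 1 \<otimes> G\<^sub>1\<close>: the tensor \<open>\<Sum>\<^sub>S a\<^sub>S \<otimes> \<xi>\<^sub>S\<close> is represented by the
  finitely supported family \<open>S \<mapsto> a\<^sub>S\<close>, where \<open>a\<^sub>S\<close> has the parity of \<open>\<xi>\<^sub>S\<close>, and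
  \<open>(a \<otimes> \<xi>\<^sub>S) (b \<otimes> \<xi>\<^sub>T) = a b \<otimes> \<xi>\<^sub>S \<xi>\<^sub>T\<close>. At an infinite index \<open>U\<close> the sum in the product
  ranges over an infinite set, so it is zero by the convention of \<^const>\<open>finsum\<close>.
\<close>

definition grassmann_envelope ::
  "('k::field, 'a, 'm) superalg_scheme \<Rightarrow> ('k, nat set \<Rightarrow> 'a) module" where
  "grassmann_envelope A =
     \<lparr>carrier = {f. (\<forall>S. f S \<in> part A (of_nat (card S)))
                  \<and> (\<forall>S. infinite S \<longrightarrow> f S = \<zero>\<^bsub>A\<^esub>) \<and> finite {S. f S \<noteq> \<zero>\<^bsub>A\<^esub>}},
      monoid.mult = \<lambda>f g U. finsum A
        (\<lambda>S. grassmann_sign S (U - S) \<odot>\<^bsub>A\<^esub> (f S \<otimes>\<^bsub>A\<^esub> g (U - S))) (Pow U),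
      one = \<lambda>S. \<zero>\<^bsub>A\<^esub>,
      ring.zero = \<lambda>S. \<zero>\<^bsub>A\<^esub>,
      add = \<lambda>f g S. f S \<oplus>\<^bsub>A\<^esub> g S,
      module.smult = \<lambda>c f S. c \<odot>\<^bsub>A\<^esub> f S\<rparr>"

definition jordan_superalgebra :: "('k::field, 'a, 'm) superalg_scheme \<Rightarrow> bool" where
  "jordan_superalgebra A \<longleftrightarrow> superalgebra A \<and> jordan_algebra (grassmann_envelope A)"

definition super_quot ::
  "('k::field, 'a, 'm) superalg_scheme \<Rightarrow> 'a set \<Rightarrow> ('k, 'a set) superalg" where
  "super_quot A I = module.extend (alg_quot A I)
     (superalg.fields (\<lambda>i. (\<lambda>a. I +>\<^bsub>A\<^esub> a) ` part A i))"


section \<open>The superalgebra \<open>JF\<^sub>0\<close> and the variety \<open>J\<V>\<^sub>0\<close>\<close>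

text \<open>\<open>Ev\<close> is the even generator \<open>z\<close>, \<open>Od\<close> is the odd generator \<open>x\<close>.\<close>

datatype super_generator = Ev | Od

primrec word_parity :: "super_generator word \<Rightarrow> bit" where
  "word_parity (Gen g) = (case g of Ev \<Rightarrow> 0 | Od \<Rightarrow> 1)"
| "word_parity (Mul u v) = word_parity u + word_parity v"

definition free_superalgebra :: "('k::field, (super_generator, 'k) napoly) superalg" where
  "free_superalgebra = module.extend (free_algebra UNIV)
     (superalg.fields (\<lambda>i. {p. \<forall>w\<in>Poly_Mapping.keys p. word_parity w = i}))"

text \<open>
  The free Jordan superalgebra \<open>Jord[z;x]\<close> is the largest quotient of the free superalgebra that is
  a Jordan superalgebra.
\<close>

definition jordan_super_ideal :: "(super_generator, 'k::field) napoly set" where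
  "jordan_super_ideal = \<Inter>{I. alg_ideal I free_superalgebra
     \<and> jordan_superalgebra (super_quot free_superalgebra I)}"

definition Jord :: "('k::field, (super_generator, 'k) napoly set) superalg" where
  "Jord = super_quot free_superalgebra jordan_super_ideal"

definition Jord_gen :: "super_generator \<Rightarrow> (super_generator, 'k::field) napoly set" where
  "Jord_gen g = jordan_super_ideal +>\<^bsub>free_superalgebra\<^esub> gen g"

definition Jzx_ideal :: "(super_generator, 'k::field) napoly set set" where
  "Jzx_ideal = alg_ideal_gen Jord
     {associator Jord (Jord_gen Ev) a b
        \<oplus>\<^bsub>Jord\<^esub> ((if i = 1 \<and> j = 1 then - 1 else 1) \<odot>\<^bsub>Jord\<^esub> associator Jord (Jord_gen Ev) b a)
      | a b i j. a \<in> part Jord i \<and> b \<in> part Jord j}"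

definition Jzx :: "('k::field, (super_generator, 'k) napoly set set) superalg" where
  "Jzx = super_quot Jord Jzx_ideal"

definition Jzx_gen :: "super_generator \<Rightarrow> (super_generator, 'k::field) napoly set set" where
  "Jzx_gen g = Jzx_ideal +>\<^bsub>Jord\<^esub> Jord_gen g"

definition JF0 :: "('k::field, (super_generator, 'k) napoly set set set) superalg" where
  "JF0 = (let z = Jzx_gen Ev; x = Jzx_gen Od
     in super_quot Jzx (alg_ideal_gen Jzx {associator Jzx (associator Jzx z x x) x x}))"

definition JV0 :: "(nat, 'k::field) napoly set" where
  "JV0 = identities (grassmann_envelope JF0)"

end

theory Submission
  imports Defs "HOL-Library.Product_Plus" "HOL-Computational_Algebra.Polynomial"
begin

text \<open>
  For every nonassociative algebra \<open>A\<close>, the subalgebra of the plus algebra of the free algebra of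
  \<open>Var A\<close> generated by the free generators is free in the variety generated by the plus algebra of
  \<open>A\<close>; so it suffices that the plus algebra of \<open>A\<^sub>0\<close> and the Grassmann envelope of \<open>JF\<^sub>0\<close> have
  the same identities. Both are compared with superalgebras of vector type on \<open>\<Phi>[t] \<oplus> \<Phi>[t]\<close>:
  one is strongly \<open>(-1,1)\<close> with odd product \<open>pq + 2p'q + pq'\<close>, the other is Jordan with odd
  product \<open>(p'q - pq')/2\<close>, and the plus algebra of the Grassmann envelope of the first is the
  Grassmann envelope of the second. Normal forms for \<open>A\<^sub>0\<close> and \<open>JF\<^sub>0\<close> show that the
  homomorphisms sending \<open>z\<close> to \<open>ct\<close>, where \<open>c\<close> runs over the scalars, separate the elements of
  \<open>A\<^sub>0\<close> and of \<open>JF\<^sub>0\<close>, hence the identities of the vector type envelopes hold there. Conversely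
  the vector type Jordan superalgebra is an image of \<open>JF\<^sub>0\<close>, while \<open>A\<^sub>0\<close> maps onto the elements
  without constant term; an identity of the latter is an identity of the whole envelope because all
  arguments can be multiplied by nilpotent central elements.
\<close>

section \<open>Homomorphisms, ideals and quotients\<close>

text \<open>The coefficients of the odd product are forced up to scale: for
  \<open>pq + a p'q + b pq'\<close> and even f, the associators (p,f,q) and (p,q,f) are (a-b)f'pq
  and -b f'pq, so right alternativity demands a = 2b. The symmetric term pq drops out of the
  super-symmetrized product, but it keeps e_i e_j nonzero. One homomorphism z -> t cannot separate:
  a normal form with i factors z and j factors of type (z,e,e) goes to a multiple of t^i, whatever j
  is. With z -> ct this multiple is proportional to c^(i+j), and a Vandermonde argument in c
  recovers j. Neither presentation comes with a multiplication table. The normal forms rest on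
  associator calculus for distinguished even elements: those commuting with everything in the (-1,1)
  case, those c with (c,a,b) = -(c,b,a) in the Jordan case. They associate with each other, can be
  pulled out of associators and generate more of their kind. No fixed nilpotent factor would do in
  the last step, since it annihilates part of the envelope; factors of growing support are
  used.\<close>

lemma ring_of_type_algebra_simps [simp]:
  "carrier (ring_of_type_algebra :: 'k::field ring) = UNIV"
  "x \<oplus>\<^bsub>ring_of_type_algebra\<^esub> y = (x + y :: 'k)"
  "x \<otimes>\<^bsub>ring_of_type_algebra\<^esub> y = (x * y :: 'k)"
  "\<zero>\<^bsub>ring_of_type_algebra\<^esub> = (0 :: 'k)"
  "\<one>\<^bsub>ring_of_type_algebra\<^esub> = (1 :: 'k)"
  by (simp_all add: ring_of_type_algebra_def)

lemma ring_of_type_algebra_uminus [simp]: "\<ominus>\<^bsub>ring_of_type_algebra\<^esub> x = - (x :: 'k::field)"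
proof -
  interpret R: cring "ring_of_type_algebra :: 'k ring" by (rule cring_from_type_algebra)
  show ?thesis
    by (rule R.minus_equality) auto
qed

lemma nonassoc_algebraI:
  fixes A :: "('k::field, 'a, 'm) module_scheme" (structure)
  assumes "abelian_group A"
    and "\<And>c x. x \<in> carrier A \<Longrightarrow> c \<odot> x \<in> carrier A"
    and "\<And>c d x. x \<in> carrier A \<Longrightarrow> (c + d) \<odot> x = c \<odot> x \<oplus> d \<odot> x"
    and "\<And>c x y. \<lbrakk>x \<in> carrier A; y \<in> carrier A\<rbrakk> \<Longrightarrow> c \<odot> (x \<oplus> y) = c \<odot> x \<oplus> c \<odot> y"
    and "\<And>c d x. x \<in> carrier A \<Longrightarrow> (c * d) \<odot> x = c \<odot> (d \<odot> x)"
    and "\<And>x. x \<in> carrier A \<Longrightarrow> 1 \<odot> x = x"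
    and "\<And>x y. \<lbrakk>x \<in> carrier A; y \<in> carrier A\<rbrakk> \<Longrightarrow> x \<otimes> y \<in> carrier A"
    and "\<And>x y w. \<lbrakk>x \<in> carrier A; y \<in> carrier A; w \<in> carrier A\<rbrakk>
          \<Longrightarrow> (x \<oplus> y) \<otimes> w = x \<otimes> w \<oplus> y \<otimes> w"
    and "\<And>x y w. \<lbrakk>x \<in> carrier A; y \<in> carrier A; w \<in> carrier A\<rbrakk>
          \<Longrightarrow> w \<otimes> (x \<oplus> y) = w \<otimes> x \<oplus> w \<otimes> y"
    and "\<And>c x y. \<lbrakk>x \<in> carrier A; y \<in> carrier A\<rbrakk> \<Longrightarrow> (c \<odot> x) \<otimes> y = c \<odot> (x \<otimes> y)"
    and "\<And>c x y. \<lbrakk>x \<in> carrier A; y \<in> carrier A\<rbrakk> \<Longrightarrow> x \<otimes> (c \<odot> y) = c \<odot> (x \<otimes> y)"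
  shows "nonassoc_algebra A"
  by (intro nonassoc_algebra.intro nonassoc_algebra_axioms.intro moduleI cring_from_type_algebra)
     (simp_all add: assms)

lemma abelian_group_cong:
  assumes "abelian_group A" "carrier B = carrier A"
    "\<zero>\<^bsub>B\<^esub> = \<zero>\<^bsub>A\<^esub>" "\<And>x y. x \<oplus>\<^bsub>B\<^esub> y = x \<oplus>\<^bsub>A\<^esub> y"
  shows "abelian_group B"
proof -
  interpret A: abelian_group A by fact
  show ?thesis
    by (rule abelian_groupI)
       (use A.l_neg in \<open>auto simp: assms A.a_ac intro!: bexI[of _ "\<ominus>\<^bsub>A\<^esub> x" for x]\<close>)
qed

context nonassoc_algebra begin

lemma smult_closed' [simp, intro]: "x \<in> carrier A \<Longrightarrow> c \<odot> x \<in> carrier A"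
  using smult_closed[of c x] by simp

lemma mult_closed' [simp, intro]: "\<lbrakk>x \<in> carrier A; y \<in> carrier A\<rbrakk> \<Longrightarrow> x \<otimes> y \<in> carrier A"
  by (rule mult_closed)

lemma smult_add_left: "x \<in> carrier A \<Longrightarrow> (c + d) \<odot> x = c \<odot> x \<oplus> d \<odot> x"
  using smult_l_distr[of c d x] by simp

lemma smult_add_right:
  "\<lbrakk>x \<in> carrier A; y \<in> carrier A\<rbrakk> \<Longrightarrow> c \<odot> (x \<oplus> y) = c \<odot> x \<oplus> c \<odot> y"
  using smult_r_distr[of c x y] by simp

lemma smult_smult: "x \<in> carrier A \<Longrightarrow> c \<odot> (d \<odot> x) = (c * d) \<odot> x"
  using smult_assoc1[of c d x] by simp

lemma one_smult [simp]: "x \<in> carrier A \<Longrightarrow> 1 \<odot> x = x"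
  using smult_one[of x] by simp

lemma zero_smult [simp]: "x \<in> carrier A \<Longrightarrow> 0 \<odot> x = \<zero>"
  using smult_l_null[of x] by simp

lemma smult_zero [simp]: "c \<odot> \<zero> = \<zero>"
  using smult_r_null[of c] by simp

lemma smult_minus_left: "x \<in> carrier A \<Longrightarrow> (- c) \<odot> x = \<ominus> (c \<odot> x)"
  using smult_l_minus[of c x] by simp

lemma smult_minus_right: "x \<in> carrier A \<Longrightarrow> c \<odot> (\<ominus> x) = \<ominus> (c \<odot> x)"
  using smult_r_minus[of c x] by simp

lemma uminus_eq_smult: "x \<in> carrier A \<Longrightarrow> \<ominus> x = (- 1) \<odot> x"
  by (simp add: smult_minus_left)

lemma minus_eq_zero_iff:
  assumes "x \<in> carrier A" "y \<in> carrier A" shows "x \<ominus> y = \<zero> \<longleftrightarrow> x = y"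
  by (metis M.minus_eq M.minus_equality M.minus_minus M.r_neg M.a_inv_closed assms)

lemma smult_eq_zeroD:
  assumes "c \<noteq> 0" "x \<in> carrier A" "c \<odot> x = \<zero>" shows "x = \<zero>"
proof -
  have "inverse c \<odot> (c \<odot> x) = (inverse c * c) \<odot> x" using assms(2) by (rule smult_smult)
  then show ?thesis using assms by simp
qed

lemma zero_mult [simp]: assumes "x \<in> carrier A" shows "\<zero> \<otimes> x = \<zero>"
  using mult_smult_left[of \<zero> x 0] assms by simp

lemma mult_zero [simp]: assumes "x \<in> carrier A" shows "x \<otimes> \<zero> = \<zero>"
  using mult_smult_right[of x \<zero> 0] assms by simp

lemma uminus_mult: "\<lbrakk>x \<in> carrier A; y \<in> carrier A\<rbrakk> \<Longrightarrow> (\<ominus> x) \<otimes> y = \<ominus> (x \<otimes> y)"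
  by (simp add: uminus_eq_smult mult_smult_left)

lemma mult_uminus: "\<lbrakk>x \<in> carrier A; y \<in> carrier A\<rbrakk> \<Longrightarrow> x \<otimes> (\<ominus> y) = \<ominus> (x \<otimes> y)"
  by (simp add: uminus_eq_smult mult_smult_right)

lemma associator_closed [simp, intro]:
  "\<lbrakk>x \<in> carrier A; y \<in> carrier A; z \<in> carrier A\<rbrakk> \<Longrightarrow> associator A x y z \<in> carrier A"
  by (simp add: associator_def)

lemma commutator_closed [simp, intro]:
  "\<lbrakk>x \<in> carrier A; y \<in> carrier A\<rbrakk> \<Longrightarrow> commutator A x y \<in> carrier A"
  by (simp add: commutator_def)

lemma nonassoc_algebra_cong:
  fixes B :: "('k, 'a, 'n) module_scheme"
  assumes "carrier B = carrier A" "\<zero>\<^bsub>B\<^esub> = \<zero>" "add B = add A" "monoid.mult B = monoid.mult A"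
    "module.smult B = module.smult A"
  shows "nonassoc_algebra B"
  by (rule nonassoc_algebraI)
     (use assms in \<open>auto intro: abelian_group_cong[OF M.abelian_group_axioms] simp: smult_add_left
        smult_add_right smult_smult mult_add_left mult_add_right mult_smult_left mult_smult_right\<close>)

lemma alg_ideal_iff:
  "alg_ideal I A \<longleftrightarrow> I \<subseteq> carrier A \<and> \<zero> \<in> I \<and> (\<forall>x\<in>I. \<forall>y\<in>I. x \<oplus> y \<in> I) \<and> (\<forall>c. \<forall>x\<in>I. c \<odot> x \<in> I)
     \<and> (\<forall>a\<in>carrier A. \<forall>x\<in>I. a \<otimes> x \<in> I \<and> x \<otimes> a \<in> I)" (is "?L \<longleftrightarrow> ?R")
proof
  assume L: ?L
  then have s: "submodule I ring_of_type_algebra A" by (simp add: alg_ideal_def)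
  interpret submodule I ring_of_type_algebra A by (rule s)
  show ?R using L smult_closed one_closed m_closed subset by (auto simp: alg_ideal_def)
next
  assume R: ?R
  have "submodule I ring_of_type_algebra A"
    by (rule submoduleI) (use R in \<open>auto simp: uminus_eq_smult subset_iff\<close>)
  with R show ?L by (simp add: alg_ideal_def)
qed

lemma subalgebra_iff:
  "subalgebra I A \<longleftrightarrow> I \<subseteq> carrier A \<and> \<zero> \<in> I \<and> (\<forall>x\<in>I. \<forall>y\<in>I. x \<oplus> y \<in> I) \<and> (\<forall>c. \<forall>x\<in>I. c \<odot> x \<in> I)
     \<and> (\<forall>a\<in>I. \<forall>x\<in>I. a \<otimes> x \<in> I)" (is "?L \<longleftrightarrow> ?R")
proof
  assume L: ?L
  then have s: "submodule I ring_of_type_algebra A" by (simp add: subalgebra_def)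
  interpret submodule I ring_of_type_algebra A by (rule s)
  show ?R using L smult_closed one_closed m_closed subset by (auto simp: subalgebra_def)
next
  assume R: ?R
  have "submodule I ring_of_type_algebra A"
    by (rule submoduleI) (use R in \<open>auto simp: uminus_eq_smult subset_iff\<close>)
  with R show ?L by (simp add: subalgebra_def)
qed

lemma submodule_iff:
  "submodule I ring_of_type_algebra A \<longleftrightarrow>
     I \<subseteq> carrier A \<and> \<zero> \<in> I \<and> (\<forall>x\<in>I. \<forall>y\<in>I. x \<oplus> y \<in> I) \<and> (\<forall>c. \<forall>x\<in>I. c \<odot> x \<in> I)" (is "?L \<longleftrightarrow> ?R")
proof
  assume s: ?L
  interpret submodule I ring_of_type_algebra A by (rule s)
  show ?R using smult_closed one_closed m_closed subset by auto
next
  assume R: ?R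
  show ?L
    by (rule submoduleI) (use R in \<open>auto simp: uminus_eq_smult subset_iff\<close>)
qed

lemma carrier_alg_ideal: "alg_ideal (carrier A) A"
  by (simp add: alg_ideal_iff)

lemma alg_ideal_Inter:
  assumes "\<And>I. I \<in> \<I> \<Longrightarrow> alg_ideal I A" "\<I> \<noteq> {}"
  shows "alg_ideal (\<Inter>\<I>) A"
  using assms unfolding alg_ideal_iff by blast

lemma alg_ideal_gen_ideal: "S \<subseteq> carrier A \<Longrightarrow> alg_ideal (alg_ideal_gen A S) A"
  unfolding alg_ideal_gen_def by (rule alg_ideal_Inter) (use carrier_alg_ideal in auto)

lemma alg_ideal_gen_incl: "S \<subseteq> alg_ideal_gen A S"
  by (auto simp: alg_ideal_gen_def)

lemma alg_ideal_gen_least: "\<lbrakk>alg_ideal I A; S \<subseteq> I\<rbrakk> \<Longrightarrow> alg_ideal_gen A S \<subseteq> I"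
  by (auto simp: alg_ideal_gen_def)

lemma plus_algebra_simps [simp]:
  "carrier (plus_algebra A) = carrier A" "add (plus_algebra A) = add A"
  "\<zero>\<^bsub>plus_algebra A\<^esub> = \<zero>" "module.smult (plus_algebra A) = module.smult A"
  "x \<otimes>\<^bsub>plus_algebra A\<^esub> y = (1 / 2) \<odot> (x \<otimes> y \<oplus> y \<otimes> x)"
  by (simp_all add: plus_algebra_def)

lemma nonassoc_algebra_plus: "nonassoc_algebra (plus_algebra A)"
proof (rule nonassoc_algebraI)
  show "abelian_group (plus_algebra A)"
    by (rule abelian_group_cong[OF M.abelian_group_axioms]) simp_all
qed (simp_all add: smult_add_left smult_add_right smult_smult mult_add_left mult_add_right
      mult_smult_left mult_smult_right M.a_ac mult.commute)

end

lemma alg_homI: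
  assumes "\<And>x. x \<in> carrier A \<Longrightarrow> h x \<in> carrier B"
    "\<And>x y. \<lbrakk>x \<in> carrier A; y \<in> carrier A\<rbrakk> \<Longrightarrow> h (x \<oplus>\<^bsub>A\<^esub> y) = h x \<oplus>\<^bsub>B\<^esub> h y"
    "\<And>x y. \<lbrakk>x \<in> carrier A; y \<in> carrier A\<rbrakk> \<Longrightarrow> h (x \<otimes>\<^bsub>A\<^esub> y) = h x \<otimes>\<^bsub>B\<^esub> h y"
    "\<And>c x. x \<in> carrier A \<Longrightarrow> h (c \<odot>\<^bsub>A\<^esub> x) = c \<odot>\<^bsub>B\<^esub> h x"
  shows "h \<in> alg_hom A B"
  using assms by (auto simp: alg_hom_def)

lemma alg_homD:
  assumes "h \<in> alg_hom A B"
  shows "x \<in> carrier A \<Longrightarrow> h x \<in> carrier B"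
    "\<lbrakk>x \<in> carrier A; y \<in> carrier A\<rbrakk> \<Longrightarrow> h (x \<oplus>\<^bsub>A\<^esub> y) = h x \<oplus>\<^bsub>B\<^esub> h y"
    "\<lbrakk>x \<in> carrier A; y \<in> carrier A\<rbrakk> \<Longrightarrow> h (x \<otimes>\<^bsub>A\<^esub> y) = h x \<otimes>\<^bsub>B\<^esub> h y"
    "x \<in> carrier A \<Longrightarrow> h (c \<odot>\<^bsub>A\<^esub> x) = c \<odot>\<^bsub>B\<^esub> h x"
  using assms by (auto simp: alg_hom_def)

lemma alg_hom_compose:
  assumes "h \<in> alg_hom A B" "g \<in> alg_hom B C"
  shows "(\<lambda>x. g (h x)) \<in> alg_hom A C"
  by (rule alg_homI) (simp_all add: alg_homD[OF assms(1)] alg_homD[OF assms(2)])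

lemma alg_hom_id: "(\<lambda>x. x) \<in> alg_hom A A"
  by (auto simp: alg_hom_def)

locale nonassoc_hom = A: nonassoc_algebra A + B: nonassoc_algebra B
  for A :: "('k::field, 'a, 'm) module_scheme" and B :: "('k, 'b, 'n) module_scheme" +
  fixes h assumes hom: "h \<in> alg_hom A B"
begin

lemmas hom_closed [simp, intro] = alg_homD(1)[OF hom]
  and hom_add [simp] = alg_homD(2)[OF hom]
  and hom_mult [simp] = alg_homD(3)[OF hom]
  and hom_smult [simp] = alg_homD(4)[OF hom]

lemma hom_zero [simp]: "h \<zero>\<^bsub>A\<^esub> = \<zero>\<^bsub>B\<^esub>"
  using hom_smult[of "\<zero>\<^bsub>A\<^esub>" 0] by simp

lemma hom_uminus [simp]: "x \<in> carrier A \<Longrightarrow> h (\<ominus>\<^bsub>A\<^esub> x) = \<ominus>\<^bsub>B\<^esub> h x"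
  by (simp add: A.uminus_eq_smult B.uminus_eq_smult)

lemma hom_minus [simp]:
  "\<lbrakk>x \<in> carrier A; y \<in> carrier A\<rbrakk> \<Longrightarrow> h (x \<ominus>\<^bsub>A\<^esub> y) = h x \<ominus>\<^bsub>B\<^esub> h y"
  by (simp add: a_minus_def)

lemma hom_associator [simp]:
  "\<lbrakk>x \<in> carrier A; y \<in> carrier A; z \<in> carrier A\<rbrakk>
    \<Longrightarrow> h (associator A x y z) = associator B (h x) (h y) (h z)"
  by (simp add: associator_def)

lemma hom_commutator [simp]:
  "\<lbrakk>x \<in> carrier A; y \<in> carrier A\<rbrakk> \<Longrightarrow> h (commutator A x y) = commutator B (h x) (h y)"
  by (simp add: commutator_def)

lemma kernel_ideal: "alg_ideal {x \<in> carrier A. h x = \<zero>\<^bsub>B\<^esub>} A"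
  by (auto simp: A.alg_ideal_iff)

lemma hom_plus: "h \<in> alg_hom (plus_algebra A) (plus_algebra B)"
  by (rule alg_homI) (simp_all add: plus_algebra_def)

lemma hom_eq_iff: "\<lbrakk>x \<in> carrier A; y \<in> carrier A\<rbrakk> \<Longrightarrow> h x = h y \<longleftrightarrow> h (x \<ominus>\<^bsub>A\<^esub> y) = \<zero>\<^bsub>B\<^esub>"
  by (simp add: B.minus_eq_zero_iff)

lemma hom_finsum:
  "(\<And>i. i \<in> S \<Longrightarrow> f i \<in> carrier A) \<Longrightarrow> h (finsum A f S) = finsum B (\<lambda>i. h (f i)) S"
proof (induction S rule: infinite_finite_induct)
  case (insert i S)
  then show ?case by (subst A.finsum_insert, auto)+
qed auto

end

lemma nonassoc_homI:
  "\<lbrakk>nonassoc_algebra A; nonassoc_algebra B; h \<in> alg_hom A B\<rbrakk> \<Longrightarrow> nonassoc_hom A B h"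
  by (simp add: nonassoc_hom_def nonassoc_hom_axioms_def)

locale alg_quotient = nonassoc_algebra A
  for A :: "('k::field, 'a, 'm) module_scheme" (structure) +
  fixes I assumes ideal: "alg_ideal I A"
begin

lemma I_simps: "x \<in> I \<Longrightarrow> x \<in> carrier A" "\<zero> \<in> I" "\<lbrakk>x \<in> I; y \<in> I\<rbrakk> \<Longrightarrow> x \<oplus> y \<in> I" "x \<in> I \<Longrightarrow> c \<odot> x \<in> I"
  "\<lbrakk>a \<in> carrier A; x \<in> I\<rbrakk> \<Longrightarrow> a \<otimes> x \<in> I" "\<lbrakk>a \<in> carrier A; x \<in> I\<rbrakk> \<Longrightarrow> x \<otimes> a \<in> I"
  using ideal by (auto simp: alg_ideal_iff)

sublocale abelian_subgroup I A
proof (rule abelian_subgroupI3)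
  show "additive_subgroup I A"
    using ideal by (auto simp: alg_ideal_def submodule_def intro: additive_subgroupI)
qed (rule M.abelian_group_axioms)

lemma coset_eq_iff:
  "\<lbrakk>x \<in> carrier A; y \<in> carrier A\<rbrakk> \<Longrightarrow> I +> x = I +> y \<longleftrightarrow> x \<ominus> y \<in> I"
  by (metis M.minus_eq a_rcos_module a_repr_independence' a_repr_independenceD)

lemma coset_zero_iff: "x \<in> carrier A \<Longrightarrow> I +> x = I \<longleftrightarrow> x \<in> I"
  using M.a_coset_join1[of I x] M.a_coset_join2[of x I] a_subgroup by blast

lemma coset_elem: "x \<in> carrier A \<Longrightarrow> y \<in> I +> x \<longleftrightarrow> y \<in> carrier A \<and> y \<ominus> x \<in> I"
  by (metis M.minus_eq a_elemrcos_carrier a_rcos_module)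

lemma quot_mult:
  assumes "x \<in> carrier A" "y \<in> carrier A"
  shows "rcoset_mult A I (I +> x) (I +> y) = I +> (x \<otimes> y)"
proof -
  have "I +> (a \<otimes> b) = I +> (x \<otimes> y)" if ab: "a \<in> I +> x" "b \<in> I +> y" for a b
  proof -
    have c: "a \<in> carrier A" "b \<in> carrier A" "a \<ominus> x \<in> I" "b \<ominus> y \<in> I"
      using ab assms by (auto simp: coset_elem)
    have "(a \<ominus> x) \<otimes> b \<oplus> x \<otimes> (b \<ominus> y) \<in> I"
      using c assms by (auto intro: I_simps)
    moreover have "(a \<ominus> x) \<otimes> b \<oplus> x \<otimes> (b \<ominus> y) = a \<otimes> b \<ominus> x \<otimes> y"
      using c assms by (simp add: a_minus_def mult_add_left mult_add_right uminus_mult mult_uminus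
          M.a_assoc M.r_neg1)
    ultimately show ?thesis using c assms by (simp add: coset_eq_iff)
  qed
  moreover have "x \<in> I +> x" "y \<in> I +> y" using assms by (auto intro: a_rcos_self)
  ultimately show ?thesis unfolding rcoset_mult_def by fast
qed

lemma quot_smult:
  assumes "x \<in> carrier A"
  shows "(\<Union>u\<in>I +> x. I +> (c \<odot> u)) = I +> (c \<odot> x)"
proof -
  have "I +> (c \<odot> u) = I +> (c \<odot> x)" if u: "u \<in> I +> x" for u
  proof -
    have c: "u \<in> carrier A" "u \<ominus> x \<in> I" using u assms by (auto simp: coset_elem)
    then have "c \<odot> (u \<ominus> x) \<in> I" by (auto intro: I_simps)
    moreover have "c \<odot> (u \<ominus> x) = c \<odot> u \<ominus> c \<odot> x"
      using c assms by (simp add: a_minus_def smult_add_right smult_minus_right)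
    ultimately show ?thesis using c assms by (simp add: coset_eq_iff)
  qed
  moreover have "x \<in> I +> x" using assms by (auto intro: a_rcos_self)
  ultimately show ?thesis by fast
qed

lemma alg_quot_simps [simp]:
  "carrier (alg_quot A I) = (\<lambda>x. I +> x) ` carrier A"
  "\<zero>\<^bsub>alg_quot A I\<^esub> = I"
  "\<lbrakk>x \<in> carrier A; y \<in> carrier A\<rbrakk> \<Longrightarrow> (I +> x) \<oplus>\<^bsub>alg_quot A I\<^esub> (I +> y) = I +> (x \<oplus> y)"
  "\<lbrakk>x \<in> carrier A; y \<in> carrier A\<rbrakk> \<Longrightarrow> (I +> x) \<otimes>\<^bsub>alg_quot A I\<^esub> (I +> y) = I +> (x \<otimes> y)"
  "x \<in> carrier A \<Longrightarrow> c \<odot>\<^bsub>alg_quot A I\<^esub> (I +> x) = I +> (c \<odot> x)"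
  apply (simp_all add: alg_quot_def ring.defs module.defs FactRing_def quot_mult quot_smult a_rcos_sum)
  apply (auto simp: A_RCOSETS_def RCOSETS_def a_r_coset_def)
  done

lemma nonassoc_algebra_quot: "nonassoc_algebra (alg_quot A I)"
proof (rule nonassoc_algebraI)
  show "abelian_group (alg_quot A I)"
  proof (rule abelian_groupI)
    fix x assume "x \<in> carrier (alg_quot A I)"
    then obtain a where a: "a \<in> carrier A" "x = I +> a" by auto
    then have "(I +> \<ominus> a) \<oplus>\<^bsub>alg_quot A I\<^esub> x = \<zero>\<^bsub>alg_quot A I\<^esub>"
      by (simp add: M.l_neg coset_zero_iff I_simps)
    then show "\<exists>y\<in>carrier (alg_quot A I). y \<oplus>\<^bsub>alg_quot A I\<^esub> x = \<zero>\<^bsub>alg_quot A I\<^esub>"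
      using a by auto
  next
    fix x assume "x \<in> carrier (alg_quot A I)"
    then obtain a where a: "a \<in> carrier A" "x = I +> a" by auto
    have "I = I +> \<zero>" using coset_zero_iff[of \<zero>] I_simps(2) by simp
    then show "\<zero>\<^bsub>alg_quot A I\<^esub> \<oplus>\<^bsub>alg_quot A I\<^esub> x = x"
      by (metis M.l_zero M.zero_closed a alg_quot_simps(2,3))
  next
    show "\<zero>\<^bsub>alg_quot A I\<^esub> \<in> carrier (alg_quot A I)"
      using coset_zero_iff[of \<zero>] I_simps by (auto simp: image_iff)
  qed (auto simp: M.a_ac)
qed (auto simp: smult_add_left smult_add_right smult_smult mult_add_left mult_add_right
      mult_smult_left mult_smult_right)

lemma quot_hom: "(\<lambda>x. I +> x) \<in> alg_hom A (alg_quot A I)"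
  by (rule alg_homI) auto

lemma quot_lift:
  fixes B :: "('k, 'b, 'n) module_scheme"
  assumes B: "nonassoc_algebra B" and h: "h \<in> alg_hom A B" and I: "\<And>x. x \<in> I \<Longrightarrow> h x = \<zero>\<^bsub>B\<^esub>"
  obtains g where "g \<in> alg_hom (alg_quot A I) B" "\<And>x. x \<in> carrier A \<Longrightarrow> g (I +> x) = h x"
proof -
  interpret h: nonassoc_hom A B h
    by (rule nonassoc_homI) (use B h in \<open>auto intro: nonassoc_algebra_axioms\<close>)
  define g where "g = (\<lambda>U. h (SOME x. x \<in> carrier A \<and> U = I +> x))"
  have g: "g (I +> x) = h x" if x: "x \<in> carrier A" for x
  proof -
    let ?y = "SOME y. y \<in> carrier A \<and> I +> x = I +> y"
    have "?y \<in> carrier A \<and> I +> x = I +> ?y"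
      by (rule someI[of _ x]) (use x in auto)
    then have "?y \<in> carrier A" "x \<ominus> ?y \<in> I" using coset_eq_iff x by auto
    then show ?thesis using I[of "x \<ominus> ?y"] x h.hom_eq_iff[of x ?y] by (simp add: g_def)
  qed
  have "g \<in> alg_hom (alg_quot A I) B"
    by (rule alg_homI) (auto simp: g)
  with g show ?thesis using that by blast
qed

end

section \<open>Free algebras\<close>

abbreviation napoly_smult :: "'k::field \<Rightarrow> ('x, 'k) napoly \<Rightarrow> ('x, 'k) napoly" where
  "napoly_smult c \<equiv> Poly_Mapping.map ((*) c)"

lemma lookup_napoly_smult [simp]:
  "Poly_Mapping.lookup (napoly_smult c p) w = c * Poly_Mapping.lookup p w"
  by (simp add: map.rep_eq when_def)

lemma napoly_smult_add: "napoly_smult c (p + q) = napoly_smult c p + napoly_smult c q"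
  by (rule poly_mapping_eqI) (simp add: lookup_add algebra_simps)

lemma napoly_add_smult: "napoly_smult (c + d) p = napoly_smult c p + napoly_smult d p"
  by (rule poly_mapping_eqI) (simp add: lookup_add algebra_simps)

lemma napoly_smult_smult: "napoly_smult c (napoly_smult d p) = napoly_smult (c * d) p"
  by (rule poly_mapping_eqI) simp

lemma napoly_smult_one [simp]: "napoly_smult 1 p = p"
  by (rule poly_mapping_eqI) simp

lemma napoly_smult_zero [simp]: "napoly_smult c 0 = 0" "napoly_smult 0 p = 0"
  by (rule poly_mapping_eqI; simp)+

lemma napoly_smult_minus_one: "napoly_smult (- 1) p = - p"
  by (rule poly_mapping_eqI) simp

lemma napoly_eq_sum_single:
  fixes p :: "('x, 'k::field) napoly"
  shows "p = (\<Sum>w\<in>Poly_Mapping.keys p. Poly_Mapping.single w (Poly_Mapping.lookup p w))"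
  by (rule poly_mapping_eqI)
     (auto simp: lookup_sum lookup_single when_def in_keys_iff sum.delta' if_distrib cong: if_cong)

lemma napoly_induct [consumes 1, case_names zero single add]:
  fixes p :: "('x, 'k::field) napoly"
  assumes "Poly_Mapping.keys p \<subseteq> W"
    and "P 0" "\<And>w c. w \<in> W \<Longrightarrow> P (Poly_Mapping.single w c)" "\<And>p q. P p \<Longrightarrow> P q \<Longrightarrow> P (p + q)"
  shows "P p"
proof -
  have "P (\<Sum>w\<in>S. Poly_Mapping.single w (Poly_Mapping.lookup p w))" if "finite S" "S \<subseteq> W" for S
    using that by (induction S) (auto intro: assms)
  from this[of "Poly_Mapping.keys p"] show ?thesis
    using assms(1) napoly_eq_sum_single[of p] by simp
qed

text \<open>The defining double sum runs over the supports, which change under addition and scaling.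
  Fixed finite supersets give several products a common index set, and bilinearity becomes a
  termwise check.\<close>

lemma napoly_mult_eq_sum:
  assumes "finite U" "finite V" "Poly_Mapping.keys p \<subseteq> U" "Poly_Mapping.keys q \<subseteq> V"
  shows "napoly_mult p q = (\<Sum>u\<in>U. \<Sum>v\<in>V.
    Poly_Mapping.single (Mul u v) (Poly_Mapping.lookup p u * Poly_Mapping.lookup q v))"
proof -
  have "napoly_mult p q = (\<Sum>u\<in>Poly_Mapping.keys p. \<Sum>v\<in>V.
    Poly_Mapping.single (Mul u v) (Poly_Mapping.lookup p u * Poly_Mapping.lookup q v))"
    unfolding napoly_mult_def
    by (intro sum.cong refl sum.mono_neutral_left) (use assms in \<open>auto simp: in_keys_iff\<close>)
  also have "\<dots> = (\<Sum>u\<in>U. \<Sum>v\<in>V.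
    Poly_Mapping.single (Mul u v) (Poly_Mapping.lookup p u * Poly_Mapping.lookup q v))"
    by (intro sum.mono_neutral_left) (use assms in \<open>auto simp: in_keys_iff\<close>)
  finally show ?thesis .
qed

lemma napoly_mult_add_left: "napoly_mult (p + p') q = napoly_mult p q + napoly_mult p' q"
  using keys_add[of p p']
  by (simp add: napoly_mult_eq_sum[of "Poly_Mapping.keys p \<union> Poly_Mapping.keys p'" "Poly_Mapping.keys q"]
      lookup_add algebra_simps single_add sum.distrib)

lemma napoly_mult_add_right: "napoly_mult q (p + p') = napoly_mult q p + napoly_mult q p'"
  using keys_add[of p p']
  by (simp add: napoly_mult_eq_sum[of "Poly_Mapping.keys q" "Poly_Mapping.keys p \<union> Poly_Mapping.keys p'"]
      lookup_add algebra_simps single_add sum.distrib)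

lemma napoly_smult_sum: "napoly_smult c (sum f S) = (\<Sum>i\<in>S. napoly_smult c (f i))"
  by (induction S rule: infinite_finite_induct) (auto simp: napoly_smult_add)

lemma keys_napoly_smult: "Poly_Mapping.keys (napoly_smult c p) \<subseteq> Poly_Mapping.keys p"
  by (auto simp: in_keys_iff)

lemma napoly_mult_smult_left: "napoly_mult (napoly_smult c p) q = napoly_smult c (napoly_mult p q)"
  by (simp add: napoly_mult_eq_sum[of "Poly_Mapping.keys p" "Poly_Mapping.keys q"] keys_napoly_smult
      napoly_smult_sum mult.assoc)

lemma napoly_mult_smult_right: "napoly_mult p (napoly_smult c q) = napoly_smult c (napoly_mult p q)"
  by (simp add: napoly_mult_eq_sum[of "Poly_Mapping.keys p" "Poly_Mapping.keys q"] keys_napoly_smult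
      napoly_smult_sum mult.left_commute)

lemma napoly_mult_single:
  "napoly_mult (Poly_Mapping.single u c) (Poly_Mapping.single v d) = Poly_Mapping.single (Mul u v) (c * d)"
  by (simp add: napoly_mult_eq_sum[of "{u}" "{v}"])

lemma napoly_mult_zero [simp]: "napoly_mult 0 p = 0" "napoly_mult p 0 = 0"
  by (simp_all add: napoly_mult_def)

lemma carrier_free_algebra:
  "p \<in> carrier (free_algebra \<X>) \<longleftrightarrow> (\<forall>w\<in>Poly_Mapping.keys p. letters w \<subseteq> \<X>)"
  by (simp add: free_algebra_def)

lemma free_algebra_simps [simp]:
  "p \<otimes>\<^bsub>free_algebra \<X>\<^esub> q = napoly_mult p q"
  "p \<oplus>\<^bsub>free_algebra \<X>\<^esub> q = p + q"
  "\<zero>\<^bsub>free_algebra \<X>\<^esub> = 0"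
  "c \<odot>\<^bsub>free_algebra \<X>\<^esub> p = napoly_smult c p"
  by (simp_all add: free_algebra_def)

lemma gen_in_free_algebra [simp]: "gen x \<in> carrier (free_algebra \<X>) \<longleftrightarrow> x \<in> \<X>"
  by (simp add: carrier_free_algebra gen_def)

lemma carrier_free_algebra_UNIV [simp]: "carrier (free_algebra UNIV) = UNIV"
  by (simp add: free_algebra_def)

lemma letters_napoly_mult:
  assumes "p \<in> carrier (free_algebra \<X>)" "q \<in> carrier (free_algebra \<X>)"
  shows "napoly_mult p q \<in> carrier (free_algebra \<X>)"
  unfolding carrier_free_algebra
proof
  fix w assume "w \<in> Poly_Mapping.keys (napoly_mult p q)"
  then have "(\<Sum>u\<in>Poly_Mapping.keys p. \<Sum>v\<in>Poly_Mapping.keys q. Poly_Mapping.lookup (Poly_Mapping.single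
      (Mul u v) (Poly_Mapping.lookup p u * Poly_Mapping.lookup q v)) w) \<noteq> 0"
    by (simp add: in_keys_iff napoly_mult_def lookup_sum)
  then obtain u v where "u \<in> Poly_Mapping.keys p" "v \<in> Poly_Mapping.keys q" "w = Mul u v"
    by (metis (no_types, lifting) sum.not_neutral_contains_not_neutral lookup_single_not_eq)
  then show "letters w \<subseteq> \<X>" using assms by (auto simp: carrier_free_algebra)
qed

lemma nonassoc_algebra_free: "nonassoc_algebra (free_algebra \<X> :: ('k::field, ('x, 'k) napoly) module)"
proof (rule nonassoc_algebraI)
  show "abelian_group (free_algebra \<X> :: ('k, ('x, 'k) napoly) module)"
  proof (rule abelian_groupI)
    fix x assume "x \<in> carrier (free_algebra \<X> :: ('k, ('x, 'k) napoly) module)"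
    then have "- x \<in> carrier (free_algebra \<X>)" by (auto simp: in_keys_iff carrier_free_algebra)
    then show "\<exists>y\<in>carrier (free_algebra \<X>). y \<oplus>\<^bsub>free_algebra \<X>\<^esub> x = \<zero>\<^bsub>free_algebra \<X>\<^esub>"
      by (intro bexI[of _ "- x"]) auto
  next
    fix x y :: "('x, 'k) napoly" assume "x \<in> carrier (free_algebra \<X>)" "y \<in> carrier (free_algebra \<X>)"
    then show "x \<oplus>\<^bsub>free_algebra \<X>\<^esub> y \<in> carrier (free_algebra \<X>)"
      using keys_add[of x y] by (auto simp: carrier_free_algebra)
  qed (simp_all add: carrier_free_algebra algebra_simps)
next
  fix c and x :: "('x, 'k) napoly" assume "x \<in> carrier (free_algebra \<X>)"
  then show "c \<odot>\<^bsub>free_algebra \<X>\<^esub> x \<in> carrier (free_algebra \<X>)"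
    using keys_napoly_smult[of c x] by (auto simp: carrier_free_algebra)
qed (simp_all add: napoly_smult_add napoly_add_smult napoly_smult_smult letters_napoly_mult
    napoly_mult_add_left napoly_mult_add_right napoly_mult_smult_left napoly_mult_smult_right)

lemma free_algebra_uminus:
  assumes "p \<in> carrier (free_algebra \<X>)"
  shows "\<ominus>\<^bsub>free_algebra \<X>\<^esub> p = - (p :: ('x, 'k::field) napoly)"
proof -
  interpret nonassoc_algebra "free_algebra \<X> :: ('k, ('x, 'k) napoly) module"
    by (rule nonassoc_algebra_free)
  show ?thesis using uminus_eq_smult[OF assms] by (simp add: napoly_smult_minus_one)
qed

lemma free_algebra_UNIV_minus [simp]: "p \<ominus>\<^bsub>free_algebra UNIV\<^esub> q = p - q"
  by (simp add: a_minus_def free_algebra_uminus)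

lemma free_algebra_generated:
  fixes p :: "('x, 'k::field) napoly"
  assumes p: "p \<in> carrier (free_algebra \<X>)"
    and S: "\<And>x. x \<in> \<X> \<Longrightarrow> P (gen x)" "P 0" "\<And>p q. P p \<Longrightarrow> P q \<Longrightarrow> P (p + q)"
      "\<And>c p. P p \<Longrightarrow> P (napoly_smult c p)" "\<And>p q. P p \<Longrightarrow> P q \<Longrightarrow> P (napoly_mult p q)"
  shows "P p"
proof -
  have w: "P (Poly_Mapping.single w 1)" if "letters w \<subseteq> \<X>" for w
    using that
  proof (induction w)
    case (Gen x)
    then show ?case using S(1)[of x] by (simp add: gen_def)
  next
    case (Mul u v)
    then show ?case using S(5)[of "Poly_Mapping.single u 1" "Poly_Mapping.single v 1"]
      by (simp add: napoly_mult_single)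
  qed
  show ?thesis
  proof (rule napoly_induct[of p "{w. letters w \<subseteq> \<X>}"])
    show "Poly_Mapping.keys p \<subseteq> {w. letters w \<subseteq> \<X>}" using p by (auto simp: carrier_free_algebra)
  next
    fix w c assume "w \<in> {w. letters w \<subseteq> \<X>}"
    then show "P (Poly_Mapping.single w c)"
      using S(4)[OF w, of w c] by simp
  qed (use S(2,3) in auto)
qed

section \<open>Evaluation of nonassociative polynomials in an algebra\<close>

primrec word_eval :: "('a, 'm) monoid_scheme \<Rightarrow> ('x \<Rightarrow> 'a) \<Rightarrow> 'x word \<Rightarrow> 'a" where
  "word_eval B v (Gen x) = v x"
| "word_eval B v (Mul s t) = word_eval B v s \<otimes>\<^bsub>B\<^esub> word_eval B v t"

text \<open>The valuation is total on the type of letters, so the lemmas below ask for all its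
  values to lie in the carrier; in exchange one map is a homomorphism from
  \<open>free_algebra\<close> over every set of letters.\<close>

definition napoly_eval ::
  "('k::field, 'a, 'm) module_scheme \<Rightarrow> ('x \<Rightarrow> 'a) \<Rightarrow> ('x, 'k) napoly \<Rightarrow> 'a" where
  "napoly_eval B v p =
     finsum B (\<lambda>w. Poly_Mapping.lookup p w \<odot>\<^bsub>B\<^esub> word_eval B v w) (Poly_Mapping.keys p)"

context nonassoc_algebra begin

lemma word_eval_closed [simp, intro]: "(\<And>x. v x \<in> carrier A) \<Longrightarrow> word_eval A v w \<in> carrier A"
  by (induction w) auto

lemma napoly_eval_superset:
  assumes "\<And>x. v x \<in> carrier A" "finite S" "Poly_Mapping.keys p \<subseteq> S"
  shows "napoly_eval A v p = finsum A (\<lambda>w. Poly_Mapping.lookup p w \<odot> word_eval A v w) S"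
  unfolding napoly_eval_def
  by (rule M.add.finprod_mono_neutral_cong_left) (use assms in \<open>auto simp: in_keys_iff\<close>)

lemma napoly_eval_single [simp]:
  assumes "\<And>x. v x \<in> carrier A"
  shows "napoly_eval A v (Poly_Mapping.single w c) = c \<odot> word_eval A v w"
  by (subst napoly_eval_superset[of v "{w}"]) (use assms in auto)

lemma napoly_eval_gen [simp]: "(\<And>x. v x \<in> carrier A) \<Longrightarrow> napoly_eval A v (gen x) = v x"
  by (simp add: gen_def)

lemma napoly_eval_closed [simp, intro]: "(\<And>x. v x \<in> carrier A) \<Longrightarrow> napoly_eval A v p \<in> carrier A"
  unfolding napoly_eval_def by (intro M.finsum_closed) auto

lemma napoly_eval_add:
  assumes "\<And>x. v x \<in> carrier A"
  shows "napoly_eval A v (p + q) = napoly_eval A v p \<oplus> napoly_eval A v q"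
  using keys_add[of p q] assms
  by (simp add: napoly_eval_superset[of v "Poly_Mapping.keys p \<union> Poly_Mapping.keys q"] lookup_add
      smult_add_left M.finsum_addf)

lemma napoly_eval_smult:
  assumes "\<And>x. v x \<in> carrier A"
  shows "napoly_eval A v (napoly_smult c p) = c \<odot> napoly_eval A v p"
proof -
  have "c \<odot> napoly_eval A v p
    = finsum A (\<lambda>w. c \<odot> (Poly_Mapping.lookup p w \<odot> word_eval A v w)) (Poly_Mapping.keys p)"
    unfolding napoly_eval_def by (rule finsum_smult_ldistr) (use assms in auto)
  then show ?thesis
    using assms by (simp add: napoly_eval_superset[OF _ _ keys_napoly_smult] smult_smult)
qed

lemma napoly_eval_zero [simp]: "napoly_eval A v 0 = \<zero>"
  by (simp add: napoly_eval_def)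

lemma napoly_eval_mult:
  assumes v: "\<And>x. v x \<in> carrier A"
  shows "napoly_eval A v (napoly_mult p q) = napoly_eval A v p \<otimes> napoly_eval A v q"
proof (rule napoly_induct[of p UNIV])
  fix u c
  show "napoly_eval A v (napoly_mult (Poly_Mapping.single u c) q)
    = napoly_eval A v (Poly_Mapping.single u c) \<otimes> napoly_eval A v q"
    by (rule napoly_induct[of q UNIV])
       (use v in \<open>simp_all add: napoly_mult_single napoly_mult_add_right napoly_eval_add
          mult_add_right mult_smult_left mult_smult_right smult_smult mult.commute\<close>)
qed (use v in \<open>simp_all add: napoly_mult_add_left napoly_eval_add mult_add_left\<close>)

lemma napoly_eval_hom:
  assumes "\<And>x. v x \<in> carrier A"
  shows "napoly_eval A v \<in> alg_hom (free_algebra \<X>) A"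
  by (rule alg_homI) (use assms in \<open>simp_all add: napoly_eval_add napoly_eval_smult napoly_eval_mult\<close>)

lemma free_hom_unique:
  assumes h: "h \<in> alg_hom (free_algebra \<X>) A" and g: "g \<in> alg_hom (free_algebra \<X>) A"
    and eq: "\<And>x. x \<in> \<X> \<Longrightarrow> h (gen x) = g (gen x)"
    and p: "p \<in> carrier (free_algebra \<X>)"
  shows "h p = g p"
proof -
  interpret R: nonassoc_algebra "free_algebra \<X> :: ('k, ('b, 'k) napoly) module"
    by (rule nonassoc_algebra_free)
  interpret h: nonassoc_hom "free_algebra \<X>" A h
    by (rule nonassoc_homI) (use h R.nonassoc_algebra_axioms nonassoc_algebra_axioms in auto)
  interpret g: nonassoc_hom "free_algebra \<X>" A g
    by (rule nonassoc_homI) (use g R.nonassoc_algebra_axioms nonassoc_algebra_axioms in auto)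
  have "p \<in> carrier (free_algebra \<X>) \<and> h p = g p"
  proof (rule free_algebra_generated[OF p])
    fix x assume "x \<in> \<X>"
    then show "gen x \<in> carrier (free_algebra \<X> :: ('k, ('b, 'k) napoly) module) \<and> h (gen x) = g (gen x)"
      using eq by simp
  next
    show "0 \<in> carrier (free_algebra \<X> :: ('k, ('b, 'k) napoly) module) \<and> h 0 = g 0"
      using h.hom_zero g.hom_zero R.M.zero_closed by simp
  next
    fix p q assume "p \<in> carrier (free_algebra \<X>) \<and> h p = g p" "q \<in> carrier (free_algebra \<X>) \<and> h q = g q"
    then show "p + q \<in> carrier (free_algebra \<X>) \<and> h (p + q) = g (p + q)"
      "napoly_mult p q \<in> carrier (free_algebra \<X>) \<and> h (napoly_mult p q) = g (napoly_mult p q)"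
      using h.hom_add[of p q] g.hom_add[of p q] R.M.add.m_closed[of p q]
        h.hom_mult[of p q] g.hom_mult[of p q] R.mult_closed[of p q]
      by simp_all
  next
    fix c p assume "p \<in> carrier (free_algebra \<X>) \<and> h p = g p"
    then show "napoly_smult c p \<in> carrier (free_algebra \<X>) \<and> h (napoly_smult c p) = g (napoly_smult c p)"
      using h.hom_smult[of p c] g.hom_smult[of p c] R.smult_closed'[of p c]
      by simp
  qed
  then show ?thesis by simp
qed

lemma identities_iff:
  fixes f :: "(nat, 'k) napoly"
  shows "f \<in> identities A \<longleftrightarrow> (\<forall>v. (\<forall>x. v x \<in> carrier A) \<longrightarrow> napoly_eval A v f = \<zero>)"
proof
  assume "f \<in> identities A"
  then show "\<forall>v. (\<forall>x. v x \<in> carrier A) \<longrightarrow> napoly_eval A v f = \<zero>"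
    unfolding identities_def using napoly_eval_hom[where \<X> = UNIV] by blast
next
  assume r: "\<forall>v. (\<forall>x. v x \<in> carrier A) \<longrightarrow> napoly_eval A v f = \<zero>"
  have "h f = \<zero>" if h: "h \<in> alg_hom (free_algebra UNIV) A" for h
  proof -
    have c: "h (gen x) \<in> carrier A" for x using alg_homD(1)[OF h] by simp
    have "h f = napoly_eval A (\<lambda>x. h (gen x)) f"
      by (rule free_hom_unique[OF h napoly_eval_hom[OF c]]) (use c in simp_all)
    then show ?thesis using r c by simp
  qed
  then show "f \<in> identities A" by (simp add: identities_def)
qed

end

lemma (in nonassoc_hom) hom_word_eval:
  "(\<And>x. v x \<in> carrier A) \<Longrightarrow> h (word_eval A v w) = word_eval B (\<lambda>x. h (v x)) w"
  by (induction w) auto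

lemma (in nonassoc_hom) hom_napoly_eval:
  "(\<And>x. v x \<in> carrier A) \<Longrightarrow> h (napoly_eval A v p) = napoly_eval B (\<lambda>x. h (v x)) p"
  unfolding napoly_eval_def by (subst hom_finsum) (auto simp: hom_word_eval)

lemma (in nonassoc_hom) identities_mono_inj:
  assumes "inj_on h (carrier A)"
  shows "identities B \<subseteq> identities A"
proof
  fix f assume f: "f \<in> identities B"
  show "f \<in> identities A"
    unfolding A.identities_iff
  proof (intro allI impI)
    fix v :: "nat \<Rightarrow> 'a" assume v: "\<forall>x. v x \<in> carrier A"
    then have "h (napoly_eval A v f) = napoly_eval B (\<lambda>x. h (v x)) f" by (simp add: hom_napoly_eval)
    also have "\<dots> = h \<zero>\<^bsub>A\<^esub>" using f v by (simp add: B.identities_iff)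
    finally show "napoly_eval A v f = \<zero>\<^bsub>A\<^esub>"
      using inj_onD[OF assms, of "napoly_eval A v f" "\<zero>\<^bsub>A\<^esub>"] v by simp
  qed
qed

lemma (in nonassoc_hom) identities_mono_surj:
  assumes "h ` carrier A = carrier B"
  shows "identities A \<subseteq> identities B"
proof
  fix f assume f: "f \<in> identities A"
  show "f \<in> identities B"
    unfolding B.identities_iff
  proof (intro allI impI)
    fix v :: "nat \<Rightarrow> 'b" assume v: "\<forall>x. v x \<in> carrier B"
    then have "\<forall>x. \<exists>y. y \<in> carrier A \<and> v x = h y" using assms by (metis imageE)
    then obtain u where u: "\<And>x. u x \<in> carrier A" "\<And>x. v x = h (u x)" by metis
    then have "v = (\<lambda>x. h (u x))" by auto
    then have "napoly_eval B v f = h (napoly_eval A u f)" using u by (simp add: hom_napoly_eval)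
    then show "napoly_eval B v f = \<zero>\<^bsub>B\<^esub>" using f u by (simp add: A.identities_iff)
  qed
qed

section \<open>Relatively free algebras\<close>

lemma alg_hom_free_UNIV_closed: "h \<in> alg_hom (free_algebra UNIV) B \<Longrightarrow> h f \<in> carrier B"
  by (auto simp: alg_hom_def carrier_free_algebra_UNIV)

lemma verbal_ideal_ideal: "alg_ideal (verbal_ideal T \<X>) (free_algebra \<X>)"
  unfolding verbal_ideal_def
  by (rule nonassoc_algebra.alg_ideal_gen_ideal[OF nonassoc_algebra_free])
     (auto simp: alg_hom_free_UNIV_closed)

text \<open>The common kernel on the right is an ideal containing all substitution instances.
  Conversely, a countable set of letters can be renamed injectively into the natural numbers: the
  renamed polynomial \<open>\<rho> p\<close> is itself an identity of \<open>A\<close>, and renaming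
  back exhibits \<open>p\<close> as a substitution instance.\<close>

lemma verbal_ideal_identities:
  fixes A :: "('k::field, 'a, 'm) module_scheme" and \<X> :: "'x set"
  assumes A: "nonassoc_algebra A" and \<X>: "countable \<X>" "\<X> \<noteq> {}"
  shows "verbal_ideal (identities A) \<X>
    = {p \<in> carrier (free_algebra \<X>). \<forall>h\<in>alg_hom (free_algebra \<X>) A. h p = \<zero>\<^bsub>A\<^esub>}" (is "_ = ?K")
proof
  let ?R = "free_algebra \<X> :: ('k, ('x, 'k) napoly) module"
  interpret R: nonassoc_algebra ?R by (rule nonassoc_algebra_free)
  interpret A: nonassoc_algebra A by fact
  have hom: "nonassoc_hom ?R A h" if "h \<in> alg_hom ?R A" for h
    by (rule nonassoc_homI) (use that A R.nonassoc_algebra_axioms in auto)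
  show "verbal_ideal (identities A) \<X> \<subseteq> ?K"
    unfolding verbal_ideal_def
  proof (rule R.alg_ideal_gen_least)
    have "?K = \<Inter>((\<lambda>h. {p \<in> carrier ?R. h p = \<zero>\<^bsub>A\<^esub>}) ` alg_hom ?R A)"
      using A.napoly_eval_hom[of "\<lambda>_. \<zero>\<^bsub>A\<^esub>" \<X>] by auto
    moreover have "alg_ideal \<dots> ?R"
      by (rule R.alg_ideal_Inter)
         (use hom[THEN nonassoc_hom.kernel_ideal] A.napoly_eval_hom[of "\<lambda>_. \<zero>\<^bsub>A\<^esub>" \<X>] in auto)
    ultimately show "alg_ideal ?K ?R" by simp
    show "{h f |h f. f \<in> identities A \<and> h \<in> alg_hom (free_algebra UNIV) ?R} \<subseteq> ?K"
      by (auto simp: identities_def alg_hom_free_UNIV_closed 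
          dest: alg_hom_compose)
  qed
  show "?K \<subseteq> verbal_ideal (identities A) \<X>"
  proof
    fix p assume p: "p \<in> ?K"
    let ?F = "free_algebra UNIV :: ('k, (nat, 'k) napoly) module"
    interpret F: nonassoc_algebra ?F by (rule nonassoc_algebra_free)
    define \<rho> where "\<rho> = napoly_eval ?F (\<lambda>x. gen (to_nat_on \<X> x))"
    define \<tau> where "\<tau> = napoly_eval ?R (\<lambda>n. gen (from_nat_into \<X> n))"
    have \<rho>: "\<rho> \<in> alg_hom ?R ?F" unfolding \<rho>_def by (rule F.napoly_eval_hom) auto
    have c: "gen (from_nat_into \<X> n) \<in> carrier ?R" for n
      using from_nat_into[OF \<X>(2)] by simp
    have \<tau>: "\<tau> \<in> alg_hom ?F ?R" unfolding \<tau>_def by (rule R.napoly_eval_hom[OF c])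
    have "\<rho> p \<in> identities A"
      using p alg_hom_compose[OF \<rho>, of _ A] by (auto simp: identities_def)
    then have "\<tau> (\<rho> p) \<in> verbal_ideal (identities A) \<X>"
      unfolding verbal_ideal_def using \<tau> by (intro R.alg_ideal_gen_incl[THEN subsetD]) blast
    moreover have "\<tau> (\<rho> p) = p"
    proof (rule R.free_hom_unique[OF alg_hom_compose[OF \<rho> \<tau>] alg_hom_id])
      fix x assume x: "x \<in> \<X>"
      show "\<tau> (\<rho> (gen x)) = gen x"
        using x \<X> R.napoly_eval_gen[of "\<lambda>n. gen (from_nat_into \<X> n)"] c
        by (simp add: \<rho>_def \<tau>_def)
    qed (use p in auto)
    ultimately show "p \<in> verbal_ideal (identities A) \<X>" by simp
  qed
qed

lemma (in nonassoc_algebra) subalgebra_gen_carrier_image: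
  fixes \<X> :: "'x set"
  assumes v: "\<And>x. v x \<in> carrier A"
  shows "carrier (subalgebra_gen A (v ` \<X>)) = napoly_eval A v ` carrier (free_algebra \<X>)"
proof
  let ?R = "free_algebra \<X> :: ('k, ('x, 'k) napoly) module"
  interpret R: nonassoc_algebra ?R by (rule nonassoc_algebra_free)
  interpret h: nonassoc_hom ?R A "napoly_eval A v"
    by (intro nonassoc_homI R.nonassoc_algebra_axioms nonassoc_algebra_axioms napoly_eval_hom v)
  have "subalgebra (napoly_eval A v ` carrier ?R) A"
    unfolding subalgebra_iff
  proof (intro conjI ballI allI)
    show "\<zero> \<in> napoly_eval A v ` carrier ?R"
      using imageI[OF R.M.zero_closed, of "napoly_eval A v"] by (simp only: h.hom_zero)
  next
    fix x y assume "x \<in> napoly_eval A v ` carrier ?R" "y \<in> napoly_eval A v ` carrier ?R"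
    then obtain p q where "p \<in> carrier ?R" "q \<in> carrier ?R" "x = napoly_eval A v p" "y = napoly_eval A v q"
      by blast
    then show "x \<oplus> y \<in> napoly_eval A v ` carrier ?R" "x \<otimes> y \<in> napoly_eval A v ` carrier ?R"
      using imageI[of "p \<oplus>\<^bsub>?R\<^esub> q" "carrier ?R" "napoly_eval A v"]
        imageI[of "p \<otimes>\<^bsub>?R\<^esub> q" "carrier ?R" "napoly_eval A v"]
      by (simp_all only: R.M.add.m_closed R.mult_closed' h.hom_add h.hom_mult simp_thms)
  next
    fix c x assume "x \<in> napoly_eval A v ` carrier ?R"
    then obtain p where "p \<in> carrier ?R" "x = napoly_eval A v p" by blast
    then show "c \<odot> x \<in> napoly_eval A v ` carrier ?R"
      using imageI[of "c \<odot>\<^bsub>?R\<^esub> p" "carrier ?R" "napoly_eval A v"]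
      by (simp only: R.smult_closed' h.hom_smult simp_thms)
  qed (use v in auto)
  moreover have "v ` \<X> \<subseteq> napoly_eval A v ` carrier ?R"
  proof
    fix y assume "y \<in> v ` \<X>"
    then obtain x where x: "x \<in> \<X>" "y = v x" by blast
    then show "y \<in> napoly_eval A v ` carrier ?R"
      using imageI[of "gen x" "carrier ?R" "napoly_eval A v"] v by simp
  qed
  ultimately show "carrier (subalgebra_gen A (v ` \<X>)) \<subseteq> napoly_eval A v ` carrier ?R"
    by (auto simp: subalgebra_gen_def)
  show "napoly_eval A v ` carrier ?R \<subseteq> carrier (subalgebra_gen A (v ` \<X>))"
  proof
    fix y assume "y \<in> napoly_eval A v ` carrier ?R"
    then obtain p where p: "p \<in> carrier ?R" "y = napoly_eval A v p" by blast
    have "napoly_eval A v p \<in> B" if B: "subalgebra B A" "v ` \<X> \<subseteq> B" for B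
      by (rule free_algebra_generated[OF p(1)])
         (use B v in \<open>simp_all add: subalgebra_iff napoly_eval_add napoly_eval_smult napoly_eval_mult image_subset_iff\<close>)
    then show "y \<in> carrier (subalgebra_gen A (v ` \<X>))"
      using p by (auto simp: subalgebra_gen_def)
  qed
qed

lemma subalgebra_gen_simps [simp]:
  "add (subalgebra_gen A S) = add A" "monoid.mult (subalgebra_gen A S) = monoid.mult A"
  "module.smult (subalgebra_gen A S) = module.smult A" "\<zero>\<^bsub>subalgebra_gen A S\<^esub> = \<zero>\<^bsub>A\<^esub>"
  by (simp_all add: subalgebra_gen_def)

text \<open>\<open>\<Psi>\<close> reads each nonassociative product as a symmetrized one, so the
  subalgebra generated by the free generators is the image of \<open>\<Phi>\<close>, the composite
  of \<open>\<Psi>\<close> with the projection \<open>q\<close>. Every homomorphism from the free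
  algebra to the plus algebra of \<open>A\<close> is the composite of \<open>\<Psi>\<close> with a
  homomorphism to \<open>A\<close>, namely the one with the same values on generators. Hence the
  kernel of \<open>\<Phi>\<close> is the verbal ideal of the plus algebra.\<close>

lemma plus_subalgebra_isomorphic:
  fixes A :: "('k::field, 'a, 'm) module_scheme" and \<X> :: "'x set"
  assumes A: "nonassoc_algebra A" and \<X>: "countable \<X>" "\<X> \<noteq> {}"
  shows "alg_isomorphic
    (subalgebra_gen (plus_algebra (relatively_free (identities A) \<X>))
      (relatively_free_gen (identities A) \<X> ` \<X>))
    (relatively_free (identities (plus_algebra A)) \<X> :: ('k, ('x, 'k) napoly set) module)"
proof -
  define R where "R = (free_algebra \<X> :: ('k, ('x, 'k) napoly) module)"
  define I where "I = verbal_ideal (identities A) \<X>"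
  define I' where "I' = verbal_ideal (identities (plus_algebra A)) \<X>"
  define F where "F = relatively_free (identities A) \<X>"
  have F_eq: "F = alg_quot R I" by (simp add: F_def relatively_free_def I_def R_def)
  interpret A: nonassoc_algebra A by fact
  interpret A': nonassoc_algebra "plus_algebra A" by (rule A.nonassoc_algebra_plus)
  interpret R: nonassoc_algebra R unfolding R_def by (rule nonassoc_algebra_free)
  interpret R': nonassoc_algebra "plus_algebra R" by (rule R.nonassoc_algebra_plus)
  interpret Q: alg_quotient R I
    by unfold_locales (simp add: I_def R_def verbal_ideal_ideal)
  interpret Q': alg_quotient R I'
    by unfold_locales (simp add: I'_def R_def verbal_ideal_ideal)
  interpret F: nonassoc_algebra F unfolding F_eq by (rule Q.nonassoc_algebra_quot)
  interpret F': nonassoc_algebra "plus_algebra F" by (rule F.nonassoc_algebra_plus)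
  define q where "q = (\<lambda>x. I +>\<^bsub>R\<^esub> x)"
  have q: "q \<in> alg_hom R F" unfolding q_def F_eq by (rule Q.quot_hom)
  interpret q: nonassoc_hom R F q
    by (rule nonassoc_homI) (use q R.nonassoc_algebra_axioms F.nonassoc_algebra_axioms in auto)
  define x0 where "x0 = (SOME x. x \<in> \<X>)"
  have x0: "x0 \<in> \<X>" using \<X>(2) by (simp add: x0_def some_in_eq)
  \<comment> \<open>A valuation has to be defined on all letters; those outside the generating set
    are sent to the fixed generator \<open>x0\<close>.\<close>
  define r where "r = (\<lambda>x. if x \<in> \<X> then x else x0)"
  have r: "r x \<in> \<X>" "x \<in> \<X> \<Longrightarrow> r x = x" for x using x0 by (auto simp: r_def)
  have gR: "gen (r x) \<in> carrier R" for x :: 'x using r(1)[of x] by (simp add: R_def)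
  define v where "v = (\<lambda>x. q (gen (r x)))"
  have v: "v x \<in> carrier (plus_algebra F)" for x using gR by (simp add: v_def)
  define \<Phi> where "\<Phi> = napoly_eval (plus_algebra F) v"
  define \<Psi> where "\<Psi> = napoly_eval (plus_algebra R) (\<lambda>x. gen (r x))"
  have \<Psi>: "\<Psi> \<in> alg_hom R (plus_algebra R)"
    unfolding \<Psi>_def by (subst (1) R_def, rule R'.napoly_eval_hom) (use gR in simp)
  have \<Phi>: "\<Phi> \<in> alg_hom R (plus_algebra F)"
    unfolding \<Phi>_def R_def by (rule F'.napoly_eval_hom[OF v])
  have \<Phi>\<Psi>: "\<Phi> p = q (\<Psi> p)" if p: "p \<in> carrier R" for p
  proof (rule F'.free_hom_unique[OF \<Phi>[unfolded R_def] alg_hom_compose[OF \<Psi> q.hom_plus, unfolded R_def]])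
    fix x assume "x \<in> \<X>"
    then show "\<Phi> (gen x) = q (\<Psi> (gen x))"
      using v gR R'.napoly_eval_gen[of "\<lambda>x. gen (r x)" x] by (simp add: \<Phi>_def \<Psi>_def v_def)
  qed (use p R_def in simp)
  have ker: "\<Phi> p = \<zero>\<^bsub>F\<^esub> \<longleftrightarrow> p \<in> I'" if p: "p \<in> carrier R" for p
  proof -
    have \<Psi>p: "\<Psi> p \<in> carrier R" using alg_homD(1)[OF \<Psi> p] by simp
    have k\<Psi>: "(\<lambda>x. k (\<Psi> x)) \<in> alg_hom R (plus_algebra A)" if "k \<in> alg_hom R A" for k
    proof -
      interpret k: nonassoc_hom R A k
        by (rule nonassoc_homI) (use that R.nonassoc_algebra_axioms A in auto)
      show ?thesis by (rule alg_hom_compose[OF \<Psi> k.hom_plus])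
    qed
    have "\<Phi> p = \<zero>\<^bsub>F\<^esub> \<longleftrightarrow> \<Psi> p \<in> I"
      using \<Phi>\<Psi>[OF p] Q.coset_zero_iff[OF \<Psi>p] by (simp add: q_def F_eq)
    also have "\<dots> \<longleftrightarrow> (\<forall>k\<in>alg_hom R A. k (\<Psi> p) = \<zero>\<^bsub>A\<^esub>)"
      using \<Psi>p verbal_ideal_identities[OF A \<X>] by (simp add: I_def R_def)
    also have "\<dots> \<longleftrightarrow> (\<forall>h\<in>alg_hom R (plus_algebra A). h p = \<zero>\<^bsub>A\<^esub>)"
    proof (intro iffI ballI)
      fix k assume "\<forall>h\<in>alg_hom R (plus_algebra A). h p = \<zero>\<^bsub>A\<^esub>" "k \<in> alg_hom R A"
      then show "k (\<Psi> p) = \<zero>\<^bsub>A\<^esub>" using bspec[OF _ k\<Psi>[of k]] by simp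
    next
      fix h assume *: "\<forall>k\<in>alg_hom R A. k (\<Psi> p) = \<zero>\<^bsub>A\<^esub>" and h: "h \<in> alg_hom R (plus_algebra A)"
      define k where "k = napoly_eval A (\<lambda>x. h (gen (r x)))"
      have hg: "h (gen (r x)) \<in> carrier A" for x using alg_homD(1)[OF h gR] by simp
      have k: "k \<in> alg_hom R A" unfolding k_def R_def by (rule A.napoly_eval_hom[OF hg])
      have "h p = k (\<Psi> p)"
      proof (rule A'.free_hom_unique[OF h[unfolded R_def] k\<Psi>[OF k, unfolded R_def]])
        fix x assume "x \<in> \<X>"
        then show "h (gen x) = k (\<Psi> (gen x))"
          using hg gR R'.napoly_eval_gen[of "\<lambda>x. gen (r x)" x]
            A.napoly_eval_gen[of "\<lambda>x. h (gen (r x))" x] by (simp add: \<Psi>_def k_def r)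
      qed (use p R_def in simp)
      then show "h p = \<zero>\<^bsub>A\<^esub>" using * k by simp
    qed
    also have "\<dots> \<longleftrightarrow> p \<in> I'"
      using p verbal_ideal_identities[OF A.nonassoc_algebra_plus \<X>] by (simp add: I'_def R_def)
    finally show ?thesis .
  qed
  define J where "J = subalgebra_gen (plus_algebra F) (relatively_free_gen (identities A) \<X> ` \<X>)"
  have "relatively_free_gen (identities A) \<X> ` \<X> = v ` \<X>"
    by (intro image_cong refl) (simp add: relatively_free_gen_def v_def q_def r I_def R_def)
  then have J: "carrier J = \<Phi> ` carrier R"
    using F'.subalgebra_gen_carrier_image[of v \<X>] v by (simp add: J_def \<Phi>_def R_def)
  interpret \<Phi>: nonassoc_hom R "plus_algebra F" \<Phi>
    by (rule nonassoc_homI) (use \<Phi> R.nonassoc_algebra_axioms F'.nonassoc_algebra_axioms in auto)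
  \<comment> \<open>By choice of preimages, \<open>\<psi>\<close> inverts the isomorphism from the
    quotient by \<open>I'\<close> onto \<open>J\<close> that \<open>\<Phi>\<close> induces.\<close>
  define \<psi> where "\<psi> y = I' +>\<^bsub>R\<^esub> (SOME p. p \<in> carrier R \<and> \<Phi> p = y)" for y
  have \<psi>: "\<psi> (\<Phi> p) = I' +>\<^bsub>R\<^esub> p" if p: "p \<in> carrier R" for p
  proof -
    let ?p = "SOME p'. p' \<in> carrier R \<and> \<Phi> p' = \<Phi> p"
    have *: "?p \<in> carrier R \<and> \<Phi> ?p = \<Phi> p" by (rule someI[of _ p]) (use p in auto)
    then have "\<Phi> (?p \<ominus>\<^bsub>R\<^esub> p) = \<zero>\<^bsub>F\<^esub>"
      using \<Phi>.hom_eq_iff[of ?p p] p by (simp del: \<Phi>.hom_minus)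
    then have "?p \<ominus>\<^bsub>R\<^esub> p \<in> I'" using ker[of "?p \<ominus>\<^bsub>R\<^esub> p"] * p by blast
    then show ?thesis using * p by (simp add: \<psi>_def Q'.coset_eq_iff)
  qed
  have "\<psi> \<in> alg_hom J (alg_quot R I')"
  proof (rule alg_homI)
    fix x y assume "x \<in> carrier J" "y \<in> carrier J"
    then obtain p s where ps: "p \<in> carrier R" "s \<in> carrier R" "x = \<Phi> p" "y = \<Phi> s" using J by auto
    have "x \<oplus>\<^bsub>J\<^esub> y = \<Phi> (p \<oplus>\<^bsub>R\<^esub> s)" "x \<otimes>\<^bsub>J\<^esub> y = \<Phi> (p \<otimes>\<^bsub>R\<^esub> s)"
      using ps by (simp_all add: J_def)
    then show "\<psi> (x \<oplus>\<^bsub>J\<^esub> y) = \<psi> x \<oplus>\<^bsub>alg_quot R I'\<^esub> \<psi> y" "\<psi> (x \<otimes>\<^bsub>J\<^esub> y) = \<psi> x \<otimes>\<^bsub>alg_quot R I'\<^esub> \<psi> y"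
      using ps \<psi>[of "p \<oplus>\<^bsub>R\<^esub> s"] \<psi>[of "p \<otimes>\<^bsub>R\<^esub> s"] by (simp_all only: R.M.add.m_closed R.mult_closed' \<psi> Q'.alg_quot_simps)
  next
    fix c x assume "x \<in> carrier J"
    then obtain p where ps: "p \<in> carrier R" "x = \<Phi> p" using J by auto
    then have "c \<odot>\<^bsub>J\<^esub> x = \<Phi> (c \<odot>\<^bsub>R\<^esub> p)" by (simp add: J_def)
    then show "\<psi> (c \<odot>\<^bsub>J\<^esub> x) = c \<odot>\<^bsub>alg_quot R I'\<^esub> \<psi> x"
      using ps by (simp only: R.smult_closed' \<psi> Q'.alg_quot_simps)
  next
    fix x assume "x \<in> carrier J"
    then show "\<psi> x \<in> carrier (alg_quot R I')" using J \<psi> by auto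
  qed
  moreover have "bij_betw \<psi> (carrier J) (carrier (alg_quot R I'))"
    unfolding bij_betw_def
  proof
    show "\<psi> ` carrier J = carrier (alg_quot R I')" by (simp add: J \<psi> image_image)
    show "inj_on \<psi> (carrier J)"
    proof (rule inj_onI)
      fix x y assume "x \<in> carrier J" "y \<in> carrier J" and eq: "\<psi> x = \<psi> y"
      then obtain p s where ps: "p \<in> carrier R" "s \<in> carrier R" "x = \<Phi> p" "y = \<Phi> s" using J by auto
      then have "p \<ominus>\<^bsub>R\<^esub> s \<in> I'" using eq by (simp add: \<psi> Q'.coset_eq_iff)
      then show "x = y"
        using ps \<Phi>.hom_eq_iff[of p s] ker[of "p \<ominus>\<^bsub>R\<^esub> s"] by (simp del: \<Phi>.hom_minus)
    qed
  qed
  ultimately have "alg_isomorphic J (alg_quot R I')" unfolding alg_isomorphic_def by blast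
  then show ?thesis
    unfolding J_def F_def R_def I'_def relatively_free_def .
qed

section \<open>Superalgebras and Grassmann envelopes\<close>

abbreviation par :: "nat set \<Rightarrow> bit" where "par S \<equiv> of_nat (card S)"

lemma par_Un: "\<lbrakk>finite S; finite T; S \<inter> T = {}\<rbrakk> \<Longrightarrow> par (S \<union> T) = par S + par T"
  by (simp add: card_Un_disjoint)

lemma par_diff: "\<lbrakk>finite U; S \<subseteq> U\<rbrakk> \<Longrightarrow> par S + par (U - S) = par U"
  using par_Un[of S "U - S"] by (simp add: finite_subset Un_absorb1)

context superalgebra begin

lemma part_closed: "x \<in> part A i \<Longrightarrow> x \<in> carrier A"
  using part_submodule[of i] by (auto simp: submodule_iff)

lemma part_zero [simp]: "\<zero> \<in> part A i"
  using part_submodule[of i] by (auto simp: submodule_iff)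

lemma part_add: "\<lbrakk>x \<in> part A i; y \<in> part A i\<rbrakk> \<Longrightarrow> x \<oplus> y \<in> part A i"
  using part_submodule[of i] by (auto simp: submodule_iff)

lemma part_smult: "x \<in> part A i \<Longrightarrow> c \<odot> x \<in> part A i"
  using part_submodule[of i] by (auto simp: submodule_iff)

lemma part_uminus: "x \<in> part A i \<Longrightarrow> \<ominus> x \<in> part A i"
  by (simp add: uminus_eq_smult part_closed part_smult)

lemma part_minus: "\<lbrakk>x \<in> part A i; y \<in> part A i\<rbrakk> \<Longrightarrow> x \<ominus> y \<in> part A i"
  by (simp add: a_minus_def part_add part_uminus)

lemma part_finsum: "(\<And>s. s \<in> S \<Longrightarrow> f s \<in> part A i) \<Longrightarrow> finsum A f S \<in> part A i"
proof (induction S rule: infinite_finite_induct)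
  case (insert x F)
  then show ?case using part_closed by (subst M.finsum_insert) (auto intro: part_add)
qed auto

lemma part_decomp: assumes "x \<in> carrier A"
  obtains x0 x1 where "x0 \<in> part A 0" "x1 \<in> part A 1" "x = x0 \<oplus> x1"
proof -
  have "x \<in> part A 0 <+> part A 1" using assms part_sum by blast
  then show ?thesis using that unfolding set_add_def set_mult_def by auto
qed

lemma part_both: "\<lbrakk>x \<in> part A 0; x \<in> part A 1\<rbrakk> \<Longrightarrow> x = \<zero>"
  using part_disjoint by auto

lemma part_associator:
  "\<lbrakk>x \<in> part A i; y \<in> part A j; z \<in> part A k\<rbrakk> \<Longrightarrow> associator A x y z \<in> part A (i + j + k)"
  using part_mult[OF part_mult[of x i y j], of z k] part_mult[OF _ part_mult[of y j z k], of x i]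
  unfolding associator_def by (intro part_minus) (simp_all only: add.assoc)

end

lemma env_simps [simp]:
  "\<zero>\<^bsub>grassmann_envelope A\<^esub> = (\<lambda>S. \<zero>\<^bsub>A\<^esub>)"
  "f \<oplus>\<^bsub>grassmann_envelope A\<^esub> g = (\<lambda>S. f S \<oplus>\<^bsub>A\<^esub> g S)"
  "c \<odot>\<^bsub>grassmann_envelope A\<^esub> f = (\<lambda>S. c \<odot>\<^bsub>A\<^esub> f S)"
  by (simp_all add: grassmann_envelope_def)

lemma env_carrier:
  "f \<in> carrier (grassmann_envelope A) \<longleftrightarrow> (\<forall>S. f S \<in> part A (par S))
     \<and> (\<forall>S. infinite S \<longrightarrow> f S = \<zero>\<^bsub>A\<^esub>) \<and> finite {S. f S \<noteq> \<zero>\<^bsub>A\<^esub>}"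
  by (simp add: grassmann_envelope_def)

lemma env_mult:
  "(f \<otimes>\<^bsub>grassmann_envelope A\<^esub> g) U = finsum A
        (\<lambda>S. grassmann_sign S (U - S) \<odot>\<^bsub>A\<^esub> (f S \<otimes>\<^bsub>A\<^esub> g (U - S))) (Pow U)"
  by (simp add: grassmann_envelope_def)

text \<open>The elementary tensor of \<open>a\<close> and the Grassmann monomial xi_S. It lies in
  the envelope when \<open>S\<close> is finite and \<open>a\<close> has the parity of
  \<open>S\<close>.\<close>

definition tens :: "('k, 'a, 'm) superalg_scheme \<Rightarrow> 'a \<Rightarrow> nat set \<Rightarrow> nat set \<Rightarrow> 'a" where
  "tens A a S = (\<lambda>T. if T = S then a else \<zero>\<^bsub>A\<^esub>)"

context superalgebra begin

abbreviation "GA \<equiv> grassmann_envelope A"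

lemma env_mult_infinite: "infinite U \<Longrightarrow> (f \<otimes>\<^bsub>GA\<^esub> g) U = \<zero>"
  by (simp add: env_mult)

lemma env_closed: "f \<in> carrier GA \<Longrightarrow> f S \<in> carrier A"
  by (auto simp: env_carrier intro: part_closed)

lemma env_mult_closed:
  assumes f: "f \<in> carrier GA" and g: "g \<in> carrier GA"
  shows "f \<otimes>\<^bsub>GA\<^esub> g \<in> carrier GA"
  unfolding env_carrier
proof (intro conjI allI impI)
  fix U show "(f \<otimes>\<^bsub>GA\<^esub> g) U \<in> part A (par U)"
  proof (cases "finite U")
    case True
    have "grassmann_sign S (U - S) \<odot> (f S \<otimes> g (U - S)) \<in> part A (par U)" if S: "S \<in> Pow U" for S
    proof (rule part_smult)
      have "f S \<otimes> g (U - S) \<in> part A (par S + par (U - S))"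
        by (rule part_mult) (use f g in \<open>auto simp: env_carrier\<close>)
      then show "f S \<otimes> g (U - S) \<in> part A (par U)" using par_diff[OF True, of S] S by auto
    qed
    then show ?thesis unfolding env_mult by (rule part_finsum)
  qed (simp add: env_mult_infinite)
next
  have "{U. (f \<otimes>\<^bsub>GA\<^esub> g) U \<noteq> \<zero>} \<subseteq> (\<lambda>(S, T). S \<union> T) ` ({S. f S \<noteq> \<zero>} \<times> {S. g S \<noteq> \<zero>})"
  proof
    fix U assume "U \<in> {U. (f \<otimes>\<^bsub>GA\<^esub> g) U \<noteq> \<zero>}"
    then have U: "(f \<otimes>\<^bsub>GA\<^esub> g) U \<noteq> \<zero>" by simp
    have "\<exists>S\<in>Pow U. grassmann_sign S (U - S) \<odot> (f S \<otimes> g (U - S)) \<noteq> \<zero>"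
    proof (rule ccontr)
      assume "\<not> ?thesis"
      then have "(f \<otimes>\<^bsub>GA\<^esub> g) U = finsum A (\<lambda>S. \<zero>) (Pow U)"
        unfolding env_mult by (intro M.finsum_cong') simp_all
      with U show False by simp
    qed
    then obtain S where S: "S \<subseteq> U" "grassmann_sign S (U - S) \<odot> (f S \<otimes> g (U - S)) \<noteq> \<zero>" by auto
    then have "f S \<noteq> \<zero>" "g (U - S) \<noteq> \<zero>" using f g by (auto simp: env_closed)
    then show "U \<in> (\<lambda>(S, T). S \<union> T) ` ({S. f S \<noteq> \<zero>} \<times> {S. g S \<noteq> \<zero>})"
      using S by (intro image_eqI[of _ _ "(S, U - S)"]) auto
  qed
  then show "finite {U. (f \<otimes>\<^bsub>GA\<^esub> g) U \<noteq> \<zero>}"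
    by (rule finite_subset) (use f g in \<open>auto simp: env_carrier\<close>)
qed (simp add: env_mult_infinite)

lemma nonassoc_algebra_env: "nonassoc_algebra GA"
proof (rule nonassoc_algebraI)
  show "abelian_group GA"
  proof (rule abelian_groupI)
    fix f g assume fg: "f \<in> carrier GA" "g \<in> carrier GA"
    have "{S. f S \<oplus> g S \<noteq> \<zero>} \<subseteq> {S. f S \<noteq> \<zero>} \<union> {S. g S \<noteq> \<zero>}" by auto
    with fg show "f \<oplus>\<^bsub>GA\<^esub> g \<in> carrier GA"
      by (auto simp: env_carrier part_add intro: finite_subset)
  next
    fix f assume f: "f \<in> carrier GA"
    have "{S. \<ominus> f S \<noteq> \<zero>} \<subseteq> {S. f S \<noteq> \<zero>}" by auto
    then have "(\<lambda>S. \<ominus> f S) \<in> carrier GA"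
      using f by (auto simp: env_carrier part_uminus intro: finite_subset)
    then show "\<exists>g\<in>carrier GA. g \<oplus>\<^bsub>GA\<^esub> f = \<zero>\<^bsub>GA\<^esub>"
      by (rule bexI[rotated]) (use f in \<open>simp add: env_closed M.l_neg\<close>)
  qed (auto simp: env_closed M.a_ac env_carrier[of "\<lambda>S. \<zero>"])
next
  fix c f assume f: "f \<in> carrier GA"
  have "{S. c \<odot> f S \<noteq> \<zero>} \<subseteq> {S. f S \<noteq> \<zero>}" by auto
  then show "c \<odot>\<^bsub>GA\<^esub> f \<in> carrier GA"
    using f by (auto simp: env_carrier part_smult intro: finite_subset)
next
  fix f g w assume fgw: "f \<in> carrier GA" "g \<in> carrier GA" "w \<in> carrier GA"
  have "((f \<oplus>\<^bsub>GA\<^esub> g) \<otimes>\<^bsub>GA\<^esub> w) U = (f \<otimes>\<^bsub>GA\<^esub> w) U \<oplus> (g \<otimes>\<^bsub>GA\<^esub> w) U" for U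
    unfolding env_mult env_simps using fgw
    by (subst M.finsum_addf[symmetric])
       (auto simp: env_closed mult_add_left smult_add_right intro!: M.finsum_cong')
  then show "(f \<oplus>\<^bsub>GA\<^esub> g) \<otimes>\<^bsub>GA\<^esub> w = f \<otimes>\<^bsub>GA\<^esub> w \<oplus>\<^bsub>GA\<^esub> g \<otimes>\<^bsub>GA\<^esub> w" by auto
  have "(w \<otimes>\<^bsub>GA\<^esub> (f \<oplus>\<^bsub>GA\<^esub> g)) U = (w \<otimes>\<^bsub>GA\<^esub> f) U \<oplus> (w \<otimes>\<^bsub>GA\<^esub> g) U" for U
    unfolding env_mult env_simps using fgw
    by (subst M.finsum_addf[symmetric])
       (auto simp: env_closed mult_add_right smult_add_right intro!: M.finsum_cong')
  then show "w \<otimes>\<^bsub>GA\<^esub> (f \<oplus>\<^bsub>GA\<^esub> g) = w \<otimes>\<^bsub>GA\<^esub> f \<oplus>\<^bsub>GA\<^esub> w \<otimes>\<^bsub>GA\<^esub> g" by auto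
next
  fix c f g assume fg: "f \<in> carrier GA" "g \<in> carrier GA"
  have *: "c \<odot> (f \<otimes>\<^bsub>GA\<^esub> g) U = finsum A
        (\<lambda>S. c \<odot> (grassmann_sign S (U - S) \<odot> (f S \<otimes> g (U - S)))) (Pow U)" for U
    using fg by (cases "finite U") (simp_all add: env_mult finsum_smult_ldistr env_closed)
  have "((c \<odot>\<^bsub>GA\<^esub> f) \<otimes>\<^bsub>GA\<^esub> g) U = c \<odot> (f \<otimes>\<^bsub>GA\<^esub> g) U" for U
    unfolding * unfolding env_mult env_simps
    using fg by (auto simp: env_closed mult_smult_left smult_smult mult.commute intro!: M.finsum_cong')
  then show "(c \<odot>\<^bsub>GA\<^esub> f) \<otimes>\<^bsub>GA\<^esub> g = c \<odot>\<^bsub>GA\<^esub> (f \<otimes>\<^bsub>GA\<^esub> g)" by auto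
  have "(f \<otimes>\<^bsub>GA\<^esub> (c \<odot>\<^bsub>GA\<^esub> g)) U = c \<odot> (f \<otimes>\<^bsub>GA\<^esub> g) U" for U
    unfolding * unfolding env_mult env_simps
    using fg by (auto simp: env_closed mult_smult_right smult_smult mult.commute intro!: M.finsum_cong')
  then show "f \<otimes>\<^bsub>GA\<^esub> (c \<odot>\<^bsub>GA\<^esub> g) = c \<odot>\<^bsub>GA\<^esub> (f \<otimes>\<^bsub>GA\<^esub> g)" by auto
qed (auto simp: env_closed smult_add_left smult_add_right smult_smult env_mult_closed)

sublocale env: nonassoc_algebra GA
  by (rule nonassoc_algebra_env)

lemma env_uminus: "f \<in> carrier GA \<Longrightarrow> \<ominus>\<^bsub>GA\<^esub> f = (\<lambda>S. \<ominus> f S)"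
  by (simp add: env.uminus_eq_smult uminus_eq_smult env_closed)

lemma env_minus: "\<lbrakk>f \<in> carrier GA; g \<in> carrier GA\<rbrakk> \<Longrightarrow> f \<ominus>\<^bsub>GA\<^esub> g = (\<lambda>S. f S \<ominus> g S)"
  by (simp add: a_minus_def env_uminus)

lemma tens_carrier: "\<lbrakk>finite S; a \<in> part A (par S)\<rbrakk> \<Longrightarrow> tens A a S \<in> carrier GA"
  by (auto simp: env_carrier tens_def)

lemma tens_zero [simp]: "tens A \<zero> S = \<zero>\<^bsub>GA\<^esub>"
  by (auto simp: tens_def)

lemma tens_mult:
  assumes "finite S" "finite T" "a \<in> carrier A" "b \<in> carrier A"
  shows "tens A a S \<otimes>\<^bsub>GA\<^esub> tens A b T =
    (if S \<inter> T = {} then tens A (grassmann_sign S T \<odot> (a \<otimes> b)) (S \<union> T) else \<zero>\<^bsub>GA\<^esub>)"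
proof
  fix U
  let ?f = "\<lambda>S'. grassmann_sign S' (U - S') \<odot> (tens A a S S' \<otimes> tens A b T (U - S'))"
  have c: "?f S' \<in> carrier A" for S' using assms by (auto simp: tens_def)
  show "(tens A a S \<otimes>\<^bsub>GA\<^esub> tens A b T) U =
    (if S \<inter> T = {} then tens A (grassmann_sign S T \<odot> (a \<otimes> b)) (S \<union> T) else \<zero>\<^bsub>GA\<^esub>) U"
  proof (cases "S \<subseteq> U \<and> T = U - S")
    case True
    then have fin: "finite U" using assms by (metis finite_Diff2)
    have "(tens A a S \<otimes>\<^bsub>GA\<^esub> tens A b T) U = finsum A (\<lambda>i. if S = i then ?f i else \<zero>) (Pow U)"
      unfolding env_mult using c assms by (intro M.finsum_cong') (auto simp: tens_def)
    also have "\<dots> = ?f S"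
      by (rule M.finsum_singleton) (use True fin c in auto)
    finally show ?thesis using True by (auto simp: tens_def)
  next
    case False
    have "(tens A a S \<otimes>\<^bsub>GA\<^esub> tens A b T) U = finsum A (\<lambda>i. \<zero>) (Pow U)"
      unfolding env_mult using c assms False by (intro M.finsum_cong') (auto simp: tens_def)
    also have "\<dots> = \<zero>" by simp
    finally show ?thesis using False by (auto simp: tens_def)
  qed
qed

end

locale super_hom = A: superalgebra A + B: superalgebra B + nonassoc_hom A B h
  for A :: "('k::field, 'a, 'm) superalg_scheme" and B :: "('k, 'b, 'n) superalg_scheme" and h +
  assumes hom_part: "x \<in> part A i \<Longrightarrow> h x \<in> part B i"
begin

lemma env_hom: "(\<lambda>f S. h (f S)) \<in> alg_hom (grassmann_envelope A) (grassmann_envelope B)"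
proof (rule alg_homI)
  fix f assume f: "f \<in> carrier A.GA"
  have "{S. h (f S) \<noteq> \<zero>\<^bsub>B\<^esub>} \<subseteq> {S. f S \<noteq> \<zero>\<^bsub>A\<^esub>}" by auto
  then show "(\<lambda>S. h (f S)) \<in> carrier B.GA"
    using f by (auto simp: env_carrier hom_part intro: finite_subset)
next
  fix f g assume fg: "f \<in> carrier A.GA" "g \<in> carrier A.GA"
  have "h ((f \<otimes>\<^bsub>A.GA\<^esub> g) U) = ((\<lambda>S. h (f S)) \<otimes>\<^bsub>B.GA\<^esub> (\<lambda>S. h (g S))) U" for U
    unfolding env_mult using fg
    by (subst hom_finsum) (auto simp: A.env_closed intro!: B.M.finsum_cong')
  then show "(\<lambda>S. h ((f \<otimes>\<^bsub>A.GA\<^esub> g) S)) = (\<lambda>S. h (f S)) \<otimes>\<^bsub>B.GA\<^esub> (\<lambda>S. h (g S))" by auto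
qed (auto simp: A.env_closed)

sublocale env: nonassoc_hom "grassmann_envelope A" "grassmann_envelope B" "\<lambda>f S. h (f S)"
  by (intro nonassoc_homI A.nonassoc_algebra_env B.nonassoc_algebra_env env_hom)

lemma env_surj:
  assumes "\<And>i. part B i \<subseteq> h ` part A i"
  shows "(\<lambda>f S. h (f S)) ` carrier A.GA = carrier B.GA"
proof
  show "carrier B.GA \<subseteq> (\<lambda>f S. h (f S)) ` carrier A.GA"
  proof
    fix g assume g: "g \<in> carrier B.GA"
    \<comment> \<open>Zero components are lifted to zero; arbitrary preimages could have infinite
      support.\<close>
    define f where "f S = (if g S = \<zero>\<^bsub>B\<^esub> then \<zero>\<^bsub>A\<^esub> else (SOME a. a \<in> part A (par S) \<and> h a = g S))" for S
    have *: "f S \<in> part A (par S) \<and> h (f S) = g S" for S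
    proof (cases "g S = \<zero>\<^bsub>B\<^esub>")
      case False
      have "\<exists>a. a \<in> part A (par S) \<and> h a = g S"
        using g assms[of "par S"] by (force simp: env_carrier)
      then show ?thesis using someI_ex[of "\<lambda>a. a \<in> part A (par S) \<and> h a = g S"] False
        by (simp add: f_def)
    qed (simp add: f_def)
    have "{S. f S \<noteq> \<zero>\<^bsub>A\<^esub>} \<subseteq> {S. g S \<noteq> \<zero>\<^bsub>B\<^esub>}" by (auto simp: f_def)
    then have "f \<in> carrier A.GA" using g * by (auto simp: env_carrier f_def intro: finite_subset)
    then show "g \<in> (\<lambda>f S. h (f S)) ` carrier A.GA" using * by (intro image_eqI[of _ _ f]) auto
  qed
qed auto

lemma env_inj: "inj_on h (carrier A) \<Longrightarrow> inj_on (\<lambda>f S. h (f S)) (carrier A.GA)"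
  by (intro inj_onI ext) (metis A.env_closed inj_onD)

end

lemma (in nonassoc_hom) jordan_image:
  assumes "jordan_algebra A" "h ` carrier A = carrier B"
  shows "jordan_algebra B"
  unfolding jordan_algebra_def
proof (intro conjI ballI)
  fix x y assume "x \<in> carrier B" "y \<in> carrier B"
  then obtain a b where "a \<in> carrier A" "b \<in> carrier A" "x = h a" "y = h b" using assms(2) by blast
  then show "x \<otimes>\<^bsub>B\<^esub> y = y \<otimes>\<^bsub>B\<^esub> x" "associator B (x \<otimes>\<^bsub>B\<^esub> x) y x = \<zero>\<^bsub>B\<^esub>"
    using assms(1) unfolding jordan_algebra_def
    by (metis hom_mult, metis hom_mult hom_associator hom_zero A.mult_closed)
qed (rule B.nonassoc_algebra_axioms)

lemma (in nonassoc_hom) jordan_inj: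
  assumes "jordan_algebra B" "inj_on h (carrier A)"
  shows "jordan_algebra A"
  unfolding jordan_algebra_def
proof (intro conjI ballI)
  fix x y assume xy: "x \<in> carrier A" "y \<in> carrier A"
  have "h (x \<otimes>\<^bsub>A\<^esub> y) = h (y \<otimes>\<^bsub>A\<^esub> x)" "h (associator A (x \<otimes>\<^bsub>A\<^esub> x) y x) = h \<zero>\<^bsub>A\<^esub>"
    using xy assms(1) by (simp_all add: jordan_algebra_def)
  then show "x \<otimes>\<^bsub>A\<^esub> y = y \<otimes>\<^bsub>A\<^esub> x" "associator A (x \<otimes>\<^bsub>A\<^esub> x) y x = \<zero>\<^bsub>A\<^esub>"
    using inj_onD[OF assms(2), of "x \<otimes>\<^bsub>A\<^esub> y" "y \<otimes>\<^bsub>A\<^esub> x"]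
      inj_onD[OF assms(2), of "associator A (x \<otimes>\<^bsub>A\<^esub> x) y x" "\<zero>\<^bsub>A\<^esub>"] xy by blast+
qed (rule A.nonassoc_algebra_axioms)

section \<open>Quotients of superalgebras\<close>

lemma super_quot_simps [simp]:
  "carrier (super_quot A I) = carrier (alg_quot A I)"
  "\<zero>\<^bsub>super_quot A I\<^esub> = \<zero>\<^bsub>alg_quot A I\<^esub>"
  "add (super_quot A I) = add (alg_quot A I)"
  "monoid.mult (super_quot A I) = monoid.mult (alg_quot A I)"
  "module.smult (super_quot A I) = module.smult (alg_quot A I)"
  "part (super_quot A I) i = (\<lambda>a. I +>\<^bsub>A\<^esub> a) ` part A i"
  by (simp_all add: super_quot_def module.defs superalg.defs)

text \<open>Homogeneity of \<open>I\<close>: without it the images of the even and odd parts in the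
  quotient could meet outside zero.\<close>

definition graded_set :: "('k, 'a, 'm) superalg_scheme \<Rightarrow> 'a set \<Rightarrow> bool" where
  "graded_set A I \<longleftrightarrow> (\<forall>x\<in>I. \<exists>x0\<in>I \<inter> part A 0. \<exists>x1\<in>I \<inter> part A 1. x = x0 \<oplus>\<^bsub>A\<^esub> x1)"

locale super_quotient = superalgebra A + alg_quotient A I
  for A :: "('k::field, 'a, 'm) superalg_scheme" (structure) and I
begin

lemma nonassoc_super_quot: "nonassoc_algebra (super_quot A I)"
  by (rule nonassoc_algebra.nonassoc_algebra_cong[OF nonassoc_algebra_quot]) simp_all

lemma super_quot_hom: "(\<lambda>a. I +> a) \<in> alg_hom A (super_quot A I)"
  using quot_hom by (simp add: alg_hom_def)

lemma super_quot_superalgebra: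
  assumes gr: "graded_set A I"
  shows "superalgebra (super_quot A I)"
proof (intro superalgebra.intro superalgebra_axioms.intro nonassoc_super_quot)
  interpret Q: nonassoc_algebra "super_quot A I" by (rule nonassoc_super_quot)
  show "submodule (part (super_quot A I) i) ring_of_type_algebra (super_quot A I)" for i
    unfolding Q.submodule_iff
  proof (intro conjI ballI allI)
    show "\<zero>\<^bsub>super_quot A I\<^esub> \<in> part (super_quot A I) i"
      using coset_zero_iff[of \<zero>] I_simps(2) by (auto intro: image_eqI[of _ _ \<zero>])
  qed (auto simp: part_closed intro!: part_add part_smult)
  show "carrier (super_quot A I) = part (super_quot A I) 0 <+>\<^bsub>super_quot A I\<^esub> part (super_quot A I) 1"
  proof
    show "carrier (super_quot A I) \<subseteq> part (super_quot A I) 0 <+>\<^bsub>super_quot A I\<^esub> part (super_quot A I) 1"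
    proof
      fix Y assume "Y \<in> carrier (super_quot A I)"
      then obtain x where x: "x \<in> carrier A" "Y = I +> x" by auto
      obtain x0 x1 where x01: "x0 \<in> part A 0" "x1 \<in> part A 1" "x = x0 \<oplus> x1" using part_decomp[OF x(1)] .
      then have "Y = (I +> x0) \<oplus>\<^bsub>super_quot A I\<^esub> (I +> x1)" using x by (simp add: part_closed)
      moreover have "I +> x0 \<in> part (super_quot A I) 0" "I +> x1 \<in> part (super_quot A I) 1"
        using x01 by auto
      ultimately show "Y \<in> part (super_quot A I) 0 <+>\<^bsub>super_quot A I\<^esub> part (super_quot A I) 1"
        unfolding set_add_def set_mult_def by (simp del: super_quot_simps) blast
    qed
  qed (auto simp: set_add_def set_mult_def part_closed)
  show "part (super_quot A I) 0 \<inter> part (super_quot A I) 1 = {\<zero>\<^bsub>super_quot A I\<^esub>}"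
  proof
    show "part (super_quot A I) 0 \<inter> part (super_quot A I) 1 \<subseteq> {\<zero>\<^bsub>super_quot A I\<^esub>}"
    proof
      fix Y assume "Y \<in> part (super_quot A I) 0 \<inter> part (super_quot A I) 1"
      then obtain a b where ab: "a \<in> part A 0" "b \<in> part A 1" "Y = I +> a" "Y = I +> b" by auto
      then have "a \<ominus> b \<in> I" using coset_eq_iff[of a b] by (auto simp: part_closed)
      then obtain x0 x1 where x: "x0 \<in> I" "x0 \<in> part A 0" "x1 \<in> part A 1" "a \<ominus> b = x0 \<oplus> x1"
        using gr unfolding graded_set_def by blast
      have c: "a \<in> carrier A" "b \<in> carrier A" "x0 \<in> carrier A" "x1 \<in> carrier A"
        using ab x part_closed by auto
      have "a \<ominus> x0 = x1 \<oplus> b"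
        using x(4) c by (metis M.a_comm M.add.inv_solve_right M.a_assoc M.a_closed M.minus_eq)
      then have "a \<ominus> x0 \<in> part A 1" using ab x by (simp add: part_add)
      moreover have "a \<ominus> x0 \<in> part A 0" using ab x by (simp add: part_minus)
      ultimately have "a = x0" using c minus_eq_zero_iff part_both by blast
      then show "Y \<in> {\<zero>\<^bsub>super_quot A I\<^esub>}" using ab x coset_zero_iff c by simp
    qed
    have "I = I +> \<zero>" using coset_zero_iff[of \<zero>] I_simps(2) by simp
    then show "{\<zero>\<^bsub>super_quot A I\<^esub>} \<subseteq> part (super_quot A I) 0 \<inter> part (super_quot A I) 1" by auto
  qed
next
  fix x y i j assume "x \<in> part (super_quot A I) i" "y \<in> part (super_quot A I) j"
  then obtain a b where ab: "a \<in> part A i" "b \<in> part A j" "x = I +> a" "y = I +> b" by auto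
  then have "x \<otimes>\<^bsub>super_quot A I\<^esub> y = I +> (a \<otimes> b)" by (simp add: part_closed)
  moreover have "I +> (a \<otimes> b) \<in> part (super_quot A I) (i + j)"
    unfolding super_quot_simps(6) using part_mult[OF ab(1,2)] by (rule imageI)
  ultimately show "x \<otimes>\<^bsub>super_quot A I\<^esub> y \<in> part (super_quot A I) (i + j)" by (simp only:)
qed

lemma super_quot_super_hom:
  assumes "graded_set A I" shows "super_hom A (super_quot A I) (\<lambda>a. I +> a)"
  by (intro super_hom.intro nonassoc_homI super_hom_axioms.intro super_quot_superalgebra assms
      superalgebra_axioms nonassoc_algebra_axioms nonassoc_super_quot super_quot_hom) auto

lemma super_quot_jordan:
  assumes "graded_set A I" "jordan_superalgebra A"
  shows "jordan_superalgebra (super_quot A I)"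
proof -
  interpret h: super_hom A "super_quot A I" "\<lambda>a. I +> a" by (rule super_quot_super_hom) fact
  show ?thesis
    using assms(2) h.env.jordan_image[OF _ h.env_surj] h.B.superalgebra_axioms
    by (simp add: jordan_superalgebra_def)
qed

lemma super_quot_lift:
  assumes gr: "graded_set A I" and h: "super_hom A B h" and I: "\<And>x. x \<in> I \<Longrightarrow> h x = \<zero>\<^bsub>B\<^esub>"
  obtains g where "super_hom (super_quot A I) B g" "\<And>x. x \<in> carrier A \<Longrightarrow> g (I +> x) = h x"
proof -
  interpret h: super_hom A B h by fact
  obtain g where g: "g \<in> alg_hom (alg_quot A I) B" "\<And>x. x \<in> carrier A \<Longrightarrow> g (I +> x) = h x"
    using quot_lift[OF h.B.nonassoc_algebra_axioms h.hom I] by blast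
  have "g \<in> alg_hom (super_quot A I) B" using g(1) by (simp add: alg_hom_def)
  then have "super_hom (super_quot A I) B g"
    by (intro super_hom.intro nonassoc_homI super_hom_axioms.intro super_quot_superalgebra gr
        h.B.superalgebra_axioms h.B.nonassoc_algebra_axioms nonassoc_super_quot)
       (use g(2) in \<open>auto simp: part_closed h.hom_part\<close>)
  with g(2) that show ?thesis by blast
qed

end

text \<open>The elements of the generated ideal whose two components also lie in it form an ideal
  \<open>I'\<close>. It contains the homogeneous generators, so by minimality it is
  everything.\<close>

lemma (in superalgebra) graded_ideal_gen:
  assumes S: "S \<subseteq> part A 0 \<union> part A 1"
  shows "graded_set A (alg_ideal_gen A S)"
proof -
  define I where "I = alg_ideal_gen A S"
  have "S \<subseteq> carrier A" using S part_closed by blast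
  then have "alg_ideal I A" unfolding I_def by (rule alg_ideal_gen_ideal)
  then interpret I: alg_quotient A I by unfold_locales
  define I' where "I' = {x \<in> I. \<exists>x0\<in>I \<inter> part A 0. \<exists>x1\<in>I \<inter> part A 1. x = x0 \<oplus> x1}"
  have I'I: "x0 \<oplus> x1 \<in> I'" if "x0 \<in> I" "x0 \<in> part A 0" "x1 \<in> I" "x1 \<in> part A 1" for x0 x1
    using that I.I_simps(3) unfolding I'_def by blast
  have I'E: "\<exists>x0 x1. x0 \<in> I \<and> x0 \<in> part A 0 \<and> x1 \<in> I \<and> x1 \<in> part A 1 \<and> x = x0 \<oplus> x1" if "x \<in> I'" for x
    using that unfolding I'_def by blast
  have "alg_ideal I' A"
    unfolding alg_ideal_iff
  proof (intro conjI ballI allI)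
    show "I' \<subseteq> carrier A" using I.I_simps(1) by (auto simp: I'_def)
    show "\<zero> \<in> I'" using I'I[of \<zero> \<zero>] I.I_simps(2) by simp
  next
    fix x y assume "x \<in> I'" "y \<in> I'"
    then obtain x0 x1 y0 y1 where *: "x0 \<in> I" "x0 \<in> part A 0" "x1 \<in> I" "x1 \<in> part A 1" "x = x0 \<oplus> x1"
      "y0 \<in> I" "y0 \<in> part A 0" "y1 \<in> I" "y1 \<in> part A 1" "y = y0 \<oplus> y1" using I'E by metis
    then have "x \<oplus> y = (x0 \<oplus> y0) \<oplus> (x1 \<oplus> y1)" by (simp add: part_closed M.a_ac)
    then show "x \<oplus> y \<in> I'" using * by (simp add: I'I I.I_simps part_add)
  next
    fix c x assume "x \<in> I'"
    then obtain x0 x1 where *: "x0 \<in> I" "x0 \<in> part A 0" "x1 \<in> I" "x1 \<in> part A 1" "x = x0 \<oplus> x1"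
      using I'E by metis
    then have "c \<odot> x = c \<odot> x0 \<oplus> c \<odot> x1" by (simp add: part_closed smult_add_right)
    then show "c \<odot> x \<in> I'" using * by (simp add: I'I I.I_simps part_smult)
  next
    fix a x assume a: "a \<in> carrier A" and "x \<in> I'"
    then obtain x0 x1 where *: "x0 \<in> I" "x0 \<in> part A 0" "x1 \<in> I" "x1 \<in> part A 1" "x = x0 \<oplus> x1"
      using I'E by metis
    obtain a0 a1 where a': "a0 \<in> part A 0" "a1 \<in> part A 1" "a = a0 \<oplus> a1" using part_decomp[OF a] .
    note c = part_closed[OF *(2)] part_closed[OF *(4)] part_closed[OF a'(1)] part_closed[OF a'(2)]
    note m = part_mult[OF *(2) a'(1)] part_mult[OF *(2) a'(2)] part_mult[OF *(4) a'(1)] part_mult[OF *(4) a'(2)]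
      part_mult[OF a'(1) *(2)] part_mult[OF a'(2) *(2)] part_mult[OF a'(1) *(4)] part_mult[OF a'(2) *(4)]
    have "a \<otimes> x = (a0 \<otimes> x0 \<oplus> a1 \<otimes> x1) \<oplus> (a0 \<otimes> x1 \<oplus> a1 \<otimes> x0)"
      "x \<otimes> a = (x0 \<otimes> a0 \<oplus> x1 \<otimes> a1) \<oplus> (x1 \<otimes> a0 \<oplus> x0 \<otimes> a1)"
      using * a' c by (simp_all add: mult_add_left mult_add_right M.a_ac)
    moreover have "(a0 \<otimes> x0 \<oplus> a1 \<otimes> x1) \<oplus> (a0 \<otimes> x1 \<oplus> a1 \<otimes> x0) \<in> I'"
      "(x0 \<otimes> a0 \<oplus> x1 \<otimes> a1) \<oplus> (x1 \<otimes> a0 \<oplus> x0 \<otimes> a1) \<in> I'"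
      using * c m by (simp_all add: I'I I.I_simps part_add)
    ultimately show "a \<otimes> x \<in> I'" "x \<otimes> a \<in> I'" by simp_all
  qed
  moreover have "S \<subseteq> I'"
  proof
    fix s assume s: "s \<in> S"
    then have "s \<in> I" using alg_ideal_gen_incl by (auto simp: I_def)
    then show "s \<in> I'" using S s I'I[of s \<zero>] I'I[of \<zero> s] I.I_simps(1,2) by auto
  qed
  ultimately have "I \<subseteq> I'" unfolding I_def by (rule alg_ideal_gen_least)
  then show ?thesis using I'E unfolding graded_set_def I_def[symmetric] by blast
qed

section \<open>Identities modulo an ideal\<close>

text \<open>Identities are verified as equations in an abelian group modulo an ideal
  \<open>K\<close>, where \<open>algebra_simps\<close> applies, instead of in quotient records. The
  intended instance is a free nonassociative algebra with \<open>K\<close> the kernel of a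
  homomorphism. Closure under division by 2, 3 and 5 stands in for characteristic zero.\<close>

locale nalg_mod =
  fixes m :: "'a::ab_group_add \<Rightarrow> 'a \<Rightarrow> 'a" (infixl \<open>\<star>\<close> 70) and K :: "'a set"
  assumes m_add_left: "(x + y) \<star> z = x \<star> z + y \<star> z"
    and m_add_right: "z \<star> (x + y) = z \<star> x + z \<star> y"
    and K_zero: "0 \<in> K"
    and K_add: "\<lbrakk>x \<in> K; y \<in> K\<rbrakk> \<Longrightarrow> x + y \<in> K"
    and K_uminus: "x \<in> K \<Longrightarrow> - x \<in> K"
    and K_left: "x \<in> K \<Longrightarrow> x \<star> y \<in> K"
    and K_right: "x \<in> K \<Longrightarrow> y \<star> x \<in> K"
    and K_div2: "x + x \<in> K \<Longrightarrow> x \<in> K"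
    and K_div3: "x + x + x \<in> K \<Longrightarrow> x \<in> K"
    and K_div5: "x + x + x + x + x \<in> K \<Longrightarrow> x \<in> K"
begin

lemma K_diff: "\<lbrakk>x \<in> K; y \<in> K\<rbrakk> \<Longrightarrow> x - y \<in> K"
  using K_add[of x "- y"] K_uminus[of y] by simp

lemma m_zero_left [simp]: "0 \<star> x = 0"
  using m_add_left[of 0 0 x] by simp

lemma m_zero_right [simp]: "x \<star> 0 = 0"
  using m_add_right[of x 0 0] by simp

lemma m_uminus_left: "(- x) \<star> y = - (x \<star> y)"
  using m_add_left[of x "- x" y] by (simp add: eq_neg_iff_add_eq_0 add.commute)

lemma m_uminus_right: "x \<star> (- y) = - (x \<star> y)"
  using m_add_right[of x y "- y"] by (simp add: eq_neg_iff_add_eq_0 add.commute)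

lemma m_diff_left: "(x - y) \<star> z = x \<star> z - y \<star> z"
  using m_add_left[of x "- y" z] by (simp add: m_uminus_left)

lemma m_diff_right: "z \<star> (x - y) = z \<star> x - z \<star> y"
  using m_add_right[of z x "- y"] by (simp add: m_uminus_right)

lemmas m_distribs = m_add_left m_add_right m_diff_left m_diff_right m_uminus_left m_uminus_right

definition as where "as x y z = (x \<star> y) \<star> z - x \<star> (y \<star> z)"

lemma as_distribs:
  "as (x + x') y z = as x y z + as x' y z" "as x (y + y') z = as x y z + as x y' z"
  "as x y (z + z') = as x y z + as x y z'"
  "as (x - x') y z = as x y z - as x' y z" "as x (y - y') z = as x y z - as x y' z"
  "as x y (z - z') = as x y z - as x y z'"
  by (simp_all add: as_def m_distribs)

lemma as_K: "x \<in> K \<Longrightarrow> as x y z \<in> K" "x \<in> K \<Longrightarrow> as y x z \<in> K" "x \<in> K \<Longrightarrow> as y z x \<in> K"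
  by (simp_all add: as_def K_diff K_left K_right)

end

section \<open>Associator calculus in strongly (-1,1)-algebras\<close>

locale sm11_mod = nalg_mod +
  assumes right_alt: "as x y y \<in> K"
    and cyclic: "as x y z + as y z x + as z x y \<in> K"
    and comm_central: "(x \<star> y - y \<star> x) \<star> z - z \<star> (x \<star> y - y \<star> x) \<in> K"
begin

lemma right_alt': "as x y z + as x z y \<in> K"
proof -
  have "as x (y + z) (y + z) - as x y y - as x z z \<in> K"
    by (intro K_diff right_alt)
  then show ?thesis by (simp add: as_distribs algebra_simps)
qed

text \<open>For the doubled symmetrized product \<open>c\<close> the associator of a, b, d is
  2(b,a,d) modulo \<open>K\<close>. The Jordan identity thus reduces to the vanishing of (y,x^2,x),
  which follows from the Teichmueller identity for y, x, x, x and right alternativity.\<close>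

lemma plus_jordan:
  fixes x y
  defines "c \<equiv> \<lambda>x y. x \<star> y + y \<star> x"
  shows "c (c (c x x) y) x - c (c x x) (c y x) \<in> K"
proof -
  have 1: "c (c a b) d - c a (c b d) - (as b a d + as b a d) \<in> K" for a b d
  proof -
    have "(as a b d + as a d b) - (as d b a + as d a b) - (as b a d + as b d a)
      - ((a \<star> d - d \<star> a) \<star> b - b \<star> (a \<star> d - d \<star> a)) \<in> K"
      by (intro K_diff right_alt' comm_central)
    then show ?thesis by (simp add: c_def as_def m_distribs algebra_simps)
  qed
  have "as (y \<star> x) x x + (as y (x \<star> x) x + as y x (x \<star> x)) - y \<star> as x x x - as y x x \<star> x \<in> K"
    by (intro K_right[OF right_alt] K_left[OF right_alt] right_alt right_alt' K_diff K_add)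
  moreover have "as (y \<star> x) x x + (as y (x \<star> x) x + as y x (x \<star> x)) - y \<star> as x x x - as y x x \<star> x
    = as y (x \<star> x) x + as y (x \<star> x) x"
    by (simp add: as_def m_distribs algebra_simps)
  ultimately have 2: "as y (x \<star> x) x + as y (x \<star> x) x \<in> K" by simp
  have "(c (c (c x x) y) x - c (c x x) (c y x) - (as y (c x x) x + as y (c x x) x))
    + ((as y (x \<star> x) x + as y (x \<star> x) x) + (as y (x \<star> x) x + as y (x \<star> x) x)) \<in> K"
    by (intro K_add 1 2)
  moreover have "as y (c x x) x = as y (x \<star> x) x + as y (x \<star> x) x"
    by (simp add: c_def as_distribs)
  ultimately show ?thesis by simp
qed

text \<open>By \<open>comm_central\<close> every commutator belongs to this set. For the
  presentation of \<open>A0\<close> it will contain z and all even letters of the normal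
  form.\<close>

definition "Zc = {c. \<forall>a. c \<star> a - a \<star> c \<in> K}"

lemma ZD: "c \<in> Zc \<Longrightarrow> c \<star> a - a \<star> c \<in> K"
  by (simp add: Zc_def)

lemma Z_commutator: "a \<star> b - b \<star> a \<in> Zc"
  using comm_central by (simp add: Zc_def)

lemma Z_K: "c \<in> K \<Longrightarrow> c \<in> Zc"
  by (simp add: Zc_def K_diff K_left K_right)

lemma Z_add: "\<lbrakk>c \<in> Zc; d \<in> Zc\<rbrakk> \<Longrightarrow> c + d \<in> Zc"
  unfolding Zc_def
proof (intro CollectI allI)
  fix a assume "c \<in> {c. \<forall>a. c \<star> a - a \<star> c \<in> K}" "d \<in> {c. \<forall>a. c \<star> a - a \<star> c \<in> K}"
  then have "(c \<star> a - a \<star> c) + (d \<star> a - a \<star> d) \<in> K" by (intro K_add) auto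
  then show "(c + d) \<star> a - a \<star> (c + d) \<in> K" by (simp add: m_distribs algebra_simps)
qed

lemma Z_uminus: "c \<in> Zc \<Longrightarrow> - c \<in> Zc"
  unfolding Zc_def
proof (intro CollectI allI)
  fix a assume "c \<in> {c. \<forall>a. c \<star> a - a \<star> c \<in> K}"
  then have "- (c \<star> a - a \<star> c) \<in> K" by (intro K_uminus) simp
  then show "- c \<star> a - a \<star> - c \<in> K" by (simp add: m_distribs)
qed

lemma Z_diff: "\<lbrakk>c \<in> Zc; d \<in> Zc\<rbrakk> \<Longrightarrow> c - d \<in> Zc"
  using Z_add[of c "- d"] Z_uminus[of d] by simp

lemma Z_div2: assumes "c + c \<in> Zc" shows "c \<in> Zc"
  unfolding Zc_def
proof (intro CollectI allI)
  fix a have "c \<star> a - a \<star> c + (c \<star> a - a \<star> c) \<in> K"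
    using ZD[OF assms, of a] by (simp add: m_distribs algebra_simps)
  then show "c \<star> a - a \<star> c \<in> K" by (rule K_div2)
qed

lemma Z_div3: assumes "c + c + c \<in> Zc" shows "c \<in> Zc"
  unfolding Zc_def
proof (intro CollectI allI)
  fix a have "c \<star> a - a \<star> c + (c \<star> a - a \<star> c) + (c \<star> a - a \<star> c) \<in> K"
    using ZD[OF assms, of a] by (simp add: m_distribs algebra_simps)
  then show "c \<star> a - a \<star> c \<in> K" by (rule K_div3)
qed

text \<open>In any algebra [ab,c] - a[b,c] - [a,c]b equals (a,b,c) - (a,c,b) + (c,a,b). For
  \<open>c\<close> in \<open>Zc\<close> the commutators vanish, and right alternativity merges the
  first two associators into -2(a,c,b).\<close>

lemma Z_middle:
  assumes "c \<in> Zc" shows "as c a b - (as a c b + as a c b) \<in> K"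
proof -
  have 1: "(c \<star> (a \<star> b) - (a \<star> b) \<star> c) - a \<star> (c \<star> b - b \<star> c) - (c \<star> a - a \<star> c) \<star> b \<in> K"
    by (rule K_diff[OF K_diff[OF ZD[OF assms] K_right[OF ZD[OF assms]]] K_left[OF ZD[OF assms]]])
  have "- ((c \<star> (a \<star> b) - (a \<star> b) \<star> c) - a \<star> (c \<star> b - b \<star> c) - (c \<star> a - a \<star> c) \<star> b)
    - (as a b c + as a c b) \<in> K"
    by (rule K_diff[OF K_uminus[OF 1] right_alt'])
  then show ?thesis by (simp add: as_def m_distribs algebra_simps)
qed

text \<open>Applying \<open>Z_middle\<close> to each of the two elements gives (c,d,a) = 2(d,c,a) =
  4(c,d,a), so 3(c,d,a) = 0.\<close>

lemma Z_assoc: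
  assumes c: "c \<in> Zc" and d: "d \<in> Zc"
  shows "as c d a \<in> K" "as c a d \<in> K" "as a c d \<in> K"
proof -
  have "(as c d a - (as d c a + as d c a)) + ((as d c a - (as c d a + as c d a))
      + (as d c a - (as c d a + as c d a))) \<in> K"
    by (intro Z_middle[OF c] Z_middle[OF d] K_add)
  then have "- (as c d a + as c d a + as c d a) \<in> K" by (simp add: algebra_simps)
  from K_uminus[OF this] have "as c d a + as c d a + as c d a \<in> K" by (simp only: minus_minus)
  then show 1: "as c d a \<in> K" by (rule K_div3)
  have "(as c d a + as c a d) - as c d a \<in> K" by (intro K_diff right_alt' 1)
  then show 2: "as c a d \<in> K" by simp
  have "as c a d - (as c a d - (as a c d + as a c d)) \<in> K" by (intro K_diff Z_middle 2 c)
  then have "as a c d + as a c d \<in> K" by simp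
  then show "as a c d \<in> K" by (rule K_div2)
qed

lemma Z_mult:
  assumes c: "c \<in> Zc" and d: "d \<in> Zc" shows "c \<star> d \<in> Zc"
  unfolding Zc_def
proof (intro CollectI allI)
  fix a
  have "c \<star> (d \<star> a - a \<star> d) + (c \<star> a - a \<star> c) \<star> d + as c d a - as c a d + as a c d \<in> K"
    by (intro K_right[OF ZD[OF d]] K_left[OF ZD[OF c]] Z_assoc[OF c d] K_diff K_add)
  then show "(c \<star> d) \<star> a - a \<star> (c \<star> d) \<in> K" by (simp add: as_def m_distribs)
qed

text \<open>\<open>R\<close> expresses the defect (c,da,b) - d(c,a,b) as 2s(d,c), where s(c,d) is
  (c,da,b) symmetrized in a and b. Symmetrizing \<open>R\<close> itself yields s(c,d) = 4s(d,c);
  using this in both directions gives 15s(d,c) = 0, which is where division by 5 enters.\<close>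

lemma Z_pull:
  assumes c: "c \<in> Zc" and d: "d \<in> Zc"
  shows "as c (d \<star> a) b - d \<star> as c a b \<in> K"
proof -
  have R: "as c (d \<star> a) b - (as d (c \<star> a) b + as d (c \<star> a) b)
      - (as d (c \<star> b) a + as d (c \<star> b) a) - d \<star> as c a b \<in> K"
    if c: "c \<in> Zc" and d: "d \<in> Zc" for a b c d
  proof -
    have "(as c (d \<star> a) b - (as (d \<star> a) c b + as (d \<star> a) c b))
      + (as d (a \<star> c - c \<star> a) b + as d (a \<star> c - c \<star> a) b)
      - ((as d a (c \<star> b) + as d (c \<star> b) a) + (as d a (c \<star> b) + as d (c \<star> b) a))
      - d \<star> (as c a b - (as a c b + as a c b)) + (as d a c \<star> b + as d a c \<star> b) \<in> K"
      by (intro as_K(2)[OF K_uminus[OF ZD[OF c], unfolded minus_diff_eq]] K_right[OF Z_middle[OF c]]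
          K_left[OF Z_assoc(2)[OF d c]] Z_middle[OF c] right_alt' K_diff K_add)
    \<comment> \<open>The Teichmueller identity for d, a, c, b; \<open>Z_middle\<close> and right
      alternativity then bring \<open>c\<close> or \<open>d\<close> to the front of each
      associator.\<close>
    moreover have "as (d \<star> a) c b = as d (a \<star> c) b - as d a (c \<star> b) + d \<star> as a c b + as d a c \<star> b"
      by (simp add: as_def m_distribs algebra_simps)
    ultimately show ?thesis
      by (simp add: as_distribs m_distribs algebra_simps)
  qed
  define s where "s c d = as c (d \<star> a) b + as c (d \<star> b) a" for c d
  have S: "s c d - (s d c + s d c + s d c + s d c) \<in> K" if c: "c \<in> Zc" and d: "d \<in> Zc" for c d
  proof -
    have "(as c (d \<star> a) b - (as d (c \<star> a) b + as d (c \<star> a) b)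
      - (as d (c \<star> b) a + as d (c \<star> b) a) - d \<star> as c a b)
      + (as c (d \<star> b) a - (as d (c \<star> b) a + as d (c \<star> b) a)
      - (as d (c \<star> a) b + as d (c \<star> a) b) - d \<star> as c b a) + d \<star> (as c a b + as c b a) \<in> K"
      by (intro K_right[OF right_alt'] R[OF c d] K_add)
    then show ?thesis by (simp add: s_def m_distribs algebra_simps)
  qed
  have s: "s d c \<in> K"
  proof -
    let ?t = "s d c + s d c + s d c"
    have "(s c d - (s d c + s d c + s d c + s d c)) + (s c d - (s d c + s d c + s d c + s d c))
      + (s c d - (s d c + s d c + s d c + s d c)) + (s c d - (s d c + s d c + s d c + s d c))
      + (s d c - (s c d + s c d + s c d + s c d)) \<in> K"
      by (intro K_add S c d)
    then have "- (?t + ?t + ?t + ?t + ?t) \<in> K" by (simp add: algebra_simps)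
    from K_uminus[OF this] have "?t + ?t + ?t + ?t + ?t \<in> K" by (simp only: minus_minus)
    then show ?thesis by (rule K_div3[OF K_div5])
  qed
  have "(as c (d \<star> a) b - (as d (c \<star> a) b + as d (c \<star> a) b)
      - (as d (c \<star> b) a + as d (c \<star> b) a) - d \<star> as c a b) + (s d c + s d c) \<in> K"
    by (intro K_add R s c d)
  then show ?thesis by (simp add: s_def algebra_simps)
qed

lemma Z_pull':
  assumes c: "c \<in> Zc" and d: "d \<in> Zc"
  shows "as c a (d \<star> b) - d \<star> as c a b \<in> K"
proof -
  have "(as c a (d \<star> b) + as c (d \<star> b) a) - (as c (d \<star> b) a - d \<star> as c b a) - d \<star> (as c a b + as c b a) \<in> K"
    by (intro K_right[OF right_alt'] right_alt' Z_pull[OF c d] K_diff)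
  then show ?thesis by (simp add: m_distribs algebra_simps)
qed

text \<open>Modulo \<open>K\<close>, 3(c,a,b) is 2([ca,b] - c[a,b]). Both terms lie in
  \<open>Zc\<close>: one is a commutator, the other a product of two elements of
  \<open>Zc\<close>.\<close>

lemma Z_as: assumes c: "c \<in> Zc" shows "as c a b \<in> Zc"
proof -
  let ?e = "(c \<star> a) \<star> b - b \<star> (c \<star> a)" and ?f = "c \<star> (a \<star> b - b \<star> a)"
  have 1: "(?e - ?f) + (?e - ?f) \<in> Zc"
    by (intro Z_add Z_diff Z_commutator Z_mult c)
  have 2: "as c a b + as c a b + as c a b - ((?e - ?f) + (?e - ?f)) \<in> K"
  proof -
    have "(as c a b + as c b a) - ((c \<star> b - b \<star> c) \<star> a + (c \<star> b - b \<star> c) \<star> a)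
      + (as c b a - (as b c a + as b c a)) + 0 \<in> K"
      by (intro right_alt' Z_middle[OF c] K_left[OF ZD[OF c]] K_zero K_add K_diff)
    then show ?thesis by (simp add: as_def m_distribs algebra_simps)
  qed
  have "as c a b + as c a b + as c a b \<in> Zc"
    using Z_add[OF Z_K[OF 2] 1] by simp
  then show ?thesis by (rule Z_div3)
qed

text \<open>The rule for moving a letter \<open>c\<close> out of the right factor of a product; it
  is the source of the coefficient 1/2 in the normal form of \<open>A0\<close>.\<close>

lemma Z_shift:
  assumes c: "c \<in> Zc"
  shows "(a \<star> (c \<star> b) - c \<star> (a \<star> b)) + (a \<star> (c \<star> b) - c \<star> (a \<star> b)) - as c a b \<in> K"
proof -
  have "(as c a b - (as a c b + as a c b)) - ((c \<star> a - a \<star> c) \<star> b + (c \<star> a - a \<star> c) \<star> b) \<in> K"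
    by (intro Z_middle[OF c] K_left[OF ZD[OF c]] K_diff K_add)
  then show ?thesis by (simp add: as_def m_distribs algebra_simps)
qed

end

section \<open>Associator calculus in Jordan algebras\<close>

locale jordan_mod = nalg_mod +
  assumes m_comm: "x \<star> y = y \<star> x"
    and jordan: "as (x \<star> x) y x \<in> K"
begin

lemma jordan_linear: "as (a \<star> b) y c + as (b \<star> c) y a + as (c \<star> a) y b \<in> K"
proof (rule K_div2)
  \<comment> \<open>Inclusion-exclusion isolates the part of the Jordan identity that is linear in
    each of a, b, c; commutativity makes each of its terms appear twice.\<close>
  have "as ((a + b + c) \<star> (a + b + c)) y (a + b + c) - as ((a + b) \<star> (a + b)) y (a + b)
    - as ((b + c) \<star> (b + c)) y (b + c) - as ((a + c) \<star> (a + c)) y (a + c)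
    + as (a \<star> a) y a + as (b \<star> b) y b + as (c \<star> c) y c \<in> K"
    by (intro K_add K_diff jordan)
  then show "as (a \<star> b) y c + as (b \<star> c) y a + as (c \<star> a) y b
    + (as (a \<star> b) y c + as (b \<star> c) y a + as (c \<star> a) y b) \<in> K"
    by (simp add: m_distribs as_distribs m_comm algebra_simps)
qed

lemma flexible: "as a b c = - as c b a"
  by (simp add: as_def m_comm)

text \<open>The ordinary form of the condition that J[z;x] imposes on z. The super version is
  reached later through Grassmann envelopes, so no signs are needed here.\<close>

definition "Zc = {c. \<forall>a b. as c a b + as c b a \<in> K}"

lemma ZD: "c \<in> Zc \<Longrightarrow> as c a b + as c b a \<in> K"
  by (simp add: Zc_def)

lemma Z_diag: "c \<in> Zc \<Longrightarrow> as c a a \<in> K"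
  by (rule K_div2[OF ZD])

lemma Z_diagI: assumes "\<And>a. as c a a \<in> K" shows "c \<in> Zc"
  unfolding Zc_def
proof (intro CollectI allI)
  fix a b
  have "as c (a + b) (a + b) - as c a a - as c b b \<in> K" by (intro K_diff assms)
  then show "as c a b + as c b a \<in> K" by (simp add: as_distribs algebra_simps)
qed

lemma Z_div2: assumes "c + c \<in> Zc" shows "c \<in> Zc"
proof (rule Z_diagI)
  fix a have "as c a a + as c a a \<in> K" using Z_diag[OF assms, of a] by (simp add: as_distribs)
  then show "as c a a \<in> K" by (rule K_div2)
qed

lemma Z_K: "c \<in> K \<Longrightarrow> c \<in> Zc"
  by (simp add: Zc_def K_add as_K)

lemma Z_add: "\<lbrakk>c \<in> Zc; d \<in> Zc\<rbrakk> \<Longrightarrow> c + d \<in> Zc"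
  by (rule Z_diagI) (simp add: as_distribs K_add Z_diag)

lemma Z_middle:
  assumes "c \<in> Zc" shows "as a c b - (as c a b + as c a b) \<in> K"
proof -
  have "- (as c a b + as c b a) \<in> K" by (intro K_uminus ZD assms)
  moreover have "as a c b - (as c a b + as c a b) = - (as c a b + as c b a)"
    by (simp add: as_def m_comm algebra_simps)
  ultimately show ?thesis by (simp only:)
qed

lemma Z_assoc:
  assumes c: "c \<in> Zc" and d: "d \<in> Zc"
  shows "as c d a \<in> K" "as c a d \<in> K" "as a c d \<in> K"
proof -
  have 1: "as c d a \<in> K" if c: "c \<in> Zc" and d: "d \<in> Zc" for c d
  proof -
    have "(as c d a - (as d c a + as d c a)) + ((as d c a - (as c d a + as c d a))
        + (as d c a - (as c d a + as c d a))) \<in> K"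
      by (intro Z_middle[OF c] Z_middle[OF d] K_add)
    then have "- (as c d a + as c d a + as c d a) \<in> K" by (simp add: algebra_simps)
    from K_uminus[OF this] have "as c d a + as c d a + as c d a \<in> K" by (simp only: minus_minus)
    then show ?thesis by (rule K_div3)
  qed
  show "as c d a \<in> K" by (rule 1[OF c d])
  have "(as c a d + as c d a) - as c d a \<in> K" by (intro K_diff ZD 1 c d)
  then show "as c a d \<in> K" by simp
  show "as a c d \<in> K" using K_uminus[OF 1[OF d c]] flexible[of a c d] by simp
qed

text \<open>This is the Teichmueller identity for c, d, a, a: its other three terms vanish because
  (d,a,a) does and because two elements of \<open>Zc\<close> associate with everything.\<close>

lemma Z_mult_aux:
  assumes c: "c \<in> Zc" and d: "d \<in> Zc"
  shows "as c (d \<star> a) a - as (c \<star> d) a a \<in> K"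
proof -
  have "as c d (a \<star> a) - c \<star> as d a a - as c d a \<star> a \<in> K"
    by (intro K_right[OF Z_diag[OF d]] K_left[OF Z_assoc(1)[OF c d]] Z_assoc(1)[OF c d] K_diff)
  moreover have "as c d (a \<star> a) - c \<star> as d a a - as c d a \<star> a = as c (d \<star> a) a - as (c \<star> d) a a"
    by (simp add: as_def m_distribs algebra_simps)
  ultimately show ?thesis by (simp only:)
qed

text \<open>In the linearized Jordan identity at c, d, a, flexibility turns (da,a,c) into -(c,a,da),
  which is (c,da,a) and hence (cd,a,a) by the preceding lemma; the third term behaves alike. So
  3(cd,a,a) = 0.\<close>

lemma Z_mult_diag:
  assumes c: "c \<in> Zc" and d: "d \<in> Zc"
  shows "as (c \<star> d) a a \<in> K"
proof (rule K_div3)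
  have "(as (c \<star> d) a a + as (d \<star> a) a c + as (a \<star> c) a d)
     + (as c a (d \<star> a) + as c (d \<star> a) a) + (as d a (c \<star> a) + as d (c \<star> a) a)
     - (as c (d \<star> a) a - as (c \<star> d) a a) - (as d (c \<star> a) a - as (d \<star> c) a a) \<in> K" (is "?e \<in> K")
    by (intro jordan_linear ZD[OF c] ZD[OF d] Z_mult_aux[OF c d] Z_mult_aux[OF d c] K_diff K_add)
  moreover have "?e = as (c \<star> d) a a + as (c \<star> d) a a + as (c \<star> d) a a"
    by (simp add: as_def m_distribs m_comm algebra_simps)
  ultimately show "as (c \<star> d) a a + as (c \<star> d) a a + as (c \<star> d) a a \<in> K" by (simp only:)
qed

lemma Z_mult: "\<lbrakk>c \<in> Zc; d \<in> Zc\<rbrakk> \<Longrightarrow> c \<star> d \<in> Zc"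
  by (rule Z_diagI[OF Z_mult_diag])

text \<open>Since (cd,a,a) vanishes, so does (d,ca,a), and (d,ca,b) is skew in a and b. Inserting
  this into the Teichmueller identity for d, a, c, b leaves twice the claim, without the factor 15
  of the (-1,1) case.\<close>

lemma Z_pull:
  assumes c: "c \<in> Zc" and d: "d \<in> Zc"
  shows "as c (d \<star> a) b - d \<star> as c a b \<in> K"
proof (rule K_div2)
  have diag: "as d (c \<star> x) x \<in> K" for x
    using K_add[OF Z_mult_aux[OF d c, of x] Z_mult_diag[OF d c, of x]] by simp
  have s: "as d (c \<star> a) b + as d (c \<star> b) a \<in> K"
  proof -
    have "as d (c \<star> (a + b)) (a + b) - as d (c \<star> a) a - as d (c \<star> b) b \<in> K" by (intro K_diff diag)
    then show ?thesis by (simp add: as_distribs m_distribs algebra_simps)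
  qed
  have "(as d (c \<star> a) b + as d (c \<star> b) a) - (as (d \<star> a) c b - (as c (d \<star> a) b + as c (d \<star> a) b))
    - (as d a (c \<star> b) + as d (c \<star> b) a) + d \<star> (as a c b - (as c a b + as c a b))
    + as d a c \<star> b \<in> K" (is "?e \<in> K")
    by (intro s Z_middle[OF c] ZD[OF d] K_right[OF Z_middle[OF c]] K_left[OF Z_assoc(2)[OF d c]] K_add K_diff)
  moreover have "?e = as c (d \<star> a) b - d \<star> as c a b + (as c (d \<star> a) b - d \<star> as c a b)"
    by (simp add: as_def m_distribs m_comm algebra_simps)
  ultimately show "as c (d \<star> a) b - d \<star> as c a b + (as c (d \<star> a) b - d \<star> as c a b) \<in> K" by (simp only:)
qed

text \<open>The map u -> (b,u,y) is a commutator of the multiplications by b and y, the standard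
  inner derivation of a Jordan algebra. Its Leibniz defect is the difference of two instances of the
  linearized identity.\<close>

lemma inner_derivation:
  "as b (c \<star> u) y - as b c y \<star> u - c \<star> as b u y \<in> K"
proof -
  have "(as (u \<star> y) b c + as (y \<star> c) b u + as (c \<star> u) b y)
    - (as (u \<star> b) y c + as (b \<star> c) y u + as (c \<star> u) y b) \<in> K" (is "?e \<in> K")
    by (intro K_diff jordan_linear)
  moreover have "?e = as b (c \<star> u) y - as b c y \<star> u - c \<star> as b u y"
    by (simp add: as_def m_distribs m_comm algebra_simps)
  ultimately show ?thesis by simp
qed

lemma inner_derivation_as:
  "as b (as u v w) y - as (as b u y) v w - as u (as b v y) w - as u v (as b w y) \<in> K"
proof -
  have "(as b ((u \<star> v) \<star> w) y - as b (u \<star> v) y \<star> w - (u \<star> v) \<star> as b w y)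
    + (as b (u \<star> v) y - as b u y \<star> v - u \<star> as b v y) \<star> w
    - (as b (u \<star> (v \<star> w)) y - as b u y \<star> (v \<star> w) - u \<star> as b (v \<star> w) y)
    - u \<star> (as b (v \<star> w) y - as b v y \<star> w - v \<star> as b w y) \<in> K" (is "?e \<in> K")
    by (intro inner_derivation K_left[OF inner_derivation] K_right[OF inner_derivation] K_add K_diff)
  moreover have "as b (as u v w) y = as b ((u \<star> v) \<star> w) y - as b (u \<star> (v \<star> w)) y"
    by (simp only: as_def[of u v w] as_distribs)
  moreover have "?e = as b ((u \<star> v) \<star> w) y - as b (u \<star> (v \<star> w)) y
      - as (as b u y) v w - as u (as b v y) w - as u v (as b w y)"
    unfolding as_def[of "as b u y"] as_def[of u "as b v y"] as_def[of u v "as b w y"]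
    by (simp add: m_distribs)
  ultimately show ?thesis by simp
qed

text \<open>A derivation respects the condition defining \<open>Zc\<close>, so D = (a,_,b) maps
  \<open>Zc\<close> to itself; and D c is 2(c,a,b) by \<open>Z_middle\<close>.\<close>

lemma Z_as: assumes c: "c \<in> Zc" shows "as c a b \<in> Zc"
proof -
  have 1: "as a c b \<in> Zc"
    unfolding Zc_def
  proof (intro CollectI allI)
    fix u v
    let ?D = "\<lambda>u. as a u b"
    have "as a (as c u v + as c v u) b
      - (?D (as c u v) - as (?D c) u v - as c (?D u) v - as c u (?D v))
      - (?D (as c v u) - as (?D c) v u - as c (?D v) u - as c v (?D u))
      - (as c (?D u) v + as c v (?D u)) - (as c (?D v) u + as c u (?D v)) \<in> K"
      by (intro as_K(2)[OF ZD[OF c]] inner_derivation_as ZD[OF c] K_diff)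
    then show "as (as a c b) u v + as (as a c b) v u \<in> K"
      by (simp add: as_distribs algebra_simps)
  qed
  have "as c a b + as c a b \<in> Zc"
    using Z_add[OF 1 Z_K[OF K_uminus[OF Z_middle[OF c, of a b]]]] by simp
  then show ?thesis by (rule Z_div2)
qed

end

section \<open>Transfer of the calculus to algebras with a carrier\<close>

lemma associator_free [simp]:
  "associator (free_algebra UNIV) x y z = napoly_mult (napoly_mult x y) z - napoly_mult x (napoly_mult y z)"
  by (simp add: associator_def)

lemma commutator_free [simp]:
  "commutator (free_algebra UNIV) x y = napoly_mult x y - napoly_mult y x"
  by (simp add: commutator_def)

lemma kernel_nalg_mod:
  fixes A :: "('k::field_char_0, 'a, 'm) module_scheme"
  assumes A: "nonassoc_algebra A" and h: "h \<in> alg_hom (free_algebra (UNIV :: 'x set)) A"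
  shows "nalg_mod napoly_mult {p. h p = \<zero>\<^bsub>A\<^esub>}"
proof -
  interpret A: nonassoc_algebra A by fact
  interpret h: nonassoc_hom "free_algebra (UNIV :: 'x set)" A h
    by (intro nonassoc_homI nonassoc_algebra_free A h)
  have hs: "h (x + y) = h x \<oplus>\<^bsub>A\<^esub> h y" "h (- x) = \<ominus>\<^bsub>A\<^esub> h x" "h (napoly_mult x y) = h x \<otimes>\<^bsub>A\<^esub> h y"
    "h 0 = \<zero>\<^bsub>A\<^esub>" "h x \<in> carrier A" for x y
    using h.hom_add[of x y] h.hom_uminus[of x] h.hom_mult[of x y] h.hom_zero h.hom_closed[of x]
    by (simp_all add: free_algebra_uminus)
  have two: "a \<oplus>\<^bsub>A\<^esub> a = 2 \<odot>\<^bsub>A\<^esub> a" if "a \<in> carrier A" for a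
    using A.smult_add_left[of a 1 1] that by simp
  have three: "a \<oplus>\<^bsub>A\<^esub> a \<oplus>\<^bsub>A\<^esub> a = 3 \<odot>\<^bsub>A\<^esub> a" if "a \<in> carrier A" for a
    using A.smult_add_left[of a 2 1] that by (simp add: two)
  have five: "a \<oplus>\<^bsub>A\<^esub> a \<oplus>\<^bsub>A\<^esub> a \<oplus>\<^bsub>A\<^esub> a \<oplus>\<^bsub>A\<^esub> a = 5 \<odot>\<^bsub>A\<^esub> a" if "a \<in> carrier A" for a
    using A.smult_add_left[of a 3 1] A.smult_add_left[of a 4 1] that by (simp add: three)
  show ?thesis
  proof unfold_locales
    fix x :: "('x, 'k) napoly"
    have c: "h x \<in> carrier A" by (simp add: hs)
    show "x \<in> {p. h p = \<zero>\<^bsub>A\<^esub>}" if "x + x \<in> {p. h p = \<zero>\<^bsub>A\<^esub>}"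
      using that A.smult_eq_zeroD[of 2 "h x"] two[OF c] by (simp add: hs(1,5))
    show "x \<in> {p. h p = \<zero>\<^bsub>A\<^esub>}" if "x + x + x \<in> {p. h p = \<zero>\<^bsub>A\<^esub>}"
      using that A.smult_eq_zeroD[of 3 "h x"] three[OF c] by (simp add: hs(1,5))
    show "x \<in> {p. h p = \<zero>\<^bsub>A\<^esub>}" if "x + x + x + x + x \<in> {p. h p = \<zero>\<^bsub>A\<^esub>}"
      using that A.smult_eq_zeroD[of 5 "h x"] five[OF c] by (simp add: hs(1,5))
  qed (auto simp: hs napoly_mult_add_left napoly_mult_add_right)
qed

definition sm11_algebra :: "('k::field, 'a, 'm) module_scheme \<Rightarrow> bool" where
  "sm11_algebra A \<longleftrightarrow> nonassoc_algebra A
     \<and> (\<forall>x\<in>carrier A. \<forall>y\<in>carrier A. associator A x y y = \<zero>\<^bsub>A\<^esub>)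
     \<and> (\<forall>x\<in>carrier A. \<forall>y\<in>carrier A. \<forall>z\<in>carrier A.
          associator A x y z \<oplus>\<^bsub>A\<^esub> associator A y z x \<oplus>\<^bsub>A\<^esub> associator A z x y = \<zero>\<^bsub>A\<^esub>)
     \<and> (\<forall>x\<in>carrier A. \<forall>y\<in>carrier A. \<forall>z\<in>carrier A. commutator A (commutator A x y) z = \<zero>\<^bsub>A\<^esub>)"

lemma strongly_m11_identities:
  fixes A :: "('k::field, 'a, 'm) module_scheme"
  assumes "sm11_algebra A" shows "strongly_m11 \<subseteq> identities A"
proof
  interpret A: nonassoc_algebra A using assms by (simp add: sm11_algebra_def)
  fix f :: "(nat, 'k) napoly" assume f: "f \<in> strongly_m11"
  show "f \<in> identities A"
    unfolding A.identities_iff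
  proof (intro allI impI)
    fix v :: "nat \<Rightarrow> 'a" assume v: "\<forall>x. v x \<in> carrier A"
    interpret h: nonassoc_hom "free_algebra UNIV" A "napoly_eval A v"
      by (intro nonassoc_homI nonassoc_algebra_free A.nonassoc_algebra_axioms A.napoly_eval_hom) (use v in simp)
    show "napoly_eval A v f = \<zero>\<^bsub>A\<^esub>"
      using f v assms h.hom_associator h.hom_commutator h.hom_add
      by (auto simp: strongly_m11_def Let_def sm11_algebra_def simp del: associator_free commutator_free
          free_algebra_simps)
  qed
qed

text \<open>The elements of the algebra serve as letters, so an identity modulo the kernel of
  \<open>h\<close>, taken at generators, can be read off at arbitrary arguments.\<close>

lemma (in nonassoc_algebra) eval_carrier_surj:
  obtains h :: "('a, 'k) napoly \<Rightarrow> 'a" where "h \<in> alg_hom (free_algebra UNIV) A" "\<And>a. a \<in> carrier A \<Longrightarrow> h (gen a) = a"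
proof
  let ?v = "\<lambda>a. if a \<in> carrier A then a else \<zero>"
  show "napoly_eval A ?v \<in> alg_hom (free_algebra UNIV) A" by (rule napoly_eval_hom) auto
  show "napoly_eval A ?v (gen a) = a" if "a \<in> carrier A" for a using that by (subst napoly_eval_gen) auto
qed

lemma sm11_plus_jordan:
  fixes A :: "('k::field_char_0, 'a, 'm) module_scheme"
  assumes "sm11_algebra A" shows "jordan_algebra (plus_algebra A)"
proof -
  interpret A: nonassoc_algebra A using assms by (simp add: sm11_algebra_def)
  obtain h :: "('a, 'k) napoly \<Rightarrow> 'a" where h: "h \<in> alg_hom (free_algebra UNIV) A"
    and hg: "\<And>a. a \<in> carrier A \<Longrightarrow> h (gen a) = a" using A.eval_carrier_surj by blast
  define K where "K = {p. h p = \<zero>\<^bsub>A\<^esub>}"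
  interpret F: nonassoc_algebra "free_algebra UNIV :: ('k, ('a, 'k) napoly) module"
    by (rule nonassoc_algebra_free)
  interpret h: nonassoc_hom "free_algebra UNIV" A h
    by (intro nonassoc_homI nonassoc_algebra_free A.nonassoc_algebra_axioms h)
  interpret nalg_mod napoly_mult K
    unfolding K_def by (rule kernel_nalg_mod[OF A.nonassoc_algebra_axioms h])
  interpret sm11_mod napoly_mult K
  proof unfold_locales
    fix x y z :: "('a, 'k) napoly"
    have c: "h x \<in> carrier A" "h y \<in> carrier A" "h z \<in> carrier A" by simp_all
    show "as x y y \<in> K" "as x y z + as y z x + as z x y \<in> K"
      "napoly_mult (napoly_mult x y - napoly_mult y x) z - napoly_mult z (napoly_mult x y - napoly_mult y x) \<in> K"
      using assms c h.hom_associator[of x y y] h.hom_associator[of x y z] h.hom_associator[of y z x]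
        h.hom_associator[of z x y] h.hom_commutator[of "commutator (free_algebra UNIV) x y" z]
        h.hom_commutator[of x y] h.hom_add[of "as x y z" "as y z x"] h.hom_add[of "as x y z + as y z x" "as z x y"]
      by (simp_all add: sm11_algebra_def K_def as_def)
  qed
  interpret P: nonassoc_algebra "plus_algebra A" by (rule A.nonassoc_algebra_plus)
  interpret FP: nonassoc_algebra "plus_algebra (free_algebra UNIV) :: ('k, ('a, 'k) napoly) module"
    by (rule F.nonassoc_algebra_plus)
  interpret hp: nonassoc_hom "plus_algebra (free_algebra UNIV)" "plus_algebra A" h
    by (intro nonassoc_homI FP.nonassoc_algebra_axioms P.nonassoc_algebra_axioms h.hom_plus)
  show ?thesis
    unfolding jordan_algebra_def
  proof (intro conjI ballI)
    fix x y assume xy: "x \<in> carrier (plus_algebra A)" "y \<in> carrier (plus_algebra A)"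
    then show "x \<otimes>\<^bsub>plus_algebra A\<^esub> y = y \<otimes>\<^bsub>plus_algebra A\<^esub> x" by (simp add: A.M.a_comm)
    let ?F = "plus_algebra (free_algebra UNIV) :: ('k, ('a, 'k) napoly) module"
    let ?x = "gen x :: ('a, 'k) napoly" and ?y = "gen y :: ('a, 'k) napoly"
    let ?c = "\<lambda>x y :: ('a, 'k) napoly. napoly_mult x y + napoly_mult y x"
    have mF: "p \<ominus>\<^bsub>?F\<^esub> q = p - q" for p q :: "('a, 'k) napoly"
    proof -
      have "p \<ominus>\<^bsub>?F\<^esub> q = p \<oplus>\<^bsub>?F\<^esub> (-1) \<odot>\<^bsub>?F\<^esub> q" by (simp only: a_minus_def FP.uminus_eq_smult F.plus_algebra_simps carrier_free_algebra_UNIV UNIV_I)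
      then show ?thesis by (simp add: napoly_smult_minus_one)
    qed
    \<comment> \<open>\<open>plus_jordan\<close> speaks of the doubled product; each term of the
      plus associator involves three products, whence 1/8.\<close>
    have "associator ?F (?x \<otimes>\<^bsub>?F\<^esub> ?x) ?y ?x =
      napoly_smult (1/8) (?c (?c (?c ?x ?x) ?y) ?x - ?c (?c ?x ?x) (?c ?y ?x))"
      unfolding associator_def mF F.plus_algebra_simps free_algebra_simps
      by (simp add: napoly_smult_add napoly_mult_add_left napoly_mult_add_right napoly_smult_smult
        napoly_mult_smult_left napoly_mult_smult_right diff_conv_add_uminus flip: napoly_smult_minus_one)
    also have "\<dots> \<in> K"
      using plus_jordan[of ?x ?y] h.hom_smult[of _ "1/8"] by (simp add: K_def)
    finally have "h (associator ?F (?x \<otimes>\<^bsub>?F\<^esub> ?x) ?y ?x) = \<zero>\<^bsub>A\<^esub>" by (simp add: K_def)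
    moreover have "h (associator ?F (?x \<otimes>\<^bsub>?F\<^esub> ?x) ?y ?x)
      = associator (plus_algebra A) (h ?x \<otimes>\<^bsub>plus_algebra A\<^esub> h ?x) (h ?y) (h ?x)"
    proof -
      have c: "?x \<otimes>\<^bsub>?F\<^esub> ?x \<in> carrier ?F" "?x \<in> carrier ?F" "?y \<in> carrier ?F" by simp_all
      show ?thesis unfolding hp.hom_associator[OF c(1,3,2)] hp.hom_mult[OF c(2,2)] ..
    qed
    ultimately show "associator (plus_algebra A) (x \<otimes>\<^bsub>plus_algebra A\<^esub> x) y x = \<zero>\<^bsub>plus_algebra A\<^esub>"
      using hg xy by simp
  qed (rule A.nonassoc_algebra_plus)
qed

section \<open>Superalgebras of vector type over the polynomial ring\<close>

text \<open>A pair is an even and an odd component. Even elements act on both components by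
  multiplication of polynomials, so the structure depends only on the product \<open>\<mu>\<close>
  of odd elements.\<close>

definition vsuper :: "('k poly \<Rightarrow> 'k poly \<Rightarrow> 'k poly) \<Rightarrow> ('k::field, 'k poly \<times> 'k poly) superalg" where
  "vsuper \<mu> = \<lparr>carrier = UNIV,
     monoid.mult = \<lambda>x y. (fst x * fst y + \<mu> (snd x) (snd y), fst x * snd y + snd x * fst y),
     one = 0, ring.zero = 0, add = (+),
     module.smult = \<lambda>c x. (Polynomial.smult c (fst x), Polynomial.smult c (snd x)),
     part = \<lambda>i. if i = 0 then {x. snd x = 0} else {x. fst x = 0}\<rparr>"

lemma vsuper_simps [simp]:
  "carrier (vsuper \<mu>) = UNIV" "\<zero>\<^bsub>vsuper \<mu>\<^esub> = 0" "x \<oplus>\<^bsub>vsuper \<mu>\<^esub> y = x + y"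
  "x \<otimes>\<^bsub>vsuper \<mu>\<^esub> y = (fst x * fst y + \<mu> (snd x) (snd y), fst x * snd y + snd x * fst y)"
  "c \<odot>\<^bsub>vsuper \<mu>\<^esub> x = (Polynomial.smult c (fst x), Polynomial.smult c (snd x))"
  "part (vsuper \<mu>) i = (if i = 0 then {x. snd x = 0} else {x. fst x = 0})"
  by (simp_all add: vsuper_def)

definition poly_bilinear :: "('k::field poly \<Rightarrow> 'k poly \<Rightarrow> 'k poly) \<Rightarrow> bool" where
  "poly_bilinear \<mu> \<longleftrightarrow> (\<forall>p q r. \<mu> (p + q) r = \<mu> p r + \<mu> q r) \<and> (\<forall>p q r. \<mu> r (p + q) = \<mu> r p + \<mu> r q)
     \<and> (\<forall>c p q. \<mu> (Polynomial.smult c p) q = Polynomial.smult c (\<mu> p q))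
     \<and> (\<forall>c p q. \<mu> p (Polynomial.smult c q) = Polynomial.smult c (\<mu> p q))"

lemma par_eq: "par S = of_bool (odd (card S))"
proof -
  have "(of_nat n :: bit) = of_bool (odd n)" for n by (induction n) auto
  then show ?thesis .
qed

lemma vsuper_superalgebra:
  assumes "poly_bilinear \<mu>" shows "superalgebra (vsuper \<mu>)"
proof -
  note b = assms[unfolded poly_bilinear_def]
  have z: "\<mu> 0 p = 0" "\<mu> p 0 = 0" for p
    using b[THEN conjunct2, THEN conjunct2, THEN conjunct1, rule_format, of 0 0 p]
      b[THEN conjunct2, THEN conjunct2, THEN conjunct2, rule_format, of p 0 0] by simp_all
  interpret A: nonassoc_algebra "vsuper \<mu>"
  proof (rule nonassoc_algebraI)
    show "abelian_group (vsuper \<mu>)"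
    proof (rule abelian_groupI)
      fix x show "\<exists>y\<in>carrier (vsuper \<mu>). y \<oplus>\<^bsub>vsuper \<mu>\<^esub> x = \<zero>\<^bsub>vsuper \<mu>\<^esub>"
        by (intro bexI[of _ "- x"]) simp_all
    qed (simp_all add: algebra_simps)
  qed (use b in \<open>auto simp: prod_eq_iff algebra_simps smult_add_left smult_add_right\<close>)
  show ?thesis
  proof (intro superalgebra.intro superalgebra_axioms.intro A.nonassoc_algebra_axioms)
    show "submodule (part (vsuper \<mu>) i) ring_of_type_algebra (vsuper \<mu>)" for i
      by (auto simp: A.submodule_iff)
    show "carrier (vsuper \<mu>) = part (vsuper \<mu>) 0 <+>\<^bsub>vsuper \<mu>\<^esub> part (vsuper \<mu>) 1"
    proof -
      have "x \<in> part (vsuper \<mu>) 0 <+>\<^bsub>vsuper \<mu>\<^esub> part (vsuper \<mu>) 1" for x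
        unfolding set_add_def set_mult_def by (auto intro!: exI[of _ "(fst x, 0)"] exI[of _ "(0, snd x)"])
      then show ?thesis by auto
    qed
    show "part (vsuper \<mu>) 0 \<inter> part (vsuper \<mu>) 1 = {\<zero>\<^bsub>vsuper \<mu>\<^esub>}"
      by (auto simp: prod_eq_iff)
    fix x y i j assume "x \<in> part (vsuper \<mu>) i" "y \<in> part (vsuper \<mu>) j"
    then show "x \<otimes>\<^bsub>vsuper \<mu>\<^esub> y \<in> part (vsuper \<mu>) (i + j)"
      by (cases i; cases j) (auto simp: z)
  qed
qed

lemma finsum_vsuper:
  assumes "poly_bilinear \<mu>" shows "finsum (vsuper \<mu>) f S = sum f S"
proof -
  interpret superalgebra "vsuper \<mu>" by (rule vsuper_superalgebra) fact
  show ?thesis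
    by (induction S rule: infinite_finite_induct) (simp_all add: M.finsum_insert[unfolded vsuper_simps])
qed

subsection \<open>Signs\<close>

lemma grassmann_sign_Un_left:
  assumes "finite S" "finite T" "finite R" "S \<inter> T = {}"
  shows "grassmann_sign (S \<union> T) R = grassmann_sign S R * (grassmann_sign T R :: 'k::field)"
proof -
  have "{(s, t). s \<in> S \<union> T \<and> t \<in> R \<and> t < s}
    = {(s, t). s \<in> S \<and> t \<in> R \<and> t < s} \<union> {(s, t). s \<in> T \<and> t \<in> R \<and> t < s}" by auto
  moreover have "finite {(s, t). s \<in> V \<and> t \<in> R \<and> t < s}" if "finite V" for V
    by (rule finite_subset[of _ "V \<times> R"]) (use that assms in auto)
  ultimately show ?thesis
    using assms unfolding grassmann_sign_def by (subst power_add[symmetric], subst card_Un_disjoint[symmetric]) auto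
qed

lemma grassmann_sign_Un_right:
  assumes "finite S" "finite T" "finite R" "S \<inter> T = {}"
  shows "grassmann_sign R (S \<union> T) = grassmann_sign R S * (grassmann_sign R T :: 'k::field)"
proof -
  have "{(s, t). s \<in> R \<and> t \<in> S \<union> T \<and> t < s}
    = {(s, t). s \<in> R \<and> t \<in> S \<and> t < s} \<union> {(s, t). s \<in> R \<and> t \<in> T \<and> t < s}" by auto
  moreover have "finite {(s, t). s \<in> R \<and> t \<in> V \<and> t < s}" if "finite V" for V
    by (rule finite_subset[of _ "R \<times> V"]) (use that assms in auto)
  ultimately show ?thesis
    using assms unfolding grassmann_sign_def by (subst power_add[symmetric], subst card_Un_disjoint[symmetric]) auto
qed

text \<open>Each pair from the two disjoint sets is an inversion for exactly one of the two orders,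
  so the exponents of the two signs add up to the product of the cardinalities.\<close>

lemma grassmann_sign_swap:
  assumes "finite S" "finite T" "S \<inter> T = {}"
  shows "grassmann_sign T S = (- 1) ^ (card S * card T) * (grassmann_sign S T :: 'k::field)"
proof -
  let ?A = "{(s, t). s \<in> S \<and> t \<in> T \<and> t < s}" and ?B = "{(t, s). t \<in> T \<and> s \<in> S \<and> s < t}"
  have fin: "finite ?A" by (rule finite_subset[of _ "S \<times> T"]) (use assms in auto)
  have fin': "finite ?B" by (rule finite_subset[of _ "T \<times> S"]) (use assms in auto)
  have U: "S \<times> T = ?A \<union> prod.swap ` ?B"
  proof (intro equalityI subsetI)
    fix x assume "x \<in> S \<times> T"
    then obtain s t where x: "x = (s, t)" "s \<in> S" "t \<in> T" by blast
    then have "s \<noteq> t" using assms(3) by blast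
    then consider "t < s" | "s < t" by linarith
    then show "x \<in> ?A \<union> prod.swap ` ?B"
    proof cases
      case 2
      then have "(t, s) \<in> ?B" using x by simp
      then have "prod.swap (t, s) \<in> prod.swap ` ?B" by (rule imageI)
      then show ?thesis using x by simp
    qed (use x in simp)
  qed auto
  have d: "?A \<inter> prod.swap ` ?B = {}" by auto
  have "card S * card T = card (S \<times> T)" by (simp add: card_cartesian_product)
  also have "\<dots> = card ?A + card (prod.swap ` ?B)"
    unfolding U by (rule card_Un_disjoint[OF fin finite_imageI[OF fin'] d])
  also have "card (prod.swap ` ?B) = card ?B" by (rule card_image) (auto simp: inj_on_def)
  finally have c: "card S * card T = card ?A + card ?B" .
  show ?thesis
    unfolding grassmann_sign_def c power_add
    by (simp add: mult.left_commute[of "(- 1) ^ _"] flip: power_mult_distrib)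
qed

lemma grassmann_sign_empty [simp]: "grassmann_sign {} S = 1" "grassmann_sign S {} = 1"
  by (simp_all add: grassmann_sign_def)

section \<open>Triple products in envelopes of vector type\<close>

definition part3 :: "nat set \<Rightarrow> (nat set \<times> nat set \<times> nat set) set" where
  "part3 U = {(S, T, R). S \<union> T \<union> R = U \<and> S \<inter> T = {} \<and> S \<inter> R = {} \<and> T \<inter> R = {}}"

text \<open>The sign of a product of three Grassmann monomials. It is common to both bracketings, so
  associators in the envelope are signed sums of associators in the superalgebra.\<close>

definition sign3 :: "nat set \<Rightarrow> nat set \<Rightarrow> nat set \<Rightarrow> 'k::field" where
  "sign3 S T R = grassmann_sign S T * grassmann_sign S R * grassmann_sign T R"

lemma sum_part3_swap: "(\<Sum>(S, T, R)\<in>part3 U. F S T R) = (\<Sum>(S, T, R)\<in>part3 U. F S R T)"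
  by (rule sum.reindex_bij_witness[of _ "\<lambda>(S, T, R). (S, R, T)" "\<lambda>(S, T, R). (S, R, T)"])
     (auto simp: part3_def)

lemma sum_part3_cycle: "(\<Sum>(S, T, R)\<in>part3 U. F S T R) = (\<Sum>(S, T, R)\<in>part3 U. F T R S)"
  by (rule sum.reindex_bij_witness[of _ "\<lambda>(S, T, R). (T, R, S)" "\<lambda>(S, T, R). (R, S, T)"])
     (auto simp: part3_def)

lemma sign3_swap:
  assumes "(S, T, R) \<in> part3 U" "finite U"
  shows "sign3 S R T = (- 1) ^ (card T * card R) * (sign3 S T R :: 'k::field)"
proof -
  have "finite T" "finite R" "T \<inter> R = {}" using assms by (auto simp: part3_def)
  from grassmann_sign_swap[OF this, where 'k = 'k] show ?thesis by (simp add: sign3_def)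
qed

lemma sign3_cycle:
  assumes "(S, T, R) \<in> part3 U" "finite U"
  shows "sign3 T R S = (- 1) ^ (card S * card T + card S * card R) * (sign3 S T R :: 'k::field)"
proof -
  have "finite S" "finite T" "finite R" "S \<inter> T = {}" "S \<inter> R = {}" using assms by (auto simp: part3_def)
  from grassmann_sign_swap[OF this(1,2,4), where 'k = 'k] grassmann_sign_swap[OF this(1,3,5), where 'k = 'k]
  show ?thesis by (simp add: sign3_def power_add)
qed

definition vm :: "('k::field poly \<Rightarrow> 'k poly \<Rightarrow> 'k poly) \<Rightarrow> 'k poly \<times> 'k poly \<Rightarrow> 'k poly \<times> 'k poly \<Rightarrow> 'k poly \<times> 'k poly"
  where "vm \<mu> x y = (fst x * fst y + \<mu> (snd x) (snd y), fst x * snd y + snd x * fst y)"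

definition vs :: "'k::field \<Rightarrow> 'k poly \<times> 'k poly \<Rightarrow> 'k poly \<times> 'k poly"
  where "vs c x = (Polynomial.smult c (fst x), Polynomial.smult c (snd x))"

declare vsuper_simps(4,5) [simp del]

lemma vsuper_ops [simp]: "x \<otimes>\<^bsub>vsuper \<mu>\<^esub> y = vm \<mu> x y" "c \<odot>\<^bsub>vsuper \<mu>\<^esub> x = vs c x"
  by (simp_all add: vm_def vs_def vsuper_simps(4,5))

lemma vs_simps [simp]:
  "vs c (x + y) = vs c x + vs c y" "vs (c + d) x = vs c x + vs d x" "vs c (vs d x) = vs (c * d) x"
  "vs 1 x = x" "vs 0 x = 0" "vs c 0 = 0" "vs (- c) x = - vs c x" "vs c (- x) = - vs c x"
  "vs c (x - y) = vs c x - vs c y"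
  by (simp_all add: vs_def prod_eq_iff smult_add_left smult_add_right smult_diff_right)

lemma vs_sum: "vs c (sum f S) = (\<Sum>i\<in>S. vs c (f i))"
  by (induction S rule: infinite_finite_induct) simp_all

locale vector_type =
  fixes \<mu> :: "'k::field_char_0 poly \<Rightarrow> 'k poly \<Rightarrow> 'k poly"
  assumes bilinear: "poly_bilinear \<mu>"
begin

sublocale superalgebra "vsuper \<mu>"
  by (rule vsuper_superalgebra) (rule bilinear)

lemma mu_simps [simp]:
  "\<mu> (p + q) r = \<mu> p r + \<mu> q r" "\<mu> r (p + q) = \<mu> r p + \<mu> r q"
  "\<mu> (Polynomial.smult c p) q = Polynomial.smult c (\<mu> p q)"
  "\<mu> p (Polynomial.smult c q) = Polynomial.smult c (\<mu> p q)"
  using bilinear by (simp_all add: poly_bilinear_def)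

lemma mu_zero [simp]: "\<mu> 0 p = 0" "\<mu> p 0 = 0"
  using mu_simps(3)[of 0 0 p] mu_simps(4)[of p 0 0] by simp_all

lemma vm_simps [simp]:
  "vm \<mu> (x + y) z = vm \<mu> x z + vm \<mu> y z" "vm \<mu> z (x + y) = vm \<mu> z x + vm \<mu> z y"
  "vm \<mu> (vs c x) y = vs c (vm \<mu> x y)" "vm \<mu> x (vs c y) = vs c (vm \<mu> x y)"
  "vm \<mu> 0 x = 0" "vm \<mu> x 0 = 0"
  by (simp_all add: vm_def vs_def prod_eq_iff algebra_simps Polynomial.smult_add_right)

lemma vm_sum_left: "vm \<mu> (sum f S) y = (\<Sum>i\<in>S. vm \<mu> (f i) y)"
  by (induction S rule: infinite_finite_induct) simp_all

lemma vm_sum_right: "vm \<mu> y (sum f S) = (\<Sum>i\<in>S. vm \<mu> y (f i))"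
  by (induction S rule: infinite_finite_induct) simp_all

lemma vector_env_mult:
  "(f \<otimes>\<^bsub>GA\<^esub> g) U = (\<Sum>S\<in>Pow U. vs (grassmann_sign S (U - S)) (vm \<mu> (f S) (g (U - S))))"
  by (simp add: env_mult finsum_vsuper[OF bilinear])

lemma vector_env_carrier:
  "f \<in> carrier GA \<longleftrightarrow> (\<forall>S. if even (card S) then snd (f S) = 0 else fst (f S) = 0)
     \<and> (\<forall>S. infinite S \<longrightarrow> f S = 0) \<and> finite {S. f S \<noteq> 0}"
  by (auto simp: env_carrier par_eq)

definition vas where "vas x y z = vm \<mu> (vm \<mu> x y) z - vm \<mu> x (vm \<mu> y z)"

lemma vector_minus: "x \<ominus>\<^bsub>vsuper \<mu>\<^esub> y = x - y"
proof -
  have "x \<ominus>\<^bsub>vsuper \<mu>\<^esub> y = x \<oplus>\<^bsub>vsuper \<mu>\<^esub> (-1) \<odot>\<^bsub>vsuper \<mu>\<^esub> y"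
    unfolding a_minus_def by (subst uminus_eq_smult) auto
  then show ?thesis by simp
qed

text \<open>The double convolution runs over chains S, V, U of subsets; T = V - S and R = U - V turn
  them into ordered partitions of U, and the outer sign factors over the disjoint union of S and
  T.\<close>

lemma env_left_mult:
  assumes "finite U"
  shows "((f \<otimes>\<^bsub>GA\<^esub> g) \<otimes>\<^bsub>GA\<^esub> h) U
    = (\<Sum>(S, T, R)\<in>part3 U. vs (sign3 S T R) (vm \<mu> (vm \<mu> (f S) (g T)) (h R)))"
proof -
  have "((f \<otimes>\<^bsub>GA\<^esub> g) \<otimes>\<^bsub>GA\<^esub> h) U = (\<Sum>V\<in>Pow U. \<Sum>S\<in>Pow V.
    vs (grassmann_sign V (U - V) * grassmann_sign S (V - S)) (vm \<mu> (vm \<mu> (f S) (g (V - S))) (h (U - V))))"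
    unfolding vector_env_mult by (simp add: vm_sum_left vs_sum)
  also have "\<dots> = (\<Sum>(V, S)\<in>Sigma (Pow U) Pow.
    vs (grassmann_sign V (U - V) * grassmann_sign S (V - S)) (vm \<mu> (vm \<mu> (f S) (g (V - S))) (h (U - V))))"
    by (rule sum.Sigma) (use assms in \<open>auto intro: finite_subset\<close>)
  also have "\<dots> = (\<Sum>(S, T, R)\<in>part3 U. vs (sign3 S T R) (vm \<mu> (vm \<mu> (f S) (g T)) (h R)))"
  proof (rule sum.reindex_bij_witness[of _ "\<lambda>(S, T, R). (S \<union> T, S)" "\<lambda>(V, S). (S, V - S, U - V)"])
    fix a assume "a \<in> Sigma (Pow U) Pow"
    then obtain V S where a: "a = (V, S)" "V \<subseteq> U" "S \<subseteq> V" by auto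
    then have fin: "finite V" "finite S" "finite (U - V)" using assms by (auto intro: finite_subset)
    have "grassmann_sign (S \<union> (V - S)) (U - V)
      = grassmann_sign S (U - V) * (grassmann_sign (V - S) (U - V) :: 'k)"
      by (rule grassmann_sign_Un_left) (use fin in auto)
    then have "grassmann_sign V (U - V) = grassmann_sign S (U - V) * (grassmann_sign (V - S) (U - V) :: 'k)"
      using a by (simp add: Un_absorb1)
    then show "(case (case a of (V, S) \<Rightarrow> (S, V - S, U - V)) of
        (S, T, R) \<Rightarrow> vs (sign3 S T R) (vm \<mu> (vm \<mu> (f S) (g T)) (h R)))
      = (case a of (V, S) \<Rightarrow> vs (grassmann_sign V (U - V) * grassmann_sign S (V - S))
          (vm \<mu> (vm \<mu> (f S) (g (V - S))) (h (U - V))))"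
      by (simp add: a sign3_def mult_ac)
  qed (auto simp: part3_def)
  finally show ?thesis .
qed

lemma env_right_mult:
  assumes "finite U"
  shows "(f \<otimes>\<^bsub>GA\<^esub> (g \<otimes>\<^bsub>GA\<^esub> h)) U
    = (\<Sum>(S, T, R)\<in>part3 U. vs (sign3 S T R) (vm \<mu> (f S) (vm \<mu> (g T) (h R))))"
proof -
  have "(f \<otimes>\<^bsub>GA\<^esub> (g \<otimes>\<^bsub>GA\<^esub> h)) U = (\<Sum>S\<in>Pow U. \<Sum>T\<in>Pow (U - S).
    vs (grassmann_sign S (U - S) * grassmann_sign T (U - S - T)) (vm \<mu> (f S) (vm \<mu> (g T) (h (U - S - T)))))"
    unfolding vector_env_mult by (simp add: vm_sum_right vs_sum)
  also have "\<dots> = (\<Sum>(S, T)\<in>Sigma (Pow U) (\<lambda>S. Pow (U - S)).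
    vs (grassmann_sign S (U - S) * grassmann_sign T (U - S - T)) (vm \<mu> (f S) (vm \<mu> (g T) (h (U - S - T)))))"
    by (rule sum.Sigma) (use assms in \<open>auto intro: finite_subset\<close>)
  also have "\<dots> = (\<Sum>(S, T, R)\<in>part3 U. vs (sign3 S T R) (vm \<mu> (f S) (vm \<mu> (g T) (h R))))"
  proof (rule sum.reindex_bij_witness[of _ "\<lambda>(S, T, R). (S, T)" "\<lambda>(S, T). (S, T, U - S - T)"])
    fix a assume "a \<in> Sigma (Pow U) (\<lambda>S. Pow (U - S))"
    then obtain T S where a: "a = (S, T)" "S \<subseteq> U" "T \<subseteq> U - S" by auto
    then have fin: "finite T" "finite S" "finite (U - S - T)" using assms by (auto intro: finite_subset)
    have "grassmann_sign S (T \<union> (U - S - T))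
      = grassmann_sign S T * (grassmann_sign S (U - S - T) :: 'k)"
      by (rule grassmann_sign_Un_right) (use fin in auto)
    moreover have "T \<union> (U - S - T) = U - S" using a by auto
    ultimately show "(case (case a of (S, T) \<Rightarrow> (S, T, U - S - T)) of
        (S, T, R) \<Rightarrow> vs (sign3 S T R) (vm \<mu> (f S) (vm \<mu> (g T) (h R))))
      = (case a of (S, T) \<Rightarrow> vs (grassmann_sign S (U - S) * grassmann_sign T (U - S - T))
          (vm \<mu> (f S) (vm \<mu> (g T) (h (U - S - T)))))"
      by (simp add: a sign3_def mult_ac)
  qed (auto simp: part3_def)
  finally show ?thesis .
qed

lemma env_associator:
  assumes "f \<in> carrier GA" "g \<in> carrier GA" "h \<in> carrier GA"
  shows "associator GA f g h U = (if finite U then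
    (\<Sum>(S, T, R)\<in>part3 U. vs (sign3 S T R) (vas (f S) (g T) (h R))) else 0)"
proof -
  have "associator GA f g h U = ((f \<otimes>\<^bsub>GA\<^esub> g) \<otimes>\<^bsub>GA\<^esub> h) U - (f \<otimes>\<^bsub>GA\<^esub> (g \<otimes>\<^bsub>GA\<^esub> h)) U"
    using assms by (simp add: associator_def env_minus vector_minus)
  then show ?thesis
    by (simp add: env_left_mult env_right_mult env_mult_infinite[unfolded vsuper_simps] vas_def
        case_prod_unfold sum_subtractf)
qed

lemma env_mult_swap:
  assumes "finite U"
  shows "(g \<otimes>\<^bsub>GA\<^esub> f) U = (\<Sum>S\<in>Pow U.
    vs ((- 1) ^ (card S * card (U - S)) * grassmann_sign S (U - S)) (vm \<mu> (g (U - S)) (f S)))"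
  unfolding vector_env_mult
proof (rule sum.reindex_bij_witness[of _ "\<lambda>S. U - S" "\<lambda>S. U - S"])
  fix S assume "S \<in> Pow U"
  then have "finite S" "finite (U - S)" "S \<inter> (U - S) = {}" "U - (U - S) = S"
    using assms by (auto intro: finite_subset)
  then show "vs ((- 1) ^ (card (U - S) * card (U - (U - S))) * grassmann_sign (U - S) (U - (U - S)))
     (vm \<mu> (g (U - (U - S))) (f (U - S))) = vs (grassmann_sign S (U - S)) (vm \<mu> (g S) (f (U - S)))"
    using grassmann_sign_swap[of S "U - S", where 'k = 'k]
    by (simp add: mult.commute[of "card S"] mult.assoc[symmetric] flip: power_mult_distrib)
qed auto

lemma vm_commute: "snd x = 0 \<or> snd y = 0 \<Longrightarrow> vm \<mu> x y = vm \<mu> y x"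
  by (auto simp: vm_def algebra_simps)

lemma env_even_central:
  assumes e: "\<And>S. odd (card S) \<Longrightarrow> e S = 0" "e \<in> carrier GA" and h: "h \<in> carrier GA"
  shows "e \<otimes>\<^bsub>GA\<^esub> h = h \<otimes>\<^bsub>GA\<^esub> e"
proof
  fix U show "(e \<otimes>\<^bsub>GA\<^esub> h) U = (h \<otimes>\<^bsub>GA\<^esub> e) U"
  proof (cases "finite U")
    case True
    show ?thesis
      unfolding env_mult_swap[OF True, of h e] unfolding vector_env_mult
    proof (rule sum.cong[OF refl])
      fix S
      show "vs (grassmann_sign S (U - S)) (vm \<mu> (e S) (h (U - S))) =
        vs ((- 1) ^ (card S * card (U - S)) * grassmann_sign S (U - S)) (vm \<mu> (h (U - S)) (e S))"
      proof (cases "odd (card S)")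
        case False
        then have "snd (e S) = 0" using e(2) by (auto simp: vector_env_carrier split: if_splits)
        then show ?thesis using False vm_commute[of "e S" "h (U - S)"] by simp
      qed (simp add: e)
    qed
  qed (simp add: env_mult_infinite)
qed

text \<open>At an odd index set each term has an even factor, and even elements commute with
  everything. A commutator thus has only even components, and \<open>env_even_central\<close> makes
  it central.\<close>

lemma env_commutator_even:
  assumes f: "f \<in> carrier GA" and g: "g \<in> carrier GA" and U: "odd (card U)"
  shows "commutator GA f g U = 0"
proof -
  \<comment> \<open>An infinite set has \<open>card\<close> 0, which is even.\<close>
  have fin: "finite U" using U by (metis card.infinite even_zero)
  have "(g \<otimes>\<^bsub>GA\<^esub> f) U = (f \<otimes>\<^bsub>GA\<^esub> g) U"
    unfolding env_mult_swap[OF fin, of g f] unfolding vector_env_mult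
  proof (rule sum.cong[OF refl])
    fix S assume S: "S \<in> Pow U"
    then have "card U = card S + card (U - S)" using fin
      by (metis Pow_iff card_Diff_subset card_mono finite_subset le_add_diff_inverse)
    then have *: "even (card S) \<or> even (card (U - S))" "even (card S * card (U - S))" using U by auto
    then have "snd (f S) = 0 \<or> snd (g (U - S)) = 0" using f g by (auto simp: vector_env_carrier split: if_splits)
    then show "vs ((- 1) ^ (card S * card (U - S)) * grassmann_sign S (U - S)) (vm \<mu> (g (U - S)) (f S))
      = vs (grassmann_sign S (U - S)) (vm \<mu> (f S) (g (U - S)))"
      using vm_commute[of "f S" "g (U - S)"] * by simp
  qed
  then show ?thesis using f g by (simp add: commutator_def env_minus vector_minus)
qed

end

text \<open>Associators of an even f and odd p, q are multiples of f'pq: by 2, 1 and -1 according as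
  f stands in the first, second or third place between p and q taken in this order.\<close>

definition mu_m11 :: "'k::field_char_0 poly \<Rightarrow> 'k poly \<Rightarrow> 'k poly" where
  "mu_m11 p q = p * q + (pderiv p * q + pderiv p * q) + p * pderiv q"

text \<open>Half of \<open>mu_m11 p q - mu_m11 q p\<close>: symmetrization of two odd elements
  carries a minus sign because their Grassmann factors anticommute.\<close>

definition mu_jordan :: "'k::field_char_0 poly \<Rightarrow> 'k poly \<Rightarrow> 'k poly" where
  "mu_jordan p q = Polynomial.smult (1 / 2) (pderiv p * q - p * pderiv q)"

interpretation m11: vector_type mu_m11
  by unfold_locales
     (simp add: poly_bilinear_def mu_m11_def algebra_simps pderiv_add pderiv_smult smult_add_right)

interpretation vjordan: vector_type mu_jordan
  by unfold_locales
     (simp add: poly_bilinear_def mu_jordan_def algebra_simps pderiv_add pderiv_smult smult_add_right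
       smult_diff_right)

text \<open>The numbers stand for the cardinalities of the index sets of x, y, z. They enter only
  through their parities, which also decide which component of each pair survives; each of the eight
  cases is an identity of differential polynomials.\<close>

lemma m11_super_right_alt:
  assumes "if even a then snd x = 0 else fst x = 0" "if even b then snd y = 0 else fst y = 0"
    "if even c then snd z = 0 else fst z = (0 :: 'k::field_char_0 poly)"
  shows "vs ((- 1) ^ (b * c)) (m11.vas x z y) = - m11.vas x y z"
  using assms
  by (cases "even a"; cases "even b"; cases "even c")
     (simp_all add: m11.vas_def vm_def vs_def mu_m11_def pderiv_add pderiv_mult algebra_simps prod_eq_iff)

lemma m11_super_cyclic:
  assumes "if even a then snd x = 0 else fst x = 0" "if even b then snd y = 0 else fst y = 0"
    "if even c then snd z = 0 else fst z = (0 :: 'k::field_char_0 poly)"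
  shows "m11.vas x y z + vs ((- 1) ^ (a * b + a * c)) (m11.vas y z x)
    + vs ((- 1) ^ (a * c + b * c)) (m11.vas z x y) = 0"
  using assms
  by (cases "even a"; cases "even b"; cases "even c")
     (simp_all add: m11.vas_def vm_def vs_def mu_m11_def pderiv_add pderiv_mult algebra_simps prod_eq_iff)

abbreviation "EnvM \<equiv> grassmann_envelope (vsuper mu_m11)"

lemma pair_double_zero:
  fixes x :: "'k::field_char_0 poly \<times> 'k poly"
  assumes "x = - x" shows "x = 0"
proof -
  have "x + x = x + - x" using assms by (rule arg_cong)
  then have "vs (1 / 2) (x + x) = 0" by simp
  moreover have "vs (1 / 2) (x + x) = vs (1 / 2 + 1 / 2) x" by (simp only: vs_simps(1,2))
  ultimately show ?thesis by simp
qed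

lemma env_sm11: "sm11_algebra (EnvM :: ('k::field_char_0, nat set \<Rightarrow> 'k poly \<times> 'k poly) module)"
  unfolding sm11_algebra_def
proof (intro conjI ballI)
  show "nonassoc_algebra (EnvM :: ('k, nat set \<Rightarrow> 'k poly \<times> 'k poly) module)"
    by (rule m11.nonassoc_algebra_env)
next
  fix f g :: "nat set \<Rightarrow> 'k poly \<times> 'k poly" assume f: "f \<in> carrier EnvM" and g: "g \<in> carrier EnvM"
  show "associator EnvM f g g = \<zero>\<^bsub>EnvM\<^esub>"
  proof
    fix U
    have "(\<Sum>(S, T, R)\<in>part3 U. vs (sign3 S T R) (m11.vas (f S) (g T) (g R))) = 0" if U: "finite U"
    proof (rule pair_double_zero)
      \<comment> \<open>Exchanging the last two index sets reproduces the sum with the opposite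
        sign, because the sign of the exchange is the one in the super identity.\<close>
      have "(\<Sum>(S, T, R)\<in>part3 U. vs (sign3 S T R) (m11.vas (f S) (g T) (g R)))
        = (\<Sum>(S, T, R)\<in>part3 U. vs (sign3 S R T) (m11.vas (f S) (g R) (g T)))"
        by (rule sum_part3_swap)
      also have "\<dots> = (\<Sum>(S, T, R)\<in>part3 U. - vs (sign3 S T R) (m11.vas (f S) (g T) (g R)))"
      proof (rule sum.cong[OF refl], clarify)
        fix S T R assume "(S, T, R) \<in> part3 U"
        then have "vs (sign3 S R T) (m11.vas (f S) (g R) (g T))
          = vs (sign3 S T R) (vs ((- 1) ^ (card T * card R)) (m11.vas (f S) (g R) (g T)))"
          by (simp add: sign3_swap[OF _ U] mult.commute)
        also have "\<dots> = - vs (sign3 S T R) (m11.vas (f S) (g T) (g R))"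
          by (subst m11_super_right_alt[of "card S" _ _ _ ]) (use f g in \<open>simp_all add: m11.vector_env_carrier\<close>)
        finally show "vs (sign3 S R T) (m11.vas (f S) (g R) (g T))
          = - vs (sign3 S T R) (m11.vas (f S) (g T) (g R))" .
      qed
      also have "\<dots> = - (\<Sum>(S, T, R)\<in>part3 U. vs (sign3 S T R) (m11.vas (f S) (g T) (g R)))"
        by (simp add: case_prod_unfold sum_negf)
      finally show "(\<Sum>(S, T, R)\<in>part3 U. vs (sign3 S T R) (m11.vas (f S) (g T) (g R)))
        = - (\<Sum>(S, T, R)\<in>part3 U. vs (sign3 S T R) (m11.vas (f S) (g T) (g R)))" .
    qed
    then show "associator EnvM f g g U = \<zero>\<^bsub>EnvM\<^esub> U" by (simp add: m11.env_associator f g)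
  qed
next
  fix f g h :: "nat set \<Rightarrow> 'k poly \<times> 'k poly"
  assume f: "f \<in> carrier EnvM" and g: "g \<in> carrier EnvM" and h: "h \<in> carrier EnvM"
  show "associator EnvM f g h \<oplus>\<^bsub>EnvM\<^esub> associator EnvM g h f \<oplus>\<^bsub>EnvM\<^esub> associator EnvM h f g = \<zero>\<^bsub>EnvM\<^esub>"
  proof
    fix U
    have "(\<Sum>(S, T, R)\<in>part3 U. vs (sign3 S T R) (m11.vas (f S) (g T) (h R)))
      + (\<Sum>(S, T, R)\<in>part3 U. vs (sign3 S T R) (m11.vas (g S) (h T) (f R)))
      + (\<Sum>(S, T, R)\<in>part3 U. vs (sign3 S T R) (m11.vas (h S) (f T) (g R))) = 0" if U: "finite U"
    proof -
      have 1: "(\<Sum>(S, T, R)\<in>part3 U. vs (sign3 S T R) (m11.vas (g S) (h T) (f R)))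
        = (\<Sum>(S, T, R)\<in>part3 U. vs (sign3 T R S) (m11.vas (g T) (h R) (f S)))"
        by (rule sum_part3_cycle)
      \<comment> \<open>Two cyclic shifts align the third sum with the first.\<close>
      have 2: "(\<Sum>(S, T, R)\<in>part3 U. vs (sign3 S T R) (m11.vas (h S) (f T) (g R)))
        = (\<Sum>(S, T, R)\<in>part3 U. vs (sign3 R S T) (m11.vas (h R) (f S) (g T)))"
        by (subst sum_part3_cycle, subst sum_part3_cycle) (rule refl)
      have 3: "vs (sign3 S T R) (m11.vas (f S) (g T) (h R)) + vs (sign3 T R S) (m11.vas (g T) (h R) (f S))
        + vs (sign3 R S T) (m11.vas (h R) (f S) (g T)) = 0" if P: "(S, T, R) \<in> part3 U" for S T R
      proof -
        have P': "(T, R, S) \<in> part3 U" using P by (auto simp: part3_def)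
        have s1: "sign3 T R S = sign3 S T R * ((- 1) ^ (card S * card T + card S * card R) :: 'k)"
          by (simp add: sign3_cycle[OF P U])
        have s2: "sign3 R S T = sign3 S T R * ((- 1) ^ (card S * card R + card T * card R) :: 'k)"
          unfolding sign3_cycle[OF P' U] s1
          by (simp add: power_add mult.commute mult.left_commute flip: power_mult_distrib)
        have "vs (sign3 S T R) (m11.vas (f S) (g T) (h R)
          + vs ((- 1) ^ (card S * card T + card S * card R)) (m11.vas (g T) (h R) (f S))
          + vs ((- 1) ^ (card S * card R + card T * card R)) (m11.vas (h R) (f S) (g T))) = 0"
          by (subst m11_super_cyclic) (use f g h in \<open>simp_all add: m11.vector_env_carrier\<close>)
        then show ?thesis by (simp add: s1 s2)
      qed
      show ?thesis
        unfolding 1 2 using 3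
        by (simp add: case_prod_unfold sum.distrib[symmetric])
    qed
    then show "(associator EnvM f g h \<oplus>\<^bsub>EnvM\<^esub> associator EnvM g h f \<oplus>\<^bsub>EnvM\<^esub> associator EnvM h f g) U
      = \<zero>\<^bsub>EnvM\<^esub> U"
      by (simp add: m11.env_associator f g h)
  qed
  have c: "commutator EnvM f g \<in> carrier EnvM" using f g by (rule m11.env.commutator_closed)
  have "commutator EnvM f g \<otimes>\<^bsub>EnvM\<^esub> h = h \<otimes>\<^bsub>EnvM\<^esub> commutator EnvM f g"
    by (rule m11.env_even_central[OF _ c h]) (rule m11.env_commutator_even[OF f g])
  then show "commutator EnvM (commutator EnvM f g) h = \<zero>\<^bsub>EnvM\<^esub>"
    using c h m11.env.minus_eq_zero_iff m11.env.mult_closed unfolding commutator_def[of _ "commutator EnvM f g"]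
    by metis
qed

abbreviation "EnvJ \<equiv> grassmann_envelope (vsuper mu_jordan)"

lemma smult_half_double: "Polynomial.smult (1 / 2) (2 * p) = (p :: 'k::field_char_0 poly)"
  unfolding mult_2 smult_add_right smult_add_left[symmetric] by simp

lemma env_plus_carrier:
  "carrier EnvJ = carrier (EnvM :: ('k::field_char_0, nat set \<Rightarrow> 'k poly \<times> 'k poly) module)"
  by (rule Set.set_eqI) (simp only: m11.vector_env_carrier vjordan.vector_env_carrier)

text \<open>Reindexing the reversed product by complements pairs the terms into the
  super-symmetrization of \<open>mu_m11\<close>, which is \<open>mu_jordan\<close> on two odd
  components and plain multiplication otherwise.\<close>

lemma env_plus_hom:
  "(\<lambda>f. f) \<in> alg_hom EnvJ (plus_algebra (EnvM :: ('k::field_char_0, nat set \<Rightarrow> 'k poly \<times> 'k poly) module))"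
proof -
  note c = env_plus_carrier[where 'k = 'k]
  show "(\<lambda>f. f) \<in> alg_hom EnvJ (plus_algebra (EnvM :: ('k, nat set \<Rightarrow> 'k poly \<times> 'k poly) module))"
  proof (rule alg_homI)
    fix f g :: "nat set \<Rightarrow> 'k poly \<times> 'k poly"
    assume fg: "f \<in> carrier EnvJ" "g \<in> carrier EnvJ"
    show "f \<otimes>\<^bsub>EnvJ\<^esub> g = f \<otimes>\<^bsub>plus_algebra EnvM\<^esub> g"
    proof
      fix U show "(f \<otimes>\<^bsub>EnvJ\<^esub> g) U = (f \<otimes>\<^bsub>plus_algebra EnvM\<^esub> g) U"
      proof (cases "finite U")
        case True
        have *: "vs (grassmann_sign S (U - S)) (vm mu_jordan (f S) (g (U - S)))
          = vs (1/2) (vs (grassmann_sign S (U - S)) (vm mu_m11 (f S) (g (U - S)))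
              + vs ((- 1) ^ (card S * card (U - S)) * grassmann_sign S (U - S)) (vm mu_m11 (g (U - S)) (f S)))" for S
        proof -
          have "vm mu_jordan (f S) (g (U - S)) = vs (1/2) (vm mu_m11 (f S) (g (U - S))
              + vs ((- 1) ^ (card S * card (U - S))) (vm mu_m11 (g (U - S)) (f S)))"
            using fg[unfolded vjordan.vector_env_carrier, THEN conjunct1, rule_format, of S]
              fg(2)[unfolded vjordan.vector_env_carrier, THEN conjunct1, rule_format, of "U - S"]
              fg(1)[unfolded vjordan.vector_env_carrier, THEN conjunct1, rule_format, of S]
            by (cases "even (card S)"; cases "even (card (U - S))")
               (simp_all add: vm_def vs_def mu_jordan_def mu_m11_def prod_eq_iff algebra_simps
                  smult_half_double flip: mult_2)
          then show ?thesis by (simp add: mult_ac)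
        qed
        have "(f \<otimes>\<^bsub>EnvJ\<^esub> g) U
          = vs (1/2) ((f \<otimes>\<^bsub>EnvM\<^esub> g) U + (g \<otimes>\<^bsub>EnvM\<^esub> f) U)"
          unfolding vjordan.vector_env_mult m11.env_mult_swap[OF True, of g f] m11.vector_env_mult[of f g]
            sum.distrib[symmetric] vs_sum
          by (rule sum.cong[OF refl]) (rule *)
        then show ?thesis by simp
      qed (simp add: m11.env_mult_infinite vjordan.env_mult_infinite)
    qed
  qed (simp_all add: c)
qed

text \<open>The Jordan identity is not checked on the vector type product: the envelope embeds into
  the plus algebra of a strongly (-1,1)-algebra, which is Jordan by
  \<open>sm11_plus_jordan\<close>.\<close>

lemma jordan_superalgebra_vsuper: "jordan_superalgebra (vsuper (mu_jordan :: 'k::field_char_0 poly \<Rightarrow> _))"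
proof -
  interpret P: nonassoc_algebra "plus_algebra (EnvM :: ('k, nat set \<Rightarrow> 'k poly \<times> 'k poly) module)"
    by (rule m11.env.nonassoc_algebra_plus)
  interpret h: nonassoc_hom "EnvJ :: ('k, nat set \<Rightarrow> 'k poly \<times> 'k poly) module" "plus_algebra EnvM" "\<lambda>f. f"
    by (intro nonassoc_homI vjordan.nonassoc_algebra_env P.nonassoc_algebra_axioms env_plus_hom)
  show ?thesis
    unfolding jordan_superalgebra_def
    using h.jordan_inj[OF sm11_plus_jordan[OF env_sm11]] vjordan.superalgebra_axioms by simp
qed

lemma identities_EnvJ:
  "identities EnvJ = identities (plus_algebra (EnvM :: ('k::field_char_0, nat set \<Rightarrow> 'k poly \<times> 'k poly) module))"
proof -
  interpret P: nonassoc_algebra "plus_algebra (EnvM :: ('k, nat set \<Rightarrow> 'k poly \<times> 'k poly) module)"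
    by (rule m11.env.nonassoc_algebra_plus)
  interpret h: nonassoc_hom "EnvJ :: ('k, nat set \<Rightarrow> 'k poly \<times> 'k poly) module" "plus_algebra EnvM" "\<lambda>f. f"
    by (intro nonassoc_homI vjordan.nonassoc_algebra_env P.nonassoc_algebra_axioms env_plus_hom)
  show ?thesis
  proof
    show "identities EnvJ \<subseteq> identities (plus_algebra (EnvM :: ('k, nat set \<Rightarrow> 'k poly \<times> 'k poly) module))"
      by (rule h.identities_mono_surj) (simp add: env_plus_carrier)
    show "identities (plus_algebra (EnvM :: ('k, nat set \<Rightarrow> 'k poly \<times> 'k poly) module)) \<subseteq> identities EnvJ"
      by (rule h.identities_mono_inj) simp
  qed
qed

section \<open>Spanning sets and normal forms\<close>

lemma vandermonde_zero:
  fixes c :: "'t \<Rightarrow> 'k::field_char_0" and d :: "'t \<Rightarrow> nat"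
  assumes T: "finite T" "inj_on d T" and z: "\<And>x. x \<noteq> 0 \<Longrightarrow> (\<Sum>t\<in>T. c t * x ^ d t) = 0" and t: "t \<in> T"
  shows "c t = 0"
proof -
  \<comment> \<open>The factor t makes \<open>P\<close> vanish also at 0, about which the hypothesis
    says nothing.\<close>
  define P where "P = [:0, 1:] * (\<Sum>t\<in>T. monom (c t) (d t))"
  have "poly P x = 0" for x
    by (cases "x = 0") (simp_all add: P_def poly_sum poly_monom z)
  then have "P = 0" using poly_all_0_iff_0 by blast
  then have "(\<Sum>t\<in>T. monom (c t) (d t)) = 0" by (simp add: P_def)
  then have "0 = coeff (\<Sum>t\<in>T. monom (c t) (d t)) (d t)" by simp
  also have "\<dots> = (\<Sum>s\<in>T. if s = t then c s else 0)"
    unfolding coeff_sum by (rule sum.cong) (use T t in \<open>auto simp: inj_on_def\<close>)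
  also have "\<dots> = c t" using T t by simp
  finally show ?thesis by simp
qed

locale nalg_scaled = nalg_mod m K for m :: "'a::ab_group_add \<Rightarrow> 'a \<Rightarrow> 'a" (infixl \<open>\<star>\<close> 70) and K +
  fixes sc :: "'k::field_char_0 \<Rightarrow> 'a \<Rightarrow> 'a"
  assumes sc_add: "sc c (x + y) = sc c x + sc c y"
    and sc_add_left: "sc (c + d) x = sc c x + sc d x"
    and sc_sc: "sc c (sc d x) = sc (c * d) x"
    and sc_one [simp]: "sc 1 x = x"
    and m_sc_left: "sc c x \<star> y = sc c (x \<star> y)"
    and m_sc_right: "x \<star> sc c y = sc c (x \<star> y)"
    and K_sc: "x \<in> K \<Longrightarrow> sc c x \<in> K"
begin

lemma sc_zero [simp]: "sc c 0 = 0" "sc 0 x = 0"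
  using sc_add[of c 0 0] sc_add_left[of 0 0 x] by simp_all

lemma sc_minus: "sc c (- x) = - sc c x" "sc (- c) x = - sc c x"
  using sc_add[of c "- x" x] sc_add_left[of "- c" c x] by (simp_all add: eq_neg_iff_add_eq_0)

lemma sc_diff: "sc c (x - y) = sc c x - sc c y"
  using sc_add[of c x "- y"] by (simp add: sc_minus)

context
  fixes Lt Od :: "'a set"
begin

text \<open>Monomials are nested to the right, c_1(c_2(...)), with at most one odd letter, which
  stands innermost. The letters in \<open>Lt\<close> will be distinguished elements to which the
  calculus above applies.\<close>

inductive even_mono :: "'a \<Rightarrow> bool" where
  "c \<in> Lt \<Longrightarrow> even_mono c"
| "c \<in> Lt \<Longrightarrow> even_mono x \<Longrightarrow> even_mono (c \<star> x)"

inductive odd_mono :: "'a \<Rightarrow> bool" where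
  "e \<in> Od \<Longrightarrow> odd_mono e"
| "c \<in> Lt \<Longrightarrow> odd_mono x \<Longrightarrow> odd_mono (c \<star> x)"

inductive_set mono_span :: "'a set" where
  even: "even_mono x \<Longrightarrow> x \<in> mono_span"
| odd: "odd_mono x \<Longrightarrow> x \<in> mono_span"
| ideal: "x \<in> K \<Longrightarrow> x \<in> mono_span"
| add: "x \<in> mono_span \<Longrightarrow> y \<in> mono_span \<Longrightarrow> x + y \<in> mono_span"
| sc: "x \<in> mono_span \<Longrightarrow> sc c x \<in> mono_span"

lemma mono_span_cong: "y \<in> mono_span \<Longrightarrow> x - y \<in> K \<Longrightarrow> x \<in> mono_span"
  using mono_span.add[OF mono_span.ideal, of "x - y" y] by simp

lemma mono_span_letter: assumes "c \<in> Lt" "x \<in> mono_span" shows "c \<star> x \<in> mono_span"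
  using assms(2,1) by (induction rule: mono_span.induct)
     (auto simp: m_add_right m_sc_right intro: mono_span.intros even_mono.intros odd_mono.intros K_right)

text \<open>Conditions under which the span of these monomials is a subalgebra, shared by both
  normal forms. The shift coefficient \<open>\<alpha>\<close> is 1/2 in the (-1,1) case and -1 in
  the Jordan case.\<close>

context
  fixes \<alpha> :: 'k
  assumes EMassoc: "\<And>c x y. \<lbrakk>c \<in> Lt; even_mono x; even_mono y \<or> odd_mono y\<rbrakk> \<Longrightarrow> as c x y \<in> K"
    and EMcomm: "\<And>x y. \<lbrakk>even_mono x; odd_mono y\<rbrakk> \<Longrightarrow> y \<star> x - x \<star> y \<in> K"
    and OO: "\<And>e e'. \<lbrakk>e \<in> Od; e' \<in> Od\<rbrakk> \<Longrightarrow> e \<star> e' \<in> mono_span"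
    and pull1: "\<And>c d x y. \<lbrakk>c \<in> Lt; d \<in> Lt; odd_mono x; odd_mono y\<rbrakk> \<Longrightarrow> as c (d \<star> x) y - d \<star> as c x y \<in> K"
    and pull2: "\<And>c d x y. \<lbrakk>c \<in> Lt; d \<in> Lt; odd_mono x; odd_mono y\<rbrakk> \<Longrightarrow> as c x (d \<star> y) - d \<star> as c x y \<in> K"
    and base: "\<And>c e e'. \<lbrakk>c \<in> Lt; e \<in> Od; e' \<in> Od\<rbrakk> \<Longrightarrow> as c e e' \<in> mono_span"
    and shift: "\<And>c x y. \<lbrakk>c \<in> Lt; odd_mono x; odd_mono y\<rbrakk>
      \<Longrightarrow> x \<star> (c \<star> y) - c \<star> (x \<star> y) - sc \<alpha> (as c x y) \<in> K"
begin

text \<open>\<open>pull1\<close> and \<open>pull2\<close> strip the letters off both odd arguments,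
  leaving letters times an associator of one letter and two odd generators, which is covered by
  \<open>base\<close>.\<close>

lemma mono_span_as:
  assumes "c \<in> Lt" "odd_mono x" "odd_mono y" shows "as c x y \<in> mono_span"
  using assms(2)
proof (induction rule: odd_mono.induct)
  case (1 e)
  show ?case using assms(3)
  proof (induction rule: odd_mono.induct)
    case (1 e') then show ?case using base \<open>e \<in> Od\<close> assms(1) by blast
  next
    case (2 d y)
    then show ?case
      using mono_span_cong[OF mono_span_letter[OF \<open>d \<in> Lt\<close>] pull2] assms(1) \<open>e \<in> Od\<close> odd_mono.intros(1) by blast
  qed
next
  case (2 d x)
  then show ?case
    using mono_span_cong[OF mono_span_letter[OF \<open>d \<in> Lt\<close>] pull1] assms by blast
qed

lemma mono_span_even_mult:
  assumes "even_mono x" "even_mono y \<or> odd_mono y" shows "x \<star> y \<in> mono_span"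
  using assms(1)
proof (induction rule: even_mono.induct)
  case (1 c)
  then show ?case using assms(2) mono_span_letter mono_span.even mono_span.odd by blast
next
  case (2 c x)
  have "(c \<star> x) \<star> y - c \<star> (x \<star> y) \<in> K" using EMassoc[OF 2(1,2) assms(2)] by (simp add: as_def)
  then show ?case using mono_span_cong mono_span_letter 2 by blast
qed

text \<open>Letters of the left factor come out at the cost of an associator, by the definition of
  associators; those of the right factor come out by the shift rule.\<close>

lemma mono_span_odd_mult:
  assumes "odd_mono x" "odd_mono y" shows "x \<star> y \<in> mono_span"
  using assms(1)
proof (induction rule: odd_mono.induct)
  case (1 e)
  show ?case using assms(2)
  proof (induction rule: odd_mono.induct)
    case (1 e') then show ?case using OO \<open>e \<in> Od\<close> by blast
  next
    case (2 c y)
    have e: "odd_mono e" using \<open>e \<in> Od\<close> by (rule odd_mono.intros)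
    have "c \<star> (e \<star> y) + sc \<alpha> (as c e y) \<in> mono_span"
      by (rule mono_span.add[OF mono_span_letter[OF 2(1,3)] mono_span.sc[OF mono_span_as[OF 2(1) e 2(2)]]])
    moreover have "e \<star> (c \<star> y) - (c \<star> (e \<star> y) + sc \<alpha> (as c e y)) \<in> K"
      using shift[OF 2(1) e 2(2)] by (simp add: algebra_simps)
    ultimately show ?case by (rule mono_span_cong)
  qed
next
  case (2 c x)
  have "as c x y + c \<star> (x \<star> y) \<in> mono_span"
    by (rule mono_span.add[OF mono_span_as[OF 2(1,2) assms(2)] mono_span_letter[OF 2(1,3)]])
  then show ?case by (simp add: as_def)
qed

lemma mono_span_mono_mult:
  assumes x: "even_mono x \<or> odd_mono x" and y: "even_mono y \<or> odd_mono y" shows "x \<star> y \<in> mono_span"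
proof (cases "even_mono x")
  case True then show ?thesis using mono_span_even_mult y by blast
next
  case False
  then have x: "odd_mono x" using x by blast
  show ?thesis
  proof (cases "odd_mono y")
    case True then show ?thesis using mono_span_odd_mult x by blast
  next
    case False
    then have "even_mono y" using y by blast
    then show ?thesis using mono_span_cong[OF mono_span_even_mult EMcomm] x by blast
  qed
qed

lemma mono_span_mult:
  assumes x: "x \<in> mono_span" and y: "y \<in> mono_span" shows "x \<star> y \<in> mono_span"
proof -
  have *: "x \<star> y \<in> mono_span" if x: "even_mono x \<or> odd_mono x" for x
    using y
    by (induction rule: mono_span.induct)
       (auto simp: m_add_right m_sc_right intro: mono_span_mono_mult[OF x] mono_span.intros K_right)
  show ?thesis using x
    by (induction rule: mono_span.induct)
       (auto simp: m_add_left m_sc_left intro: * mono_span.intros K_left)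
qed

end
end
end

subsection \<open>Alternating functions of lists\<close>

locale alternating =
  fixes g :: "nat list \<Rightarrow> 'b::ab_group_add" and H :: "'b set"
  assumes H_zero: "0 \<in> H" and H_add: "\<lbrakk>x \<in> H; y \<in> H\<rbrakk> \<Longrightarrow> x + y \<in> H" and H_uminus: "x \<in> H \<Longrightarrow> - x \<in> H"
    and H_div2: "x + x \<in> H \<Longrightarrow> x \<in> H"
    and alternating: "g (xs @ a # b # ys) + g (xs @ b # a # ys) \<in> H"
begin

text \<open>Equality up to sign modulo \<open>H\<close>. The sign of the sorting permutation is not
  tracked, since a spanning statement only asks for some scalar.\<close>

definition pm :: "'b \<Rightarrow> 'b \<Rightarrow> bool" where "pm x y \<longleftrightarrow> x - y \<in> H \<or> x + y \<in> H"

lemma pm_refl: "pm x x" by (simp add: pm_def H_zero)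

lemma pm_trans:
  assumes "pm x y" "pm y z" shows "pm x z"
proof -
  have d: "x - y \<in> H" if "x \<in> H" "y \<in> H" for x y using H_add[OF that(1) H_uminus[OF that(2)]] by simp
  show ?thesis
    using assms H_add[of "x - y" "y - z"] H_add[of "x - y" "y + z"] d[of "x + y" "y - z"] d[of "x + y" "y + z"]
    by (auto simp: pm_def)
qed

lemma pm_insort: "pm (g (xs @ x # ys)) (g (xs @ insort x ys))"
proof (induction ys arbitrary: xs)
  case (Cons y ys)
  show ?case
  proof (cases "x \<le> y")
    case False
    have "pm (g (xs @ x # y # ys)) (g (xs @ y # x # ys))" by (simp add: pm_def alternating)
    also have "pm \<dots> (g (xs @ y # insort x ys))" using Cons.IH[of "xs @ [y]"] by simp
    finally (pm_trans) show ?thesis using False by simp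
  qed (simp add: pm_refl)
qed (simp add: pm_refl)

lemma pm_sort: "pm (g (xs @ l)) (g (xs @ sort l))"
proof (induction l arbitrary: xs)
  case (Cons x l)
  have "pm (g (xs @ x # l)) (g (xs @ x # sort l))" using Cons.IH[of "xs @ [x]"] by simp
  also have "pm \<dots> (g (xs @ insort x (sort l)))" by (rule pm_insort)
  finally (pm_trans) show ?case by simp
qed (simp add: pm_refl)

lemma sorted_not_distinct: "sorted l \<Longrightarrow> \<not> distinct l \<Longrightarrow> \<exists>xs a ys. l = xs @ a # a # ys" for l :: "nat list"
proof (induction l)
  case (Cons x l)
  show ?case
  proof (cases "distinct l")
    case False
    then obtain xs a ys where "l = xs @ a # a # ys" using Cons by auto
    then have "x # l = (x # xs) @ a # a # ys" by simp
    then show ?thesis by blast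
  next
    case True
    then have "x \<in> set l" using Cons.prems by auto
    then obtain y l' where l: "l = y # l'" by (cases l) auto
    then have "y = x" using Cons.prems \<open>x \<in> set l\<close> by (auto simp: le_antisym)
    then have "x # l = [] @ x # x # l'" using l by simp
    then show ?thesis by blast
  qed
qed simp

text \<open>Sorting changes the value only up to sign. A repeated entry becomes two equal neighbours
  after sorting, so twice the value lies in \<open>H\<close>.\<close>

lemma normal_form: "pm (g l) (g (sorted_list_of_set (set l))) \<and> length l = card (set l) \<or> g l \<in> H"
proof (cases "distinct l")
  case True
  then have "sort l = sorted_list_of_set (set l)" by (metis distinct_remdups_id sorted_list_of_set_sort_remdups)
  then show ?thesis using pm_sort[of "[]" l] True by (simp add: distinct_card)
next
  case False
  then have "\<not> distinct (sort l)" by simp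
  then obtain xs a ys where "sort l = xs @ a # a # ys" using sorted_not_distinct[of "sort l"] by auto
  then have "g (sort l) + g (sort l) \<in> H" using alternating[of xs a a ys] by simp
  then have "g (sort l) \<in> H" by (rule H_div2)
  moreover have "pm (g l) (g (sort l))" using pm_sort[of "[]" l] by simp
  ultimately have "g l \<in> H"
    using H_add[of "g l - g (sort l)" "g (sort l)"] H_add[of "g l + g (sort l)" "- g (sort l)"] H_uminus
    by (auto simp: pm_def)
  then show ?thesis ..
qed

end

subsection \<open>Normal forms for the presentation of \<open>A\<^sub>0\<close>\<close>

locale a0_mod = sm11_mod m K + nalg_scaled m K sc
  for m :: "'a::ab_group_add \<Rightarrow> 'a \<Rightarrow> 'a" (infixl \<open>\<star>\<close> 70) and K and sc :: "'k::field_char_0 \<Rightarrow> 'a \<Rightarrow> 'a" +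
  fixes z :: 'a and e :: "nat \<Rightarrow> 'a"
  assumes z_central: "z \<star> x - x \<star> z \<in> K"
    and e_anti: "e i \<star> e j + e j \<star> e i \<in> K"
    and e_assoc: "as (e i) (e j) (e p) \<in> K"
    and ee_assoc: "as (e i \<star> e j - e j \<star> e i) (e p) (e q) \<in> K"
    and zee_assoc: "as (as z (e i) (e j)) (e p) (e q) \<in> K"
begin

text \<open>Both families of even letters, e_i e_j and (z,e_i,e_j), obey the same rules below and
  are treated together; \<open>b\<close> marks the associators.\<close>

definition lt :: "bool \<Rightarrow> nat \<Rightarrow> nat \<Rightarrow> 'a" where
  "lt b i j = (if b then as z (e i) (e j) else e i \<star> e j)"

lemma z_Z: "z \<in> Zc"
  using z_central by (simp add: Zc_def)

text \<open>2 e_i e_j is a commutator plus an anticommutator, and the latter is zero modulo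
  \<open>K\<close>; for the associators the claim is \<open>Z_as\<close> for z.\<close>

lemma lt_Z: "lt b i j \<in> Zc"
proof (cases b)
  case False
  have "(e i \<star> e j - e j \<star> e i) + (e i \<star> e j + e j \<star> e i) \<in> Zc"
    by (rule Z_add[OF Z_commutator Z_K[OF e_anti]])
  then have "e i \<star> e j + e i \<star> e j \<in> Zc" by simp
  then show ?thesis using False Z_div2[of "e i \<star> e j"] by (simp add: lt_def)
qed (simp add: lt_def Z_as z_Z)

lemma lt_skew: "lt b i j + lt b j i \<in> K"
  by (simp add: lt_def right_alt' e_anti)

lemma lt_assoc: "as (lt b i j) (e p) (e q) \<in> K"
proof (cases b)
  case False
  have "as (e i \<star> e j - e j \<star> e i) (e p) (e q) + as (e i \<star> e j + e j \<star> e i) (e p) (e q) \<in> K"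
    by (rule K_add[OF ee_assoc as_K(1)[OF e_anti]])
  then have "as (e i \<star> e j) (e p) (e q) + as (e i \<star> e j) (e p) (e q) \<in> K" by (simp add: as_distribs)
  then show ?thesis using False K_div2[of "as (e i \<star> e j) (e p) (e q)"] by (simp add: lt_def)
qed (simp add: lt_def zee_assoc)

text \<open>For the letter (z,e_p,e_i), the Teichmueller identity and \<open>Z_assoc\<close>
  identify its product by e_j with (z e_p,e_i,e_j), which is skew in i and j by right
  alternativity.\<close>

lemma lt_e: "lt b p i \<star> e j + lt b p j \<star> e i \<in> K"
proof (cases b)
  case False
  have "as (e p) (e i) (e j) + as (e p) (e j) (e i) + e p \<star> (e i \<star> e j + e j \<star> e i) \<in> K"
    by (rule K_add[OF K_add[OF e_assoc e_assoc] K_right[OF e_anti]])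
  then show ?thesis using False by (simp add: lt_def as_def m_distribs algebra_simps)
next
  case True
  have Q: "lt True p i \<star> e j - as (z \<star> e p) (e i) (e j) \<in> K" for i j
  proof -
    have "as z (e p) (e i \<star> e j) - as z (e p \<star> e i) (e j) - z \<star> as (e p) (e i) (e j) \<in> K"
      using Z_assoc(2)[OF z_Z lt_Z[of False i j], of "e p"] Z_assoc(1)[OF z_Z lt_Z[of False p i], of "e j"]
        K_right[OF e_assoc] by (intro K_diff[OF K_diff]) (simp_all add: lt_def)
    moreover have "as z (e p) (e i \<star> e j) - as z (e p \<star> e i) (e j) - z \<star> as (e p) (e i) (e j)
      = lt True p i \<star> e j - as (z \<star> e p) (e i) (e j)"
      by (simp add: lt_def as_def m_distribs algebra_simps)
    ultimately show ?thesis by simp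
  qed
  have "(lt True p i \<star> e j - as (z \<star> e p) (e i) (e j)) + (lt True p j \<star> e i - as (z \<star> e p) (e j) (e i))
    + (as (z \<star> e p) (e i) (e j) + as (z \<star> e p) (e j) (e i)) \<in> K"
    by (rule K_add[OF K_add[OF Q Q] right_alt'])
  then show ?thesis using True by (simp add: algebra_simps)
qed

text \<open>Skewness in two indices that belong to neighbouring letters. If the second letter is
  (z,e_j,e_q), \<open>Z_pull\<close> moves the first one inside this associator, next to e_j, where
  \<open>lt_e\<close> applies. The hypothesis reflects that in \<open>G\<close> the associator
  letters precede the products e_i e_j.\<close>

lemma lt_lt:
  assumes "b' \<Longrightarrow> b" shows "lt b p i \<star> lt b' j q + lt b p j \<star> lt b' i q \<in> K"
proof (cases b')
  case False
  have "(lt b p i \<star> e j + lt b p j \<star> e i) \<star> e q - as (lt b p i) (e j) (e q) - as (lt b p j) (e i) (e q) \<in> K"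
    by (rule K_diff[OF K_diff[OF K_left[OF lt_e] lt_assoc] lt_assoc])
  then show ?thesis using False by (simp add: lt_def[of False] as_def m_distribs algebra_simps)
next
  case True
  then have b: b by (rule assms)
  have "as z (lt b p i \<star> e j + lt b p j \<star> e i) (e q)
    - (as z (lt b p i \<star> e j) (e q) - lt b p i \<star> as z (e j) (e q))
    - (as z (lt b p j \<star> e i) (e q) - lt b p j \<star> as z (e i) (e q)) \<in> K"
    by (rule K_diff[OF K_diff[OF as_K(2)[OF lt_e] Z_pull[OF z_Z lt_Z]] Z_pull[OF z_Z lt_Z]])
  then show ?thesis using True by (simp add: lt_def[of True] as_distribs algebra_simps)
qed

text \<open>Pairs \<open>(t, x)\<close> stand for \<open>t 1 + x\<close> in the unital hull.\<close>

definition L :: "'a \<Rightarrow> 'k \<times> 'a \<Rightarrow> 'k \<times> 'a" where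
  "L c v = (0, sc (fst v) c + c \<star> snd v)"

definition KK :: "('k \<times> 'a) set" where "KK = {v. fst v = 0 \<and> snd v \<in> K}"

lemma KK_div2: assumes "v + v \<in> KK" shows "v \<in> KK"
proof -
  have 1: "fst v + fst v = 0" and 2: "snd v + snd v \<in> K" using assms by (simp_all add: KK_def)
  have "2 * fst v = 0" using 1 by (simp only: mult_2)
  then show ?thesis using K_div2[OF 2] by (simp add: KK_def)
qed

lemma KK_closed: "0 \<in> KK" "\<lbrakk>v \<in> KK; v' \<in> KK\<rbrakk> \<Longrightarrow> v + v' \<in> KK" "v \<in> KK \<Longrightarrow> - v \<in> KK"
  "\<lbrakk>v \<in> KK; v' \<in> KK\<rbrakk> \<Longrightarrow> v - v' \<in> KK"
  by (simp_all add: KK_def K_zero K_add K_uminus K_diff)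

lemma L_add: "L c (v + v') = L c v + L c v'"
  by (simp add: L_def sc_add_left m_distribs)

lemma L_diff: "L c (v - v') = L c v - L c v'"
  using L_add[of c "v - v'" v'] by (simp add: algebra_simps)

lemma L_KK: "v \<in> KK \<Longrightarrow> L c v \<in> KK"
  by (simp add: KK_def L_def K_right)

lemma L_letter_add: "c + c' \<in> K \<Longrightarrow> L c v + L c' v \<in> KK"
  using K_add[OF K_sc K_left, of "c + c'" "c + c'" "fst v" "snd v"]
  by (simp add: KK_def L_def sc_add m_distribs algebra_simps)

lemma L_L:
  assumes "c \<in> Zc" "d \<in> Zc" shows "L c (L d v) - L (c \<star> d) v \<in> KK"
proof -
  have "- as c d (snd v) \<in> K" by (rule K_uminus[OF Z_assoc(1)[OF assms]])
  then show ?thesis by (simp add: KK_def L_def m_distribs m_sc_right as_def)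
qed

lemma L_L_add:
  assumes "c \<in> Zc" "d \<in> Zc" "c' \<in> Zc" "d' \<in> Zc" "c \<star> d + c' \<star> d' \<in> K"
  shows "L c (L d v) + L c' (L d' v) \<in> KK"
proof -
  have "(L c (L d v) - L (c \<star> d) v) + (L c' (L d' v) - L (c' \<star> d') v) + (L (c \<star> d) v + L (c' \<star> d') v) \<in> KK"
    by (rule KK_closed(2)[OF KK_closed(2)[OF L_L L_L] L_letter_add]) (rule assms)+
  then show ?thesis by (simp add: algebra_simps)
qed

lemma L_commute:
  assumes c: "c \<in> Zc" and d: "d \<in> Zc" shows "L c (L d v) - L d (L c v) \<in> KK"
proof -
  have "c \<star> d + - (d \<star> c) \<in> K" using ZD[OF c, of d] by simp
  then have "L (c \<star> d) v + L (- (d \<star> c)) v \<in> KK" by (rule L_letter_add)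
  then have "(L c (L d v) - L (c \<star> d) v) - (L d (L c v) - L (d \<star> c) v) + (L (c \<star> d) v + L (- (d \<star> c)) v) \<in> KK"
    by (rule KK_closed(2)[OF KK_closed(4)[OF L_L[OF c d] L_L[OF d c]]])
  moreover have "L (- (d \<star> c)) v = - L (d \<star> c) v" by (simp add: L_def sc_minus m_distribs)
  ultimately show ?thesis by (simp add: algebra_simps)
qed

text \<open>Consecutive entries of the list are grouped in pairs: the first \<open>j\<close> pairs
  give letters (z,e_p,e_q), the later ones letters e_p e_q, and a single last entry gives an odd
  generator. Truncated subtraction stops the counter at 0; normal forms keep to lists with at least
  2j entries. The empty list is what requires the adjoined unit.\<close>

fun G :: "nat \<Rightarrow> nat list \<Rightarrow> 'k \<times> 'a" where
  "G j [] = (1, 0)"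
| "G j [p] = (0, e p)"
| "G j (p # q # l) = L (lt (0 < j) p q) (G (j - 1) l)"

definition M :: "nat \<Rightarrow> nat \<Rightarrow> nat list \<Rightarrow> 'k \<times> 'a" where
  "M i j l = (L z ^^ i) (G j l)"

text \<open>Two neighbouring entries form one letter, or straddle a letter and the final generator,
  or straddle two letters: these cases are \<open>lt_skew\<close>, \<open>lt_e\<close> and
  \<open>lt_lt\<close>. The induction removes two entries at a time so as to preserve the
  pairing.\<close>

lemma G_alternating: "G j (xs @ a # b # ys) + G j (xs @ b # a # ys) \<in> KK"
proof (induction xs arbitrary: j rule: induct_list012)
  case 1
  then show ?case by (simp add: L_letter_add lt_skew)
next
  case (2 p)
  show ?case
  proof (cases ys)
    case Nil
    then show ?thesis using lt_e[of "0 < j" p a b] by (simp add: KK_def L_def)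
  next
    case (Cons q ys')
    have "L (lt (0 < j) p a) (L (lt (0 < j - 1) b q) (G (j - 1 - 1) ys'))
      + L (lt (0 < j) p b) (L (lt (0 < j - 1) a q) (G (j - 1 - 1) ys')) \<in> KK"
      by (rule L_L_add[OF lt_Z lt_Z lt_Z lt_Z lt_lt]) simp
    then show ?thesis using Cons by simp
  qed
next
  case (3 x y zs)
  then show ?case by (simp add: L_KK flip: L_add)
qed

lemma Lz_pow_add: "(L z ^^ i) (v + v') = (L z ^^ i) v + (L z ^^ i) v'"
  by (induction i) (simp_all add: L_add)

lemma Lz_pow_diff: "(L z ^^ i) (v - v') = (L z ^^ i) v - (L z ^^ i) v'"
  by (induction i) (simp_all add: L_diff)

lemma Lz_pow_KK: "v \<in> KK \<Longrightarrow> (L z ^^ i) v \<in> KK"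
  by (induction i) (simp_all add: L_KK)

lemma M_alternating: "alternating (M i j) KK"
proof
  fix xs a b ys show "M i j (xs @ a # b # ys) + M i j (xs @ b # a # ys) \<in> KK"
    unfolding M_def Lz_pow_add[symmetric] by (intro Lz_pow_KK G_alternating)
qed (fact KK_closed KK_div2)+

lemma Lz_pow_commute:
  assumes "c \<in> Zc" shows "L c ((L z ^^ i) v) - (L z ^^ i) (L c v) \<in> KK"
proof (induction i)
  case (Suc i)
  have "(L c (L z ((L z ^^ i) v)) - L z (L c ((L z ^^ i) v))) + L z (L c ((L z ^^ i) v) - (L z ^^ i) (L c v)) \<in> KK"
    by (rule KK_closed(2)[OF L_commute[OF assms z_Z] L_KK[OF Suc]])
  then show ?case by (simp add: L_diff)
qed (simp add: KK_closed)

text \<open>A letter e_p e_q has to travel past the \<open>j\<close> associator letters to keep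
  these in front; it can, since left multiplications by elements of \<open>Zc\<close> commute modulo
  \<open>KK\<close>.\<close>

lemma G_insert_k:
  "2 * j \<le> length l \<Longrightarrow> \<exists>l'. 2 * j \<le> length l' \<and> L (lt False p q) (G j l) - G j l' \<in> KK"
proof (induction j arbitrary: l)
  case 0
  show ?case by (intro exI[of _ "p # q # l"]) (simp add: KK_closed)
next
  case (Suc j)
  then obtain a b l0 where l: "l = a # b # l0" by (metis Suc_le_length_iff Suc_mult_less_cancel1 add_Suc mult_2 numeral_2_eq_2 mult_Suc_right add_2_eq_Suc)
  then obtain l1 where l1: "2 * j \<le> length l1" "L (lt False p q) (G j l0) - G j l1 \<in> KK"
    using Suc.IH[of l0] Suc.prems by auto
  have "(L (lt False p q) (L (lt True a b) (G j l0)) - L (lt True a b) (L (lt False p q) (G j l0)))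
    + L (lt True a b) (L (lt False p q) (G j l0) - G j l1) \<in> KK"
    by (rule KK_closed(2)[OF L_commute[OF lt_Z lt_Z] L_KK[OF l1(2)]])
  then show ?case using l l1 by (intro exI[of _ "a # b # l1"]) (simp add: L_diff)
qed

definition letters_A0 :: "'a set" where
  "letters_A0 = insert z {lt b p q | b p q. True}"

lemma letters_Z: "c \<in> letters_A0 \<Longrightarrow> c \<in> Zc"
  by (auto simp: letters_A0_def z_Z lt_Z)

lemma M_letter:
  assumes c: "c \<in> letters_A0" and j: "2 * j \<le> length l"
  shows "\<exists>i' j' l'. 2 * j' \<le> length l' \<and> L c (M i j l) - M i' j' l' \<in> KK"
proof -
  consider "c = z" | p q where "c = lt True p q" | p q where "c = lt False p q"
    using c by (auto simp: letters_A0_def) (metis (full_types))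
  then show ?thesis
  proof cases
    case 1
    then show ?thesis using j by (intro exI[of _ "Suc i"] exI[of _ j] exI[of _ l]) (simp add: M_def KK_closed)
  next
    case (2 p q)
    have "L c (M i j l) - M i (Suc j) (p # q # l) \<in> KK"
      using Lz_pow_commute[OF lt_Z, of True p q i "G j l"] 2 by (simp add: M_def)
    then show ?thesis using j by (intro exI[of _ i] exI[of _ "Suc j"] exI[of _ "p # q # l"]) simp
  next
    case (3 p q)
    obtain l' where l': "2 * j \<le> length l'" "L c (G j l) - G j l' \<in> KK" using G_insert_k[OF j] 3 by auto
    have "(L c (M i j l) - (L z ^^ i) (L c (G j l))) + (L z ^^ i) (L c (G j l) - G j l') \<in> KK"
      unfolding M_def by (rule KK_closed(2)[OF Lz_pow_commute[OF letters_Z[OF c]] Lz_pow_KK[OF l'(2)]])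
    then have "L c (M i j l) - M i j l' \<in> KK" by (simp add: Lz_pow_diff M_def)
    then show ?thesis using l' by blast
  qed
qed

abbreviation "EM \<equiv> even_mono letters_A0"
abbreviation "OM \<equiv> odd_mono letters_A0 (range e)"
abbreviation "MS \<equiv> mono_span letters_A0 (range e)"

lemma L_zero: "(0, c \<star> x) = L c (0, x)"
  by (simp add: L_def)

lemma M_step:
  assumes "c \<in> letters_A0" "2 * j \<le> length l" "(0, x) - M i j l \<in> KK"
  shows "\<exists>i j l. 2 * j \<le> length l \<and> (0, c \<star> x) - M i j l \<in> KK"
proof -
  obtain i' j' l' where *: "2 * j' \<le> length l'" "L c (M i j l) - M i' j' l' \<in> KK"
    using M_letter[OF assms(1,2)] by blast
  have "L c ((0, x) - M i j l) + (L c (M i j l) - M i' j' l') \<in> KK"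
    by (rule KK_closed(2)[OF L_KK[OF assms(3)] *(2)])
  then have "(0, c \<star> x) - M i' j' l' \<in> KK" by (simp only: L_zero L_diff) (simp add: algebra_simps)
  then show ?thesis using * by blast
qed

lemma mono_M: "EM x \<or> OM x \<Longrightarrow> \<exists>i j l. 2 * j \<le> length l \<and> (0, x) - M i j l \<in> KK"
proof (erule disjE)
  assume "EM x" then show ?thesis
  proof (induction rule: even_mono.induct)
    case (1 c)
    have "L c (M 0 0 []) = (0, c)" by (simp add: L_def M_def)
    then show ?case using M_letter[OF 1, of 0 "[]" 0] by simp
  next
    case (2 c x) then show ?case using M_step by blast
  qed
next
  assume "OM x" then show ?thesis
  proof (induction rule: odd_mono.induct)
    case (1 x)
    then obtain p where "x = e p" by auto
    then have "(0, x) - M 0 0 [p] \<in> KK" by (simp add: M_def KK_closed)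
    then show ?case by (intro exI[of _ 0] exI[of _ "[p]"]) auto
  next
    case (2 c x) then show ?case using M_step by blast
  qed
qed

definition nf :: "nat \<times> nat \<times> nat set \<Rightarrow> 'k \<times> 'a" where
  "nf t = (case t of (i, j, S) \<Rightarrow> M i j (sorted_list_of_set S))"

definition nf_index :: "(nat \<times> nat \<times> nat set) set" where
  "nf_index = {(i, j, S). finite S \<and> 2 * j \<le> card S}"

definition scv :: "'k \<Rightarrow> 'k \<times> 'a \<Rightarrow> 'k \<times> 'a" where "scv c v = (c * fst v, sc c (snd v))"

lemma scv_simps: "scv c (v + v') = scv c v + scv c v'" "scv (c + d) v = scv c v + scv d v"
  "scv c (scv d v) = scv (c * d) v" "scv 1 v = v" "scv 0 v = 0" "scv (- c) v = - scv c v" "scv c 0 = 0"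
  "scv c (v - v') = scv c v - scv c v'"
  by (simp_all add: scv_def prod_eq_iff sc_add sc_add_left sc_sc algebra_simps sc_minus sc_diff)

lemma scv_KK: "v \<in> KK \<Longrightarrow> scv c v \<in> KK"
  by (simp add: KK_def scv_def K_sc)

lemma scv_sum: "scv c (sum f T) = (\<Sum>t\<in>T. scv c (f t))"
  by (induction T rule: infinite_finite_induct) (simp_all add: scv_simps)

lemma mono_nf:
  assumes "EM x \<or> OM x"
  shows "(0, x) \<in> KK \<or> (\<exists>t\<in>nf_index. \<exists>c. (0, x) - scv c (nf t) \<in> KK)"
proof -
  obtain i j l where l: "2 * j \<le> length l" "(0, x) - M i j l \<in> KK" using mono_M[OF assms] by blast
  interpret A: alternating "M i j" KK by (rule M_alternating)
  from A.normal_form[of l] show ?thesis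
  proof
    assume "M i j l \<in> KK"
    then have "(0, x) - M i j l + M i j l \<in> KK" by (rule KK_closed(2)[OF l(2)])
    then show ?thesis by simp
  next
    assume *: "A.pm (M i j l) (M i j (sorted_list_of_set (set l))) \<and> length l = card (set l)"
    have t: "(i, j, set l) \<in> nf_index" using l * by (simp add: nf_index_def)
    have "(0, x) - scv 1 (nf (i, j, set l)) \<in> KK \<or> (0, x) - scv (- 1) (nf (i, j, set l)) \<in> KK"
      using * KK_closed(2)[OF l(2), of "M i j l - nf (i, j, set l)"]
        KK_closed(2)[OF l(2), of "M i j l + nf (i, j, set l)"]
      by (auto simp: A.pm_def scv_simps nf_def)
    then show ?thesis using t by blast
  qed
qed

lemma span_nf:
  assumes "x \<in> MS"
  shows "\<exists>T c. finite T \<and> T \<subseteq> nf_index \<and> (0, x) - (\<Sum>t\<in>T. scv (c t) (nf t)) \<in> KK"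
  using assms
proof (induction rule: mono_span.induct)
  case (add x y)
  from add.IH(1) obtain T c where T: "finite T" "T \<subseteq> nf_index" "(0, x) - (\<Sum>t\<in>T. scv (c t) (nf t)) \<in> KK"
    by blast
  from add.IH(2) obtain T' c' where T': "finite T'" "T' \<subseteq> nf_index" "(0, y) - (\<Sum>t\<in>T'. scv (c' t) (nf t)) \<in> KK"
    by blast
  note * = T T'
  let ?c = "\<lambda>t. (if t \<in> T then c t else 0) + (if t \<in> T' then c' t else 0)"
  have e: "(\<Sum>t\<in>T \<union> T'. scv (if t \<in> S then d t else 0) (nf t)) = (\<Sum>t\<in>S. scv (d t) (nf t))"
    if "S \<subseteq> T \<union> T'" for S d
    by (rule sum.mono_neutral_cong_right) (use that T(1) T'(1) in \<open>auto simp: scv_simps(5)\<close>)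
  have sum: "(\<Sum>t\<in>T \<union> T'. scv (?c t) (nf t)) = (\<Sum>t\<in>T. scv (c t) (nf t)) + (\<Sum>t\<in>T'. scv (c' t) (nf t))"
    unfolding scv_simps(2) sum.distrib using e[of T c] e[of T' c'] by simp
  have "((0, x) - (\<Sum>t\<in>T. scv (c t) (nf t))) + ((0, y) - (\<Sum>t\<in>T'. scv (c' t) (nf t))) \<in> KK"
    by (rule KK_closed(2)[OF *(3,6)])
  moreover have "((0, x) - A) + ((0, y) - B) = (0, x + y) - (A + B)" for A B :: "'k \<times> 'a"
    by (simp add: prod_eq_iff)
  ultimately have "(0, x + y) - (\<Sum>t\<in>T \<union> T'. scv (?c t) (nf t)) \<in> KK" by (simp only: sum)
  moreover have "finite (T \<union> T')" "T \<union> T' \<subseteq> nf_index" using * by auto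
  ultimately show ?case by (intro exI[of _ "T \<union> T'"] exI[of _ ?c] conjI)
next
  case (sc x c)
  then obtain T d where *: "finite T" "T \<subseteq> nf_index" "(0, x) - (\<Sum>t\<in>T. scv (d t) (nf t)) \<in> KK" by blast
  have "scv c ((0, x) - (\<Sum>t\<in>T. scv (d t) (nf t))) \<in> KK" by (rule scv_KK[OF *(3)])
  moreover have "scv c (0, x) = (0, sc c x)" by (simp add: scv_def)
  ultimately have "(0, sc c x) - (\<Sum>t\<in>T. scv (c * d t) (nf t)) \<in> KK"
    by (simp only: scv_simps(8) scv_sum scv_simps(3))
  with *(1,2) show ?case by (intro exI[of _ T] exI[of _ "\<lambda>t. c * d t"] conjI)
next
  case (ideal x)
  then show ?case by (intro exI[of _ "{}"]) (simp add: KK_def)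
next
  case (even x)
  then consider "(0, x) \<in> KK" | t c where "t \<in> nf_index" "(0, x) - scv c (nf t) \<in> KK" using mono_nf by blast
  then show ?case
  proof cases
    case 1 then show ?thesis by (intro exI[of _ "{}"]) simp
  next
    case (2 t c) then show ?thesis by (intro exI[of _ "{t}"] exI[of _ "\<lambda>_. c"]) simp
  qed
next
  case (odd x)
  then consider "(0, x) \<in> KK" | t c where "t \<in> nf_index" "(0, x) - scv c (nf t) \<in> KK" using mono_nf by blast
  then show ?case
  proof cases
    case 1 then show ?thesis by (intro exI[of _ "{}"]) simp
  next
    case (2 t c) then show ?thesis by (intro exI[of _ "{t}"] exI[of _ "\<lambda>_. c"]) simp
  qed
qed

lemma EM_Z: "EM x \<Longrightarrow> x \<in> Zc"
  by (induction rule: even_mono.induct) (simp_all add: letters_Z Z_mult)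

lemma MS_mult: "\<lbrakk>x \<in> MS; y \<in> MS\<rbrakk> \<Longrightarrow> x \<star> y \<in> MS"
proof (rule mono_span_mult[of letters_A0 "range e" "1 / 2"])
  fix c x y assume "c \<in> letters_A0"
  then have c: "c \<in> Zc" by (rule letters_Z)
  show "as c x y \<in> K" if "EM x" using Z_assoc(1)[OF c EM_Z[OF that]] .
  show "as c (d \<star> x) y - d \<star> as c x y \<in> K" "as c x (d \<star> y) - d \<star> as c x y \<in> K" if "d \<in> letters_A0" for d
    using Z_pull[OF c letters_Z[OF that]] Z_pull'[OF c letters_Z[OF that]] by auto
  have "sc (1 / 2) ((x \<star> (c \<star> y) - c \<star> (x \<star> y)) + (x \<star> (c \<star> y) - c \<star> (x \<star> y)) - as c x y) \<in> K"
    by (intro K_sc Z_shift c)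
  moreover have "sc (1 / 2) (v + v) = v" for v
    using sc_add_left[of "1/2" "1/2" v] by (simp add: sc_add)
  ultimately show "x \<star> (c \<star> y) - c \<star> (x \<star> y) - sc (1 / 2) (as c x y) \<in> K" by (simp add: sc_diff[of _ "_ + _"])
next
  fix x y assume "EM x"
  then have "- (x \<star> y - y \<star> x) \<in> K" by (intro K_uminus ZD EM_Z)
  then show "y \<star> x - x \<star> y \<in> K" by simp
next
  fix e1 e2 assume e: "e1 \<in> range e" "e2 \<in> range e"
  then obtain p q where pq: "e1 = e p" "e2 = e q" by auto
  then have "e1 \<star> e2 = lt False p q" by (simp add: lt_def)
  then show "e1 \<star> e2 \<in> MS" by (auto intro!: mono_span.even even_mono.intros simp: letters_A0_def)
  fix c assume "c \<in> letters_A0"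
  then consider "c = z" | b i j where "c = lt b i j" by (auto simp: letters_A0_def)
  then show "as c e1 e2 \<in> MS"
  proof cases
    case 1
    then have "as c e1 e2 = lt True p q" using pq by (simp add: lt_def)
    then show ?thesis by (auto intro!: mono_span.even even_mono.intros simp: letters_A0_def)
  next
    case 2
    then show ?thesis using pq lt_assoc by (auto intro: mono_span.ideal)
  qed
qed

end

section \<open>The algebra \<open>A\<^sub>0\<close>\<close>

abbreviation "RA \<equiv> relatively_free strongly_m11 (UNIV :: A0_generator set)"
abbreviation "rga \<equiv> relatively_free_gen strongly_m11 (UNIV :: A0_generator set)"

definition RA_proj :: "(A0_generator, 'k::field_char_0) napoly \<Rightarrow> (A0_generator, 'k) napoly set" where
  "RA_proj p = verbal_ideal strongly_m11 UNIV +>\<^bsub>free_algebra UNIV\<^esub> p"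

text \<open>The projection from the free nonassociative algebra through both quotients; calculations
  in \<open>A0\<close> take place modulo its kernel.\<close>

definition A0_proj :: "(A0_generator, 'k::field_char_0) napoly \<Rightarrow> (A0_generator, 'k) napoly set set" where
  "A0_proj p = alg_ideal_gen RA A0_relations +>\<^bsub>RA\<^esub> RA_proj p"

interpretation FA: nonassoc_algebra "free_algebra UNIV :: ('k::field_char_0, (A0_generator, 'k) napoly) module"
  by (rule nonassoc_algebra_free)

interpretation QA: alg_quotient "free_algebra UNIV :: ('k::field_char_0, (A0_generator, 'k) napoly) module"
  "verbal_ideal strongly_m11 UNIV"
  by unfold_locales (rule verbal_ideal_ideal)

lemma RA_eq: "RA = alg_quot (free_algebra UNIV) (verbal_ideal strongly_m11 UNIV)"
  by (simp add: relatively_free_def)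

interpretation RA: nonassoc_algebra "RA :: ('k::field_char_0, (A0_generator, 'k) napoly set) module"
  unfolding RA_eq by (rule QA.nonassoc_algebra_quot)

interpretation RAh: nonassoc_hom "free_algebra UNIV :: ('k::field_char_0, (A0_generator, 'k) napoly) module" RA RA_proj
  unfolding RA_proj_def RA_eq
  by (intro nonassoc_homI FA.nonassoc_algebra_axioms QA.nonassoc_algebra_quot QA.quot_hom)

lemma rga_eq: "rga x = RA_proj (gen x)"
  by (simp add: relatively_free_gen_def RA_proj_def)

lemma rga_closed [simp]: "rga x \<in> carrier (RA :: ('k::field_char_0, (A0_generator, 'k) napoly set) module)"
  unfolding rga_eq by (rule RAh.hom_closed) simp

lemma A0_relations_carrier: "A0_relations \<subseteq> carrier (RA :: ('k::field_char_0, (A0_generator, 'k) napoly set) module)"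
  unfolding A0_relations_def Let_def by auto

interpretation QA2: alg_quotient "RA :: ('k::field_char_0, (A0_generator, 'k) napoly set) module"
  "alg_ideal_gen RA A0_relations"
  by unfold_locales (rule RA.alg_ideal_gen_ideal[OF A0_relations_carrier])

interpretation A0: nonassoc_algebra "A0 :: ('k::field_char_0, (A0_generator, 'k) napoly set set) module"
  unfolding A0_def by (rule QA2.nonassoc_algebra_quot)

interpretation A0h: nonassoc_hom "free_algebra UNIV :: ('k::field_char_0, (A0_generator, 'k) napoly) module" A0 A0_proj
proof (intro nonassoc_homI FA.nonassoc_algebra_axioms A0.nonassoc_algebra_axioms)
  show "A0_proj \<in> alg_hom (free_algebra UNIV :: ('k, (A0_generator, 'k) napoly) module) A0"
    unfolding A0_proj_def A0_def by (rule alg_hom_compose[OF RAh.hom QA2.quot_hom])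
qed

lemma A0_carrier: "carrier (A0 :: ('k::field_char_0, (A0_generator, 'k) napoly set set) module) = range A0_proj"
  unfolding A0_def A0_proj_def QA2.alg_quot_simps(1)
  by (simp add: RA_eq image_image RA_proj_def)

lemma A0_proj_zero_iff: "A0_proj p = \<zero>\<^bsub>A0\<^esub> \<longleftrightarrow> RA_proj p \<in> alg_ideal_gen RA A0_relations"
  unfolding A0_proj_def A0_def QA2.alg_quot_simps(2) by (rule QA2.coset_zero_iff) simp

lemma RA_proj_zero_iff: "RA_proj p = \<zero>\<^bsub>RA\<^esub> \<longleftrightarrow> p \<in> verbal_ideal strongly_m11 UNIV"
  unfolding RA_proj_def RA_eq QA.alg_quot_simps(2) by (rule QA.coset_zero_iff) simp

lemma A0_proj_relation: "RA_proj p \<in> A0_relations \<Longrightarrow> A0_proj p = \<zero>\<^bsub>A0\<^esub>"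
  using RA.alg_ideal_gen_incl by (auto simp: A0_proj_zero_iff)

lemma A0_proj_verbal: assumes "p \<in> verbal_ideal strongly_m11 UNIV" shows "A0_proj p = \<zero>\<^bsub>A0\<^esub>"
  using assms QA2.I_simps(2) by (simp add: A0_proj_zero_iff RA_proj_zero_iff[THEN iffD2])

lemma strongly_m11_verbal:
  fixes x y z :: "(A0_generator, 'k::field_char_0) napoly"
  shows "associator (free_algebra UNIV) x y y \<in> verbal_ideal strongly_m11 UNIV"
    "associator (free_algebra UNIV) x y z + associator (free_algebra UNIV) y z x
      + associator (free_algebra UNIV) z x y \<in> verbal_ideal strongly_m11 UNIV"
    "commutator (free_algebra UNIV) (commutator (free_algebra UNIV) x y) z \<in> verbal_ideal strongly_m11 UNIV"
proof -
  let ?v = "\<lambda>n :: nat. if n = 0 then x else if n = 1 then y else z"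
  let ?F = "free_algebra UNIV :: ('k, (nat, 'k) napoly) module"
  interpret h: nonassoc_hom ?F "free_algebra UNIV" "napoly_eval (free_algebra UNIV) ?v"
    by (intro nonassoc_homI nonassoc_algebra_free FA.napoly_eval_hom) simp
  have *: "napoly_eval (free_algebra UNIV) ?v f \<in> verbal_ideal strongly_m11 UNIV" if "f \<in> strongly_m11" for f
    unfolding verbal_ideal_def by (rule FA.alg_ideal_gen_incl[THEN subsetD]) (use that h.hom in blast)
  have g: "napoly_eval (free_algebra UNIV) ?v (gen 0) = x" "napoly_eval (free_algebra UNIV) ?v (gen 1) = y"
    "napoly_eval (free_algebra UNIV) ?v (gen 2) = z"
    using FA.napoly_eval_gen[of ?v] by simp_all
  have c: "a \<in> carrier ?F" for a by simp
  note hs = h.hom_associator[OF c c c] h.hom_commutator[OF c c] h.hom_add[OF c c] g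
  have "associator ?F (gen 0) (gen 1) (gen 1) \<in> strongly_m11"
    "associator ?F (gen 0) (gen 1) (gen 2) \<oplus>\<^bsub>?F\<^esub> associator ?F (gen 1) (gen 2) (gen 0)
      \<oplus>\<^bsub>?F\<^esub> associator ?F (gen 2) (gen 0) (gen 1) \<in> strongly_m11"
    "commutator ?F (commutator ?F (gen 0) (gen 1)) (gen 2) \<in> strongly_m11"
    unfolding strongly_m11_def Let_def by (simp_all only: insert_iff refl simp_thms)
  from *[OF this(1)] *[OF this(2)] *[OF this(3)]
  show "associator (free_algebra UNIV) x y y \<in> verbal_ideal strongly_m11 UNIV"
    "associator (free_algebra UNIV) x y z + associator (free_algebra UNIV) y z x
      + associator (free_algebra UNIV) z x y \<in> verbal_ideal strongly_m11 UNIV"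
    "commutator (free_algebra UNIV) (commutator (free_algebra UNIV) x y) z \<in> verbal_ideal strongly_m11 UNIV"
    unfolding hs by (simp_all only: free_algebra_simps)
qed

interpretation A0m: a0_mod napoly_mult "{p. A0_proj p = \<zero>\<^bsub>A0\<^esub>}" "napoly_smult :: 'k::field_char_0 \<Rightarrow> _"
  "gen Z" "\<lambda>i. gen (E i)"
proof -
  let ?K = "{p :: (A0_generator, 'k) napoly. A0_proj p = \<zero>\<^bsub>A0\<^esub>}"
  interpret N: nalg_mod napoly_mult ?K
    by (rule kernel_nalg_mod[OF A0.nonassoc_algebra_axioms A0h.hom])
  have as: "N.as x y z = associator (free_algebra UNIV) x y z" for x y z
    by (simp add: N.as_def)
  have R: "RA_proj (associator (free_algebra UNIV) x y z) = associator RA (RA_proj x) (RA_proj y) (RA_proj z)"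
    "RA_proj (commutator (free_algebra UNIV) x y) = commutator RA (RA_proj x) (RA_proj y)"
    "RA_proj (napoly_mult x y) = RA_proj x \<otimes>\<^bsub>RA\<^esub> RA_proj y"
    "RA_proj (x + y) = RA_proj x \<oplus>\<^bsub>RA\<^esub> RA_proj y"
    for x y z :: "(A0_generator, 'k) napoly"
    using RAh.hom_associator[of x y z] RAh.hom_commutator[of x y] RAh.hom_mult[of x y] RAh.hom_add[of x y]
    by (simp_all only: carrier_free_algebra_UNIV UNIV_I free_algebra_simps simp_thms)
  have rel: "\<And>i j. (rga (E i) \<otimes>\<^bsub>RA\<^esub> rga (E j)) \<oplus>\<^bsub>RA\<^esub> (rga (E j) \<otimes>\<^bsub>RA\<^esub> rga (E i)) \<in> (A0_relations :: (A0_generator, 'k) napoly set set)"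
    "\<And>i j p. associator RA (rga (E i)) (rga (E j)) (rga (E p)) \<in> (A0_relations :: (A0_generator, 'k) napoly set set)"
    "\<And>i j p q. associator RA (commutator RA (rga (E i)) (rga (E j))) (rga (E p)) (rga (E q)) \<in> (A0_relations :: (A0_generator, 'k) napoly set set)"
    "\<And>i j p q. associator RA (associator RA (rga Z) (rga (E i)) (rga (E j))) (rga (E p)) (rga (E q)) \<in> (A0_relations :: (A0_generator, 'k) napoly set set)"
    "\<And>f. f \<in> carrier RA \<Longrightarrow> commutator RA (rga Z) f \<in> (A0_relations :: (A0_generator, 'k) napoly set set)"
    unfolding A0_relations_def Let_def by blast+
  show "a0_mod napoly_mult ?K napoly_smult (gen Z) (\<lambda>i. gen (E i))"
  proof unfold_locales
    fix x y z :: "(A0_generator, 'k) napoly"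
    show "N.as x y y \<in> ?K" unfolding as using A0_proj_verbal[OF strongly_m11_verbal(1)] by blast
    show "N.as x y z + N.as y z x + N.as z x y \<in> ?K" unfolding as
      using A0_proj_verbal[OF strongly_m11_verbal(2)] by blast
    show "napoly_mult (napoly_mult x y - napoly_mult y x) z - napoly_mult z (napoly_mult x y - napoly_mult y x) \<in> ?K"
      using A0_proj_verbal[OF strongly_m11_verbal(3), of x y z] by simp
    show "napoly_smult c x \<in> ?K" if "x \<in> ?K" for c
      using that A0h.hom_smult[of x c] by simp
  next
    fix x :: "(A0_generator, 'k) napoly"
    have "commutator RA (rga Z) (RA_proj x) \<in> A0_relations"
      using rel(5) RAh.hom_closed by simp
    then have "A0_proj (commutator (free_algebra UNIV) (gen Z) x) = \<zero>\<^bsub>A0\<^esub>"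
      by (intro A0_proj_relation) (simp only: R rga_eq)
    then show "napoly_mult (gen Z) x - napoly_mult x (gen Z) \<in> ?K" by simp
  next
    fix i j p q
    show "napoly_mult (gen (E i)) (gen (E j)) + napoly_mult (gen (E j)) (gen (E i)) \<in> ?K"
      unfolding mem_Collect_eq by (rule A0_proj_relation) (simp only: R rga_eq[symmetric] rel)
    show "N.as (gen (E i)) (gen (E j)) (gen (E p)) \<in> ?K"
      unfolding as mem_Collect_eq by (rule A0_proj_relation) (simp only: R rga_eq[symmetric] rel)
    show "N.as (napoly_mult (gen (E i)) (gen (E j)) - napoly_mult (gen (E j)) (gen (E i))) (gen (E p)) (gen (E q)) \<in> ?K"
      unfolding as commutator_free[symmetric] mem_Collect_eq
      by (rule A0_proj_relation) (simp only: R rga_eq[symmetric] rel)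
    show "N.as (N.as (gen Z) (gen (E i)) (gen (E j))) (gen (E p)) (gen (E q)) \<in> ?K"
      unfolding as mem_Collect_eq by (rule A0_proj_relation) (simp only: R rga_eq[symmetric] rel)
  qed (simp_all add: napoly_smult_add napoly_add_smult napoly_smult_smult
      napoly_mult_smult_left napoly_mult_smult_right)
qed

lemma A0_lift:
  fixes B :: "('k::field_char_0, 'b, 'n) module_scheme"
  assumes B: "sm11_algebra B" and v: "\<And>x. v x \<in> carrier B"
    and r1: "\<And>i j. (v (E i) \<otimes>\<^bsub>B\<^esub> v (E j)) \<oplus>\<^bsub>B\<^esub> (v (E j) \<otimes>\<^bsub>B\<^esub> v (E i)) = \<zero>\<^bsub>B\<^esub>"
    and r2: "\<And>i j p. associator B (v (E i)) (v (E j)) (v (E p)) = \<zero>\<^bsub>B\<^esub>"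
    and r3: "\<And>i j p q. associator B (commutator B (v (E i)) (v (E j))) (v (E p)) (v (E q)) = \<zero>\<^bsub>B\<^esub>"
    and r4: "\<And>i j p q. associator B (associator B (v Z) (v (E i)) (v (E j))) (v (E p)) (v (E q)) = \<zero>\<^bsub>B\<^esub>"
    and r5: "\<And>f. f \<in> carrier B \<Longrightarrow> commutator B (v Z) f = \<zero>\<^bsub>B\<^esub>"
  obtains h where "h \<in> alg_hom A0 B" "\<And>p. h (A0_proj p) = napoly_eval B v p"
proof -
  interpret B: nonassoc_algebra B using B by (simp add: sm11_algebra_def)
  interpret e: nonassoc_hom "free_algebra UNIV :: ('k, (A0_generator, 'k) napoly) module" B "napoly_eval B v"
    by (intro nonassoc_homI nonassoc_algebra_free B.nonassoc_algebra_axioms B.napoly_eval_hom v)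
  have "verbal_ideal strongly_m11 UNIV \<subseteq> {x \<in> carrier (free_algebra UNIV). napoly_eval B v x = \<zero>\<^bsub>B\<^esub>}"
    unfolding verbal_ideal_def
  proof (rule FA.alg_ideal_gen_least[OF e.kernel_ideal])
    show "{h f |h f. f \<in> strongly_m11 \<and> h \<in> alg_hom (free_algebra UNIV) (free_algebra UNIV)}
      \<subseteq> {x \<in> carrier (free_algebra UNIV). napoly_eval B v x = \<zero>\<^bsub>B\<^esub>}"
    proof clarify
      fix h :: "(nat, 'k) napoly \<Rightarrow> (A0_generator, 'k) napoly" and f :: "(nat, 'k) napoly"
      assume f: "f \<in> strongly_m11" and h: "h \<in> alg_hom (free_algebra UNIV) (free_algebra (UNIV :: A0_generator set))"
      have "f \<in> identities B" using strongly_m11_identities[OF B] f by blast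
      then show "h f \<in> carrier (free_algebra UNIV) \<and> napoly_eval B v (h f) = \<zero>\<^bsub>B\<^esub>"
        using alg_hom_compose[OF h e.hom] by (simp add: identities_def)
    qed
  qed
  then have 1: "napoly_eval B v x = \<zero>\<^bsub>B\<^esub>" if "x \<in> verbal_ideal strongly_m11 UNIV" for x using that by blast
  obtain g where g: "g \<in> alg_hom RA B" "\<And>x. g (RA_proj x) = napoly_eval B v x"
    using QA.quot_lift[OF B.nonassoc_algebra_axioms e.hom 1] unfolding RA_eq RA_proj_def by auto
  interpret g: nonassoc_hom "RA :: ('k, (A0_generator, 'k) napoly set) module" B g
    by (intro nonassoc_homI RA.nonassoc_algebra_axioms B.nonassoc_algebra_axioms g)
  have gv: "g (rga x) = v x" for x by (simp add: rga_eq g v)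
  have "alg_ideal_gen RA A0_relations \<subseteq> {x \<in> carrier RA. g x = \<zero>\<^bsub>B\<^esub>}"
  proof (rule RA.alg_ideal_gen_least[OF g.kernel_ideal], rule subsetI)
    fix x :: "(A0_generator, 'k) napoly set" assume x: "x \<in> A0_relations"
    have "g x = \<zero>\<^bsub>B\<^esub>"
      using x unfolding A0_relations_def Let_def
      by (elim UnE CollectE exE conjE) (simp_all add: gv r1 r2 r3 r4 r5)
    then show "x \<in> {x \<in> carrier RA. g x = \<zero>\<^bsub>B\<^esub>}" using x A0_relations_carrier by blast
  qed
  then have 2: "g x = \<zero>\<^bsub>B\<^esub>" if "x \<in> alg_ideal_gen RA A0_relations" for x using that by blast
  obtain h where "h \<in> alg_hom A0 B" "\<And>x. x \<in> carrier RA \<Longrightarrow> h (alg_ideal_gen RA A0_relations +>\<^bsub>RA\<^esub> x) = g x"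
    using QA2.quot_lift[OF B.nonassoc_algebra_axioms g.hom 2] unfolding A0_def by blast
  then show ?thesis using that[of h] g by (simp add: A0_proj_def)
qed

subsection \<open>Representations of \<open>A\<^sub>0\<close>\<close>

abbreviation "tm \<equiv> tens (vsuper mu_m11)"

definition A0_rep :: "'k::field_char_0 \<Rightarrow> A0_generator \<Rightarrow> nat set \<Rightarrow> 'k poly \<times> 'k poly" where
  "A0_rep c x = (case x of Z \<Rightarrow> tm ([:0, c:], 0) {} | E i \<Rightarrow> tm (0, 1) {i})"

abbreviation "A0_ev c \<equiv> napoly_eval EnvM (A0_rep c)"

lemma tm_closed: "\<lbrakk>finite S; if even (card S) then snd a = 0 else fst a = 0\<rbrakk> \<Longrightarrow> tm a S \<in> carrier EnvM"
  by (rule m11.tens_carrier) (auto simp: par_eq)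

lemma A0_rep_closed [simp]: "A0_rep c x \<in> carrier EnvM"
  by (cases x) (simp_all add: A0_rep_def tm_closed)

lemma tm_mult:
  "\<lbrakk>finite S; finite T; S \<inter> T = {}\<rbrakk> \<Longrightarrow>
    tm a S \<otimes>\<^bsub>EnvM\<^esub> tm b T = tm (vs (grassmann_sign S T) (vm mu_m11 a b)) (S \<union> T)"
  by (simp add: m11.tens_mult)

definition cst :: "'k::field_char_0 poly \<times> 'k poly \<Rightarrow> bool" where
  "cst x \<longleftrightarrow> pderiv (fst x) = 0 \<and> pderiv (snd x) = 0"

lemma cst_vs: "cst x \<Longrightarrow> cst (vs c x)"
  by (simp add: cst_def vs_def pderiv_smult)

lemma cst_sum: "(\<And>i. i \<in> S \<Longrightarrow> cst (f i)) \<Longrightarrow> cst (sum f S)"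
  by (induction S rule: infinite_finite_induct) (simp_all add: cst_def pderiv_add)

lemma cst_vm: "\<lbrakk>cst x; cst y\<rbrakk> \<Longrightarrow> cst (vm mu_m11 x y)"
  by (simp add: cst_def vm_def mu_m11_def pderiv_add pderiv_mult)

lemma cst_mult: "\<lbrakk>\<And>S. cst (f S); \<And>S. cst (g S)\<rbrakk> \<Longrightarrow> cst ((f \<otimes>\<^bsub>EnvM\<^esub> g) U)"
  unfolding m11.vector_env_mult by (intro cst_sum cst_vs cst_vm)

text \<open>Every term of an associator in this superalgebra contains a derivative. This yields the
  relations among the e_i, whose images have constant coefficients.\<close>

lemma cst_associator:
  assumes "f \<in> carrier EnvM" "g \<in> carrier EnvM" "h \<in> carrier EnvM"
    and "\<And>S. cst (f S)" "\<And>S. cst (g S)" "\<And>S. cst (h S)"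
  shows "associator EnvM f g h = \<zero>\<^bsub>EnvM\<^esub>"
proof -
  have "m11.vas x y z = 0" if "cst x" "cst y" "cst z" for x y z
    using that by (simp add: m11.vas_def vm_def mu_m11_def cst_def pderiv_add pderiv_mult algebra_simps prod_eq_iff)
  then have "m11.vas (f S) (g T) (h R) = 0" for S T R using assms(4-6) by blast
  then show ?thesis using assms(1-3) by (intro ext) (simp add: m11.env_associator)
qed

text \<open>With two constant entries at the end, an associator depends only on the derivative of
  its first entry. The case in use is (z,e_i,e_j) with z linear in t; its associators with the e's
  then vanish by \<open>cst_associator\<close>.\<close>

lemma linear_associator:
  assumes "f \<in> carrier EnvM" "g \<in> carrier EnvM" "h \<in> carrier EnvM"
    and "\<And>S. pderiv (pderiv (fst (f S))) = 0 \<and> pderiv (pderiv (snd (f S))) = 0"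
    and "\<And>S. cst (g S)" "\<And>S. cst (h S)"
  shows "cst (associator EnvM f g h U)"
proof -
  have "cst (m11.vas x y z)" if "pderiv (pderiv (fst x)) = 0" "pderiv (pderiv (snd x)) = 0" "cst y" "cst z" for x y z
    using that by (simp add: m11.vas_def vm_def mu_m11_def cst_def pderiv_add pderiv_mult pderiv_diff algebra_simps)
  then have "cst (m11.vas (f S) (g T) (h R))" for S T R using assms(4-6) by blast
  then have "cst (\<Sum>(S, T, R)\<in>part3 U. vs (sign3 S T R) (m11.vas (f S) (g T) (h R)))"
    by (intro cst_sum) (simp add: case_prod_unfold cst_vs)
  then show ?thesis using assms(1-3) by (simp add: m11.env_associator) (simp add: cst_def)
qed

lemma cst_E: "cst (A0_rep c (E i) S)"
  by (simp add: A0_rep_def tens_def cst_def pderiv_1)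

lemma E_anticommute:
  "(A0_rep c (E i) \<otimes>\<^bsub>EnvM\<^esub> A0_rep c (E j)) \<oplus>\<^bsub>EnvM\<^esub> (A0_rep c (E j) \<otimes>\<^bsub>EnvM\<^esub> A0_rep c (E i)) = \<zero>\<^bsub>EnvM\<^esub>"
proof (cases "i = j")
  case True
  then show ?thesis by (simp add: A0_rep_def m11.tens_mult)
next
  case False
  then have "grassmann_sign {j} {i} = - (grassmann_sign {i} {j} :: 'a)"
    using grassmann_sign_swap[of "{i}" "{j}", where 'k = 'a] by simp
  moreover have "A0_rep c (E p) \<otimes>\<^bsub>EnvM\<^esub> A0_rep c (E q)
    = tm (vs (grassmann_sign {p} {q}) (vm mu_m11 (0, 1) (0, 1))) {p, q}" if "p \<noteq> q" for p q
    using that by (simp add: A0_rep_def tm_mult insert_commute)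
  ultimately show ?thesis using False by (simp add: tens_def fun_eq_iff insert_commute)
qed

lemma A0_rep_hom:
  obtains h where "h \<in> alg_hom A0 EnvM" "\<And>p. h (A0_proj p) = A0_ev c p"
proof (rule A0_lift[OF env_sm11 A0_rep_closed])
  fix i j p q
  show "(A0_rep c (E i) \<otimes>\<^bsub>EnvM\<^esub> A0_rep c (E j)) \<oplus>\<^bsub>EnvM\<^esub> (A0_rep c (E j) \<otimes>\<^bsub>EnvM\<^esub> A0_rep c (E i)) = \<zero>\<^bsub>EnvM\<^esub>"
    by (rule E_anticommute)
  show "associator EnvM (A0_rep c (E i)) (A0_rep c (E j)) (A0_rep c (E p)) = \<zero>\<^bsub>EnvM\<^esub>"
    by (rule cst_associator) (simp_all add: cst_E)
  have "cst (commutator EnvM (A0_rep c (E i)) (A0_rep c (E j)) S)" for S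
    using cst_mult[of "A0_rep c (E i)" "A0_rep c (E j)" S] cst_mult[of "A0_rep c (E j)" "A0_rep c (E i)" S]
    by (simp add: commutator_def m11.env_minus m11.vector_minus cst_E) (simp add: cst_def pderiv_diff)
  then show "associator EnvM (commutator EnvM (A0_rep c (E i)) (A0_rep c (E j))) (A0_rep c (E p)) (A0_rep c (E q)) = \<zero>\<^bsub>EnvM\<^esub>"
    by (intro cst_associator) (simp_all add: cst_E)
  have "pderiv (pderiv (fst (A0_rep c Z S))) = 0 \<and> pderiv (pderiv (snd (A0_rep c Z S))) = 0" for S
    by (simp add: A0_rep_def tens_def pderiv_pCons)
  then have "cst (associator EnvM (A0_rep c Z) (A0_rep c (E i)) (A0_rep c (E j)) S)" for S
    by (intro linear_associator) (simp_all add: cst_E)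
  then show "associator EnvM (associator EnvM (A0_rep c Z) (A0_rep c (E i)) (A0_rep c (E j))) (A0_rep c (E p)) (A0_rep c (E q)) = \<zero>\<^bsub>EnvM\<^esub>"
    by (intro cst_associator) (simp_all add: cst_E)
next
  fix f :: "nat set \<Rightarrow> 'a poly \<times> 'a poly" assume f: "f \<in> carrier EnvM"
  have "A0_rep c Z S = 0" if "odd (card S)" for S
    using that by (auto simp: A0_rep_def tens_def)
  then have "A0_rep c Z \<otimes>\<^bsub>EnvM\<^esub> f = f \<otimes>\<^bsub>EnvM\<^esub> A0_rep c Z"
    by (rule m11.env_even_central) (simp_all add: f)
  then show "commutator EnvM (A0_rep c Z) f = \<zero>\<^bsub>EnvM\<^esub>"
    using f m11.env_mult_closed[OF f A0_rep_closed] by (simp add: commutator_def m11.env_minus m11.vector_minus)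
qed (use that in blast)

section \<open>Values of the normal forms and separation in A_0\<close>

definition env_one :: "nat set \<Rightarrow> 'k::field_char_0 poly \<times> 'k poly" where
  "env_one = tm (1, 0) {}"

lemma env_one_closed [simp]: "env_one \<in> carrier EnvM"
  by (simp add: env_one_def tm_closed)

lemma mult_env_one: assumes f: "f \<in> carrier EnvM" shows "f \<otimes>\<^bsub>EnvM\<^esub> env_one = f"
proof
  fix U show "(f \<otimes>\<^bsub>EnvM\<^esub> env_one) U = f U"
  proof (cases "finite U")
    case True
    have "(f \<otimes>\<^bsub>EnvM\<^esub> env_one) U = (\<Sum>S\<in>Pow U. if S = U then f U else 0)"
      unfolding m11.vector_env_mult
    proof (rule sum.cong[OF refl])
      fix S assume "S \<in> Pow U"
      then have *: "U - S = {} \<longleftrightarrow> S = U" by auto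
      show "vs (grassmann_sign S (U - S)) (vm mu_m11 (f S) (env_one (U - S))) = (if S = U then f U else 0)"
      proof (cases "S = U")
        case True
        then show ?thesis by (simp add: env_one_def tens_def vm_def prod_eq_iff)
      next
        case False
        then have "env_one (U - S) = (0 :: 'a poly \<times> 'a poly)" using * by (simp add: env_one_def tens_def)
        then show ?thesis using False by simp
      qed
    qed
    also have "\<dots> = f U" using True by simp
    finally show ?thesis .
  next
    case False
    then show ?thesis using f by (simp add: m11.env_mult_infinite m11.vector_env_carrier)
  qed
qed

text \<open>\<open>A0_ev\<close> extended to the unital hull, the adjoined unit going to
  \<open>env_one\<close>; the operators \<open>L\<close> become left multiplications in the
  envelope.\<close>

definition A0_hull :: "'k::field_char_0 \<Rightarrow> 'k \<times> (A0_generator, 'k) napoly \<Rightarrow> nat set \<Rightarrow> 'k poly \<times> 'k poly" where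
  "A0_hull c v = (\<lambda>S. vs (fst v) (env_one S) + A0_ev c (snd v) S)"

lemma A0_ev_hom: "nonassoc_hom (free_algebra UNIV) EnvM (A0_ev c)"
  by (intro nonassoc_homI nonassoc_algebra_free m11.nonassoc_algebra_env m11.env.napoly_eval_hom) simp

lemma A0_ev_simps:
  "A0_ev c (p + q) = (\<lambda>S. A0_ev c p S + A0_ev c q S)"
  "A0_ev c (napoly_mult p q) = A0_ev c p \<otimes>\<^bsub>EnvM\<^esub> A0_ev c q"
  "A0_ev c (napoly_smult d p) = (\<lambda>S. vs d (A0_ev c p S))"
  "A0_ev c (gen x) = A0_rep c x" "A0_ev c p \<in> carrier EnvM"
  "A0_ev c (associator (free_algebra UNIV) p q r) = associator EnvM (A0_ev c p) (A0_ev c q) (A0_ev c r)"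
proof -
  interpret h: nonassoc_hom "free_algebra UNIV" EnvM "A0_ev c" by (rule A0_ev_hom)
  have c: "x \<in> carrier (free_algebra UNIV)" for x :: "(A0_generator, 'a) napoly" by simp
  show "A0_ev c (associator (free_algebra UNIV) p q r) = associator EnvM (A0_ev c p) (A0_ev c q) (A0_ev c r)"
    by (rule h.hom_associator[OF c c c])
qed (simp_all add: m11.env.napoly_eval_add m11.env.napoly_eval_mult m11.env.napoly_eval_smult)

lemma A0_hull_L: "A0_hull c (A0m.L p v) = A0_ev c p \<otimes>\<^bsub>EnvM\<^esub> A0_hull c v"
proof -
  have h: "A0_hull c v = fst v \<odot>\<^bsub>EnvM\<^esub> env_one \<oplus>\<^bsub>EnvM\<^esub> A0_ev c (snd v)"
    by (simp add: A0_hull_def)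
  have "A0_ev c p \<otimes>\<^bsub>EnvM\<^esub> A0_hull c v
    = fst v \<odot>\<^bsub>EnvM\<^esub> (A0_ev c p \<otimes>\<^bsub>EnvM\<^esub> env_one) \<oplus>\<^bsub>EnvM\<^esub> A0_ev c p \<otimes>\<^bsub>EnvM\<^esub> A0_ev c (snd v)"
    unfolding h using A0_ev_simps(5)[of c]
    by (simp only: m11.env.mult_add_right m11.env.mult_smult_right m11.env.smult_closed' env_one_closed)
  then show ?thesis
    by (simp add: mult_env_one A0_ev_simps A0m.L_def A0_hull_def)
qed

lemma grassmann_sign_increasing:
  assumes "\<And>s t. s \<in> S \<Longrightarrow> t \<in> T \<Longrightarrow> s < t" shows "grassmann_sign S T = (1 :: 'k::field)"
proof -
  have "{(s, t). s \<in> S \<and> t \<in> T \<and> t < s} = {}" using assms by (auto dest: less_asym)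
  then show ?thesis by (simp only: grassmann_sign_def) simp
qed

text \<open>The scalar 2c is twice the derivative of ct, as (f,p,q) is 2f'pq for even f and odd p,
  q. Increasing indices make the Grassmann sign +1.\<close>

lemma A0_ev_lt:
  assumes "p < q" shows "A0_ev c (A0m.lt b p q) = tm (if b then [:2 * c:] else 1, 0) {p, q}"
proof -
  have s: "grassmann_sign {p} {q} = (1 :: 'a)"
    by (rule grassmann_sign_increasing) (use assms in auto)
  have ee: "A0_rep c (E p) \<otimes>\<^bsub>EnvM\<^esub> A0_rep c (E q) = tm (1, 0) {p, q}"
    using assms s by (simp add: A0_rep_def tm_mult vm_def mu_m11_def insert_commute pderiv_1)
  show ?thesis
  proof (cases b)
    case True
    have "associator EnvM (A0_rep c Z) (A0_rep c (E p)) (A0_rep c (E q)) = tm ([:2 * c:], 0) {p, q}"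
    proof -
      have 1: "A0_rep c Z \<otimes>\<^bsub>EnvM\<^esub> A0_rep c (E p) = tm (0, [:0, c:]) {p}"
        by (simp add: A0_rep_def tm_mult vm_def mu_m11_def)
      have 2: "tm (0, [:0, c:]) {p} \<otimes>\<^bsub>EnvM\<^esub> A0_rep c (E q) = tm ([:2 * c, c:], 0) {p, q}"
        using assms s by (simp add: A0_rep_def tm_mult vm_def mu_m11_def insert_commute pderiv_pCons pderiv_1)
      have 3: "A0_rep c Z \<otimes>\<^bsub>EnvM\<^esub> tm (1, 0) {p, q} = tm ([:0, c:], 0) {p, q}"
        by (simp add: A0_rep_def tm_mult vm_def mu_m11_def)
      have "associator EnvM (A0_rep c Z) (A0_rep c (E p)) (A0_rep c (E q))
        = tm ([:2 * c, c:], 0) {p, q} \<ominus>\<^bsub>EnvM\<^esub> tm ([:0, c:], 0) {p, q}"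
        unfolding associator_def 1 2 ee 3 ..
      also have "\<dots> = tm ([:2 * c:], 0) {p, q}"
      proof -
        have "tm ([:2 * c, c:], 0) {p, q} \<in> carrier EnvM" "tm ([:0, c:], 0) {p, q} \<in> carrier EnvM"
          using assms by (auto intro!: tm_closed)
        then show ?thesis by (auto simp: m11.env_minus m11.vector_minus tens_def)
      qed
      finally show ?thesis .
    qed
    then show ?thesis
      using True A0_ev_simps(6)[of c "gen Z" "gen (E p)" "gen (E q)"]
      by (simp add: A0m.lt_def A0m.as_def A0_ev_simps(4))
  qed (simp add: A0m.lt_def A0_ev_simps ee)
qed

definition hvec :: "nat \<Rightarrow> nat list \<Rightarrow> 'k::field_char_0 poly \<times> 'k poly" where
  "hvec i l = (if even (length l) then (monom 1 i, 0) else (0, monom 1 i))"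

lemma A0_hull_G:
  "sorted l \<Longrightarrow> distinct l \<Longrightarrow> 2 * j \<le> length l \<Longrightarrow>
    A0_hull c (A0m.G j l) = tm (vs ((2 * c) ^ j) (hvec 0 l)) (set l)"
proof (induction j l rule: A0m.G.induct)
  case (1 j)
  then show ?case by (simp add: A0_hull_def hvec_def env_one_def vs_def tens_def fun_eq_iff)
next
  case (2 j p)
  then have "j = 0" by simp
  then show ?case
    by (auto simp: A0_hull_def A0_ev_simps hvec_def A0_rep_def vs_def tens_def fun_eq_iff monom_0 one_pCons zero_prod_def)
next
  case (3 j p q l)
  have IH: "A0_hull c (A0m.G (j - 1) l) = tm (vs ((2 * c) ^ (j - 1)) (hvec 0 l)) (set l)"
    using 3 by simp
  have pq: "p < q" "\<And>t. t \<in> set l \<Longrightarrow> q < t" using 3(2,3) by (auto simp: order_less_le)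
  have s: "grassmann_sign {p, q} (set l) = (1 :: 'a)"
    by (rule grassmann_sign_increasing) (use pq in force)
  have d: "{p, q} \<inter> set l = {}" using 3(3) by auto
  have "A0_hull c (A0m.G j (p # q # l))
    = tm (if 0 < j then [:2 * c:] else 1, 0) {p, q} \<otimes>\<^bsub>EnvM\<^esub> tm (vs ((2 * c) ^ (j - 1)) (hvec 0 l)) (set l)"
    by (simp only: A0m.G.simps A0_hull_L A0_ev_lt[OF pq(1)] IH)
  also have "\<dots> = tm (vm mu_m11 (if 0 < j then [:2 * c:] else 1, 0) (vs ((2 * c) ^ (j - 1)) (hvec 0 l))) ({p, q} \<union> set l)"
    using d by (simp add: tm_mult s del: m11.vm_simps)
  also have "vm mu_m11 (if 0 < j then [:2 * c:] else 1, 0) (vs ((2 * c) ^ (j - 1)) (hvec 0 l))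
    = vs ((2 * c) ^ j) (hvec 0 (p # q # l))"
    by (cases j) (simp_all add: vm_def vs_def hvec_def)
  finally show ?case by simp
qed

text \<open>Each z contributes ct and each associator letter the constant 2c, so the degree in t
  sees only i, while the power of c records i + j.\<close>

lemma A0_hull_M:
  assumes "sorted l" "distinct l" "2 * j \<le> length l"
  shows "A0_hull c (A0m.M i j l) = tm (vs (2 ^ j * c ^ (i + j)) (hvec i l)) (set l)"
proof (induction i)
  case 0
  show ?case using A0_hull_G[OF assms, of c] by (simp add: A0m.M_def power_mult_distrib)
next
  case (Suc i)
  have m: "[:0, c:] * monom 1 i = Polynomial.smult c (monom 1 (Suc i))"
    by (simp add: monom_Suc)
  have "A0_hull c (A0m.M (Suc i) j l) = A0_rep c Z \<otimes>\<^bsub>EnvM\<^esub> A0_hull c (A0m.M i j l)"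
    by (simp add: A0m.M_def A0_hull_L A0_ev_simps)
  also have "\<dots> = tm (vm mu_m11 ([:0, c:], 0) (vs (2 ^ j * c ^ (i + j)) (hvec i l))) (set l)"
    unfolding Suc by (simp add: A0_rep_def tm_mult)
  also have "vm mu_m11 ([:0, c:], 0) (vs (2 ^ j * c ^ (i + j)) (hvec i l)) = vs (2 ^ j * c ^ (Suc i + j)) (hvec (Suc i) l)"
    using m by (simp add: vm_def vs_def hvec_def m11.mu_zero mult_ac del: mult_pCons_left)
  finally show ?case .
qed

definition env_coeff :: "nat \<Rightarrow> nat set \<Rightarrow> (nat set \<Rightarrow> 'k::field_char_0 poly \<times> 'k poly) \<Rightarrow> 'k" where
  "env_coeff i S u = coeff (if even (card S) then fst (u S) else snd (u S)) i"

lemma A0_hull_nf: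
  assumes "t \<in> A0m.nf_index" "t = (i', j', S')"
  shows "env_coeff i S (A0_hull c (A0m.nf t)) = (if i' = i \<and> S' = S then 2 ^ j' * c ^ (i' + j') else 0)"
proof -
  have S: "finite S'" "2 * j' \<le> card S'" using assms by (auto simp: A0m.nf_index_def)
  then have "A0_hull c (A0m.nf t) = tm (vs (2 ^ j' * c ^ (i' + j')) (hvec i' (sorted_list_of_set S'))) S'"
    using A0_hull_M[of "sorted_list_of_set S'" j' c i'] assms by (simp add: A0m.nf_def)
  then show ?thesis using S by (auto simp: env_coeff_def tens_def hvec_def vs_def)
qed

lemma A0_hull_linear:
  "A0_hull c (v + w) S = A0_hull c v S + A0_hull c w S" "A0_hull c (A0m.scv d v) S = vs d (A0_hull c v S)"
  by (simp_all add: A0_hull_def A0_ev_simps A0m.scv_def add_ac)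

lemma env_coeff_linear:
  "env_coeff i S (\<lambda>S. f S + g S) = env_coeff i S f + env_coeff i S g"
  "env_coeff i S (\<lambda>S. vs d (f S)) = d * env_coeff i S f"
  by (simp_all add: env_coeff_def vs_def)

lemma hull_coeff_sum:
  "env_coeff i S (A0_hull c (\<Sum>t\<in>T. A0m.scv (d t) (f t))) = (\<Sum>t\<in>T. d t * env_coeff i S (A0_hull c (f t)))"
proof (induction T rule: infinite_finite_induct)
  have "env_coeff i S (A0_hull c (A0m.scv 0 0)) = 0"
  proof -
    have "A0_hull c (A0m.scv 0 0) S = 0" by (simp add: A0_hull_linear)
    then show ?thesis by (simp add: env_coeff_def)
  qed
  then show "env_coeff i S (A0_hull c (\<Sum>t\<in>{}. A0m.scv (d t) (f t))) = (\<Sum>t\<in>{}. d t * env_coeff i S (A0_hull c (f t)))"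
    by (simp add: A0m.scv_simps)
  then show "infinite T \<Longrightarrow> env_coeff i S (A0_hull c (\<Sum>t\<in>T. A0m.scv (d t) (f t))) = (\<Sum>t\<in>T. d t * env_coeff i S (A0_hull c (f t)))" for T
    by simp
next
  case (insert t T)
  have "A0_hull c (A0m.scv (d t) (f t) + (\<Sum>t\<in>T. A0m.scv (d t) (f t)))
    = (\<lambda>S. vs (d t) (A0_hull c (f t) S) + A0_hull c (\<Sum>t\<in>T. A0m.scv (d t) (f t)) S)"
    by (rule ext) (simp only: A0_hull_linear)
  then show ?case using insert by (simp add: env_coeff_linear)
qed

lemma napoly_in_MS: "p \<in> A0m.MS"
proof (rule free_algebra_generated[of p UNIV])
  fix x show "gen x \<in> A0m.MS"
  proof (cases x)
    case Z
    then show ?thesis by (auto simp: A0m.letters_A0_def intro!: A0m.mono_span.even A0m.even_mono.intros)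
  next
    case (E i)
    then show ?thesis by (auto intro!: A0m.mono_span.odd A0m.odd_mono.intros)
  qed
  show "0 \<in> A0m.MS" by (rule A0m.mono_span.ideal) (use A0h.hom_zero in simp)
qed (auto intro: A0m.mono_span.add A0m.mono_span.sc A0m.MS_mult)

text \<open>The coefficient of t^i at the index set S is a polynomial in c whose terms have
  exponents i + j, distinct for distinct j. Vanishing for every c therefore kills all coefficients
  of the normal form.\<close>

lemma A0_separation:
  assumes z: "\<And>c. A0_ev c p = \<zero>\<^bsub>EnvM\<^esub>" shows "A0_proj p = \<zero>\<^bsub>A0\<^esub>"
proof -
  obtain T d where T: "finite T" "T \<subseteq> A0m.nf_index" and KK: "(0, p) - (\<Sum>t\<in>T. A0m.scv (d t) (A0m.nf t)) \<in> A0m.KK"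
    using A0m.span_nf[OF napoly_in_MS] by blast
  \<comment> \<open>The evaluation factors through \<open>A0\<close>, so an element and its normal
    form, which agree modulo \<open>KK\<close>, have the same value.\<close>
  have kill: "A0_hull c v = (\<lambda>S. 0)" if "v \<in> A0m.KK" for c v
  proof -
    obtain h where h: "h \<in> alg_hom A0 EnvM" "\<And>p. h (A0_proj p) = A0_ev c p"
      using A0_rep_hom[where c = c] by blast
    interpret h: nonassoc_hom A0 EnvM h
      by (intro nonassoc_homI A0.nonassoc_algebra_axioms m11.nonassoc_algebra_env h)
    have "A0_ev c (snd v) = \<zero>\<^bsub>EnvM\<^esub>" using that h(2)[of "snd v"] h.hom_zero by (simp add: A0m.KK_def)
    then show ?thesis using that by (simp add: A0m.KK_def A0_hull_def)
  qed
  have zero: "(\<Sum>t\<in>T. d t * env_coeff i S (A0_hull c (A0m.nf t))) = 0" for i S c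
  proof -
    let ?s = "\<Sum>t\<in>T. A0m.scv (d t) (A0m.nf t)"
    have "A0_hull c (0, p) U = A0_hull c ((0, p) - ?s) U + A0_hull c ?s U" for U
      using A0_hull_linear(1)[of c "(0, p) - ?s" ?s U] by simp
    then have "A0_hull c ?s = (\<lambda>S. 0)" using kill[OF KK] z[of c] by (simp add: A0_hull_def fun_eq_iff)
    then have "env_coeff i S (A0_hull c ?s) = 0" by (simp add: env_coeff_def)
    then show ?thesis by (simp add: hull_coeff_sum)
  qed
  have "d t = 0" if t: "t \<in> T" for t
  proof -
    obtain i j S where ijs: "t = (i, j, S)" by (cases t)
    let ?T = "{t \<in> T. fst t = i \<and> snd (snd t) = S}"
    have "d t * 2 ^ fst (snd t) = 0"
    proof (rule vandermonde_zero[of ?T "\<lambda>t. fst t + fst (snd t)" "\<lambda>t. d t * 2 ^ fst (snd t)" t])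
      fix x :: 'a
      have "0 = (\<Sum>t\<in>T. d t * env_coeff i S (A0_hull x (A0m.nf t)))" by (simp add: zero)
      also have "\<dots> = (\<Sum>t\<in>?T. d t * 2 ^ fst (snd t) * x ^ (fst t + fst (snd t)))"
      proof (rule sum.mono_neutral_cong_right)
        show "\<forall>t\<in>T - ?T. d t * env_coeff i S (A0_hull x (A0m.nf t)) = 0"
        proof
          fix t assume t: "t \<in> T - ?T"
          then have tn: "t \<in> A0m.nf_index" and k: "\<not> (fst t = i \<and> snd (snd t) = S)" using T(2) by auto
          have tt: "t = (fst t, fst (snd t), snd (snd t))" by simp
          have "env_coeff i S (A0_hull x (A0m.nf t)) = 0"
            using A0_hull_nf[OF tn tt, of i S x] unfolding if_not_P[OF k] .
          then show "d t * env_coeff i S (A0_hull x (A0m.nf t)) = 0" by simp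
        qed
        show "d t * env_coeff i S (A0_hull x (A0m.nf t)) = d t * 2 ^ fst (snd t) * x ^ (fst t + fst (snd t))"
          if "t \<in> ?T" for t
        proof -
          have tn: "t \<in> A0m.nf_index" and k: "fst t = i \<and> snd (snd t) = S" using that T(2) by blast+
          have tt: "t = (fst t, fst (snd t), snd (snd t))" by simp
          have "env_coeff i S (A0_hull x (A0m.nf t)) = 2 ^ fst (snd t) * x ^ (fst t + fst (snd t))"
            using A0_hull_nf[OF tn tt, of i S x] unfolding if_P[OF k] .
          then show ?thesis by (simp add: mult.assoc)
        qed
      qed (use T in auto)
      finally show "(\<Sum>t\<in>?T. d t * 2 ^ fst (snd t) * x ^ (fst t + fst (snd t))) = 0" by simp
    qed (use T t ijs in \<open>auto simp: inj_on_def\<close>)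
    then show ?thesis by simp
  qed
  then have "(\<Sum>t\<in>T. A0m.scv (d t) (A0m.nf t)) = 0" by (intro sum.neutral) (simp add: A0m.scv_simps)
  then show ?thesis using KK by (simp add: A0m.KK_def)
qed

subsection \<open>The image of \<open>A\<^sub>0\<close>\<close>

text \<open>Powers of z give all multiples of t at the empty set, and products of the e_i give xi_S
  for nonempty S. Over such S a polynomial splits into its constant term and a multiple of t, both
  of which are reached; only constants at the empty set are not covered.\<close>

lemma A0_image:
  assumes h: "h \<in> alg_hom A0 EnvM" "\<And>p. h (A0_proj p) = A0_ev 1 p"
    and u: "u \<in> carrier EnvM" "coeff (fst (u {})) 0 = (0 :: 'k::field_char_0)"
  shows "u \<in> h ` carrier A0"
proof -
  let ?I = "h ` carrier A0"
  have I: "?I = range (A0_ev 1)" by (simp add: A0_carrier image_image h(2))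
  have add: "f \<oplus>\<^bsub>EnvM\<^esub> g \<in> ?I" and mult: "f \<otimes>\<^bsub>EnvM\<^esub> g \<in> ?I" if "f \<in> ?I" "g \<in> ?I" for f g
  proof -
    from that obtain p q where "f = A0_ev 1 p" "g = A0_ev 1 q" unfolding I by blast
    then have "f \<oplus>\<^bsub>EnvM\<^esub> g = A0_ev 1 (p + q)" "f \<otimes>\<^bsub>EnvM\<^esub> g = A0_ev 1 (napoly_mult p q)"
      by (simp_all add: A0_ev_simps)
    then show "f \<oplus>\<^bsub>EnvM\<^esub> g \<in> ?I" "f \<otimes>\<^bsub>EnvM\<^esub> g \<in> ?I" unfolding I by blast+
  qed
  have smult: "c \<odot>\<^bsub>EnvM\<^esub> f \<in> ?I" if "f \<in> ?I" for f c
  proof -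
    from that obtain p where "f = A0_ev 1 p" unfolding I by blast
    then have "c \<odot>\<^bsub>EnvM\<^esub> f = A0_ev 1 (napoly_smult c p)" by (simp add: A0_ev_simps)
    then show ?thesis unfolding I by blast
  qed
  have zero: "(\<lambda>S. 0) \<in> ?I"
  proof -
    have "A0_ev (1 :: 'k) 0 = (\<lambda>S. 0)" by simp
    then show ?thesis unfolding I by (rule range_eqI[OF sym])
  qed
  have gens: "A0_rep 1 x \<in> ?I" for x
  proof -
    have "A0_rep 1 x = A0_ev (1 :: 'k) (gen x)" by (simp add: A0_ev_simps)
    then show ?thesis unfolding I by (rule range_eqI)
  qed
  have tadd: "tm (a + b) S = tm a S \<oplus>\<^bsub>EnvM\<^esub> tm b S" for a b :: "'k poly \<times> 'k poly" and S
    by (auto simp: tens_def)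
  have tsc: "tm (vs c a) S = c \<odot>\<^bsub>EnvM\<^esub> tm a S" for a :: "'k poly \<times> 'k poly" and S c
    by (auto simp: tens_def)
  have even0: "tm ([:0, 1:] * q, 0) {} \<in> ?I" for q :: "'k poly"
  proof (induction q)
    case 0
    have "tm (0, 0) {} = (\<lambda>S. (0, 0) :: 'k poly \<times> 'k poly)" by (auto simp: tens_def zero_prod_def)
    then show ?case using zero by (simp add: zero_prod_def)
  next
    case (pCons a q)
    have "([:0, 1:] * pCons a q, 0) = vs a ([:0, 1:], 0) + vm mu_m11 ([:0, 1:], 0) ([:0, 1:] * q, 0)"
      by (simp add: vs_def vm_def)
    then have "tm ([:0, 1:] * pCons a q, 0) {} = a \<odot>\<^bsub>EnvM\<^esub> A0_rep 1 Z
      \<oplus>\<^bsub>EnvM\<^esub> A0_rep 1 Z \<otimes>\<^bsub>EnvM\<^esub> tm ([:0, 1:] * q, 0) {}"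
      by (simp only: tadd tsc) (simp add: A0_rep_def tm_mult)
    then show ?case using add smult mult gens pCons.IH by metis
  qed
  have xi: "tm (if even (card S) then (1, 0) else (0, 1)) S \<in> ?I" if "finite S" "S \<noteq> {}" for S
    using that
  proof (induction S rule: finite_ne_induct)
    case (singleton i)
    then show ?case using gens[of "E i"] by (simp add: A0_rep_def)
  next
    case (insert i S)
    let ?a = "\<lambda>S. if even (card S) then (1, 0) else (0, 1 :: 'k poly)"
    \<comment> \<open>The sign is its own inverse, so scaling by it removes it.\<close>
    define s where "s = (grassmann_sign S {i} :: 'k)"
    have s: "s * s = 1" by (simp add: s_def grassmann_sign_def flip: power_mult_distrib)
    have "tm (?a S) S \<otimes>\<^bsub>EnvM\<^esub> A0_rep 1 (E i) = tm (vs s (?a (insert i S))) (insert i S)"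
      using insert by (simp add: A0_rep_def tm_mult vm_def s_def mu_m11_def pderiv_1)
    then have "tm (vs s (?a (insert i S))) (insert i S) \<in> ?I" using mult[OF insert.IH gens] by metis
    from smult[OF this, of s] show ?case
      unfolding tsc[symmetric] vs_simps(3) s vs_simps(4) .
  qed
  have simple: "tm a S \<in> ?I"
    if S: "finite S" and a: "if even (card S) then snd a = 0 else fst a = 0" and a0: "S = {} \<Longrightarrow> coeff (fst a) 0 = 0"
    for a :: "'k poly \<times> 'k poly" and S
  proof -
    define p where "p = (if even (card S) then fst a else snd a)"
    have ap: "a = (if even (card S) then (p, 0) else (0, p))" using a by (auto simp: p_def prod_eq_iff)
    obtain b q where p: "p = pCons b q" by (cases p)
    show ?thesis
    proof (cases "S = {}")
      case True
      then have "a = ([:0, 1:] * q, 0)" using ap a0 p by simp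
      then show ?thesis using True even0 by simp
    next
      case False
      let ?x = "if even (card S) then (1, 0) else (0, 1 :: 'k poly)"
      have "a = vs b ?x + vm mu_m11 ([:0, 1:] * q, 0) ?x"
        by (simp add: ap p vs_def vm_def one_pCons)
      then have "tm a S = b \<odot>\<^bsub>EnvM\<^esub> tm ?x S \<oplus>\<^bsub>EnvM\<^esub> tm ([:0, 1:] * q, 0) {} \<otimes>\<^bsub>EnvM\<^esub> tm ?x S"
        using S by (simp only: tadd tsc) (simp add: tm_mult)
      then show ?thesis using add smult mult even0 xi[OF S False] by metis
    qed
  qed
  have "u \<in> ?I" if "finite W" "{S. u S \<noteq> 0} \<subseteq> W" "u \<in> carrier EnvM" "coeff (fst (u {})) 0 = 0" for W u
    using that
  proof (induction W arbitrary: u)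
    case empty
    then have "u = (\<lambda>S. 0)" by auto
    then show ?case using zero by simp
  next
    case (insert S W)
    define u' where "u' = u(S := 0)"
    have "{T. u' T \<noteq> 0} \<subseteq> W" using insert.prems by (auto simp: u'_def)
    moreover have "u' \<in> carrier EnvM"
      using insert.prems(2) finite_subset[OF \<open>{T. u' T \<noteq> 0} \<subseteq> W\<close> insert.hyps(1)]
      unfolding m11.vector_env_carrier by (auto simp: u'_def)
    moreover have "coeff (fst (u' {})) 0 = 0" using insert.prems by (simp add: u'_def)
    ultimately have u': "u' \<in> ?I" by (rule insert.IH)
    have u: "u = u' \<oplus>\<^bsub>EnvM\<^esub> tm (u S) S" by (auto simp: u'_def tens_def)
    show ?case
    proof (cases "finite S")
      case True
      have "tm (u S) S \<in> ?I"
        by (rule simple) (use True insert.prems in \<open>auto simp: m11.vector_env_carrier\<close>)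
      then show ?thesis using u add u' by metis
    next
      case False
      then have "u = u'" using insert.prems(2) by (auto simp: u'_def m11.vector_env_carrier)
      then show ?thesis using u' by simp
    qed
  qed
  then show ?thesis using u by (auto simp: m11.vector_env_carrier)
qed

section \<open>Identities of Jordan algebras\<close>

definition jordan_Z :: "('k::field, 'a, 'm) module_scheme \<Rightarrow> 'a set" where
  "jordan_Z B = {c \<in> carrier B. \<forall>a\<in>carrier B. \<forall>b\<in>carrier B.
     associator B c a b \<oplus>\<^bsub>B\<^esub> associator B c b a = \<zero>\<^bsub>B\<^esub>}"

lemma jordan_Z_properties:
  fixes B :: "('k::field_char_0, 'a, 'm) module_scheme"
  assumes J: "jordan_algebra B" and c: "c \<in> jordan_Z B" and d: "d \<in> jordan_Z B"
    and a: "a \<in> carrier B" and b: "b \<in> carrier B"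
  shows "associator B c d a = \<zero>\<^bsub>B\<^esub>" "c \<otimes>\<^bsub>B\<^esub> d \<in> jordan_Z B"
    "associator B c (d \<otimes>\<^bsub>B\<^esub> a) b = d \<otimes>\<^bsub>B\<^esub> associator B c a b" "associator B c a b \<in> jordan_Z B"
proof -
  interpret B: nonassoc_algebra B using J by (simp add: jordan_algebra_def)
  have comm: "x \<otimes>\<^bsub>B\<^esub> y = y \<otimes>\<^bsub>B\<^esub> x" if "x \<in> carrier B" "y \<in> carrier B" for x y
    using J that by (simp add: jordan_algebra_def)
  obtain h :: "('a, 'k) napoly \<Rightarrow> 'a" where h: "h \<in> alg_hom (free_algebra UNIV) B"
    and hg: "\<And>a. a \<in> carrier B \<Longrightarrow> h (gen a) = a" using B.eval_carrier_surj by blast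
  interpret h: nonassoc_hom "free_algebra UNIV" B h
    by (intro nonassoc_homI nonassoc_algebra_free B.nonassoc_algebra_axioms h)
  define K where "K = {p. h p = \<zero>\<^bsub>B\<^esub>}"
  interpret N: nalg_mod napoly_mult K
    unfolding K_def by (rule kernel_nalg_mod[OF B.nonassoc_algebra_axioms h])
  \<comment> \<open>\<open>jordan_mod\<close> asks for exact commutativity, which the free algebra
    lacks. Its symmetrized product is commutative, and it maps to the product of \<open>B\<close>
    because \<open>B\<close> is commutative.\<close>
  define m where "m p q = napoly_smult (1/2) (napoly_mult p q + napoly_mult q p)" for p q :: "('a, 'k) napoly"
  have hc [simp]: "h p \<in> carrier B" for p using h.hom_closed[of p] by simp
  have hm: "h (m p q) = h p \<otimes>\<^bsub>B\<^esub> h q" for p q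
  proof -
    have "h (m p q) = (1/2) \<odot>\<^bsub>B\<^esub> (h p \<otimes>\<^bsub>B\<^esub> h q \<oplus>\<^bsub>B\<^esub> h q \<otimes>\<^bsub>B\<^esub> h p)"
      using h.hom_smult[of "napoly_mult p q + napoly_mult q p" "1/2"] h.hom_mult[of p q] h.hom_mult[of q p]
        h.hom_add[of "napoly_mult p q" "napoly_mult q p"] by (simp add: m_def)
    also have "h q \<otimes>\<^bsub>B\<^esub> h p = h p \<otimes>\<^bsub>B\<^esub> h q" by (rule comm) simp_all
    also have "(1/2) \<odot>\<^bsub>B\<^esub> (h p \<otimes>\<^bsub>B\<^esub> h q \<oplus>\<^bsub>B\<^esub> h p \<otimes>\<^bsub>B\<^esub> h q) = (1/2 + 1/2) \<odot>\<^bsub>B\<^esub> (h p \<otimes>\<^bsub>B\<^esub> h q)"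
      by (simp only: B.smult_add_right B.smult_add_left B.mult_closed hc)
    finally show ?thesis by simp
  qed
  have ha: "h (p + q) = h p \<oplus>\<^bsub>B\<^esub> h q" "h (p - q) = h p \<ominus>\<^bsub>B\<^esub> h q" for p q
    using h.hom_add[of p q] h.hom_minus[of p q] by simp_all
  interpret M: nalg_mod m K
  proof unfold_locales
    fix x y z :: "('a, 'k) napoly"
    show "m (x + y) z = m x z + m y z" "m z (x + y) = m z x + m z y"
      by (simp_all add: m_def napoly_mult_add_left napoly_mult_add_right napoly_smult_add algebra_simps)
    show "m x y \<in> K" "m y x \<in> K" if "x \<in> K" using that by (simp_all add: K_def hm)
  qed (fact N.K_zero N.K_add N.K_uminus N.K_div2 N.K_div3 N.K_div5)+
  have has: "h (M.as x y z) = associator B (h x) (h y) (h z)" for x y z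
    by (simp add: M.as_def associator_def ha hm)
  interpret M: jordan_mod m K
  proof unfold_locales
    fix x y :: "('a, 'k) napoly"
    show "m x y = m y x" by (simp add: m_def add.commute)
    show "M.as (m x x) y x \<in> K" using J by (simp add: K_def has hm jordan_algebra_def)
  qed
  have Z: "gen x \<in> M.Zc" if "x \<in> jordan_Z B" for x
    using that unfolding M.Zc_def by (auto simp: K_def ha has jordan_Z_def hg)
  have Z': "h p \<in> jordan_Z B" if p: "p \<in> M.Zc" for p
    unfolding jordan_Z_def
  proof (intro CollectI conjI ballI)
    fix a b assume ab: "a \<in> carrier B" "b \<in> carrier B"
    have "M.as p (gen a) (gen b) + M.as p (gen b) (gen a) \<in> K" using p by (rule M.ZD)
    then show "associator B (h p) a b \<oplus>\<^bsub>B\<^esub> associator B (h p) b a = \<zero>\<^bsub>B\<^esub>"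
      using ab by (simp add: K_def ha has hg)
  qed simp
  have cd: "c \<in> carrier B" "d \<in> carrier B" using c d by (simp_all add: jordan_Z_def)
  show "associator B c d a = \<zero>\<^bsub>B\<^esub>"
    using M.Z_assoc(1)[OF Z[OF c] Z[OF d], of "gen a"] cd a by (simp add: K_def has hg)
  show "c \<otimes>\<^bsub>B\<^esub> d \<in> jordan_Z B"
    using Z'[OF M.Z_mult[OF Z[OF c] Z[OF d]]] cd by (simp add: hm hg)
  show "associator B c a b \<in> jordan_Z B"
    using Z'[OF M.Z_as[OF Z[OF c], of "gen a" "gen b"]] cd a b by (simp add: has hg)
  show "associator B c (d \<otimes>\<^bsub>B\<^esub> a) b = d \<otimes>\<^bsub>B\<^esub> associator B c a b"
    using M.Z_pull[OF Z[OF c] Z[OF d], of "gen a" "gen b"] cd a b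
    by (simp add: K_def has hg hm ha B.minus_eq_zero_iff)
qed

section \<open>Free Jordan superalgebras\<close>

lemma free_superalgebra_simps [simp]:
  "carrier free_superalgebra = UNIV" "\<zero>\<^bsub>free_superalgebra\<^esub> = 0"
  "p \<oplus>\<^bsub>free_superalgebra\<^esub> q = p + q" "p \<otimes>\<^bsub>free_superalgebra\<^esub> q = napoly_mult p q"
  "c \<odot>\<^bsub>free_superalgebra\<^esub> p = napoly_smult c p"
  "p \<in> part free_superalgebra i \<longleftrightarrow> (\<forall>w\<in>Poly_Mapping.keys p. word_parity w = i)"
  by (simp_all add: free_superalgebra_def module.defs superalg.defs free_algebra_def)

lemma free_superalgebra_nonassoc:
  "nonassoc_algebra (free_superalgebra :: ('k::field, (super_generator, 'k) napoly) superalg)"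
proof -
  interpret F: nonassoc_algebra "free_algebra UNIV :: ('k, (super_generator, 'k) napoly) module"
    by (rule nonassoc_algebra_free)
  show ?thesis
    by (rule F.nonassoc_algebra_cong) (auto simp: free_superalgebra_def module.defs superalg.defs)
qed

lemma part_free_mult:
  assumes "\<forall>w\<in>Poly_Mapping.keys p. word_parity w = i" "\<forall>w\<in>Poly_Mapping.keys q. word_parity w = j"
  shows "\<forall>w\<in>Poly_Mapping.keys (napoly_mult p q). word_parity w = i + (j :: bit)"
proof
  fix w assume "w \<in> Poly_Mapping.keys (napoly_mult p q)"
  then have "(\<Sum>u\<in>Poly_Mapping.keys p. \<Sum>v\<in>Poly_Mapping.keys q. Poly_Mapping.lookup (Poly_Mapping.single
      (Mul u v) (Poly_Mapping.lookup p u * Poly_Mapping.lookup q v)) w) \<noteq> 0"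
    by (simp add: in_keys_iff napoly_mult_def lookup_sum)
  then obtain u v where "u \<in> Poly_Mapping.keys p" "v \<in> Poly_Mapping.keys q" "w = Mul u v"
    by (metis (no_types, lifting) sum.not_neutral_contains_not_neutral lookup_single_not_eq)
  then show "word_parity w = i + j" using assms by auto
qed

interpretation SF: superalgebra "free_superalgebra :: ('k::field_char_0, (super_generator, 'k) napoly) superalg"
proof (intro superalgebra.intro superalgebra_axioms.intro free_superalgebra_nonassoc)
  let ?F = "free_superalgebra :: ('k, (super_generator, 'k) napoly) superalg"
  interpret F: nonassoc_algebra ?F by (rule free_superalgebra_nonassoc)
  show "submodule (part ?F i) ring_of_type_algebra ?F" for i
    unfolding F.submodule_iff
  proof (intro conjI ballI allI)
    fix p q assume "p \<in> part ?F i" "q \<in> part ?F i"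
    then show "p \<oplus>\<^bsub>?F\<^esub> q \<in> part ?F i" using keys_add[of p q] by auto
  next
    fix c p assume "p \<in> part ?F i"
    then show "c \<odot>\<^bsub>?F\<^esub> p \<in> part ?F i" using keys_napoly_smult[of c p] by auto
  qed simp_all
  have dec: "\<exists>p0 p1. p0 \<in> part ?F 0 \<and> p1 \<in> part ?F 1 \<and> p = p0 + p1" for p :: "(super_generator, 'k) napoly"
  proof (rule napoly_induct[of p UNIV])
    fix w :: "super_generator word" and c :: 'k
    let ?p = "Poly_Mapping.single w c"
    show "\<exists>p0 p1. p0 \<in> part ?F 0 \<and> p1 \<in> part ?F 1 \<and> ?p = p0 + p1"
    proof (cases "word_parity w = 0")
      case True
      then have "?p \<in> part ?F 0 \<and> 0 \<in> part ?F 1 \<and> ?p = ?p + 0" by simp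
      then show ?thesis by blast
    next
      case False
      then have "0 \<in> part ?F 0 \<and> ?p \<in> part ?F 1 \<and> ?p = 0 + ?p" by simp
      then show ?thesis by blast
    qed
  next
    have "0 \<in> part ?F 0 \<and> 0 \<in> part ?F 1 \<and> 0 = 0 + (0 :: (super_generator, 'k) napoly)" by simp
    then show "\<exists>p0 p1. p0 \<in> part ?F 0 \<and> p1 \<in> part ?F 1 \<and> 0 = p0 + p1" by blast
  next
    fix p q assume "\<exists>p0 p1. p0 \<in> part ?F 0 \<and> p1 \<in> part ?F 1 \<and> p = p0 + p1"
      "\<exists>p0 p1. p0 \<in> part ?F 0 \<and> p1 \<in> part ?F 1 \<and> q = p0 + p1"
    then obtain p0 p1 q0 q1 where *: "p0 \<in> part ?F 0" "p1 \<in> part ?F 1" "p = p0 + p1"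
      "q0 \<in> part ?F 0" "q1 \<in> part ?F 1" "q = q0 + q1" by blast
    have "p0 + q0 \<in> part ?F 0" "p1 + q1 \<in> part ?F 1"
      using * keys_add[of p0 q0] keys_add[of p1 q1] by auto
    moreover have "p + q = (p0 + q0) + (p1 + q1)" using * by (simp add: add_ac)
    ultimately show "\<exists>p0 p1. p0 \<in> part ?F 0 \<and> p1 \<in> part ?F 1 \<and> p + q = p0 + p1" by blast
  qed simp
  have "p \<in> part ?F 0 <+>\<^bsub>?F\<^esub> part ?F 1" for p :: "(super_generator, 'k) napoly"
  proof -
    obtain p0 p1 where p: "p0 \<in> part ?F 0" "p1 \<in> part ?F 1" "p = p0 + p1" using dec[of p] by blast
    then have "p = p0 \<oplus>\<^bsub>?F\<^esub> p1" by (simp only: free_superalgebra_simps)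
    then show ?thesis using p(1,2) unfolding set_add_def' by blast
  qed
  then show "carrier ?F = part ?F 0 <+>\<^bsub>?F\<^esub> part ?F 1"
    unfolding free_superalgebra_simps(1) by (rule UNIV_eq_I)
  show "part ?F 0 \<inter> part ?F 1 = {\<zero>\<^bsub>?F\<^esub>}"
  proof (intro equalityI subsetI)
    fix p assume p: "p \<in> part ?F 0 \<inter> part ?F 1"
    have "Poly_Mapping.keys p = {}"
    proof (rule ccontr)
      assume "Poly_Mapping.keys p \<noteq> {}"
      then obtain w where "w \<in> Poly_Mapping.keys p" by blast
      then have "word_parity w = 0" "word_parity w = 1"
        using p unfolding Int_iff free_superalgebra_simps by blast+
      then show False by simp
    qed
    then show "p \<in> {\<zero>\<^bsub>?F\<^esub>}" by (simp only: keys_eq_empty free_superalgebra_simps singleton_iff)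
  qed simp
  fix p q i j assume "p \<in> part ?F i" "q \<in> part ?F j"
  then show "p \<otimes>\<^bsub>?F\<^esub> q \<in> part ?F (i + j)"
    unfolding free_superalgebra_simps by (rule part_free_mult)
qed

section \<open>Kernels and intersections of ideals with Jordan quotients\<close>

context super_quotient begin

lemma graded_iff:
  "graded_set A I \<longleftrightarrow> (\<forall>x0\<in>part A 0. \<forall>x1\<in>part A 1. x0 \<oplus> x1 \<in> I \<longrightarrow> x0 \<in> I)"
proof (intro iffI ballI impI)
  fix x0 x1 assume gr: "graded_set A I" and x: "x0 \<in> part A 0" "x1 \<in> part A 1" "x0 \<oplus> x1 \<in> I"
  then obtain y0 y1 where y: "y0 \<in> I" "y0 \<in> part A 0" "y1 \<in> part A 1" "x0 \<oplus> x1 = y0 \<oplus> y1"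
    unfolding graded_set_def by blast
  have cc: "x0 \<in> carrier A" "x1 \<in> carrier A" "y0 \<in> carrier A" "y1 \<in> carrier A"
    using x y part_closed by auto
  have "(x0 \<ominus> y0) = (y1 \<ominus> x1)"
  proof -
    have "x0 = (x0 \<oplus> x1) \<oplus> \<ominus> x1" using cc by (simp add: M.a_assoc M.r_neg)
    also have "\<dots> = y0 \<oplus> (y1 \<oplus> \<ominus> x1)" unfolding y(4) using cc by (simp add: M.a_assoc)
    finally have "x0 \<ominus> y0 = (y0 \<oplus> (y1 \<oplus> \<ominus> x1)) \<oplus> \<ominus> y0" unfolding a_minus_def by simp
    also have "\<dots> = \<ominus> y0 \<oplus> (y0 \<oplus> (y1 \<oplus> \<ominus> x1))" by (rule M.a_comm) (simp_all add: cc)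
    also have "\<dots> = y1 \<oplus> \<ominus> x1" by (rule M.r_neg1) (simp_all add: cc)
    finally show ?thesis unfolding a_minus_def .
  qed
  then have "x0 \<ominus> y0 \<in> part A 1" using x y by (simp add: part_minus)
  moreover have "x0 \<ominus> y0 \<in> part A 0" using x y by (simp add: part_minus)
  ultimately have "x0 \<ominus> y0 = \<zero>" using part_both by blast
  then have "x0 = y0" by (rule minus_eq_zero_iff[THEN iffD1, OF cc(1,3)])
  then show "x0 \<in> I" using y by simp
next
  assume *: "\<forall>x0\<in>part A 0. \<forall>x1\<in>part A 1. x0 \<oplus> x1 \<in> I \<longrightarrow> x0 \<in> I"
  show "graded_set A I"
    unfolding graded_set_def
  proof
    fix x assume x: "x \<in> I"
    obtain x0 x1 where d: "x0 \<in> part A 0" "x1 \<in> part A 1" "x = x0 \<oplus> x1"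
      using part_decomp[OF I_simps(1)[OF x]] .
    then have x0: "x0 \<in> I" using * x by blast
    have "x \<oplus> \<ominus> x0 = x1"
      unfolding d(3) using part_closed[OF d(1)] part_closed[OF d(2)]
      by (simp add: M.a_assoc M.a_comm[of x1] M.r_neg1 M.r_neg2)
    then have "x1 \<in> I" using I_simps(3)[OF x I_simps(4)[OF x0, of "- 1"]] uminus_eq_smult[OF I_simps(1)[OF x0]] by simp
    then show "\<exists>x0\<in>I \<inter> part A 0. \<exists>x1\<in>I \<inter> part A 1. x = x0 \<oplus> x1" using d x0 by blast
  qed
qed

lemma graded_of_superalgebra:
  assumes "superalgebra (super_quot A I)" shows "graded_set A I"
  unfolding graded_iff
proof (intro ballI impI)
  interpret Q: superalgebra "super_quot A I" by fact
  fix x0 x1 assume x: "x0 \<in> part A 0" "x1 \<in> part A 1" "x0 \<oplus> x1 \<in> I"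
  note c = part_closed[OF x(1)] part_closed[OF x(2)]
  have "I +> x0 = I +> (\<ominus> x1)" using x c by (subst coset_eq_iff) (simp_all add: a_minus_def)
  then have "I +> x0 \<in> part (super_quot A I) 1" using x by (simp add: part_uminus)
  moreover have "I +> x0 \<in> part (super_quot A I) 0" using x by simp
  ultimately have "I +> x0 = I" using Q.part_both[of "I +> x0"] by simp
  then show "x0 \<in> I" using c coset_zero_iff by simp
qed

end

text \<open>The quotient by the kernel embeds into \<open>B\<close>, and so do the envelopes. For
  the free superalgebra this places kernels of maps to Jordan superalgebras among the ideals
  intersected in \<open>jordan_super_ideal\<close>.\<close>

lemma super_hom_kernel:
  assumes h: "super_hom A B h" and B: "jordan_superalgebra B"
  defines "I \<equiv> {x \<in> carrier A. h x = \<zero>\<^bsub>B\<^esub>}"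
  shows "alg_ideal I A" "jordan_superalgebra (super_quot A I)"
proof -
  interpret h: super_hom A B h by fact
  show I: "alg_ideal I A" unfolding I_def by (rule h.kernel_ideal)
  interpret Q: super_quotient A I by unfold_locales (rule I)
  have gr: "graded_set A I"
    unfolding Q.graded_iff
  proof (intro ballI impI)
    fix x0 x1 assume x: "x0 \<in> part A 0" "x1 \<in> part A 1" "x0 \<oplus>\<^bsub>A\<^esub> x1 \<in> I"
    note c = h.A.part_closed[OF x(1)] h.A.part_closed[OF x(2)]
    have "h (x0 \<oplus>\<^bsub>A\<^esub> x1) = \<zero>\<^bsub>B\<^esub>" using x(3) unfolding I_def by blast
    then have "h x0 \<oplus>\<^bsub>B\<^esub> h x1 = \<zero>\<^bsub>B\<^esub>" unfolding h.hom_add[OF c] .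
    then have "h x0 = \<ominus>\<^bsub>B\<^esub> h x1"
      by (rule h.B.M.minus_equality[OF _ h.hom_closed[OF c(2)] h.hom_closed[OF c(1)], symmetric])
    then have "h x0 \<in> part B 1" using h.B.part_uminus[OF h.hom_part[OF x(2)]] by simp
    then have "h x0 = \<zero>\<^bsub>B\<^esub>" by (rule h.B.part_both[OF h.hom_part[OF x(1)]])
    then show "x0 \<in> I" unfolding I_def using c by blast
  qed
  obtain g where g: "super_hom (super_quot A I) B g" "\<And>x. x \<in> carrier A \<Longrightarrow> g (I +>\<^bsub>A\<^esub> x) = h x"
  proof -
    have hI: "h x = \<zero>\<^bsub>B\<^esub>" if "x \<in> I" for x using that unfolding I_def by blast
    show thesis by (rule Q.super_quot_lift[OF gr h hI]) (assumption, rule that)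
  qed
  interpret g: super_hom "super_quot A I" B g by fact
  have "inj_on g (carrier (super_quot A I))"
  proof (rule inj_onI)
    fix x y assume xy: "x \<in> carrier (super_quot A I)" "y \<in> carrier (super_quot A I)" "g x = g y"
    then obtain a b where ab: "a \<in> carrier A" "b \<in> carrier A" "x = I +>\<^bsub>A\<^esub> a" "y = I +>\<^bsub>A\<^esub> b"
      by auto
    then have "h a = h b" using xy(3) g(2)[OF ab(1)] g(2)[OF ab(2)] by simp
    then have "h (a \<ominus>\<^bsub>A\<^esub> b) = \<zero>\<^bsub>B\<^esub>" using ab h.hom_eq_iff[of a b] by blast
    then have "a \<ominus>\<^bsub>A\<^esub> b \<in> I" unfolding I_def using h.A.M.minus_closed[OF ab(1,2)] by blast
    then show "x = y" using Q.coset_eq_iff[OF ab(1,2)] unfolding ab(3,4) by blast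
  qed
  then show "jordan_superalgebra (super_quot A I)"
    unfolding jordan_superalgebra_def
    using g.env.jordan_inj[OF _ g.env_inj] B g.A.superalgebra_axioms unfolding jordan_superalgebra_def by blast
qed

text \<open>The quotient by the intersection is a subdirect product of Jordan quotients: an element
  of its envelope is zero once all homomorphisms to Jordan superalgebras kill it. This makes
  \<open>Jord\<close> itself a Jordan superalgebra.\<close>

lemma jordan_super_quot_Inter:
  fixes A :: "('k::field_char_0, 'a, 'm) superalg_scheme"
  assumes A: "superalgebra A" and ne: "\<I> \<noteq> {}"
    and I: "\<And>I. I \<in> \<I> \<Longrightarrow> alg_ideal I A \<and> jordan_superalgebra (super_quot A I)"
  shows "alg_ideal (\<Inter>\<I>) A" "graded_set A (\<Inter>\<I>)" "jordan_superalgebra (super_quot A (\<Inter>\<I>))"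
proof -
  interpret A: superalgebra A by fact
  show id: "alg_ideal (\<Inter>\<I>) A" by (rule A.alg_ideal_Inter) (use I ne in auto)
  interpret Q: super_quotient A "\<Inter>\<I>" by unfold_locales (rule id)
  have QI: "super_quotient A I" if "I \<in> \<I>" for I by unfold_locales (rule I[OF that, THEN conjunct1])
  have grI: "graded_set A I" if "I \<in> \<I>" for I
    using super_quotient.graded_of_superalgebra[OF QI[OF that]] I[OF that, THEN conjunct2]
    unfolding jordan_superalgebra_def by blast
  show gr: "graded_set A (\<Inter>\<I>)"
    unfolding Q.graded_iff
  proof (intro ballI impI InterI)
    fix x0 x1 I assume x: "x0 \<in> part A 0" "x1 \<in> part A 1" "x0 \<oplus>\<^bsub>A\<^esub> x1 \<in> \<Inter>\<I>" and I': "I \<in> \<I>"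
    have "x0 \<oplus>\<^bsub>A\<^esub> x1 \<in> I" using x(3) I' by (rule InterD)
    with x(1,2) show "x0 \<in> I"
      using grI[OF I', unfolded super_quotient.graded_iff[OF QI[OF I']]] by blast
  qed
  interpret S: superalgebra "super_quot A (\<Inter>\<I>)" by (rule Q.super_quot_superalgebra[OF gr])
  let ?G = "grassmann_envelope (super_quot A (\<Inter>\<I>))"
  have zero: "v = \<zero>\<^bsub>?G\<^esub>" if v: "v \<in> carrier ?G"
    and z: "\<And>(B :: ('k, 'a set) superalg) g. jordan_superalgebra B \<Longrightarrow> super_hom (super_quot A (\<Inter>\<I>)) B g \<Longrightarrow> (\<lambda>S. g (v S)) = \<zero>\<^bsub>grassmann_envelope B\<^esub>"
    for v
  proof (rule ext)
    fix S
    have "v S \<in> carrier (super_quot A (\<Inter>\<I>))" using v by (rule S.env_closed)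
    then obtain a where a: "a \<in> carrier A" "v S = \<Inter>\<I> +>\<^bsub>A\<^esub> a" by auto
    have "a \<in> I" if I': "I \<in> \<I>" for I
    proof -
      interpret QI: super_quotient A I by (rule QI[OF I'])
      have "I +>\<^bsub>A\<^esub> x = \<zero>\<^bsub>super_quot A I\<^esub>" if "x \<in> \<Inter>\<I>" for x
      proof -
        have xI: "x \<in> I" using that I' by (rule InterD)
        show ?thesis using QI.coset_zero_iff[OF QI.I_simps(1)[OF xI]] xI by simp
      qed
      then obtain g where g: "super_hom (super_quot A (\<Inter>\<I>)) (super_quot A I) g"
        "\<And>x. x \<in> carrier A \<Longrightarrow> g (\<Inter>\<I> +>\<^bsub>A\<^esub> x) = I +>\<^bsub>A\<^esub> x"
        using Q.super_quot_lift[OF gr QI.super_quot_super_hom[OF grI[OF I']]] by blast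
      have JI: "jordan_superalgebra (super_quot A I)" using I[OF I'] by (rule conjunct2)
      have "g (v S) = I" using fun_cong[OF z[OF JI g(1)], of S] by simp
      then have "I +>\<^bsub>A\<^esub> a = I" using g(2)[OF a(1)] a(2) by simp
      then show "a \<in> I" using QI.coset_zero_iff[OF a(1)] by simp
    qed
    then have "a \<in> \<Inter>\<I>" by (rule InterI)
    then have "\<Inter>\<I> +>\<^bsub>A\<^esub> a = \<Inter>\<I>" using Q.coset_zero_iff[OF a(1)] by simp
    then show "v S = \<zero>\<^bsub>?G\<^esub> S" unfolding a(2) by simp
  qed
  show "jordan_superalgebra (super_quot A (\<Inter>\<I>))"
    unfolding jordan_superalgebra_def jordan_algebra_def
  proof (intro conjI ballI)
    fix x y assume xy: "x \<in> carrier ?G" "y \<in> carrier ?G"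
    note m1 = S.env.mult_closed[OF xy] and m2 = S.env.mult_closed[OF xy(2,1)]
      and m3 = S.env.mult_closed[OF xy(1) xy(1)]
    have "x \<otimes>\<^bsub>?G\<^esub> y \<ominus>\<^bsub>?G\<^esub> y \<otimes>\<^bsub>?G\<^esub> x = \<zero>\<^bsub>?G\<^esub>"
    proof (rule zero)
      show "x \<otimes>\<^bsub>?G\<^esub> y \<ominus>\<^bsub>?G\<^esub> y \<otimes>\<^bsub>?G\<^esub> x \<in> carrier ?G" by (rule S.env.M.minus_closed[OF m1 m2])
      fix B :: "('k, 'a set) superalg" and g
      assume B: "jordan_superalgebra B" "super_hom (super_quot A (\<Inter>\<I>)) B g"
      interpret g: super_hom "super_quot A (\<Inter>\<I>)" B g by fact
      note c = g.env.hom_closed[OF xy(1)] g.env.hom_closed[OF xy(2)]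
      have cm: "(\<lambda>S. g (x S)) \<otimes>\<^bsub>g.B.GA\<^esub> (\<lambda>S. g (y S)) = (\<lambda>S. g (y S)) \<otimes>\<^bsub>g.B.GA\<^esub> (\<lambda>S. g (x S))"
        using B(1) c unfolding jordan_superalgebra_def jordan_algebra_def by blast
      show "(\<lambda>S. g ((x \<otimes>\<^bsub>?G\<^esub> y \<ominus>\<^bsub>?G\<^esub> y \<otimes>\<^bsub>?G\<^esub> x) S)) = \<zero>\<^bsub>g.B.GA\<^esub>"
        unfolding g.env.hom_minus[OF m1 m2] g.env.hom_mult[OF xy] g.env.hom_mult[OF xy(2,1)] cm
        by (rule g.B.env.minus_eq_zero_iff[THEN iffD2, OF _ _ refl]) (rule g.B.env.mult_closed[OF c(2,1)])+
    qed
    then show "x \<otimes>\<^bsub>?G\<^esub> y = y \<otimes>\<^bsub>?G\<^esub> x"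
      by (rule S.env.minus_eq_zero_iff[THEN iffD1, OF m1 m2])
    show "associator ?G (x \<otimes>\<^bsub>?G\<^esub> x) y x = \<zero>\<^bsub>?G\<^esub>"
    proof (rule zero)
      show "associator ?G (x \<otimes>\<^bsub>?G\<^esub> x) y x \<in> carrier ?G" by (rule S.env.associator_closed[OF m3 xy(2,1)])
      fix B :: "('k, 'a set) superalg" and g
      assume B: "jordan_superalgebra B" "super_hom (super_quot A (\<Inter>\<I>)) B g"
      interpret g: super_hom "super_quot A (\<Inter>\<I>)" B g by fact
      note c = g.env.hom_closed[OF xy(1)] g.env.hom_closed[OF xy(2)]
      show "(\<lambda>S. g (associator ?G (x \<otimes>\<^bsub>?G\<^esub> x) y x S)) = \<zero>\<^bsub>g.B.GA\<^esub>"
        unfolding g.env.hom_associator[OF m3 xy(2,1)] g.env.hom_mult[OF xy(1) xy(1)]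
        using B(1) c unfolding jordan_superalgebra_def jordan_algebra_def by blast
    qed
  qed (rule S.superalgebra_axioms, rule S.nonassoc_algebra_env)
qed

subsection \<open>Simple tensors\<close>

context superalgebra begin

lemma tens_associator:
  assumes "finite S" "finite T" "finite R" "S \<inter> T = {}" "S \<inter> R = {}" "T \<inter> R = {}"
    and a: "a \<in> part A (par S)" and b: "b \<in> part A (par T)" and c: "c \<in> part A (par R)"
  shows "associator GA (tens A a S) (tens A b T) (tens A c R)
    = tens A (sign3 S T R \<odot> associator A a b c) (S \<union> T \<union> R)"
proof -
  note cl = part_closed[OF a] part_closed[OF b] part_closed[OF c]
  have s: "grassmann_sign (S \<union> T) R = grassmann_sign S R * (grassmann_sign T R :: 'k)"
    "grassmann_sign S (T \<union> R) = grassmann_sign S T * (grassmann_sign S R :: 'k)"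
    using assms by (simp_all add: grassmann_sign_Un_left grassmann_sign_Un_right)
  have d: "(S \<union> T) \<inter> R = {}" "S \<inter> (T \<union> R) = {}" using assms by auto
  have "(tens A a S \<otimes>\<^bsub>GA\<^esub> tens A b T) \<otimes>\<^bsub>GA\<^esub> tens A c R = tens A (sign3 S T R \<odot> (a \<otimes> b \<otimes> c)) (S \<union> T \<union> R)"
    "tens A a S \<otimes>\<^bsub>GA\<^esub> (tens A b T \<otimes>\<^bsub>GA\<^esub> tens A c R) = tens A (sign3 S T R \<odot> (a \<otimes> (b \<otimes> c))) (S \<union> T \<union> R)"
    using assms d cl by (simp_all add: tens_mult mult_smult_left mult_smult_right smult_smult s sign3_def mult_ac Un_assoc)
  moreover have "tens A a S \<in> carrier GA" "tens A b T \<in> carrier GA" "tens A c R \<in> carrier GA"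
    using assms by (simp_all add: tens_carrier)
  note t = this
  have "associator GA (tens A a S) (tens A b T) (tens A c R)
    = (\<lambda>U. ((tens A a S \<otimes>\<^bsub>GA\<^esub> tens A b T) \<otimes>\<^bsub>GA\<^esub> tens A c R) U
        \<ominus> (tens A a S \<otimes>\<^bsub>GA\<^esub> (tens A b T \<otimes>\<^bsub>GA\<^esub> tens A c R)) U)"
    unfolding associator_def
    by (rule env_minus[OF env.mult_closed[OF env.mult_closed[OF t(1,2)] t(3)]
          env.mult_closed[OF t(1) env.mult_closed[OF t(2,3)]]])
  ultimately have "associator GA (tens A a S) (tens A b T) (tens A c R)
    = (\<lambda>U. tens A (sign3 S T R \<odot> (a \<otimes> b \<otimes> c)) (S \<union> T \<union> R) U \<ominus> tens A (sign3 S T R \<odot> (a \<otimes> (b \<otimes> c))) (S \<union> T \<union> R) U)"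
    by (simp only:)
  moreover have "sign3 S T R \<odot> (a \<otimes> b \<otimes> c) \<ominus> sign3 S T R \<odot> (a \<otimes> (b \<otimes> c)) = sign3 S T R \<odot> associator A a b c"
    using cl by (simp add: associator_def a_minus_def smult_add_right smult_minus_right)
  ultimately show ?thesis by (auto simp: tens_def a_minus_def M.r_neg)
qed

lemma tens_eq_iff: "tens A a S = tens A b S \<longleftrightarrow> a = b"
  by (auto simp: tens_def fun_eq_iff)

end

subsection \<open>Associator-skew elements of Jordan superalgebras\<close>

context nonassoc_algebra begin

lemma associator_add_mid:
  "\<lbrakk>x \<in> carrier A; y \<in> carrier A; y' \<in> carrier A; z \<in> carrier A\<rbrakk>
    \<Longrightarrow> associator A x (y \<oplus> y') z = associator A x y z \<oplus> associator A x y' z"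
  by (simp add: associator_def mult_add_left mult_add_right a_minus_def M.minus_add M.a_ac)

lemma associator_add_right:
  "\<lbrakk>x \<in> carrier A; y \<in> carrier A; z \<in> carrier A; z' \<in> carrier A\<rbrakk>
    \<Longrightarrow> associator A x y (z \<oplus> z') = associator A x y z \<oplus> associator A x y z'"
  by (simp add: associator_def mult_add_left mult_add_right a_minus_def M.minus_add M.a_ac)

lemma skew_add:
  "\<lbrakk>c \<in> carrier A; f \<in> carrier A; g \<in> carrier A; g' \<in> carrier A\<rbrakk>
    \<Longrightarrow> associator A c f (g \<oplus> g') \<oplus> associator A c (g \<oplus> g') f
      = (associator A c f g \<oplus> associator A c g f) \<oplus> (associator A c f g' \<oplus> associator A c g' f)"
  by (simp add: associator_add_mid associator_add_right M.a_ac)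

lemma skew_zero:
  "\<lbrakk>c \<in> carrier A; f \<in> carrier A\<rbrakk> \<Longrightarrow> associator A c f \<zero> \<oplus> associator A c \<zero> f = \<zero>"
  by (simp add: associator_def a_minus_def M.r_neg)

end

lemma grassmann_sign_less:
  assumes "\<And>s t. s \<in> S \<Longrightarrow> t \<in> T \<Longrightarrow> s < t" shows "grassmann_sign S T = 1"
proof -
  have "{(s, t). s \<in> S \<and> t \<in> T \<and> t < s} = {}" using assms by force
  then show ?thesis unfolding grassmann_sign_def by (simp only: card.empty power_0)
qed

lemma grassmann_sign_greater:
  assumes "t < s" shows "grassmann_sign {s} {t} = - 1"
proof -
  have "{(s', t'). s' \<in> {s} \<and> t' \<in> {t} \<and> t' < s'} = {(s, t)}" using assms by auto
  then show ?thesis unfolding grassmann_sign_def by simp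
qed

context superalgebra begin

lemma tens_induct:
  assumes f: "f \<in> carrier GA" and zero: "P \<zero>\<^bsub>GA\<^esub>"
    and add: "\<And>f g. \<lbrakk>f \<in> carrier GA; g \<in> carrier GA; P f; P g\<rbrakk> \<Longrightarrow> P (f \<oplus>\<^bsub>GA\<^esub> g)"
    and tens: "\<And>a S. \<lbrakk>finite S; a \<in> part A (par S)\<rbrakk> \<Longrightarrow> P (tens A a S)"
  shows "P f"
proof -
  have "P f" if "finite W" "{S. f S \<noteq> \<zero>} \<subseteq> W" "f \<in> carrier GA" for W f
    using that
  proof (induction W arbitrary: f rule: finite_induct)
    case empty
    then have "f = \<zero>\<^bsub>GA\<^esub>" by (simp add: fun_eq_iff)
    then show ?case using zero by simp
  next
    case (insert S W)
    let ?g = "f(S := \<zero>)"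
    have "{T. ?g T \<noteq> \<zero>} \<subseteq> {T. f T \<noteq> \<zero>}" by auto
    then have g: "?g \<in> carrier GA"
      using insert.prems(2) unfolding env_carrier by (auto intro: finite_subset)
    have Pg: "P ?g" by (rule insert.IH[OF _ g]) (use insert.prems(1) in auto)
    show ?case
    proof (cases "finite S")
      case True
      have fS: "f S \<in> part A (par S)" using insert.prems(2) by (simp add: env_carrier)
      have eq: "f = ?g \<oplus>\<^bsub>GA\<^esub> tens A (f S) S"
        using env_closed[OF insert.prems(2)] by (auto simp: tens_def fun_eq_iff)
      show ?thesis
        by (subst eq) (rule add[OF g tens_carrier[OF True fS] Pg tens[OF True fS]])
    next
      case False
      then have "f S = \<zero>" using insert.prems(2) by (simp add: env_carrier)
      then have "?g = f" by auto
      then show ?thesis using Pg by simp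
    qed
  qed
  from this[OF _ subset_refl f] f show ?thesis by (simp add: env_carrier)
qed

lemma tens_zeroD: "tens A a S = \<zero>\<^bsub>GA\<^esub> \<Longrightarrow> a = \<zero>"
  by (drule fun_cong[of _ _ S]) (simp add: tens_def)

text \<open>For disjoint S and T the sign of exchanging the Grassmann monomials cancels the sign in
  the super condition; for intersecting S and T both associators vanish. Additivity in both
  arguments reduces everything to elementary tensors.\<close>

lemma jordan_Z_tens:
  assumes c: "c \<in> part A 0"
    and skew: "\<And>i j a b. \<lbrakk>a \<in> part A i; b \<in> part A j\<rbrakk>
      \<Longrightarrow> associator A c a b \<oplus> (if i = 1 \<and> j = 1 then - 1 else 1) \<odot> associator A c b a = \<zero>"
  shows "tens A c {} \<in> jordan_Z GA"
proof -
  let ?c = "tens A c {}"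
  let ?s = "\<lambda>f g. associator GA ?c f g \<oplus>\<^bsub>GA\<^esub> associator GA ?c g f"
  have cc: "?c \<in> carrier GA" by (rule tens_carrier) (use c in simp_all)
  have base: "?s (tens A a S) (tens A b T) = \<zero>\<^bsub>GA\<^esub>"
    if S: "finite S" "a \<in> part A (par S)" and T: "finite T" "b \<in> part A (par T)" for a b S T
  proof -
    note cl = part_closed[OF c] part_closed[OF S(2)] part_closed[OF T(2)]
    show ?thesis
    proof (cases "S \<inter> T = {}")
      case True
      have s: "sign3 {} S T = (grassmann_sign S T :: 'k)" "sign3 {} T S = (grassmann_sign T S :: 'k)"
        by (simp_all add: sign3_def)
      have "(- 1) ^ (card S * card T) = (if par S = 1 \<and> par T = 1 then - 1 else 1 :: 'k)"
        by (simp add: par_eq)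
      then have sw: "grassmann_sign T S = grassmann_sign S T * (if par S = 1 \<and> par T = 1 then - 1 else 1 :: 'k)"
        using grassmann_sign_swap[OF S(1) T(1) True, where 'k = 'k] by (simp only: mult.commute)
      have c0: "c \<in> part A (par {})" using c by simp
      have 1: "associator GA ?c (tens A a S) (tens A b T) = tens A (grassmann_sign S T \<odot> associator A c a b) (S \<union> T)"
        using tens_associator[of "{}" S T c a b] S T True c0 by (simp add: s)
      have 2: "associator GA ?c (tens A b T) (tens A a S) = tens A (grassmann_sign T S \<odot> associator A c b a) (S \<union> T)"
        using tens_associator[of "{}" T S c b a] S T True c0 by (simp add: s Un_commute Int_commute)
      have "grassmann_sign S T \<odot> associator A c a b \<oplus> grassmann_sign T S \<odot> associator A c b a
        = grassmann_sign S T \<odot> (associator A c a b \<oplus> (if par S = 1 \<and> par T = 1 then - 1 else 1) \<odot> associator A c b a)"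
        unfolding sw using cl
        by (simp only: smult_add_right smult_smult[symmetric] associator_closed smult_closed')
      also have "\<dots> = \<zero>" unfolding skew[OF S(2) T(2)] by simp
      finally show ?thesis unfolding 1 2 by (auto simp: tens_def)
    next
      case False
      have z: "tens A a S \<otimes>\<^bsub>GA\<^esub> tens A b T = \<zero>\<^bsub>GA\<^esub>" "tens A b T \<otimes>\<^bsub>GA\<^esub> tens A a S = \<zero>\<^bsub>GA\<^esub>"
        "(?c \<otimes>\<^bsub>GA\<^esub> tens A a S) \<otimes>\<^bsub>GA\<^esub> tens A b T = \<zero>\<^bsub>GA\<^esub>" "(?c \<otimes>\<^bsub>GA\<^esub> tens A b T) \<otimes>\<^bsub>GA\<^esub> tens A a S = \<zero>\<^bsub>GA\<^esub>"
        using False S T cl by (simp_all add: tens_mult Int_commute)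
      have "associator GA ?c (tens A a S) (tens A b T) = \<zero>\<^bsub>GA\<^esub>" "associator GA ?c (tens A b T) (tens A a S) = \<zero>\<^bsub>GA\<^esub>"
        unfolding associator_def z env.mult_zero[OF cc]
        by (rule env.minus_eq_zero_iff[THEN iffD2, OF env.M.zero_closed env.M.zero_closed refl])+
      then show ?thesis by (simp only: env.M.l_zero env.M.zero_closed)
    qed
  qed
  have step: "?s (tens A a S) g = \<zero>\<^bsub>GA\<^esub>" if S: "finite S" "a \<in> part A (par S)" and g: "g \<in> carrier GA" for a S g
    using g
  proof (rule tens_induct)
    note t = tens_carrier[OF S]
    show "?s (tens A a S) \<zero>\<^bsub>GA\<^esub> = \<zero>\<^bsub>GA\<^esub>" by (rule env.skew_zero[OF cc t])
    show "?s (tens A a S) (f \<oplus>\<^bsub>GA\<^esub> g) = \<zero>\<^bsub>GA\<^esub>"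
      if "f \<in> carrier GA" "g \<in> carrier GA" "?s (tens A a S) f = \<zero>\<^bsub>GA\<^esub>" "?s (tens A a S) g = \<zero>\<^bsub>GA\<^esub>" for f g
      unfolding env.skew_add[OF cc t that(1,2)] that(3,4) by (rule env.M.l_zero) (rule env.M.zero_closed)
  qed (rule base[OF S])
  have "?s g f = \<zero>\<^bsub>GA\<^esub>" if g: "g \<in> carrier GA" and f: "f \<in> carrier GA" for f g
    using f
  proof (rule tens_induct)
    show "?s g \<zero>\<^bsub>GA\<^esub> = \<zero>\<^bsub>GA\<^esub>" by (rule env.skew_zero[OF cc g])
    show "?s g (f \<oplus>\<^bsub>GA\<^esub> f') = \<zero>\<^bsub>GA\<^esub>"
      if "f \<in> carrier GA" "f' \<in> carrier GA" "?s g f = \<zero>\<^bsub>GA\<^esub>" "?s g f' = \<zero>\<^bsub>GA\<^esub>" for f f'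
      unfolding env.skew_add[OF cc g that(1,2)] that(3,4) by (rule env.M.l_zero) (rule env.M.zero_closed)
    fix a S assume S: "finite S" "a \<in> part A (par S)"
    note t = tens_carrier[OF S]
    show "?s g (tens A a S) = \<zero>\<^bsub>GA\<^esub>"
      unfolding env.M.a_comm[OF env.associator_closed[OF cc g t] env.associator_closed[OF cc t g]]
      by (rule step[OF S g])
  qed
  then show ?thesis using cc unfolding jordan_Z_def by blast
qed

end

locale jordan_super = superalgebra A
  for A :: "('k::field_char_0, 'a, 'm) superalg_scheme" (structure) +
  assumes jordan: "jordan_algebra (grassmann_envelope A)"
begin

text \<open>The super form of skewness, stated through the envelope so that
  \<open>jordan_Z_properties\<close> applies. Statements about the superalgebra are recovered on
  elementary tensors with disjoint supports.\<close>

definition Zev where "Zev = {c \<in> part A 0. tens A c {} \<in> jordan_Z GA}"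

lemma Zev_part: "c \<in> Zev \<Longrightarrow> c \<in> part A 0"
  by (simp add: Zev_def)

lemma Zev_tens: "c \<in> Zev \<Longrightarrow> tens A c {} \<in> jordan_Z GA"
  by (simp add: Zev_def)

lemma ev_tens: "c \<in> part A 0 \<Longrightarrow> tens A c {} \<in> carrier GA"
  by (rule tens_carrier) simp_all

lemma od_tens: "a \<in> part A 1 \<Longrightarrow> tens A a {n} \<in> carrier GA"
  by (rule tens_carrier) simp_all

lemma Zev_assoc:
  assumes c: "c \<in> Zev" and d: "d \<in> Zev" and a: "a \<in> part A i"
  shows "associator A c d a = \<zero>"
proof -
  define S where "S = (if i = 0 then {} else {0 :: nat})"
  have S: "finite S" "par S = i" by (cases i; simp add: S_def)+
  have a': "a \<in> part A (par S)" using a S by simp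
  note t = tens_carrier[OF S(1) a']
  have cd: "c \<in> part A (par {})" "d \<in> part A (par {})" using c d Zev_part by simp_all
  have "associator GA (tens A c {}) (tens A d {}) (tens A a S) = \<zero>\<^bsub>GA\<^esub>"
    by (rule jordan_Z_properties(1)[OF jordan Zev_tens[OF c] Zev_tens[OF d] t t])
  moreover have "associator GA (tens A c {}) (tens A d {}) (tens A a S) = tens A (sign3 {} {} S \<odot> associator A c d a) ({} \<union> {} \<union> S)"
    by (rule tens_associator) (use S a' cd in simp_all)
  ultimately have "sign3 {} {} S \<odot> associator A c d a = \<zero>" using tens_zeroD by metis
  then show ?thesis using part_closed[OF cd(1)] part_closed[OF cd(2)] part_closed[OF a] by (simp add: sign3_def)
qed

lemma Zev_mult: assumes c: "c \<in> Zev" and d: "d \<in> Zev" shows "c \<otimes> d \<in> Zev"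
proof -
  note t = ev_tens[OF Zev_part[OF c]]
  note cl = part_closed[OF Zev_part[OF c]] part_closed[OF Zev_part[OF d]]
  have "tens A c {} \<otimes>\<^bsub>GA\<^esub> tens A d {} \<in> jordan_Z GA"
    by (rule jordan_Z_properties(2)[OF jordan Zev_tens[OF c] Zev_tens[OF d] t t])
  moreover have "tens A c {} \<otimes>\<^bsub>GA\<^esub> tens A d {} = tens A (c \<otimes> d) {}"
    using cl by (simp add: tens_mult)
  moreover have "c \<otimes> d \<in> part A 0" using part_mult[OF Zev_part[OF c] Zev_part[OF d]] by simp
  ultimately show ?thesis by (simp add: Zev_def)
qed

lemma even_odd_commute: assumes x: "x \<in> part A 0" and y: "y \<in> part A 1" shows "y \<otimes> x = x \<otimes> y"
proof -
  have "tens A x {} \<otimes>\<^bsub>GA\<^esub> tens A y {0} = tens A y {0} \<otimes>\<^bsub>GA\<^esub> tens A x {}"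
    using jordan ev_tens[OF x] od_tens[OF y] unfolding jordan_algebra_def by blast
  then have "tens A (x \<otimes> y) {0} = tens A (y \<otimes> x) {0}"
    using part_closed[OF x] part_closed[OF y] by (simp add: tens_mult)
  then show ?thesis unfolding tens_eq_iff by (rule sym)
qed

lemma even_commute: assumes x: "x \<in> part A 0" and y: "y \<in> part A 0" shows "y \<otimes> x = x \<otimes> y"
proof -
  have "tens A x {} \<otimes>\<^bsub>GA\<^esub> tens A y {} = tens A y {} \<otimes>\<^bsub>GA\<^esub> tens A x {}"
    using jordan ev_tens[OF x] ev_tens[OF y] unfolding jordan_algebra_def by blast
  then have "tens A (x \<otimes> y) {} = tens A (y \<otimes> x) {}"
    using part_closed[OF x] part_closed[OF y] by (simp add: tens_mult)
  then show ?thesis unfolding tens_eq_iff by (rule sym)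
qed

lemma sign01: "grassmann_sign {0} {1} = (1 :: 'k)" "grassmann_sign {1} {0} = (- 1 :: 'k)"
  by (rule grassmann_sign_less, simp, rule grassmann_sign_greater, simp)

lemma odd_anticommute: assumes x: "x \<in> part A 1" and y: "y \<in> part A 1" shows "x \<otimes> y = \<ominus> (y \<otimes> x)"
proof -
  note cl = part_closed[OF x] part_closed[OF y]
  have "tens A x {0} \<otimes>\<^bsub>GA\<^esub> tens A y {1} = tens A y {1} \<otimes>\<^bsub>GA\<^esub> tens A x {0}"
    using jordan od_tens[OF x] od_tens[OF y] unfolding jordan_algebra_def by blast
  moreover have "tens A x {0} \<otimes>\<^bsub>GA\<^esub> tens A y {1} = tens A (grassmann_sign {0} {1} \<odot> (x \<otimes> y)) ({0} \<union> {1})"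
    "tens A y {1} \<otimes>\<^bsub>GA\<^esub> tens A x {0} = tens A (grassmann_sign {1} {0} \<odot> (y \<otimes> x)) ({1} \<union> {0})"
    using tens_mult[of "{0}" "{1}" x y] tens_mult[of "{1}" "{0}" y x] cl by simp_all
  ultimately have "tens A (grassmann_sign {0} {1} \<odot> (x \<otimes> y)) ({0} \<union> {1}) = tens A (grassmann_sign {1} {0} \<odot> (y \<otimes> x)) ({0} \<union> {1})"
    by (simp only: Un_commute)
  then have "1 \<odot> (x \<otimes> y) = (- 1) \<odot> (y \<otimes> x)" unfolding tens_eq_iff sign01 .
  then show ?thesis using cl by (simp add: uminus_eq_smult)
qed

lemma tens_assoc_odd:
  assumes c: "c \<in> part A 0" and a: "a \<in> part A 1" and b: "b \<in> part A 1"
  shows "associator GA (tens A c {}) (tens A a {0}) (tens A b {1}) = tens A (associator A c a b) {0, 1}"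
    "associator GA (tens A c {}) (tens A b {1}) (tens A a {0}) = tens A ((- 1) \<odot> associator A c b a) {0, 1}"
proof -
  have p: "c \<in> part A (par {})" "a \<in> part A (par {0})" "b \<in> part A (par {1})" using assms by simp_all
  note cl = part_closed[OF c] part_closed[OF a] part_closed[OF b]
  have s: "sign3 {} {0} {1} = (1 :: 'k)" "sign3 {} {1} {0} = (- 1 :: 'k)"
    unfolding sign3_def sign01 by simp_all
  have "associator GA (tens A c {}) (tens A a {0}) (tens A b {1}) = tens A (sign3 {} {0} {1} \<odot> associator A c a b) ({} \<union> {0} \<union> {1})"
    by (rule tens_associator) (use p in simp_all)
  then show "associator GA (tens A c {}) (tens A a {0}) (tens A b {1}) = tens A (associator A c a b) {0, 1}"
    unfolding s using cl by (simp add: insert_commute)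
  have "associator GA (tens A c {}) (tens A b {1}) (tens A a {0}) = tens A (sign3 {} {1} {0} \<odot> associator A c b a) ({} \<union> {1} \<union> {0})"
    by (rule tens_associator) (use p in simp_all)
  then show "associator GA (tens A c {}) (tens A b {1}) (tens A a {0}) = tens A ((- 1) \<odot> associator A c b a) {0, 1}"
    unfolding s by (simp add: insert_commute)
qed

text \<open>Skewness in the envelope becomes symmetry here, since exchanging two Grassmann
  generators changes the sign.\<close>

lemma Zev_odd_symmetric:
  assumes c: "c \<in> Zev" and a: "a \<in> part A 1" and b: "b \<in> part A 1"
  shows "associator A c a b = associator A c b a"
proof -
  note p = Zev_part[OF c]
  note cl = part_closed[OF p] part_closed[OF a] part_closed[OF b]
  have "associator GA (tens A c {}) (tens A a {0}) (tens A b {1}) \<oplus>\<^bsub>GA\<^esub> associator GA (tens A c {}) (tens A b {1}) (tens A a {0}) = \<zero>\<^bsub>GA\<^esub>"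
    using Zev_tens[OF c] od_tens[OF a] od_tens[OF b] unfolding jordan_Z_def by blast
  then have "associator A c a b \<oplus> (- 1) \<odot> associator A c b a = \<zero>"
    unfolding tens_assoc_odd[OF p a b] by (drule_tac fun_cong[of _ _ "{0, 1}"]) (simp add: tens_def)
  then have "associator A c a b \<ominus> associator A c b a = \<zero>"
    using cl by (simp add: a_minus_def uminus_eq_smult)
  then show ?thesis by (rule minus_eq_zero_iff[THEN iffD1, rotated 2]) (use cl in simp_all)
qed

lemma Zev_pull:
  assumes c: "c \<in> Zev" and d: "d \<in> Zev" and a: "a \<in> part A 1" and b: "b \<in> part A 1"
  shows "associator A c (d \<otimes> a) b = d \<otimes> associator A c a b"
proof -
  note p = Zev_part[OF c] Zev_part[OF d]
  note cl = part_closed[OF p(1)] part_closed[OF p(2)] part_closed[OF a] part_closed[OF b]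
  have da: "d \<otimes> a \<in> part A 1" using part_mult[OF p(2) a] by simp
  have 1: "tens A d {} \<otimes>\<^bsub>GA\<^esub> tens A a {0} = tens A (d \<otimes> a) {0}" using cl by (simp add: tens_mult)
  have "associator GA (tens A c {}) (tens A d {} \<otimes>\<^bsub>GA\<^esub> tens A a {0}) (tens A b {1})
    = tens A d {} \<otimes>\<^bsub>GA\<^esub> associator GA (tens A c {}) (tens A a {0}) (tens A b {1})"
    by (rule jordan_Z_properties(3)[OF jordan Zev_tens[OF c] Zev_tens[OF d] od_tens[OF a] od_tens[OF b]])
  then have "tens A (associator A c (d \<otimes> a) b) {0, 1} = tens A d {} \<otimes>\<^bsub>GA\<^esub> tens A (associator A c a b) {0, 1}"
    unfolding 1 tens_assoc_odd(1)[OF p(1) da b] tens_assoc_odd(1)[OF p(1) a b] .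
  also have "\<dots> = tens A (d \<otimes> associator A c a b) {0, 1}" using cl by (simp add: tens_mult)
  finally show ?thesis unfolding tens_eq_iff .
qed

text \<open>The envelope yields the condition for w tensored with xi_0 xi_1, not for w tensored with
  1. Testing it on tensors supported in the fresh indices 2 and 3 gives the super condition on w,
  which \<open>jordan_Z_tens\<close> turns into the required form.\<close>

lemma Zev_associator:
  assumes c: "c \<in> Zev" and a: "a \<in> part A 1" and b: "b \<in> part A 1"
  shows "associator A c a b \<in> Zev"
proof -
  define w where "w = associator A c a b"
  have w0: "w \<in> part A 0" using part_associator[OF Zev_part[OF c] a b] by (simp add: w_def)
  have wZ: "tens A w {0, 1} \<in> jordan_Z GA"
    using jordan_Z_properties(4)[OF jordan Zev_tens[OF c] Zev_tens[OF c] od_tens[OF a, where n = 0] od_tens[OF b, where n = 1]]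
    unfolding tens_assoc_odd(1)[OF Zev_part[OF c] a b] w_def .
  have "tens A w {} \<in> jordan_Z GA"
  proof (rule jordan_Z_tens[OF w0])
    fix i j p q assume pq: "p \<in> part A i" "q \<in> part A j"
    define S where "S = (if i = 0 then {} else {2 :: nat})"
    define T where "T = (if j = 0 then {} else {3 :: nat})"
    have S: "finite S" "par S = i" "S \<subseteq> {2}" and T: "finite T" "par T = j" "T \<subseteq> {3}"
      by (cases i; simp add: S_def)+ (cases j; simp add: T_def)+
    have p': "p \<in> part A (par S)" "q \<in> part A (par T)" "w \<in> part A (par {0, 1})" using pq S T w0 by simp_all
    note cl = part_closed[OF pq(1)] part_closed[OF pq(2)] part_closed[OF w0]
    have d: "{0, 1} \<inter> S = {}" "{0, 1} \<inter> T = {}" "S \<inter> T = {}" using S T by auto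
    have s1: "grassmann_sign {0, 1} S = (1 :: 'k)" "grassmann_sign {0, 1} T = (1 :: 'k)" "grassmann_sign S T = (1 :: 'k)"
      by (rule grassmann_sign_less; use subsetD[OF S(3)] subsetD[OF T(3)] in fastforce)+
    have s2: "grassmann_sign T S = (if i = 1 \<and> j = 1 then - 1 else 1 :: 'k)"
      by (cases i; cases j) (simp_all add: S_def T_def grassmann_sign_greater)
    have "associator GA (tens A w {0, 1}) (tens A p S) (tens A q T) \<oplus>\<^bsub>GA\<^esub> associator GA (tens A w {0, 1}) (tens A q T) (tens A p S) = \<zero>\<^bsub>GA\<^esub>"
      using wZ tens_carrier[OF S(1) p'(1)] tens_carrier[OF T(1) p'(2)] unfolding jordan_Z_def by blast
    moreover have "associator GA (tens A w {0, 1}) (tens A p S) (tens A q T) = tens A (sign3 {0, 1} S T \<odot> associator A w p q) ({0, 1} \<union> S \<union> T)"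
      by (rule tens_associator) (use S T d p' in simp_all)
    moreover have "associator GA (tens A w {0, 1}) (tens A q T) (tens A p S) = tens A (sign3 {0, 1} T S \<odot> associator A w q p) ({0, 1} \<union> S \<union> T)"
    proof -
      have "associator GA (tens A w {0, 1}) (tens A q T) (tens A p S) = tens A (sign3 {0, 1} T S \<odot> associator A w q p) ({0, 1} \<union> T \<union> S)"
        by (rule tens_associator) (use S T d p' in \<open>simp_all add: Int_commute\<close>)
      moreover have "{0, 1} \<union> T \<union> S = {0, 1} \<union> S \<union> T" by auto
      ultimately show ?thesis by simp
    qed
    ultimately have "sign3 {0, 1} S T \<odot> associator A w p q \<oplus> sign3 {0, 1} T S \<odot> associator A w q p = \<zero>"
      by (simp only:) (drule fun_cong[of _ _ "{0, 1} \<union> S \<union> T"], simp add: tens_def)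
    then show "associator A w p q \<oplus> (if i = 1 \<and> j = 1 then - 1 else 1) \<odot> associator A w q p = \<zero>"
      using cl unfolding sign3_def s1 s2 mult_1 mult_1_right by (simp only: one_smult associator_closed)
  qed
  then show ?thesis using w0 unfolding Zev_def w_def by simp
qed

end

section \<open>The superalgebra \<open>JF\<^sub>0\<close>\<close>

subsection \<open>Evaluation in a superalgebra of vector type\<close>

abbreviation "VJ \<equiv> vsuper mu_jordan"

definition jv :: "'k::field_char_0 \<Rightarrow> super_generator \<Rightarrow> 'k poly \<times> 'k poly" where
  "jv c g = (case g of Ev \<Rightarrow> ([:0, c:], 0) | Od \<Rightarrow> (0, 1))"

abbreviation "jev c \<equiv> napoly_eval VJ (jv c)"

lemma jev_simps:
  "jev c (p + q) = jev c p + jev c q" "jev c (napoly_mult p q) = vm mu_jordan (jev c p) (jev c q)"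
  "jev c (napoly_smult d p) = vs d (jev c p)" "jev c (gen Ev) = ([:0, c:], 0)" "jev c (gen Od) = (0, 1)"
  "jev c 0 = 0"
  using vjordan.napoly_eval_add[of "jv c" p q] vjordan.napoly_eval_mult[of "jv c" p q]
    vjordan.napoly_eval_smult[of "jv c" d p] vjordan.napoly_eval_gen[of "jv c"] vjordan.napoly_eval_zero[of "jv c"]
  by (simp_all add: jv_def)

lemma jev_part:
  assumes "\<forall>w\<in>Poly_Mapping.keys p. word_parity w = i" shows "jev c p \<in> part VJ i"
proof -
  have "word_eval VJ (jv c) w \<in> part VJ (word_parity w)" for w
  proof (induction w)
    case (Gen g)
    then show ?case by (cases g) (simp_all add: jv_def)
  next
    case (Mul u v)
    then show ?case unfolding word_eval.simps word_parity.simps by (rule vjordan.part_mult)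
  qed
  then show ?thesis
    unfolding napoly_eval_def using assms by (intro vjordan.part_finsum vjordan.part_smult) metis
qed

lemma jev_super_hom: "super_hom free_superalgebra VJ (jev c)"
proof (intro super_hom.intro nonassoc_homI super_hom_axioms.intro SF.superalgebra_axioms
    SF.nonassoc_algebra_axioms vjordan.superalgebra_axioms vjordan.nonassoc_algebra_axioms)
  show "jev c \<in> alg_hom free_superalgebra VJ"
    by (rule alg_homI) (simp_all only: free_superalgebra_simps vsuper_simps(1,3) vsuper_ops jev_simps UNIV_I)
  show "jev c x \<in> part VJ i" if "x \<in> part free_superalgebra i" for x i
    using that jev_part unfolding free_superalgebra_simps by blast
qed

lemma associator_VJ: "associator VJ x y z = vjordan.vas x y z"
  by (simp add: associator_def vjordan.vas_def vjordan.vector_minus)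

text \<open>Symmetry in p and q is the skewness required of z. For f = ct and p = q = 1 the value is
  the constant c/2, whose own associator with p = q = 1 vanishes: this is the last relation of
  \<open>JF0\<close>.\<close>

lemma vas_even_odd_odd:
  "vjordan.vas (f, 0) (0, p) (0, q) = (Polynomial.smult (1 / 2) (pderiv f * p * q), 0)"
  by (simp add: vjordan.vas_def vm_def mu_jordan_def pderiv_mult algebra_simps Polynomial.smult_add_right smult_diff_right)

lemma vas_even:
  "vjordan.vas (f, 0) (p, 0) (q, r) = 0" "vjordan.vas (f, 0) (p, r) (q, 0) = 0"
  by (simp_all add: vjordan.vas_def vm_def algebra_simps prod_eq_iff)

lemma VJ_skew:
  assumes "a \<in> part VJ i" "b \<in> part VJ j"
  shows "associator VJ (f, 0) a b \<oplus>\<^bsub>VJ\<^esub> (if i = 1 \<and> j = 1 then - 1 else 1) \<odot>\<^bsub>VJ\<^esub> associator VJ (f, 0) b a = \<zero>\<^bsub>VJ\<^esub>"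
proof -
  obtain a0 a1 b0 b1 where ab: "a = (a0, a1)" "b = (b0, b1)" by (cases a, cases b)
  show ?thesis
    using assms unfolding associator_VJ ab
    by (cases i; cases j) (simp_all add: vas_even_odd_odd vas_even mult_ac zero_prod_def)
qed

subsection \<open>The projection onto \<open>JF\<^sub>0\<close>\<close>

lemma super_hom_compose:
  assumes "super_hom A B h" "super_hom B C g" shows "super_hom A C (\<lambda>x. g (h x))"
proof -
  interpret h: super_hom A B h by fact
  interpret g: super_hom B C g by fact
  show ?thesis
    by (intro super_hom.intro nonassoc_homI super_hom_axioms.intro h.A.superalgebra_axioms g.B.superalgebra_axioms
        h.A.nonassoc_algebra_axioms g.B.nonassoc_algebra_axioms alg_hom_compose[OF h.hom g.hom])
       (rule g.hom_part, rule h.hom_part)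
qed

lemma jordan_super_ideal:
  "alg_ideal jordan_super_ideal (free_superalgebra :: ('k::field_char_0, (super_generator, 'k) napoly) superalg)"
  "graded_set free_superalgebra (jordan_super_ideal :: (super_generator, 'k) napoly set)"
  "jordan_superalgebra (Jord :: ('k, (super_generator, 'k) napoly set) superalg)"
proof -
  let ?F = "free_superalgebra :: ('k, (super_generator, 'k) napoly) superalg"
  let ?I = "{I. alg_ideal I ?F \<and> jordan_superalgebra (super_quot ?F I)}"
  \<comment> \<open>The family of ideals has to be nonempty; any value of the parameter provides a
    member.\<close>
  have "{x \<in> carrier ?F. jev 0 x = \<zero>\<^bsub>VJ\<^esub>} \<in> ?I"
    using super_hom_kernel[OF jev_super_hom[of "0 :: 'k"] jordan_superalgebra_vsuper] by blast
  then have ne: "?I \<noteq> {}" by blast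
  have *: "alg_ideal I ?F \<and> jordan_superalgebra (super_quot ?F I)" if "I \<in> ?I" for I using that by blast
  note r = jordan_super_quot_Inter[OF SF.superalgebra_axioms ne *]
  show "alg_ideal jordan_super_ideal ?F" unfolding jordan_super_ideal_def by (rule r(1))
  show "graded_set ?F jordan_super_ideal" unfolding jordan_super_ideal_def by (rule r(2))
  show "jordan_superalgebra (Jord :: ('k, (super_generator, 'k) napoly set) superalg)"
    unfolding Jord_def jordan_super_ideal_def by (rule r(3))
qed

interpretation JI: super_quotient "free_superalgebra :: ('k::field_char_0, (super_generator, 'k) napoly) superalg" jordan_super_ideal
  by unfold_locales (rule jordan_super_ideal(1))

interpretation Jord: superalgebra "Jord :: ('k::field_char_0, (super_generator, 'k) napoly set) superalg"
  using jordan_super_ideal(3) unfolding jordan_superalgebra_def by blast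

lemma Jord_proj: "super_hom free_superalgebra (Jord :: ('k::field_char_0, (super_generator, 'k) napoly set) superalg)
    (\<lambda>p. jordan_super_ideal +>\<^bsub>free_superalgebra\<^esub> p)"
  unfolding Jord_def by (rule JI.super_quot_super_hom[OF jordan_super_ideal(2)])

interpretation Jp: super_hom free_superalgebra "Jord :: ('k::field_char_0, (super_generator, 'k) napoly set) superalg"
    "\<lambda>p. jordan_super_ideal +>\<^bsub>free_superalgebra\<^esub> p"
  by (rule Jord_proj)

lemma gen_part: "gen Ev \<in> part free_superalgebra 0" "gen Od \<in> part free_superalgebra 1"
  by (simp_all add: gen_def)

lemma Jord_gen_part:
  "(Jord_gen Ev :: (super_generator, 'k::field_char_0) napoly set) \<in> part Jord 0"
  "(Jord_gen Od :: (super_generator, 'k) napoly set) \<in> part Jord 1"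
  unfolding Jord_gen_def by (rule Jp.hom_part[OF gen_part(1)], rule Jp.hom_part[OF gen_part(2)])

definition Jzx_relations :: "(super_generator, 'k::field_char_0) napoly set set" where
  "Jzx_relations = {associator Jord (Jord_gen Ev) a b
        \<oplus>\<^bsub>Jord\<^esub> ((if i = 1 \<and> j = 1 then - 1 else 1) \<odot>\<^bsub>Jord\<^esub> associator Jord (Jord_gen Ev) b a)
      | a b i j. a \<in> part Jord i \<and> b \<in> part Jord j}"

lemma Jzx_ideal_eq: "Jzx_ideal = alg_ideal_gen Jord Jzx_relations"
  by (simp add: Jzx_ideal_def Jzx_relations_def)

lemma Jzx_relations_part: "Jzx_relations \<subseteq> part Jord 0 \<union> part Jord 1"
proof
  fix s :: "(super_generator, 'k::field_char_0) napoly set" assume "s \<in> Jzx_relations"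
  then obtain a b i j where ab: "a \<in> part Jord i" "b \<in> part Jord j"
    and s: "s = associator Jord (Jord_gen Ev) a b
        \<oplus>\<^bsub>Jord\<^esub> ((if i = 1 \<and> j = 1 then - 1 else 1) \<odot>\<^bsub>Jord\<^esub> associator Jord (Jord_gen Ev) b a)"
    unfolding Jzx_relations_def by blast
  have 1: "associator Jord (Jord_gen Ev) a b \<in> part Jord (i + j)"
    using Jord.part_associator[OF Jord_gen_part(1) ab] unfolding add_0_left .
  have 2: "associator Jord (Jord_gen Ev) b a \<in> part Jord (i + j)"
    using Jord.part_associator[OF Jord_gen_part(1) ab(2,1)] unfolding add_0_left add.commute[of j i] .
  have "s \<in> part Jord (i + j)" unfolding s by (rule Jord.part_add[OF 1 Jord.part_smult[OF 2]])
  moreover have k: "k = 0 \<or> k = 1" for k :: bit by (cases k) simp_all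
  ultimately show "s \<in> part Jord 0 \<union> part Jord 1" using k[of "i + j"] by (elim disjE) (simp_all only: UnI1 UnI2)
qed

lemma Jzx_ideal_alg: "alg_ideal (Jzx_ideal :: (super_generator, 'k::field_char_0) napoly set set) Jord"
  unfolding Jzx_ideal_eq by (rule Jord.alg_ideal_gen_ideal) (use Jzx_relations_part Jord.part_closed in blast)

lemma Jzx_ideal_graded: "graded_set Jord (Jzx_ideal :: (super_generator, 'k::field_char_0) napoly set set)"
  unfolding Jzx_ideal_eq by (rule Jord.graded_ideal_gen[OF Jzx_relations_part])

interpretation JzI: super_quotient "Jord :: ('k::field_char_0, (super_generator, 'k) napoly set) superalg" Jzx_ideal
  by unfold_locales (rule Jzx_ideal_alg)

lemma Jzx_jordan: "jordan_superalgebra (Jzx :: ('k::field_char_0, (super_generator, 'k) napoly set set) superalg)"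
  unfolding Jzx_def by (rule JzI.super_quot_jordan[OF Jzx_ideal_graded jordan_super_ideal(3)])

interpretation Jzx: superalgebra "Jzx :: ('k::field_char_0, (super_generator, 'k) napoly set set) superalg"
  using Jzx_jordan unfolding jordan_superalgebra_def by blast

interpretation Jzp: super_hom Jord "Jzx :: ('k::field_char_0, (super_generator, 'k) napoly set set) superalg"
    "\<lambda>p. Jzx_ideal +>\<^bsub>Jord\<^esub> p"
  unfolding Jzx_def by (rule JzI.super_quot_super_hom[OF Jzx_ideal_graded])

lemma Jzx_gen_part:
  "(Jzx_gen Ev :: (super_generator, 'k::field_char_0) napoly set set) \<in> part Jzx 0"
  "(Jzx_gen Od :: (super_generator, 'k) napoly set set) \<in> part Jzx 1"
  unfolding Jzx_gen_def by (rule Jzp.hom_part[OF Jord_gen_part(1)], rule Jzp.hom_part[OF Jord_gen_part(2)])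

definition JF0_relation :: "(super_generator, 'k::field_char_0) napoly set set" where
  "JF0_relation = associator Jzx (associator Jzx (Jzx_gen Ev) (Jzx_gen Od) (Jzx_gen Od)) (Jzx_gen Od) (Jzx_gen Od)"

definition JF0_ideal :: "(super_generator, 'k::field_char_0) napoly set set set" where
  "JF0_ideal = alg_ideal_gen Jzx {JF0_relation}"

lemma JF0_eq: "JF0 = super_quot Jzx JF0_ideal"
  by (simp add: JF0_def JF0_ideal_def JF0_relation_def Let_def)

lemma JF0_relation_part: "JF0_relation \<in> part Jzx 0"
proof -
  note w = Jzx.part_associator[OF Jzx_gen_part(1,2,2)]
  from Jzx.part_associator[OF w Jzx_gen_part(2,2)] show ?thesis unfolding JF0_relation_def by simp
qed

lemma JF0_ideal_alg: "alg_ideal (JF0_ideal :: (super_generator, 'k::field_char_0) napoly set set set) Jzx"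
  unfolding JF0_ideal_def by (rule Jzx.alg_ideal_gen_ideal) (use JF0_relation_part Jzx.part_closed in blast)

lemma JF0_ideal_graded: "graded_set Jzx (JF0_ideal :: (super_generator, 'k::field_char_0) napoly set set set)"
  unfolding JF0_ideal_def by (rule Jzx.graded_ideal_gen) (use JF0_relation_part in blast)

interpretation JFI: super_quotient "Jzx :: ('k::field_char_0, (super_generator, 'k) napoly set set) superalg" JF0_ideal
  by unfold_locales (rule JF0_ideal_alg)

lemma JF0_jordan: "jordan_superalgebra (JF0 :: ('k::field_char_0, (super_generator, 'k) napoly set set set) superalg)"
  unfolding JF0_eq by (rule JFI.super_quot_jordan[OF JF0_ideal_graded Jzx_jordan])

interpretation JF: superalgebra "JF0 :: ('k::field_char_0, (super_generator, 'k) napoly set set set) superalg"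
  using JF0_jordan unfolding jordan_superalgebra_def by blast

interpretation JFp: super_hom Jzx "JF0 :: ('k::field_char_0, (super_generator, 'k) napoly set set set) superalg"
    "\<lambda>p. JF0_ideal +>\<^bsub>Jzx\<^esub> p"
  unfolding JF0_eq by (rule JFI.super_quot_super_hom[OF JF0_ideal_graded])

definition JF0_proj :: "(super_generator, 'k::field_char_0) napoly \<Rightarrow> (super_generator, 'k) napoly set set set" where
  "JF0_proj p = JF0_ideal +>\<^bsub>Jzx\<^esub> (Jzx_ideal +>\<^bsub>Jord\<^esub> (jordan_super_ideal +>\<^bsub>free_superalgebra\<^esub> p))"

lemma JF0_proj_super_hom:
  "super_hom free_superalgebra (JF0 :: ('k::field_char_0, (super_generator, 'k) napoly set set set) superalg) JF0_proj"
  unfolding JF0_proj_def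
  by (rule super_hom_compose[OF super_hom_compose[OF Jp.super_hom_axioms Jzp.super_hom_axioms] JFp.super_hom_axioms])

interpretation JQ: super_hom free_superalgebra "JF0 :: ('k::field_char_0, (super_generator, 'k) napoly set set set) superalg" JF0_proj
  by (rule JF0_proj_super_hom)

lemma JF0_proj_simps:
  "JF0_proj (p + q) = JF0_proj p \<oplus>\<^bsub>JF0\<^esub> JF0_proj q" "JF0_proj (napoly_mult p q) = JF0_proj p \<otimes>\<^bsub>JF0\<^esub> JF0_proj q"
  "JF0_proj (napoly_smult c p) = c \<odot>\<^bsub>JF0\<^esub> JF0_proj p" "JF0_proj 0 = \<zero>\<^bsub>JF0\<^esub>" "JF0_proj p \<in> carrier JF0"
  using JQ.hom_add[of p q] JQ.hom_mult[of p q] JQ.hom_smult[of p c] JQ.hom_zero JQ.hom_closed[of p] by simp_all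

lemma JF0_carrier: "carrier (JF0 :: ('k::field_char_0, (super_generator, 'k) napoly set set set) superalg) = range JF0_proj"
proof -
  have 1: "carrier (JF0 :: ('k, (super_generator, 'k) napoly set set set) superalg) = (\<lambda>x. JF0_ideal +>\<^bsub>Jzx\<^esub> x) ` carrier Jzx"
    unfolding JF0_eq super_quot_simps(1) JFI.alg_quot_simps(1) by (rule refl)
  have 2: "carrier (Jzx :: ('k, (super_generator, 'k) napoly set set) superalg) = (\<lambda>x. Jzx_ideal +>\<^bsub>Jord\<^esub> x) ` carrier Jord"
    unfolding Jzx_def super_quot_simps(1) JzI.alg_quot_simps(1) by (rule refl)
  have 3: "carrier (Jord :: ('k, (super_generator, 'k) napoly set) superalg) = range (\<lambda>x. jordan_super_ideal +>\<^bsub>free_superalgebra\<^esub> x)"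
    unfolding Jord_def super_quot_simps(1) JI.alg_quot_simps(1) by simp
  show ?thesis unfolding 1 2 3 image_image JF0_proj_def by (rule refl)
qed

lemma JF0_gens:
  "JF0_proj (gen Ev :: (super_generator, 'k::field_char_0) napoly) \<in> part JF0 0"
  "JF0_proj (gen Od :: (super_generator, 'k) napoly) \<in> part JF0 1"
  by (rule JQ.hom_part[OF gen_part(1)], rule JQ.hom_part[OF gen_part(2)])

lemma JF0_skew:
  assumes a: "a \<in> part JF0 i" and b: "b \<in> part JF0 j"
  shows "associator JF0 (JF0_proj (gen Ev)) a b \<oplus>\<^bsub>JF0\<^esub>
    (if i = 1 \<and> j = 1 then - 1 else 1) \<odot>\<^bsub>JF0\<^esub> associator JF0 (JF0_proj (gen Ev)) b a = \<zero>\<^bsub>JF0\<^esub>"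
proof -
  interpret q: super_hom Jord JF0 "\<lambda>p. JF0_ideal +>\<^bsub>Jzx\<^esub> (Jzx_ideal +>\<^bsub>Jord\<^esub> p)"
    by (rule super_hom_compose[OF Jzp.super_hom_axioms JFp.super_hom_axioms])
  let ?q = "\<lambda>p. JF0_ideal +>\<^bsub>Jzx\<^esub> (Jzx_ideal +>\<^bsub>Jord\<^esub> p)"
  have p: "part JF0 i = ?q ` part Jord i" for i unfolding JF0_eq Jzx_def super_quot_simps by (simp add: image_image)
  obtain a' b' where ab: "a' \<in> part Jord i" "b' \<in> part Jord j" "a = ?q a'" "b = ?q b'"
    using a b unfolding p by blast
  note c = Jord.part_closed[OF ab(1)] Jord.part_closed[OF ab(2)]
  have zc: "(Jord_gen Ev :: (super_generator, 'a) napoly set) \<in> carrier Jord" by (rule Jord.part_closed[OF Jord_gen_part(1)])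
  note A = Jord.associator_closed[OF zc c(1,2)] Jord.associator_closed[OF zc c(2,1)]
  let ?c = "if i = 1 \<and> j = 1 then - 1 else 1 :: 'a"
  let ?r = "associator Jord (Jord_gen Ev) a' b' \<oplus>\<^bsub>Jord\<^esub> (?c \<odot>\<^bsub>Jord\<^esub> associator Jord (Jord_gen Ev) b' a')"
  have "?r \<in> Jzx_relations" using ab unfolding Jzx_relations_def by blast
  then have r: "?r \<in> Jzx_ideal" unfolding Jzx_ideal_eq using Jord.alg_ideal_gen_incl by blast
  have "Jzx_ideal +>\<^bsub>Jord\<^esub> ?r = Jzx_ideal" using JzI.coset_zero_iff[OF JzI.I_simps(1)[OF r]] r by blast
  then have "?q ?r = JF0_ideal +>\<^bsub>Jzx\<^esub> \<zero>\<^bsub>Jzx\<^esub>" by (simp add: Jzx_def)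
  also have "\<dots> = \<zero>\<^bsub>JF0\<^esub>" by (rule JFp.hom_zero)
  finally have "?q ?r = \<zero>\<^bsub>JF0\<^esub>" .
  moreover have "?q ?r = associator JF0 (?q (Jord_gen Ev)) (?q a') (?q b') \<oplus>\<^bsub>JF0\<^esub>
    ?c \<odot>\<^bsub>JF0\<^esub> associator JF0 (?q (Jord_gen Ev)) (?q b') (?q a')"
    unfolding q.hom_add[OF A(1) Jord.smult_closed'[OF A(2)]] q.hom_smult[OF A(2)] q.hom_associator[OF zc c(1,2)]
      q.hom_associator[OF zc c(2,1)] by (rule refl)
  ultimately show ?thesis by (simp only: ab JF0_proj_def Jord_gen_def)
qed

lemma JF0_relation:
  "associator JF0 (associator JF0 (JF0_proj (gen Ev)) (JF0_proj (gen Od)) (JF0_proj (gen Od))) (JF0_proj (gen Od)) (JF0_proj (gen Od))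
    = \<zero>\<^bsub>(JF0 :: ('k::field_char_0, (super_generator, 'k) napoly set set set) superalg)\<^esub>"
proof -
  have r: "(JF0_relation :: (super_generator, 'k) napoly set set) \<in> JF0_ideal" unfolding JF0_ideal_def using Jzx.alg_ideal_gen_incl by blast
  then have "JF0_ideal +>\<^bsub>Jzx\<^esub> JF0_relation = \<zero>\<^bsub>(JF0 :: ('k, (super_generator, 'k) napoly set set set) superalg)\<^esub>"
    using JFI.coset_zero_iff[OF JFI.I_simps(1)[OF r]] unfolding JF0_eq by simp
  moreover have "JF0_proj (gen g) = JF0_ideal +>\<^bsub>Jzx\<^esub> (Jzx_gen g :: (super_generator, 'k) napoly set set)" for g
    by (simp add: JF0_proj_def Jzx_gen_def Jord_gen_def)
  moreover have c: "(Jzx_gen g :: (super_generator, 'k) napoly set set) \<in> carrier Jzx" for g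
    using Jzx.part_closed[OF Jzx_gen_part(1)] Jzx.part_closed[OF Jzx_gen_part(2)] by (cases g) simp_all
  ultimately show ?thesis
    unfolding JF0_relation_def JFp.hom_associator[OF Jzx.associator_closed[OF c c c] c c] JFp.hom_associator[OF c c c]
    by (simp only:)
qed

text \<open>Each ideal dies for its own reason: the Jordan ideal because the kernel of
  \<open>jev c\<close> is among the intersected ideals, the skewness relations by
  \<open>VJ_skew\<close>, and the last relation because (z,x,x) has a constant value.\<close>

lemma JF0_lift:
  obtains g where "super_hom JF0 VJ g" "\<And>p. g (JF0_proj p) = jev (c :: 'k::field_char_0) p"
proof -
  have k1: "jev c x = \<zero>\<^bsub>VJ\<^esub>" if x: "x \<in> jordan_super_ideal" for x
  proof -
    have "{x \<in> carrier free_superalgebra. jev c x = \<zero>\<^bsub>VJ\<^esub>} \<in> {I. alg_ideal I free_superalgebra \<and> jordan_superalgebra (super_quot free_superalgebra I)}"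
      using super_hom_kernel[OF jev_super_hom[of c] jordan_superalgebra_vsuper] by blast
    from InterD[OF x[unfolded jordan_super_ideal_def] this] show ?thesis by blast
  qed
  obtain g1 where g1: "super_hom Jord VJ g1" "\<And>x. x \<in> carrier free_superalgebra \<Longrightarrow> g1 (jordan_super_ideal +>\<^bsub>free_superalgebra\<^esub> x) = jev c x"
    by (rule JI.super_quot_lift[OF jordan_super_ideal(2) jev_super_hom k1]) (unfold Jord_def[symmetric], assumption, blast)
  interpret g1: super_hom Jord VJ g1 by fact
  have g1g: "g1 (Jord_gen x) = jv c x" for x unfolding Jord_gen_def by (cases x) (simp_all add: g1(2) jev_simps jv_def)
  have "alg_ideal_gen Jord Jzx_relations \<subseteq> {x \<in> carrier Jord. g1 x = \<zero>\<^bsub>VJ\<^esub>}"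
  proof (rule Jord.alg_ideal_gen_least[OF g1.kernel_ideal], rule subsetI)
    fix s :: "(super_generator, 'k) napoly set" assume s': "s \<in> Jzx_relations"
    then obtain a b i j where ab: "a \<in> part Jord i" "b \<in> part Jord j"
      and s: "s = associator Jord (Jord_gen Ev) a b
          \<oplus>\<^bsub>Jord\<^esub> ((if i = 1 \<and> j = 1 then - 1 else 1) \<odot>\<^bsub>Jord\<^esub> associator Jord (Jord_gen Ev) b a)"
      unfolding Jzx_relations_def by blast
    note cl = Jord.part_closed[OF ab(1)] Jord.part_closed[OF ab(2)]
    have zc: "(Jord_gen Ev :: (super_generator, 'k) napoly set) \<in> carrier Jord" by (rule Jord.part_closed[OF Jord_gen_part(1)])
    note A = Jord.associator_closed[OF zc cl(1,2)] Jord.associator_closed[OF zc cl(2,1)]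
    have "g1 s = associator VJ (g1 (Jord_gen Ev)) (g1 a) (g1 b) \<oplus>\<^bsub>VJ\<^esub>
      (if i = 1 \<and> j = 1 then - 1 else 1) \<odot>\<^bsub>VJ\<^esub> associator VJ (g1 (Jord_gen Ev)) (g1 b) (g1 a)"
      unfolding s g1.hom_add[OF A(1) Jord.smult_closed'[OF A(2)]] g1.hom_smult[OF A(2)] g1.hom_associator[OF zc cl(1,2)]
        g1.hom_associator[OF zc cl(2,1)] by (rule refl)
    also have "\<dots> = \<zero>\<^bsub>VJ\<^esub>" unfolding g1g jv_def super_generator.case
      by (rule VJ_skew[OF g1.hom_part[OF ab(1)] g1.hom_part[OF ab(2)]])
    finally show "s \<in> {x \<in> carrier Jord. g1 x = \<zero>\<^bsub>VJ\<^esub>}"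
      using s' Jzx_relations_part Jord.part_closed by blast
  qed
  then have k2: "g1 x = \<zero>\<^bsub>VJ\<^esub>" if "x \<in> Jzx_ideal" for x using that unfolding Jzx_ideal_eq by blast
  obtain g2 where g2: "super_hom Jzx VJ g2" "\<And>x. x \<in> carrier Jord \<Longrightarrow> g2 (Jzx_ideal +>\<^bsub>Jord\<^esub> x) = g1 x"
    by (rule JzI.super_quot_lift[OF Jzx_ideal_graded g1(1) k2]) (unfold Jzx_def[symmetric], assumption, blast)
  interpret g2: super_hom Jzx VJ g2 by fact
  have g2g: "g2 (Jzx_gen Ev) = ([:0, c:], 0)" "g2 (Jzx_gen Od) = (0, 1)"
    unfolding Jzx_gen_def using g2(2)[OF Jord.part_closed[OF Jord_gen_part(1)]] g2(2)[OF Jord.part_closed[OF Jord_gen_part(2)]]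
    by (simp_all add: g1g jv_def)
  have cl: "(Jzx_gen g :: (super_generator, 'k) napoly set set) \<in> carrier Jzx" for g
    using Jzx.part_closed[OF Jzx_gen_part(1)] Jzx.part_closed[OF Jzx_gen_part(2)] by (cases g) simp_all
  have "g2 JF0_relation = associator VJ (associator VJ (g2 (Jzx_gen Ev)) (g2 (Jzx_gen Od)) (g2 (Jzx_gen Od))) (g2 (Jzx_gen Od)) (g2 (Jzx_gen Od))"
    unfolding JF0_relation_def g2.hom_associator[OF Jzx.associator_closed[OF cl cl cl] cl cl] g2.hom_associator[OF cl cl cl]
    by (rule refl)
  also have "\<dots> = \<zero>\<^bsub>VJ\<^esub>" unfolding g2g associator_VJ vas_even_odd_odd by (simp add: pderiv_pCons zero_prod_def)
  finally have "JF0_relation \<in> {x \<in> carrier Jzx. g2 x = \<zero>\<^bsub>VJ\<^esub>}" using JF0_relation_part Jzx.part_closed by blast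
  then have "JF0_ideal \<subseteq> {x \<in> carrier Jzx. g2 x = \<zero>\<^bsub>VJ\<^esub>}"
    unfolding JF0_ideal_def by (intro Jzx.alg_ideal_gen_least[OF g2.kernel_ideal]) blast
  then have k3: "g2 x = \<zero>\<^bsub>VJ\<^esub>" if "x \<in> JF0_ideal" for x using that by blast
  obtain g3 where g3: "super_hom JF0 VJ g3" "\<And>x. x \<in> carrier Jzx \<Longrightarrow> g3 (JF0_ideal +>\<^bsub>Jzx\<^esub> x) = g2 x"
    by (rule JFI.super_quot_lift[OF JF0_ideal_graded g2(1) k3]) (unfold JF0_eq[symmetric], assumption, blast)
  have "g3 (JF0_proj p) = jev c p" for p
  proof -
    have p: "p \<in> carrier free_superalgebra" by simp
    show ?thesis unfolding JF0_proj_def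
      using g3(2)[OF Jzp.hom_closed[OF Jp.hom_closed[OF p]]] g2(2)[OF Jp.hom_closed[OF p]] g1(2)[OF p] by simp
  qed
  with g3(1) show ?thesis by (rule that)
qed

section \<open>Enlarging the Grassmann support\<close>

lemma env_mult_add_right: "g \<otimes>\<^bsub>EnvM\<^esub> (\<lambda>U. a U + b U) = (\<lambda>U. (g \<otimes>\<^bsub>EnvM\<^esub> a) U + (g \<otimes>\<^bsub>EnvM\<^esub> b) U)"
  by (rule ext) (simp add: m11.vector_env_mult sum.distrib)

lemma env_mult_add_left: "(\<lambda>U. a U + b U) \<otimes>\<^bsub>EnvM\<^esub> g = (\<lambda>U. (a \<otimes>\<^bsub>EnvM\<^esub> g) U + (b \<otimes>\<^bsub>EnvM\<^esub> g) U)"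
  by (rule ext) (simp add: m11.vector_env_mult sum.distrib)

lemma env_mult_vs_right: "g \<otimes>\<^bsub>EnvM\<^esub> (\<lambda>U. vs c (a U)) = (\<lambda>U. vs c ((g \<otimes>\<^bsub>EnvM\<^esub> a) U))"
  by (rule ext) (simp add: m11.vector_env_mult vs_sum mult.commute)

lemma env_mult_sum_right:
  "g \<otimes>\<^bsub>EnvM\<^esub> (\<lambda>U. \<Sum>w\<in>W. vs (c w) (h w U)) = (\<lambda>U. \<Sum>w\<in>W. vs (c w) ((g \<otimes>\<^bsub>EnvM\<^esub> h w) U))"
proof (induction W rule: infinite_finite_induct)
  case (insert w W)
  then show ?case by (simp add: env_mult_add_right env_mult_vs_right)
qed (simp_all add: m11.vector_env_mult)

abbreviation env_pow :: "(nat set \<Rightarrow> 'k::field_char_0 poly \<times> 'k poly) \<Rightarrow> nat \<Rightarrow> (nat set \<Rightarrow> 'k poly \<times> 'k poly) \<Rightarrow> (nat set \<Rightarrow> 'k poly \<times> 'k poly)"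
  where "env_pow g n \<equiv> (\<lambda>a. g \<otimes>\<^bsub>EnvM\<^esub> a) ^^ n"

lemma env_pow_sum:
  "env_pow g n (\<lambda>U. \<Sum>w\<in>W. vs (c w) (h w U)) = (\<lambda>U. \<Sum>w\<in>W. vs (c w) (env_pow g n (h w) U))"
  by (induction n) (simp_all add: env_mult_sum_right)

lemma env_pow_closed: "\<lbrakk>g \<in> carrier EnvM; a \<in> carrier EnvM\<rbrakk> \<Longrightarrow> env_pow g n a \<in> carrier EnvM"
  by (induction n) (simp_all add: m11.env.mult_closed)

text \<open>Even elements with constant coefficients commute and associate with everything in the
  envelope, so multiplication by them passes through all products, symmetrized ones
  included.\<close>

definition centroidal :: "(nat set \<Rightarrow> 'k::field_char_0 poly \<times> 'k poly) \<Rightarrow> bool" where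
  "centroidal g \<longleftrightarrow> g \<in> carrier EnvM \<and> (\<forall>S. snd (g S) = 0 \<and> pderiv (fst (g S)) = 0)"

lemma centroidal_closed: "centroidal g \<Longrightarrow> g \<in> carrier EnvM"
  by (simp add: centroidal_def)

lemma centroidal_mult:
  assumes g: "centroidal g" and a: "a \<in> carrier EnvM" and b: "b \<in> carrier EnvM"
  shows "(g \<otimes>\<^bsub>EnvM\<^esub> a) \<otimes>\<^bsub>EnvM\<^esub> b = g \<otimes>\<^bsub>EnvM\<^esub> (a \<otimes>\<^bsub>EnvM\<^esub> b)"
    "a \<otimes>\<^bsub>EnvM\<^esub> (g \<otimes>\<^bsub>EnvM\<^esub> b) = g \<otimes>\<^bsub>EnvM\<^esub> (a \<otimes>\<^bsub>EnvM\<^esub> b)"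
    "g \<otimes>\<^bsub>EnvM\<^esub> a = a \<otimes>\<^bsub>EnvM\<^esub> g"
proof -
  note gc = centroidal_closed[OF g]
  have v: "m11.vas x y z = 0" "m11.vas y x z = 0" if "snd x = 0" "pderiv (fst x) = 0" for x y z :: "'a poly \<times> 'a poly"
    using that by (simp_all add: m11.vas_def vm_def mu_m11_def pderiv_mult algebra_simps prod_eq_iff)
  have v': "m11.vas (g S) y z = 0" "m11.vas y (g S) z = 0" for S :: "nat set" and y z
    using g by (simp_all add: centroidal_def v)
  have "associator EnvM g a b = \<zero>\<^bsub>EnvM\<^esub>" "associator EnvM a g b = \<zero>\<^bsub>EnvM\<^esub>"
    by (rule ext, simp add: m11.env_associator gc a b v')+
  note as = this[unfolded associator_def]
  show 1: "(g \<otimes>\<^bsub>EnvM\<^esub> a) \<otimes>\<^bsub>EnvM\<^esub> b = g \<otimes>\<^bsub>EnvM\<^esub> (a \<otimes>\<^bsub>EnvM\<^esub> b)"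
    by (rule m11.env.minus_eq_zero_iff[THEN iffD1, OF _ _ as(1)]) (intro m11.env.mult_closed gc a b)+
  have 2: "(a \<otimes>\<^bsub>EnvM\<^esub> g) \<otimes>\<^bsub>EnvM\<^esub> b = a \<otimes>\<^bsub>EnvM\<^esub> (g \<otimes>\<^bsub>EnvM\<^esub> b)"
    by (rule m11.env.minus_eq_zero_iff[THEN iffD1, OF _ _ as(2)]) (intro m11.env.mult_closed gc a b)+
  show 3: "g \<otimes>\<^bsub>EnvM\<^esub> a = a \<otimes>\<^bsub>EnvM\<^esub> g"
  proof (rule m11.env_even_central[OF _ gc a])
    fix S :: "nat set" assume "odd (card S)"
    then have "fst (g S) = 0" using gc by (auto simp: m11.vector_env_carrier)
    then show "g S = 0" using g by (simp add: centroidal_def prod_eq_iff)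
  qed
  show "a \<otimes>\<^bsub>EnvM\<^esub> (g \<otimes>\<^bsub>EnvM\<^esub> b) = g \<otimes>\<^bsub>EnvM\<^esub> (a \<otimes>\<^bsub>EnvM\<^esub> b)"
    unfolding 2[symmetric] 3[symmetric] by (rule 1)
qed

lemma centroidal_commute:
  assumes "centroidal g" "centroidal p" "a \<in> carrier EnvM"
  shows "g \<otimes>\<^bsub>EnvM\<^esub> (p \<otimes>\<^bsub>EnvM\<^esub> a) = p \<otimes>\<^bsub>EnvM\<^esub> (g \<otimes>\<^bsub>EnvM\<^esub> a)"
  by (rule centroidal_mult(2)[OF assms(2) centroidal_closed[OF assms(1)] assms(3)])

interpretation PM: nonassoc_algebra "plus_algebra (EnvM :: ('k::field_char_0, nat set \<Rightarrow> 'k poly \<times> 'k poly) module)"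
  by (rule m11.env.nonassoc_algebra_plus)

abbreviation plus_mult (infixl \<open>\<bullet>\<close> 70) where "a \<bullet> b \<equiv> a \<otimes>\<^bsub>plus_algebra EnvM\<^esub> b"

lemma plus_mult_eq: "a \<bullet> b = (\<lambda>U. vs (1 / 2) ((a \<otimes>\<^bsub>EnvM\<^esub> b) U + (b \<otimes>\<^bsub>EnvM\<^esub> a) U))"
  by simp

lemma centroidal_plus:
  assumes g: "centroidal g" and a: "a \<in> carrier EnvM" and b: "b \<in> carrier EnvM"
  shows "(g \<otimes>\<^bsub>EnvM\<^esub> a) \<bullet> b = g \<otimes>\<^bsub>EnvM\<^esub> (a \<bullet> b)" "a \<bullet> (g \<otimes>\<^bsub>EnvM\<^esub> b) = g \<otimes>\<^bsub>EnvM\<^esub> (a \<bullet> b)"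
  unfolding plus_mult_eq env_mult_vs_right env_mult_add_right centroidal_mult(1,2)[OF g a b] centroidal_mult(1,2)[OF g b a] by (rule refl)+

lemma env_pow_plus:
  assumes g: "centroidal g" and a: "a \<in> carrier EnvM" and b: "b \<in> carrier EnvM"
  shows "env_pow g i a \<bullet> env_pow g j b = env_pow g (i + j) (a \<bullet> b)"
proof -
  note gc = centroidal_closed[OF g]
  have 1: "a \<bullet> env_pow g j b = env_pow g j (a \<bullet> b)"
  proof (induction j)
    case (Suc j)
    then show ?case
      unfolding funpow.simps o_apply centroidal_plus(2)[OF g a env_pow_closed[OF gc b]] by (rule arg_cong)
  qed simp
  show ?thesis
  proof (induction i)
    case 0 then show ?case using 1 by simp
  next
    case (Suc i)
    then show ?case
      unfolding funpow.simps o_apply add_Suc centroidal_plus(1)[OF g env_pow_closed[OF gc a] env_pow_closed[OF gc b]]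
      by (rule arg_cong)
  qed
qed

primrec word_length :: "'x word \<Rightarrow> nat" where
  "word_length (Gen x) = 1"
| "word_length (Mul u v) = word_length u + word_length v"

text \<open>Each leaf contributes one factor g and one factor c, and all of them can be moved to the
  front. The power of c then tells words of different lengths apart.\<close>

lemma word_eval_scaled:
  assumes g: "centroidal g" and u: "\<And>x. u x \<in> carrier EnvM"
  shows "word_eval (plus_algebra EnvM) (\<lambda>x U. vs c ((g \<otimes>\<^bsub>EnvM\<^esub> u x) U)) w
    = (\<lambda>U. vs (c ^ word_length w) (env_pow g (word_length w) (word_eval (plus_algebra EnvM) u w) U))"
proof (induction w)
  case (Mul w1 w2)
  let ?a = "word_eval (plus_algebra EnvM) u w1" and ?b = "word_eval (plus_algebra EnvM) u w2"
  let ?i = "word_length w1" and ?j = "word_length w2"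
  have ab: "?a \<in> carrier EnvM" "?b \<in> carrier EnvM"
    using PM.word_eval_closed[of u] u by simp_all
  have cl: "env_pow g ?i ?a \<in> carrier (plus_algebra EnvM)" "env_pow g ?j ?b \<in> carrier (plus_algebra EnvM)"
    using env_pow_closed[OF centroidal_closed[OF g] ab(1)] env_pow_closed[OF centroidal_closed[OF g] ab(2)] by simp_all
  have sm: "(\<lambda>U. vs d (f U)) = d \<odot>\<^bsub>plus_algebra EnvM\<^esub> f" for d and f :: "nat set \<Rightarrow> 'a poly \<times> 'a poly" by simp
  have "(\<lambda>U. vs (c ^ ?i) (env_pow g ?i ?a U)) \<bullet> (\<lambda>U. vs (c ^ ?j) (env_pow g ?j ?b U))
    = (c ^ ?i) \<odot>\<^bsub>plus_algebra EnvM\<^esub> ((c ^ ?j) \<odot>\<^bsub>plus_algebra EnvM\<^esub> (env_pow g ?i ?a \<bullet> env_pow g ?j ?b))"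
    unfolding sm PM.mult_smult_left[OF cl(1) PM.smult_closed'[OF cl(2)]] PM.mult_smult_right[OF cl] by (rule refl)
  also have "\<dots> = (\<lambda>U. vs (c ^ (?i + ?j)) (env_pow g (?i + ?j) (?a \<bullet> ?b) U))"
    unfolding env_pow_plus[OF g ab] sm[symmetric] vs_simps(3) power_add by (rule refl)
  finally show ?case unfolding word_eval.simps word_length.simps Mul.IH .
qed simp

lemma napoly_eval_plus_EnvM:
  assumes "\<And>x. u x \<in> carrier EnvM"
  shows "napoly_eval (plus_algebra EnvM) u f
    = (\<lambda>U. \<Sum>w\<in>Poly_Mapping.keys f. vs (Poly_Mapping.lookup f w) (word_eval (plus_algebra EnvM) u w U))"
proof -
  have c: "word_eval (plus_algebra EnvM) u w \<in> carrier EnvM" for w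
    using PM.word_eval_closed[of u w] assms by simp
  have "finsum (plus_algebra EnvM) (\<lambda>w. d w \<odot>\<^bsub>plus_algebra EnvM\<^esub> word_eval (plus_algebra EnvM) u w) W
    = (\<lambda>U. \<Sum>w\<in>W. vs (d w) (word_eval (plus_algebra EnvM) u w U))" if "finite W" for W d
    using that
  proof (induction W rule: finite_induct)
    case empty
    then show ?case by (subst PM.M.finsum_empty) simp
  next
    case (insert w W)
    have "(\<lambda>w. d w \<odot>\<^bsub>plus_algebra EnvM\<^esub> word_eval (plus_algebra EnvM) u w) \<in> V \<rightarrow> carrier (plus_algebra EnvM)" for V
      by (intro Pi_I PM.smult_closed' PM.word_eval_closed) (use assms in simp)
    then show ?case using insert by (subst PM.M.finsum_insert) auto
  qed
  then show ?thesis unfolding napoly_eval_def by simp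
qed

subsection \<open>Nilpotent central elements\<close>

text \<open>The sum of xi_{2m} xi_{2m+1} over m in \<open>M\<close>. Each summand has square zero,
  but the nilpotency index of the sum grows with \<open>M\<close>.\<close>

definition pair_elem :: "nat set \<Rightarrow> nat set \<Rightarrow> 'k::field_char_0 poly \<times> 'k poly" where
  "pair_elem M S = (if \<exists>m\<in>M. S = {2 * m, 2 * m + 1} then (1, 0) else 0)"

lemma pair_elem_centroidal: assumes "finite M" shows "centroidal (pair_elem M)"
proof -
  have "{S. pair_elem M S \<noteq> (0 :: 'a poly \<times> 'a poly)} \<subseteq> (\<lambda>m. {2 * m, 2 * m + 1}) ` M" by (auto simp: pair_elem_def)
  then have f: "finite {S. pair_elem M S \<noteq> (0 :: 'a poly \<times> 'a poly)}" using assms by (meson finite_imageI finite_subset)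
  have "pair_elem M S = (0 :: 'a poly \<times> 'a poly)" if "infinite S \<or> odd (card S)" for S
    using that by (auto simp: pair_elem_def)
  then show ?thesis using f by (auto simp: centroidal_def m11.vector_env_carrier pair_elem_def pderiv_1)
qed

lemma pair_elem_insert: "N \<notin> M \<Longrightarrow> pair_elem (insert N M) = (\<lambda>U. pair_elem M U + pair_elem {N} U)"
proof
  fix U assume N: "N \<notin> M"
  have "{2 * N, 2 * N + 1} \<noteq> {2 * m, 2 * m + 1}" if "m \<in> M" for m
  proof -
    have "m \<noteq> N" using that N by blast
    then have "2 * N \<notin> {2 * m, 2 * m + 1}" by (simp; presburger)
    then show ?thesis by blast
  qed
  then show "pair_elem (insert N M) U = (pair_elem M U :: 'a poly \<times> 'a poly) + pair_elem {N} U"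
    by (auto simp: pair_elem_def)
qed

lemma pair_elem_single: "pair_elem {N} = tens (vsuper mu_m11) (1, 0) {2 * N, 2 * N + 1}"
  by (auto simp: pair_elem_def tens_def)

lemma pair_elem_square:
  assumes a: "a \<in> carrier EnvM"
  shows "pair_elem {N} \<otimes>\<^bsub>EnvM\<^esub> (pair_elem {N} \<otimes>\<^bsub>EnvM\<^esub> a) = (\<lambda>U. 0)"
proof -
  have c: "centroidal (pair_elem {N} :: _ \<Rightarrow> 'a poly \<times> 'a poly)" by (rule pair_elem_centroidal) simp
  have "pair_elem {N} \<otimes>\<^bsub>EnvM\<^esub> pair_elem {N} = \<zero>\<^bsub>(EnvM :: ('a, nat set \<Rightarrow> 'a poly \<times> 'a poly) module)\<^esub>"
    unfolding pair_elem_single by (subst m11.tens_mult) auto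
  then have "(pair_elem {N} \<otimes>\<^bsub>EnvM\<^esub> pair_elem {N}) \<otimes>\<^bsub>EnvM\<^esub> a = \<zero>\<^bsub>EnvM\<^esub> \<otimes>\<^bsub>EnvM\<^esub> a" by (simp only:)
  also have "\<dots> = (\<lambda>U. 0)" by (rule ext) (simp add: m11.vector_env_mult)
  finally have "(pair_elem {N} \<otimes>\<^bsub>EnvM\<^esub> pair_elem {N}) \<otimes>\<^bsub>EnvM\<^esub> a = (\<lambda>U. 0)" .
  then show ?thesis unfolding centroidal_mult(1)[OF c centroidal_closed[OF c] a] .
qed

text \<open>The indices 2N and 2N+1 do not occur in the support of \<open>b\<close>, so the
  component of \<open>b\<close> at S reappears, up to sign, at the union of S with this
  pair.\<close>

lemma pair_elem_injective:
  assumes b: "b \<in> carrier EnvM" and N: "\<And>S x. \<lbrakk>b S \<noteq> 0; x \<in> S\<rbrakk> \<Longrightarrow> x < N"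
    and z: "pair_elem {N} \<otimes>\<^bsub>EnvM\<^esub> b = (\<lambda>U. 0 :: 'k::field_char_0 poly \<times> 'k poly)"
  shows "b = (\<lambda>U. 0)"
proof
  fix S show "b S = 0"
  proof (rule ccontr)
    assume nz: "b S \<noteq> 0"
    then have fin: "finite S" using b unfolding m11.vector_env_carrier by blast
    let ?E = "{2 * N, 2 * N + 1}"
    have d: "S \<inter> ?E = {}" using N[OF nz] by force
    let ?U = "S \<union> ?E"
    have "(pair_elem {N} \<otimes>\<^bsub>EnvM\<^esub> b) ?U = (\<Sum>T\<in>Pow ?U. if T = ?E then vs (grassmann_sign ?E S) (b S) else 0)"
      unfolding m11.vector_env_mult
    proof (rule sum.cong[OF refl])
      fix T
      have "?U - ?E = S" using d by blast
      moreover have "vm mu_m11 (1, 0) y = y" for y :: "'k poly \<times> 'k poly" by (simp add: vm_def prod_eq_iff)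
      ultimately show "vs (grassmann_sign T (?U - T)) (vm mu_m11 (pair_elem {N} T) (b (?U - T)))
        = (if T = ?E then vs (grassmann_sign ?E S) (b S) else 0)"
        by (cases "T = ?E") (simp_all add: pair_elem_def)
    qed
    also have "\<dots> = vs (grassmann_sign ?E S) (b S)"
    proof -
      have "finite (Pow ?U)" "?E \<in> Pow ?U" using fin by simp_all
      then show ?thesis by (simp only: sum.delta if_True)
    qed
    finally have "vs (grassmann_sign ?E S) (b S) = 0" using z by simp
    then have "vs (inverse (grassmann_sign ?E S)) (vs (grassmann_sign ?E S) (b S)) = 0" by simp
    moreover have "inverse (grassmann_sign ?E S) * grassmann_sign ?E S = (1 :: 'k)" by (simp add: grassmann_sign_def)
    ultimately have "b S = 0" by (simp only: vs_simps)
    with nz show False by contradiction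
  qed
qed

text \<open>The binomial formula for g + p, cut off after the linear term because p has square
  zero.\<close>

lemma env_pow_pair:
  assumes M: "finite M" "N \<notin> M" and a: "a \<in> carrier EnvM"
  shows "env_pow (pair_elem (insert N M)) (Suc n) a = (\<lambda>U. env_pow (pair_elem M) (Suc n) a U
    + vs (of_nat (Suc n)) ((pair_elem {N} \<otimes>\<^bsub>EnvM\<^esub> env_pow (pair_elem M) n a) U))"
proof (induction n)
  case 0
  show ?case by (simp add: pair_elem_insert[OF M(2)] env_mult_add_left)
next
  case (Suc n)
  let ?g = "pair_elem M :: nat set \<Rightarrow> 'a poly \<times> 'a poly" and ?p = "pair_elem {N} :: nat set \<Rightarrow> 'a poly \<times> 'a poly"
  have g: "centroidal ?g" "centroidal ?p" using M by (auto intro: pair_elem_centroidal)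
  let ?b = "env_pow ?g n a"
  have b: "?b \<in> carrier EnvM" by (rule env_pow_closed[OF centroidal_closed[OF g(1)] a])
  have "env_pow (pair_elem (insert N M)) (Suc (Suc n)) a = pair_elem (insert N M) \<otimes>\<^bsub>EnvM\<^esub> env_pow (pair_elem (insert N M)) (Suc n) a"
    by simp
  also have "\<dots> = (\<lambda>U. ?g U + ?p U) \<otimes>\<^bsub>EnvM\<^esub> (\<lambda>U. env_pow ?g (Suc n) a U + vs (of_nat (Suc n)) ((?p \<otimes>\<^bsub>EnvM\<^esub> ?b) U))"
    unfolding Suc.IH unfolding pair_elem_insert[OF M(2)] by (rule refl)
  also have "\<dots> = (\<lambda>U. ((?g \<otimes>\<^bsub>EnvM\<^esub> env_pow ?g (Suc n) a) U + vs (of_nat (Suc n)) ((?g \<otimes>\<^bsub>EnvM\<^esub> (?p \<otimes>\<^bsub>EnvM\<^esub> ?b)) U))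
    + ((?p \<otimes>\<^bsub>EnvM\<^esub> env_pow ?g (Suc n) a) U + vs (of_nat (Suc n)) ((?p \<otimes>\<^bsub>EnvM\<^esub> (?p \<otimes>\<^bsub>EnvM\<^esub> ?b)) U)))"
    unfolding env_mult_add_left env_mult_add_right env_mult_vs_right by (rule refl)
  also have "\<dots> = (\<lambda>U. (?g \<otimes>\<^bsub>EnvM\<^esub> env_pow ?g (Suc n) a) U + vs (of_nat (Suc (Suc n))) ((?p \<otimes>\<^bsub>EnvM\<^esub> env_pow ?g (Suc n) a) U))"
  proof -
    have e: "env_pow ?g (Suc n) a = ?g \<otimes>\<^bsub>EnvM\<^esub> ?b" by simp
    have v: "vs (of_nat (Suc (Suc n))) y = y + vs (of_nat (Suc n)) y" for y :: "'a poly \<times> 'a poly"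
      unfolding of_nat_Suc[of "Suc n"] vs_simps(2,4) by (rule refl)
    show ?thesis
      unfolding centroidal_commute[OF g b] pair_elem_square[OF b] v e
      by (rule ext) (simp only: vs_simps(6) add_0_right add_0_left add_ac)
  qed
  finally show ?case by simp
qed

text \<open>Enlarging M by an index N beyond M and beyond the support of g^n a, and comparing the
  two vanishing (n+1)st powers, leaves (n+1) p g^n a = 0. Multiplication by p is injective on g^n a,
  so g^n a = 0, and the exponent drops by one.\<close>

lemma env_pow_nilpotent:
  assumes a: "a \<in> carrier EnvM" and z: "\<And>M. finite M \<Longrightarrow> env_pow (pair_elem M) n a = (\<lambda>U. 0 :: 'k::field_char_0 poly \<times> 'k poly)"
  shows "a = (\<lambda>U. 0)"
  using z
proof (induction n)
  case 0
  from 0[of "{}"] show ?case by simp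
next
  case (Suc n)
  show ?case
  proof (rule Suc.IH)
    fix M :: "nat set" assume M: "finite M"
    let ?b = "env_pow (pair_elem M) n a :: nat set \<Rightarrow> 'k poly \<times> 'k poly"
    have b: "?b \<in> carrier EnvM" by (rule env_pow_closed[OF centroidal_closed[OF pair_elem_centroidal[OF M]] a])
    have "finite {S. ?b S \<noteq> 0}" "\<And>S. ?b S \<noteq> 0 \<Longrightarrow> finite S" using b unfolding m11.vector_env_carrier by blast+
    then have "finite (\<Union>{S. ?b S \<noteq> 0} \<union> M)" using M by blast
    then obtain N where N: "\<And>x. x \<in> \<Union>{S. ?b S \<noteq> 0} \<union> M \<Longrightarrow> x < N" unfolding finite_nat_set_iff_bounded by blast
    then have NM: "N \<notin> M" by blast
    have z: "env_pow (pair_elem (insert N M)) (Suc n) a = (\<lambda>U. 0)" "env_pow (pair_elem M) (Suc n) a = (\<lambda>U. 0)"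
      by (rule Suc.prems, simp add: M, rule Suc.prems[OF M])
    have e: "vs (of_nat (Suc n)) ((pair_elem {N} \<otimes>\<^bsub>EnvM\<^esub> ?b) U) = 0" for U
      by (rule fun_cong[OF env_pow_pair[OF M NM a, of n], of U, unfolded z(1) z(2) add_0_left, symmetric])
    have "vs (inverse (of_nat (Suc n))) (vs (of_nat (Suc n)) ((pair_elem {N} \<otimes>\<^bsub>EnvM\<^esub> ?b) U)) = 0" for U
      by (simp only: e vs_simps(6))
    moreover have "inverse (of_nat (Suc n)) * of_nat (Suc n) = (1 :: 'k)" by (rule left_inverse) (rule of_nat_neq_0)
    ultimately have "pair_elem {N} \<otimes>\<^bsub>EnvM\<^esub> ?b = (\<lambda>U. 0)" by (simp only: vs_simps fun_eq_iff simp_thms)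
    then show "?b = (\<lambda>U. 0)" by (rule pair_elem_injective[OF b, rotated]) (use N in blast)
  qed
qed

subsection \<open>Identities of \<open>A\<^sub>0\<^sup>+\<close>\<close>

text \<open>Arguments c g u(x) have no component at the empty set, hence lie in the image of
  \<open>A0\<close>. The value of f there is a polynomial in c whose coefficients are g^n times the
  part of f of word length n. Each of them vanishes, and letting g vary over all
  \<open>pair_elem M\<close> removes the factor g^n.\<close>

lemma identities_plus_A0_le:
  "identities (plus_algebra A0) \<subseteq> identities (plus_algebra (EnvM :: ('k::field_char_0, nat set \<Rightarrow> 'k poly \<times> 'k poly) module))"
proof
  fix f :: "(nat, 'k) napoly" assume f: "f \<in> identities (plus_algebra A0)"
  obtain h where h: "h \<in> alg_hom A0 EnvM" "\<And>p. h (A0_proj p) = A0_ev (1 :: 'k) p"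
    by (rule A0_rep_hom[where c = 1]) (rule that, assumption, blast)
  interpret h: nonassoc_hom A0 EnvM h
    by (intro nonassoc_homI A0.nonassoc_algebra_axioms m11.nonassoc_algebra_env h)
  interpret PA: nonassoc_algebra "plus_algebra (A0 :: ('k, _) module)" by (rule A0.nonassoc_algebra_plus)
  interpret hp: nonassoc_hom "plus_algebra A0" "plus_algebra EnvM" h
    by (intro nonassoc_homI PA.nonassoc_algebra_axioms PM.nonassoc_algebra_axioms h.hom_plus)
  have ev0: "napoly_eval (plus_algebra EnvM) v f = (\<lambda>U. 0)"
    if v: "\<And>x. v x \<in> carrier EnvM" "\<And>x. coeff (fst (v x {})) 0 = 0" for v
  proof -
    have "\<exists>a. a \<in> carrier A0 \<and> h a = v x" for x using A0_image[OF h v(1) v(2)] by (metis imageE)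
    then obtain a where a: "\<And>x. a x \<in> carrier A0" "\<And>x. h (a x) = v x" by metis
    have "napoly_eval (plus_algebra A0) a f = \<zero>\<^bsub>plus_algebra A0\<^esub>"
      using f a(1) unfolding PA.identities_iff by simp
    then have "h (napoly_eval (plus_algebra A0) a f) = \<zero>\<^bsub>plus_algebra EnvM\<^esub>" using hp.hom_zero by simp
    moreover have "h (napoly_eval (plus_algebra A0) a f) = napoly_eval (plus_algebra EnvM) (\<lambda>x. h (a x)) f"
      by (rule hp.hom_napoly_eval) (simp add: a)
    ultimately show ?thesis by (simp add: a(2))
  qed
  show "f \<in> identities (plus_algebra EnvM)"
    unfolding PM.identities_iff
  proof (intro allI impI)
    fix u :: "nat \<Rightarrow> nat set \<Rightarrow> 'k poly \<times> 'k poly" assume "\<forall>x. u x \<in> carrier (plus_algebra EnvM)"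
    then have u: "u x \<in> carrier EnvM" for x by simp
    let ?w = "word_eval (plus_algebra EnvM) u"
    let ?c = "Poly_Mapping.lookup f" and ?K = "Poly_Mapping.keys f"
    define F where "F n = (\<lambda>U. \<Sum>w\<in>{w \<in> ?K. word_length w = n}. vs (?c w) (?w w U))" for n
    have wc: "?w w \<in> carrier EnvM" for w using PM.word_eval_closed[of u w] u by simp
    have Fc: "F n \<in> carrier EnvM" for n
    proof -
      have "(\<lambda>U. \<Sum>w\<in>W. vs (?c w) (?w w U)) \<in> carrier EnvM" if "finite W" for W
        using that
      proof (induction W rule: finite_induct)
        case empty
        show ?case using m11.env.M.zero_closed by simp
      next
        case (insert w W)
        then show ?case using m11.env.M.a_closed[OF m11.env.smult_closed'[OF wc[of w]] insert.IH, of "?c w"] by simp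
      qed
      then show ?thesis unfolding F_def by simp
    qed
    have "env_pow (pair_elem M) n (F n) = (\<lambda>U. 0)" if M: "finite M" for M n
    proof (cases "n \<in> word_length ` ?K")
      case False
      then have "F n = (\<lambda>U. \<Sum>w\<in>{}. vs (?c w) (?w w U))" unfolding F_def by (intro ext sum.cong) auto
      then show ?thesis using env_pow_sum[where W = "{}" and g = "pair_elem M" and n = n] by simp
    next
      case True
      note g = pair_elem_centroidal[OF M, where 'a = 'k]
      let ?g = "pair_elem M :: nat set \<Rightarrow> 'k poly \<times> 'k poly"
      let ?T = "\<lambda>w U. env_pow ?g (word_length w) (?w w) U"
      have sum0: "(\<Sum>w\<in>?K. vs (x ^ word_length w) (vs (?c w) (?T w U))) = 0" for x U
      proof -
        let ?v = "\<lambda>y U. vs x ((?g \<otimes>\<^bsub>EnvM\<^esub> u y) U)"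
        have vc: "?v y \<in> carrier EnvM" for y
          using m11.env.smult_closed'[OF m11.env.mult_closed[OF centroidal_closed[OF g] u[of y]], of x] by simp
        have "(?g \<otimes>\<^bsub>EnvM\<^esub> u y) {} = 0" for y by (simp add: m11.vector_env_mult pair_elem_def)
        then have "napoly_eval (plus_algebra EnvM) ?v f = (\<lambda>U. 0)" by (intro ev0 vc) simp
        then have "(\<Sum>w\<in>?K. vs (?c w) (vs (x ^ word_length w) (?T w U))) = 0"
          unfolding napoly_eval_plus_EnvM[OF vc] word_eval_scaled[OF g u] by (rule fun_cong)
        then show ?thesis by (simp only: vs_simps(3) mult.commute)
      qed
      have "env_pow ?g n (F n) U = 0" for U
      proof -
        \<comment> \<open>The Vandermonde argument concerns scalars, so it is applied after a linear
          functional; the coefficient functionals together separate pairs of polynomials.\<close>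
        have lin: "\<phi> (env_pow ?g n (F n) U) = 0"
          if \<phi>: "\<And>p q. \<phi> (p + q) = \<phi> p + \<phi> q" "\<And>c p. \<phi> (vs c p) = c * \<phi> p" for \<phi> :: "'k poly \<times> 'k poly \<Rightarrow> 'k"
        proof -
          have \<phi>0: "\<phi> 0 = 0" using \<phi>(2)[of 0 0] by simp
          have \<phi>s: "\<phi> (sum k W) = (\<Sum>w\<in>W. \<phi> (k w))" for k :: "nat word \<Rightarrow> _" and W
            by (induction W rule: infinite_finite_induct) (simp_all add: \<phi> \<phi>0)
          let ?d = "\<lambda>n. \<Sum>w\<in>{w \<in> ?K. word_length w = n}. \<phi> (vs (?c w) (?T w U))"
          have "?d n = 0"
          proof (rule vandermonde_zero[of "word_length ` ?K" "\<lambda>n. n" ?d n])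
            fix x :: 'k
            have "0 = (\<Sum>w\<in>?K. x ^ word_length w * \<phi> (vs (?c w) (?T w U)))"
              using arg_cong[OF sum0[of x U], of \<phi>] by (simp only: \<phi>s \<phi> \<phi>0)
            also have "\<dots> = (\<Sum>m\<in>word_length ` ?K. \<Sum>w\<in>{w \<in> ?K. word_length w = m}. x ^ word_length w * \<phi> (vs (?c w) (?T w U)))"
              by (rule sum.image_gen) simp
            also have "\<dots> = (\<Sum>m\<in>word_length ` ?K. ?d m * x ^ m)"
              by (rule sum.cong[OF refl], unfold sum_distrib_right, rule sum.cong[OF refl]) (simp add: mult.commute)
            finally show "(\<Sum>m\<in>word_length ` ?K. ?d m * x ^ m) = 0" by (rule sym)
          qed (use True in simp_all)
          moreover have "\<phi> (env_pow ?g n (F n) U) = ?d n"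
            unfolding F_def env_pow_sum \<phi>s by (rule sum.cong) simp_all
          ultimately show ?thesis by simp
        qed
        have "coeff (fst (env_pow ?g n (F n) U)) k = 0" "coeff (snd (env_pow ?g n (F n) U)) k = 0" for k
          by (rule lin[of "\<lambda>p. coeff (fst p) k"], simp, simp add: vs_def,
              rule lin[of "\<lambda>p. coeff (snd p) k"], simp, simp add: vs_def)
        then show ?thesis by (simp add: prod_eq_iff poly_eq_iff)
      qed
      then show ?thesis by (simp add: fun_eq_iff)
    qed
    then have F0: "F n = (\<lambda>U. 0)" for n by (rule env_pow_nilpotent[OF Fc])
    have "(\<Sum>w\<in>?K. vs (?c w) (?w w U)) = (\<Sum>n\<in>word_length ` ?K. F n U)" for U
      unfolding F_def by (rule sum.image_gen) simp
    then show "napoly_eval (plus_algebra EnvM) u f = \<zero>\<^bsub>plus_algebra EnvM\<^esub>"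
      unfolding napoly_eval_plus_EnvM[OF u] by (simp add: F0)
  qed
qed

lemma identities_plus_A0:
  "identities (plus_algebra A0) = identities (plus_algebra (EnvM :: ('k::field_char_0, nat set \<Rightarrow> 'k poly \<times> 'k poly) module))"
proof (rule subset_antisym[OF identities_plus_A0_le], rule subsetI)
  fix f :: "(nat, 'k) napoly" assume f: "f \<in> identities (plus_algebra EnvM)"
  interpret PA: nonassoc_algebra "plus_algebra (A0 :: ('k, _) module)" by (rule A0.nonassoc_algebra_plus)
  show "f \<in> identities (plus_algebra A0)"
    unfolding PA.identities_iff
  proof (intro allI impI)
    fix a :: "nat \<Rightarrow> (A0_generator, 'k) napoly set set" assume a: "\<forall>x. a x \<in> carrier (plus_algebra A0)"
    let ?e = "napoly_eval (plus_algebra A0) a f"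
    have "?e \<in> carrier A0" using PA.napoly_eval_closed[of a f] a by simp
    then obtain p where p: "?e = A0_proj p" unfolding A0_carrier by blast
    have "A0_ev c p = \<zero>\<^bsub>EnvM\<^esub>" for c
    proof -
      obtain h where h: "h \<in> alg_hom A0 EnvM" "\<And>p. h (A0_proj p) = A0_ev c p"
        by (rule A0_rep_hom[where c = c]) (rule that, assumption, blast)
      interpret h: nonassoc_hom A0 EnvM h
        by (intro nonassoc_homI A0.nonassoc_algebra_axioms m11.nonassoc_algebra_env h)
      interpret hp: nonassoc_hom "plus_algebra A0" "plus_algebra EnvM" h
        by (intro nonassoc_homI PA.nonassoc_algebra_axioms PM.nonassoc_algebra_axioms h.hom_plus)
      have "A0_ev c p = h ?e" unfolding p h(2) ..
      also have "\<dots> = napoly_eval (plus_algebra EnvM) (\<lambda>x. h (a x)) f" by (rule hp.hom_napoly_eval) (use a in simp)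
      also have "\<dots> = \<zero>\<^bsub>plus_algebra EnvM\<^esub>"
        by (rule f[unfolded PM.identities_iff, THEN spec, THEN mp], rule allI, rule hp.hom_closed) (use a in simp)
      finally show ?thesis by simp
    qed
    then show "?e = \<zero>\<^bsub>plus_algebra A0\<^esub>" using A0_separation[of p] p by simp
  qed
qed

subsection \<open>Normal forms in \<open>JF\<^sub>0\<close>\<close>

interpretation JS: jordan_super "JF0 :: ('k::field_char_0, (super_generator, 'k) napoly set set set) superalg"
  by unfold_locales (rule JF0_jordan[unfolded jordan_superalgebra_def, THEN conjunct2])

lemma JF0_z: "JF0_proj (gen Ev :: (super_generator, 'k::field_char_0) napoly) \<in> JS.Zev"
  unfolding JS.Zev_def mem_Collect_eq
proof
  show "JF0_proj (gen Ev :: (super_generator, 'k) napoly) \<in> part JF0 0" by (rule JF0_gens(1))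
  then show "tens JF0 (JF0_proj (gen Ev :: (super_generator, 'k) napoly)) {} \<in> jordan_Z (grassmann_envelope JF0)"
    by (rule superalgebra.jordan_Z_tens[OF JF.superalgebra_axioms]) (rule JF0_skew)
qed

lemma JF0_proj_diff: "JF0_proj (p - r) = JF0_proj p \<ominus>\<^bsub>JF0\<^esub> JF0_proj r"
proof -
  have "JF0_proj (p + napoly_smult (- 1) r) = JF0_proj p \<oplus>\<^bsub>JF0\<^esub> (- 1) \<odot>\<^bsub>JF0\<^esub> JF0_proj r"
    by (simp only: JF0_proj_simps)
  then show ?thesis
    unfolding a_minus_def JF.uminus_eq_smult[OF JF0_proj_simps(5)] napoly_smult_minus_one by simp
qed

lemma JF0_proj_eq_iff: "JF0_proj (p - r) = \<zero>\<^bsub>JF0\<^esub> \<longleftrightarrow> JF0_proj p = JF0_proj r"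
  unfolding JF0_proj_diff by (rule JF.minus_eq_zero_iff) (rule JF0_proj_simps(5))+

interpretation JN: nalg_scaled napoly_mult "{p. JF0_proj p = \<zero>\<^bsub>JF0\<^esub>}"
  "napoly_smult :: 'k::field_char_0 \<Rightarrow> (super_generator, 'k) napoly \<Rightarrow> _"
proof -
  let ?K = "{p :: (super_generator, 'k) napoly. JF0_proj p = \<zero>\<^bsub>JF0\<^esub>}"
  have h: "(JF0_proj :: (super_generator, 'k) napoly \<Rightarrow> _) \<in> alg_hom (free_algebra UNIV) JF0"
    by (rule alg_homI) (simp_all add: JF0_proj_simps)
  interpret N: nalg_mod napoly_mult ?K by (rule kernel_nalg_mod[OF JF.nonassoc_algebra_axioms h])
  show "nalg_scaled napoly_mult ?K napoly_smult"
    by unfold_locales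
      (simp_all add: napoly_smult_add napoly_add_smult napoly_smult_smult napoly_mult_smult_left
        napoly_mult_smult_right JF0_proj_simps)
qed

lemma JF0_as: "JF0_proj (JN.as x y z) = associator JF0 (JF0_proj x) (JF0_proj y) (JF0_proj z)"
  unfolding JN.as_def associator_def JF0_proj_diff JF0_proj_simps(2) by (rule refl)

definition wE :: "(super_generator, 'k::field_char_0) napoly" where
  "wE = JN.as (gen Ev) (gen Od) (gen Od)"

text \<open>Adjoining associators (c,x,x) of letters stops at w = (z,x,x), because the relation of
  \<open>JF0\<close> makes (w,x,x) zero.\<close>

definition JF0_letters :: "(super_generator, 'k::field_char_0) napoly set" where
  "JF0_letters = {gen Ev, wE}"

definition JF0_odd :: "(super_generator, 'k::field_char_0) napoly set" where
  "JF0_odd = {gen Od}"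

lemma JF0_letter_Zev: assumes "c \<in> JF0_letters" shows "JF0_proj c \<in> JS.Zev"
proof -
  have "JF0_proj wE \<in> JS.Zev" unfolding wE_def JF0_as by (rule JS.Zev_associator[OF JF0_z JF0_gens(2) JF0_gens(2)])
  then show ?thesis using assms JF0_z unfolding JF0_letters_def by blast
qed

lemma JF0_even_Zev: "JN.even_mono JF0_letters u \<Longrightarrow> JF0_proj u \<in> JS.Zev"
proof (induction rule: JN.even_mono.induct)
  case (1 c) then show ?case by (rule JF0_letter_Zev)
next
  case (2 c x)
  then show ?case unfolding JF0_proj_simps(2) using JS.Zev_mult[OF JF0_letter_Zev[OF 2(1)]] by blast
qed

lemma JF0_odd_part: "JN.odd_mono JF0_letters JF0_odd y \<Longrightarrow> JF0_proj y \<in> part JF0 1"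
proof (induction rule: JN.odd_mono.induct)
  case (1 e) then show ?case using JF0_gens(2) unfolding JF0_odd_def by blast
next
  case (2 c x)
  show ?case
    unfolding JF0_proj_simps(2)
    using JF.part_mult[OF JS.Zev_part[OF JF0_letter_Zev[OF 2(1)]] 2(3)] unfolding add_0_left .
qed

text \<open>The shift coefficient is -1: for odd x and y, x(cy) = -(cy)x = -(c,y,x) - c(yx), and
  symmetry of (c,_,_) on odd elements together with yx = -xy turns this into c(xy) -
  (c,x,y).\<close>

lemma JF0_span_mult:
  assumes "x \<in> JN.mono_span JF0_letters JF0_odd" "y \<in> JN.mono_span JF0_letters JF0_odd"
  shows "napoly_mult x y \<in> JN.mono_span JF0_letters (JF0_odd :: (super_generator, 'k::field_char_0) napoly set)"
proof (rule JN.mono_span_mult[where \<alpha> = "- 1"])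
  note q = JF0_proj_simps(5)
  fix c x y :: "(super_generator, 'k) napoly"
  assume c: "c \<in> JF0_letters" and x: "JN.even_mono JF0_letters x"
    and y: "JN.even_mono JF0_letters y \<or> JN.odd_mono JF0_letters JF0_odd y"
  have "JF0_proj y \<in> part JF0 0 \<or> JF0_proj y \<in> part JF0 1"
    using y JS.Zev_part[OF JF0_even_Zev] JF0_odd_part by blast
  then have "associator JF0 (JF0_proj c) (JF0_proj x) (JF0_proj y) = \<zero>\<^bsub>JF0\<^esub>"
    using JS.Zev_assoc[OF JF0_letter_Zev[OF c] JF0_even_Zev[OF x]] by blast
  then show "JN.as c x y \<in> {p. JF0_proj p = \<zero>\<^bsub>JF0\<^esub>}" by (simp add: JF0_as)
next
  fix x y :: "(super_generator, 'k) napoly"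
  assume x: "JN.even_mono JF0_letters x" and y: "JN.odd_mono JF0_letters JF0_odd y"
  show "napoly_mult y x - napoly_mult x y \<in> {p. JF0_proj p = \<zero>\<^bsub>JF0\<^esub>}"
    using JS.even_odd_commute[OF JS.Zev_part[OF JF0_even_Zev[OF x]] JF0_odd_part[OF y]]
    by (simp add: JF0_proj_eq_iff JF0_proj_simps(2))
next
  fix e e' :: "(super_generator, 'k) napoly"
  assume e: "e \<in> JF0_odd" "e' \<in> JF0_odd"
  let ?a = "JF0_proj (gen Od :: (super_generator, 'k) napoly) \<otimes>\<^bsub>JF0\<^esub> JF0_proj (gen Od)"
  have a: "?a \<in> carrier JF0" by (rule JF.mult_closed) (rule JF0_proj_simps(5))+
  \<comment> \<open>Anticommutativity makes the square of the odd generator equal to its negative,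
    hence zero.\<close>
  have "?a = \<ominus>\<^bsub>JF0\<^esub> ?a" by (rule JS.odd_anticommute[OF JF0_gens(2) JF0_gens(2)])
  then have "?a \<oplus>\<^bsub>JF0\<^esub> ?a = \<ominus>\<^bsub>JF0\<^esub> ?a \<oplus>\<^bsub>JF0\<^esub> ?a" by (rule arg_cong)
  also have "\<dots> = \<zero>\<^bsub>JF0\<^esub>" by (rule JF.M.l_neg[OF a])
  finally have "(1 + 1) \<odot>\<^bsub>JF0\<^esub> ?a = \<zero>\<^bsub>JF0\<^esub>" unfolding JF.smult_add_left[OF a] JF.one_smult[OF a] .
  then have "?a = \<zero>\<^bsub>JF0\<^esub>" by (rule JF.smult_eq_zeroD[rotated 2]) (use a in simp_all)
  then have "napoly_mult e e' \<in> {p. JF0_proj p = \<zero>\<^bsub>JF0\<^esub>}" using e by (simp add: JF0_odd_def JF0_proj_simps(2))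
  then show "napoly_mult e e' \<in> JN.mono_span JF0_letters JF0_odd" by (rule JN.mono_span.ideal)
next
  fix c d x y :: "(super_generator, 'k) napoly"
  assume c: "c \<in> JF0_letters" and d: "d \<in> JF0_letters"
    and x: "JN.odd_mono JF0_letters JF0_odd x" and y: "JN.odd_mono JF0_letters JF0_odd y"
  note Z = JF0_letter_Zev[OF c] JF0_letter_Zev[OF d] and O = JF0_odd_part[OF x] JF0_odd_part[OF y]
  show "JN.as c (napoly_mult d x) y - napoly_mult d (JN.as c x y) \<in> {p. JF0_proj p = \<zero>\<^bsub>JF0\<^esub>}"
    using JS.Zev_pull[OF Z O] by (simp only: mem_Collect_eq JF0_proj_eq_iff JF0_as JF0_proj_simps(2))
  have dy: "JF0_proj d \<otimes>\<^bsub>JF0\<^esub> JF0_proj y \<in> part JF0 1"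
    using JF.part_mult[OF JS.Zev_part[OF Z(2)] O(2)] unfolding add_0_left .
  show "JN.as c x (napoly_mult d y) - napoly_mult d (JN.as c x y) \<in> {p. JF0_proj p = \<zero>\<^bsub>JF0\<^esub>}"
    using JS.Zev_odd_symmetric[OF Z(1) O(1) dy] JS.Zev_pull[OF Z O(2,1)] JS.Zev_odd_symmetric[OF Z(1) O(2,1)]
    by (simp only: mem_Collect_eq JF0_proj_eq_iff JF0_as JF0_proj_simps(2))
next
  fix c e e' :: "(super_generator, 'k) napoly"
  assume c: "c \<in> JF0_letters" and e: "e \<in> JF0_odd" "e' \<in> JF0_odd"
  then have e: "e = gen Od" "e' = gen Od" by (simp_all add: JF0_odd_def)
  have w: "wE \<in> JF0_letters" by (simp add: JF0_letters_def)
  consider "c = gen Ev" | "c = wE" using c by (auto simp: JF0_letters_def)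
  then show "JN.as c e e' \<in> JN.mono_span JF0_letters JF0_odd"
  proof cases
    case 1
    then have "JN.as c e e' = wE" by (simp add: e wE_def)
    then show ?thesis using JN.mono_span.even[OF JN.even_mono.intros(1)[OF w]] by simp
  next
    case 2
    have "JN.as c e e' \<in> {p. JF0_proj p = \<zero>\<^bsub>JF0\<^esub>}"
      using JF0_relation unfolding 2 e wE_def mem_Collect_eq JF0_as .
    then show ?thesis by (rule JN.mono_span.ideal)
  qed
next
  fix c x y :: "(super_generator, 'k) napoly"
  assume c: "c \<in> JF0_letters"
    and x: "JN.odd_mono JF0_letters JF0_odd x" and y: "JN.odd_mono JF0_letters JF0_odd y"
  note Z = JF0_letter_Zev[OF c] and O = JF0_odd_part[OF x] JF0_odd_part[OF y]
  let ?C = "JF0_proj c" and ?X = "JF0_proj x" and ?Y = "JF0_proj y"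
  have cl: "?C \<in> carrier JF0" "?X \<in> carrier JF0" "?Y \<in> carrier JF0" by (rule JF0_proj_simps(5))+
  note m = JF.mult_closed
  have cy: "?C \<otimes>\<^bsub>JF0\<^esub> ?Y \<in> part JF0 1" using JF.part_mult[OF JS.Zev_part[OF Z] O(2)] unfolding add_0_left .
  have "?X \<otimes>\<^bsub>JF0\<^esub> (?C \<otimes>\<^bsub>JF0\<^esub> ?Y) = \<ominus>\<^bsub>JF0\<^esub> ((?C \<otimes>\<^bsub>JF0\<^esub> ?Y) \<otimes>\<^bsub>JF0\<^esub> ?X)"
    by (rule JS.odd_anticommute[OF O(1) cy])
  also have "(?C \<otimes>\<^bsub>JF0\<^esub> ?Y) \<otimes>\<^bsub>JF0\<^esub> ?X = associator JF0 ?C ?Y ?X \<oplus>\<^bsub>JF0\<^esub> ?C \<otimes>\<^bsub>JF0\<^esub> (?Y \<otimes>\<^bsub>JF0\<^esub> ?X)"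
    using cl by (simp add: associator_def a_minus_def JF.M.a_assoc JF.M.l_neg m)
  also have "associator JF0 ?C ?Y ?X = associator JF0 ?C ?X ?Y" by (rule JS.Zev_odd_symmetric[OF Z O(2,1)])
  also have "?C \<otimes>\<^bsub>JF0\<^esub> (?Y \<otimes>\<^bsub>JF0\<^esub> ?X) = \<ominus>\<^bsub>JF0\<^esub> (?C \<otimes>\<^bsub>JF0\<^esub> (?X \<otimes>\<^bsub>JF0\<^esub> ?Y))"
    unfolding JS.odd_anticommute[OF O(2,1)] by (rule JF.mult_uminus[OF cl(1) m[OF cl(2,3)]])
  also have "\<ominus>\<^bsub>JF0\<^esub> (associator JF0 ?C ?X ?Y \<oplus>\<^bsub>JF0\<^esub> \<ominus>\<^bsub>JF0\<^esub> (?C \<otimes>\<^bsub>JF0\<^esub> (?X \<otimes>\<^bsub>JF0\<^esub> ?Y)))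
    = \<ominus>\<^bsub>JF0\<^esub> associator JF0 ?C ?X ?Y \<oplus>\<^bsub>JF0\<^esub> ?C \<otimes>\<^bsub>JF0\<^esub> (?X \<otimes>\<^bsub>JF0\<^esub> ?Y)"
    using cl by (simp add: JF.M.minus_add m JF.associator_closed)
  also have "\<dots> = ?C \<otimes>\<^bsub>JF0\<^esub> (?X \<otimes>\<^bsub>JF0\<^esub> ?Y) \<oplus>\<^bsub>JF0\<^esub> \<ominus>\<^bsub>JF0\<^esub> associator JF0 ?C ?X ?Y"
    by (rule JF.M.a_comm) (intro JF.M.a_inv_closed JF.associator_closed m cl)+
  also have "\<ominus>\<^bsub>JF0\<^esub> associator JF0 ?C ?X ?Y = (- 1) \<odot>\<^bsub>JF0\<^esub> associator JF0 ?C ?X ?Y"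
    by (rule JF.uminus_eq_smult) (intro JF.associator_closed cl)
  finally have "JF0_proj (napoly_mult x (napoly_mult c y)) = JF0_proj (napoly_mult c (napoly_mult x y) + napoly_smult (- 1) (JN.as c x y))"
    by (simp only: JF0_proj_simps(1-3) JF0_as)
  then have "JF0_proj (napoly_mult x (napoly_mult c y) - (napoly_mult c (napoly_mult x y) + napoly_smult (- 1) (JN.as c x y))) = \<zero>\<^bsub>JF0\<^esub>"
    unfolding JF0_proj_eq_iff .
  then show "napoly_mult x (napoly_mult c y) - napoly_mult c (napoly_mult x y) - napoly_smult (- 1) (JN.as c x y) \<in> {p. JF0_proj p = \<zero>\<^bsub>JF0\<^esub>}"
    unfolding mem_Collect_eq diff_diff_add .
qed (fact assms)+

lemma napoly_in_JF0_span: "p \<in> JN.mono_span JF0_letters (JF0_odd :: (super_generator, 'k::field_char_0) napoly set)"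
proof (rule free_algebra_generated[of p UNIV])
  show "gen x \<in> JN.mono_span JF0_letters (JF0_odd :: (super_generator, 'k) napoly set)" for x
  proof (cases x)
    case Ev
    have "(gen Ev :: (super_generator, 'k) napoly) \<in> JF0_letters" by (simp add: JF0_letters_def)
    then show ?thesis unfolding Ev by (rule JN.mono_span.even[OF JN.even_mono.intros(1)])
  next
    case Od
    have "(gen Od :: (super_generator, 'k) napoly) \<in> JF0_odd" by (simp add: JF0_odd_def)
    then show ?thesis unfolding Od by (rule JN.mono_span.odd[OF JN.odd_mono.intros(1)])
  qed
  show "0 \<in> JN.mono_span JF0_letters (JF0_odd :: (super_generator, 'k) napoly set)"
    by (rule JN.mono_span.ideal) (simp add: JF0_proj_simps(4))
qed (simp, rule JN.mono_span.add, assumption+, rule JN.mono_span.sc, assumption, rule JF0_span_mult)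

text \<open>The monomial z^i w^j without a unit at hand: the innermost factor is w if there is one
  and z otherwise, whence the exponents lowered by one. The meaningless pair (0,0) would give z and
  is kept out of \<open>JF0_index\<close>.\<close>

definition nfE :: "nat \<Rightarrow> nat \<Rightarrow> (super_generator, 'k::field_char_0) napoly" where
  "nfE i j = (if j = 0 then (napoly_mult (gen Ev) ^^ (i - 1)) (gen Ev)
    else (napoly_mult (gen Ev) ^^ i) ((napoly_mult wE ^^ (j - 1)) wE))"

definition nfO :: "nat \<Rightarrow> nat \<Rightarrow> (super_generator, 'k::field_char_0) napoly" where
  "nfO i j = (napoly_mult (gen Ev) ^^ i) ((napoly_mult wE ^^ j) (gen Od))"

lemma z_nfE: "0 < i + j \<Longrightarrow> napoly_mult (gen Ev) (nfE i j) = nfE (Suc i) j"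
  by (cases i) (simp_all add: nfE_def)

lemma z_nfO: "napoly_mult (gen Ev) (nfO i j) = nfO (Suc i) j"
  by (simp add: nfO_def)

lemma JF0_wz_part:
  assumes "JF0_proj p \<in> part JF0 k"
  shows "JF0_proj (napoly_mult (gen Ev) p) \<in> part JF0 k" "JF0_proj (napoly_mult wE p) \<in> part JF0 k"
proof -
  have l: "gen Ev \<in> JF0_letters" "wE \<in> JF0_letters" by (simp_all add: JF0_letters_def)
  show "JF0_proj (napoly_mult (gen Ev) p) \<in> part JF0 k" "JF0_proj (napoly_mult wE p) \<in> part JF0 k"
    unfolding JF0_proj_simps(2)
    using JF.part_mult[OF JS.Zev_part[OF JF0_letter_Zev[OF l(1)]] assms] JF.part_mult[OF JS.Zev_part[OF JF0_letter_Zev[OF l(2)]] assms]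
    unfolding add_0_left .
qed

text \<open>The letters commute and associate with homogeneous elements, so a new w can be moved
  inward past the power of z; this restores the order of the normal form.\<close>

lemma JF0_w_z_pow:
  assumes p: "JF0_proj p \<in> part JF0 k"
  shows "JF0_proj (napoly_mult wE ((napoly_mult (gen Ev) ^^ n) p)) = JF0_proj ((napoly_mult (gen Ev) ^^ n) (napoly_mult wE p))"
proof (induction n)
  case (Suc n)
  let ?p = "(napoly_mult (gen Ev) ^^ n) p"
  have l: "gen Ev \<in> JF0_letters" "wE \<in> JF0_letters" by (simp_all add: JF0_letters_def)
  note Z = JF0_letter_Zev[OF l(1)] JF0_letter_Zev[OF l(2)]
  have part: "JF0_proj ?p \<in> part JF0 k"
  proof (induction n)
    case (Suc n)
    then show ?case unfolding funpow.simps o_apply by (rule JF0_wz_part(1))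
  qed (simp add: p)
  note cl = JF.part_closed[OF JS.Zev_part[OF Z(1)]] JF.part_closed[OF JS.Zev_part[OF Z(2)]] JF.part_closed[OF part]
  have as: "(JF0_proj c \<otimes>\<^bsub>JF0\<^esub> JF0_proj d) \<otimes>\<^bsub>JF0\<^esub> JF0_proj ?p = JF0_proj c \<otimes>\<^bsub>JF0\<^esub> (JF0_proj d \<otimes>\<^bsub>JF0\<^esub> JF0_proj ?p)"
    if "c \<in> JF0_letters" "d \<in> JF0_letters" for c d
    by (rule JF.minus_eq_zero_iff[THEN iffD1, OF _ _ JS.Zev_assoc[OF JF0_letter_Zev[OF that(1)] JF0_letter_Zev[OF that(2)] part, unfolded associator_def]])
       (intro JF.mult_closed JF0_proj_simps(5))+
  have "JF0_proj (napoly_mult wE ((napoly_mult (gen Ev) ^^ Suc n) p))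
    = JF0_proj wE \<otimes>\<^bsub>JF0\<^esub> (JF0_proj (gen Ev) \<otimes>\<^bsub>JF0\<^esub> JF0_proj ?p)" by (simp add: JF0_proj_simps(2))
  also have "\<dots> = (JF0_proj wE \<otimes>\<^bsub>JF0\<^esub> JF0_proj (gen Ev)) \<otimes>\<^bsub>JF0\<^esub> JF0_proj ?p" by (rule as[OF l(2,1), symmetric])
  also have "JF0_proj wE \<otimes>\<^bsub>JF0\<^esub> JF0_proj (gen Ev) = JF0_proj (gen Ev) \<otimes>\<^bsub>JF0\<^esub> JF0_proj wE"
    by (rule JS.even_commute[OF JS.Zev_part[OF Z(1)] JS.Zev_part[OF Z(2)]])
  also have "\<dots> \<otimes>\<^bsub>JF0\<^esub> JF0_proj ?p = JF0_proj (gen Ev) \<otimes>\<^bsub>JF0\<^esub> (JF0_proj wE \<otimes>\<^bsub>JF0\<^esub> JF0_proj ?p)" by (rule as[OF l])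
  also have "\<dots> = JF0_proj ((napoly_mult (gen Ev) ^^ Suc n) (napoly_mult wE p))"
    using Suc.IH by (simp add: JF0_proj_simps(2))
  finally show ?case .
qed simp

lemma w_pow_part:
  assumes p: "JF0_proj p \<in> part JF0 k" shows "JF0_proj ((napoly_mult wE ^^ n) p) \<in> part JF0 k"
proof (induction n)
  case (Suc n)
  then show ?case unfolding funpow.simps o_apply by (rule JF0_wz_part(2))
qed (simp add: p)

lemma w_nfO: "JF0_proj (napoly_mult wE (nfO i j)) = JF0_proj (nfO i (Suc j))"
  unfolding nfO_def JF0_w_z_pow[OF w_pow_part[OF JF0_gens(2)]] by simp

lemma w_nfE:
  assumes "0 < i + j" shows "JF0_proj (napoly_mult wE (nfE i j)) = JF0_proj (nfE i (Suc j))"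
proof -
  have l: "gen Ev \<in> JF0_letters" "wE \<in> JF0_letters" by (simp_all add: JF0_letters_def)
  note Z = JS.Zev_part[OF JF0_letter_Zev[OF l(1)]] JS.Zev_part[OF JF0_letter_Zev[OF l(2)]]
  show ?thesis
  proof (cases j)
    case 0
    then obtain i' where i: "i = Suc i'" using assms by (cases i) auto
    have c: "JF0_proj (napoly_mult wE (gen Ev)) = JF0_proj (napoly_mult (gen Ev) wE)"
      unfolding JF0_proj_simps(2) by (rule JS.even_commute[OF Z])
    have e: "JF0_proj ((napoly_mult (gen Ev) ^^ n) (napoly_mult wE (gen Ev))) = JF0_proj ((napoly_mult (gen Ev) ^^ n) (napoly_mult (gen Ev) wE))" for n
      by (induction n) (simp_all add: c JF0_proj_simps(2)[of "gen Ev" "(_ ^^ _) _"])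
    show ?thesis
      using trans[OF JF0_w_z_pow[OF Z(1), of i'] e[of i']] unfolding 0 i nfE_def by (simp add: funpow_swap1)
  next
    case (Suc j')
    then show ?thesis unfolding nfE_def using JF0_w_z_pow[OF w_pow_part[OF Z(2)], of i j'] by simp
  qed
qed

lemma even_mono_nf: "JN.even_mono JF0_letters u \<Longrightarrow> \<exists>i j. 0 < i + j \<and> JF0_proj u = JF0_proj (nfE i j)"
proof (induction rule: JN.even_mono.induct)
  case (1 c)
  then consider "c = gen Ev" | "c = wE" by (auto simp: JF0_letters_def)
  then show ?case
  proof cases
    case 1 then show ?thesis by - (rule exI[of _ 1], rule exI[of _ 0], simp add: nfE_def)
  next
    case 2 then show ?thesis by - (rule exI[of _ 0], rule exI[of _ 1], simp add: nfE_def)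
  qed
next
  case (2 c x)
  from 2(3) obtain i j where ij: "0 < i + j" "JF0_proj x = JF0_proj (nfE i j)" by (elim exE conjE) (rule that)
  have e: "JF0_proj (napoly_mult c x) = JF0_proj (napoly_mult c (nfE i j))" unfolding JF0_proj_simps(2) ij(2) ..
  consider "c = gen Ev" | "c = wE" using 2(1) by (auto simp: JF0_letters_def)
  then show ?case
  proof cases
    case 1
    have "JF0_proj (napoly_mult c x) = JF0_proj (nfE (Suc i) j)" using e unfolding 1 z_nfE[OF ij(1)] .
    then show ?thesis by - (rule exI[of _ "Suc i"], rule exI[of _ j], rule conjI, rule add_Suc[THEN ssubst], rule zero_less_Suc, assumption)
  next
    case 2
    have "JF0_proj (napoly_mult c x) = JF0_proj (nfE i (Suc j))" using e unfolding 2 w_nfE[OF ij(1)] .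
    then show ?thesis by - (rule exI[of _ i], rule exI[of _ "Suc j"], rule conjI, rule add_Suc_right[THEN ssubst], rule zero_less_Suc, assumption)
  qed
qed

lemma odd_mono_nf: "JN.odd_mono JF0_letters JF0_odd u \<Longrightarrow> \<exists>i j. JF0_proj u = JF0_proj (nfO i j)"
proof (induction rule: JN.odd_mono.induct)
  case (1 c)
  then show ?case by (intro exI[of _ 0]) (simp add: nfO_def JF0_odd_def)
next
  case (2 c x)
  from 2(3) obtain i j where ij: "JF0_proj x = JF0_proj (nfO i j)" by (elim exE conjE) (rule that)
  have e: "JF0_proj (napoly_mult c x) = JF0_proj (napoly_mult c (nfO i j))" unfolding JF0_proj_simps(2) ij ..
  consider "c = gen Ev" | "c = wE" using 2(1) by (auto simp: JF0_letters_def)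
  then show ?case
  proof cases
    case 1
    have "JF0_proj (napoly_mult c x) = JF0_proj (nfO (Suc i) j)" using e unfolding 1 z_nfO .
    then show ?thesis by - (rule exI[of _ "Suc i"], rule exI[of _ j], assumption)
  next
    case 2
    have "JF0_proj (napoly_mult c x) = JF0_proj (nfO i (Suc j))" using e unfolding 2 w_nfO .
    then show ?thesis by - (rule exI[of _ i], rule exI[of _ "Suc j"], assumption)
  qed
qed

definition JF0_nf :: "nat \<times> nat \<times> bool \<Rightarrow> (super_generator, 'k::field_char_0) napoly" where
  "JF0_nf t = (case t of (i, j, b) \<Rightarrow> if b then nfO i j else nfE i j)"

definition JF0_index :: "(nat \<times> nat \<times> bool) set" where
  "JF0_index = {(i, j, b). b \<or> 0 < i + j}"

lemma napoly_map_ident: "Poly_Mapping.map (\<lambda>a. a) p = (p :: ('x, 'k::field) napoly)"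
proof -
  have "(\<lambda>a. a) = ((*) 1 :: 'k \<Rightarrow> 'k)" by (rule ext) simp
  then show ?thesis using napoly_smult_one[of p] by (simp only:)
qed

lemma JF0_span_nf:
  assumes "p \<in> JN.mono_span JF0_letters JF0_odd"
  shows "\<exists>T d. finite T \<and> T \<subseteq> JF0_index \<and> JF0_proj p = JF0_proj (\<Sum>t\<in>T. napoly_smult (d t) (JF0_nf t))"
  using assms
proof (induction rule: JN.mono_span.induct)
  case (even x)
  from even_mono_nf[OF even] obtain i j where "0 < i + j" "JF0_proj x = JF0_proj (nfE i j)" by (elim exE conjE) (rule that)
  then show ?case
    by (intro exI[of _ "{(i, j, False)}"] exI[of _ "\<lambda>_. 1"]) (simp add: JF0_nf_def JF0_index_def napoly_map_ident)
next
  case (odd x)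
  from odd_mono_nf[OF odd] obtain i j where "JF0_proj x = JF0_proj (nfO i j)" by (elim exE conjE) (rule that)
  then show ?case
    by (intro exI[of _ "{(i, j, True)}"] exI[of _ "\<lambda>_. 1"]) (simp add: JF0_nf_def JF0_index_def napoly_map_ident)
next
  case (ideal x)
  then show ?case by (intro exI[of _ "{}"]) (simp add: JF0_proj_simps(4))
next
  case (add x y)
  from add.IH(1) obtain T d where T: "finite T" "T \<subseteq> JF0_index" "JF0_proj x = JF0_proj (\<Sum>t\<in>T. napoly_smult (d t) (JF0_nf t))" by (elim exE conjE) (rule that)
  from add.IH(2) obtain T' d' where T': "finite T'" "T' \<subseteq> JF0_index" "JF0_proj y = JF0_proj (\<Sum>t\<in>T'. napoly_smult (d' t) (JF0_nf t))" by (elim exE conjE) (rule that)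
  let ?d = "\<lambda>t. (if t \<in> T then d t else 0) + (if t \<in> T' then d' t else 0)"
  have e: "(\<Sum>t\<in>T \<union> T'. napoly_smult (if t \<in> S then c t else 0) (JF0_nf t)) = (\<Sum>t\<in>S. napoly_smult (c t) (JF0_nf t))"
    if "S \<subseteq> T \<union> T'" for S c
    by (rule sum.mono_neutral_cong_right) (use that T(1) T'(1) in auto)
  have "(\<Sum>t\<in>T \<union> T'. napoly_smult (?d t) (JF0_nf t)) = (\<Sum>t\<in>T. napoly_smult (d t) (JF0_nf t)) + (\<Sum>t\<in>T'. napoly_smult (d' t) (JF0_nf t))"
    unfolding napoly_add_smult sum.distrib using e[of T d] e[of T' d'] by simp
  then have "JF0_proj (x + y) = JF0_proj (\<Sum>t\<in>T \<union> T'. napoly_smult (?d t) (JF0_nf t))"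
    by (simp only: JF0_proj_simps(1) T(3) T'(3))
  moreover have "finite (T \<union> T')" "T \<union> T' \<subseteq> JF0_index" using T T' by auto
  ultimately show ?case by (intro exI[of _ "T \<union> T'"] exI[of _ ?d] conjI)
next
  case (sc x c)
  from sc(2) obtain T d where T: "finite T" "T \<subseteq> JF0_index" "JF0_proj x = JF0_proj (\<Sum>t\<in>T. napoly_smult (d t) (JF0_nf t))" by (elim exE conjE) (rule that)
  have "JF0_proj (napoly_smult c x) = JF0_proj (\<Sum>t\<in>T. napoly_smult (c * d t) (JF0_nf t))"
    unfolding JF0_proj_simps(3) T(3) unfolding JF0_proj_simps(3)[symmetric] napoly_smult_sum napoly_smult_smult ..
  with T(1,2) show ?case by (intro exI[of _ T] exI[of _ "\<lambda>t. c * d t"] conjI)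
qed

subsection \<open>Separation\<close>

lemma jev_diff: "jev c (p - r) = jev c p - jev c r"
proof -
  have "jev c (p + napoly_smult (- 1) r) = jev c p + vs (- 1) (jev c r)" by (simp only: jev_simps)
  then show ?thesis by (simp add: napoly_smult_minus_one)
qed

lemma jev_w: "jev c wE = ([:c / 2:], 0)"
proof -
  have "jev c wE = vjordan.vas ([:0, c:], 0) (0, 1) (0, 1)"
    unfolding wE_def JN.as_def jev_diff jev_simps vjordan.vas_def ..
  then show ?thesis by (simp add: vas_even_odd_odd pderiv_pCons)
qed

lemma jev_even_pow:
  assumes "jev c a = (f, 0)" shows "jev c ((napoly_mult a ^^ n) p) = (f ^ n * fst (jev c p), f ^ n * snd (jev c p))"
  by (induction n) (simp_all add: jev_simps(2) assms vm_def mult.assoc)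

lemma jev_nf:
  assumes "t = (i, j, b)" "t \<in> JF0_index"
  shows "jev c (JF0_nf t) = (if b then (0, monom (c ^ i * (c / 2) ^ j) i) else (monom (c ^ i * (c / 2) ^ j) i, 0))"
proof -
  have 1: "[:0, c:] ^ n = monom (c ^ n) n" for n
    by (induction n) (simp_all add: monom_Suc smult_monom)
  have 2: "[:c / 2:] ^ n = [:(c / 2) ^ n:]" for n
    by (induction n) simp_all
  have 3: "[:0, c:] ^ i * [:c / 2:] ^ j = monom (c ^ i * (c / 2) ^ j) i"
    unfolding 1 2 by (simp add: smult_monom mult.commute)
  show ?thesis
  proof (cases b)
    case True
    then show ?thesis
      using 3 by (simp add: JF0_nf_def assms(1) nfO_def jev_even_pow[OF jev_simps(4)] jev_even_pow[OF jev_w] jev_simps(5) mult.assoc)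
  next
    case False
    have "jev c (nfE i j) = ([:0, c:] ^ i * [:c / 2:] ^ j, 0)"
    proof (cases j)
      case 0
      then obtain i' where "i = Suc i'" using assms False by (cases i) (auto simp: JF0_index_def)
      then show ?thesis using 0 by (simp add: nfE_def jev_even_pow[OF jev_simps(4)] jev_simps(4) mult.commute)
    next
      case (Suc j')
      then show ?thesis
        by (simp add: nfE_def jev_even_pow[OF jev_simps(4)] jev_even_pow[OF jev_w] jev_w mult.commute mult.left_commute)
    qed
    then show ?thesis using False 3 by (simp add: JF0_nf_def assms(1))
  qed
qed

lemma jev_sum: "jev c (\<Sum>t\<in>T. napoly_smult (d t) (f t)) = (\<Sum>t\<in>T. vs (d t) (jev c (f t)))"
  by (induction T rule: infinite_finite_induct) (simp_all add: jev_simps)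

text \<open>Normal forms with exponents i and j have values c^i (c/2)^j t^i in their component. As
  for \<open>A0\<close>, the degree in t gives i, and the exponent i + j of c then gives j.\<close>

lemma JF0_separation:
  fixes p :: "(super_generator, 'k::field_char_0) napoly"
  assumes z: "\<And>c. jev c p = 0" shows "JF0_proj p = \<zero>\<^bsub>JF0\<^esub>"
proof -
  obtain T and d :: "nat \<times> nat \<times> bool \<Rightarrow> 'k" where T: "finite T" "T \<subseteq> JF0_index"
    "JF0_proj p = JF0_proj (\<Sum>t\<in>T. napoly_smult (d t) (JF0_nf t))"
    using JF0_span_nf[OF napoly_in_JF0_span[of p]] by (elim exE conjE) (rule that)
  have zero: "(\<Sum>t\<in>T. vs (d t) (jev c (JF0_nf t))) = 0" for c
  proof -
    obtain g where g: "super_hom JF0 VJ g" "\<And>p. g (JF0_proj p) = jev c p" by (rule JF0_lift[where c = c]) (rule that, assumption, blast)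
    have "jev c (\<Sum>t\<in>T. napoly_smult (d t) (JF0_nf t)) = jev c p" unfolding g(2)[symmetric] T(3) ..
    then show ?thesis unfolding jev_sum z .
  qed
  have "d t = 0" if t: "t \<in> T" for t
  proof -
    obtain i j b where ijb: "t = (i, j, b)" by (cases t)
    define \<phi> where "\<phi> x = coeff (if b then snd x else fst x) i" for x :: "'k poly \<times> 'k poly"
    have \<phi>: "\<phi> (x + y) = \<phi> x + \<phi> y" "\<phi> (vs a x) = a * \<phi> x" "\<phi> 0 = 0" for x y a
      by (simp_all add: \<phi>_def vs_def)
    have \<phi>s: "\<phi> (\<Sum>t\<in>S. vs (d t) (k t)) = (\<Sum>t\<in>S. d t * \<phi> (k t))" for S :: "(nat \<times> nat \<times> bool) set" and k
      by (induction S rule: infinite_finite_induct) (simp_all add: \<phi>)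
    let ?T = "{t \<in> T. fst t = i \<and> snd (snd t) = b}"
    let ?c = "\<lambda>t. d t * (1 / 2) ^ fst (snd t)"
    have "?c t = 0"
    proof (rule vandermonde_zero[of ?T "\<lambda>t. fst t + fst (snd t)" ?c t])
      fix x :: 'k
      have "0 = \<phi> (\<Sum>t\<in>T. vs (d t) (jev x (JF0_nf t)))" unfolding zero by (simp add: \<phi>_def)
      also have "\<dots> = (\<Sum>t\<in>T. d t * \<phi> (jev x (JF0_nf t)))" by (rule \<phi>s)
      also have "\<dots> = (\<Sum>t\<in>?T. ?c t * x ^ (fst t + fst (snd t)))"
      proof (rule sum.mono_neutral_cong_right)
        have nf: "\<phi> (jev x (JF0_nf s)) = (if fst s = i \<and> snd (snd s) = b then x ^ fst s * (x / 2) ^ fst (snd s) else 0)"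
          if s: "s \<in> T" for s
        proof -
          have "s \<in> JF0_index" using s T(2) by blast
          from jev_nf[OF _ this, of "fst s" "fst (snd s)" "snd (snd s)" x]
          have "jev x (JF0_nf s) = (if snd (snd s) then (0, monom (x ^ fst s * (x / 2) ^ fst (snd s)) (fst s))
            else (monom (x ^ fst s * (x / 2) ^ fst (snd s)) (fst s), 0))" by simp
          then show ?thesis unfolding \<phi>_def by (cases b; cases "snd (snd s)") simp_all
        qed
        show "\<forall>s\<in>T - ?T. d s * \<phi> (jev x (JF0_nf s)) = 0"
        proof
          fix s assume "s \<in> T - ?T"
          then have "s \<in> T" and k: "\<not> (fst s = i \<and> snd (snd s) = b)" by blast+
          then show "d s * \<phi> (jev x (JF0_nf s)) = 0" unfolding nf[OF \<open>s \<in> T\<close>] if_not_P[OF k] by simp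
        qed
        show "d s * \<phi> (jev x (JF0_nf s)) = ?c s * x ^ (fst s + fst (snd s))" if "s \<in> ?T" for s
        proof -
          have "s \<in> T" and k: "fst s = i \<and> snd (snd s) = b" using that by blast+
          then show ?thesis unfolding nf[OF \<open>s \<in> T\<close>] if_P[OF k] by (simp add: power_add power_divide)
        qed
      qed (use T in auto)
      finally show "(\<Sum>t\<in>?T. ?c t * x ^ (fst t + fst (snd t))) = 0" by simp
    qed (use T t ijb in \<open>auto simp: inj_on_def\<close>)
    then show ?thesis by simp
  qed
  then have "(\<Sum>t\<in>T. napoly_smult (d t) (JF0_nf t)) = 0" by (intro sum.neutral) simp
  then show ?thesis using T(3) by (simp add: JF0_proj_simps(4))
qed

subsection \<open>Identities of the Grassmann envelope of \<open>JF\<^sub>0\<close>\<close>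

text \<open>Constants are reached because w goes to 1/2 at c = 1, which the coefficient 2a in the
  witness compensates. The Jordan side thus needs no enlargement of the Grassmann support.\<close>

lemma jev_surj: "\<exists>p. jev 1 p = (y :: 'k::field_char_0 poly \<times> 'k poly)"
proof -
  have ev: "\<exists>p. jev 1 p = (u, 0)" for u :: "'k poly"
  proof (induction u)
    case 0
    show ?case by (rule exI[of _ 0]) (simp add: jev_simps(6) zero_prod_def)
  next
    case (pCons a u)
    then obtain p where "jev 1 p = (u, 0)" by blast
    then have "jev 1 (napoly_smult (2 * a) wE + napoly_mult (gen Ev) p) = (pCons a u, 0)"
      unfolding jev_simps jev_w by (simp add: vs_def vm_def)
    then show ?case ..
  qed
  obtain p r where "jev 1 p = (fst y, 0)" "jev 1 r = (snd y, 0)" using ev by metis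
  then have "jev 1 (p + napoly_mult r (gen Od)) = y" unfolding jev_simps by (simp add: vm_def prod_eq_iff)
  then show ?thesis ..
qed

text \<open>Surjectivity at c = 1 gives one inclusion. The other comes from joint separation over
  all c, applied to each component of an element of the envelope.\<close>

lemma identities_EnvJF0:
  "identities (grassmann_envelope JF0) = identities (EnvJ :: ('k::field_char_0, nat set \<Rightarrow> 'k poly \<times> 'k poly) module)"
proof
  obtain g where g: "super_hom JF0 VJ g" "\<And>p. g (JF0_proj p) = jev (1 :: 'k) p" by (rule JF0_lift[where c = 1]) (rule that, assumption, blast)
  interpret g: super_hom JF0 VJ g by fact
  have "part VJ i \<subseteq> g ` part JF0 i" for i
  proof
    fix y :: "'k poly \<times> 'k poly" assume y: "y \<in> part VJ i"
    obtain p where p: "jev 1 p = y" using jev_surj[of y] by blast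
    obtain a0 a1 where a: "a0 \<in> part JF0 0" "a1 \<in> part JF0 1" "JF0_proj p = a0 \<oplus>\<^bsub>JF0\<^esub> a1"
      using JF.part_decomp[OF JF0_proj_simps(5)[of p]] by blast
    have "g (a0 \<oplus>\<^bsub>JF0\<^esub> a1) = g a0 \<oplus>\<^bsub>VJ\<^esub> g a1" by (rule g.hom_add[OF JF.part_closed[OF a(1)] JF.part_closed[OF a(2)]])
    then have e: "y = g a0 + g a1" unfolding a(3)[symmetric] g(2) p by simp
    have s: "snd (g a0) = 0" "fst (g a1) = 0" using g.hom_part[OF a(1)] g.hom_part[OF a(2)] by simp_all
    show "y \<in> g ` part JF0 i"
    proof (cases "i = 0")
      case True
      then have "y = g a0" using y e s by (simp add: prod_eq_iff)
      then show ?thesis using a(1) True by blast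
    next
      case False
      then have i: "i = 1" by simp
      then have "y = g a1" using y e s by (simp add: prod_eq_iff)
      then show ?thesis using a(2) i by blast
    qed
  qed
  then show "identities (grassmann_envelope JF0) \<subseteq> identities (EnvJ :: ('k, nat set \<Rightarrow> 'k poly \<times> 'k poly) module)"
    by (intro g.env.identities_mono_surj g.env_surj)
  show "identities (EnvJ :: ('k, nat set \<Rightarrow> 'k poly \<times> 'k poly) module) \<subseteq> identities (grassmann_envelope JF0)"
  proof
    fix f :: "(nat, 'k) napoly" assume f: "f \<in> identities EnvJ"
    show "f \<in> identities (grassmann_envelope JF0)"
      unfolding nonassoc_algebra.identities_iff[OF JF.nonassoc_algebra_env]
    proof (intro allI impI)
      fix v :: "nat \<Rightarrow> nat set \<Rightarrow> (super_generator, 'k) napoly set set set"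
      assume v: "\<forall>x. v x \<in> carrier (grassmann_envelope JF0)"
      let ?e = "napoly_eval (grassmann_envelope JF0) v f"
      have ec: "?e \<in> carrier (grassmann_envelope JF0)" by (rule nonassoc_algebra.napoly_eval_closed[OF JF.nonassoc_algebra_env]) (use v in blast)
      have "?e S = \<zero>\<^bsub>JF0\<^esub>" for S
      proof -
        obtain p where p: "?e S = JF0_proj p" using JF.env_closed[OF ec, of S] unfolding JF0_carrier by blast
        have "jev c p = 0" for c
        proof -
          obtain g where g: "super_hom JF0 VJ g" "\<And>p. g (JF0_proj p) = jev c p" by (rule JF0_lift[where c = c]) (rule that, assumption, blast)
          interpret g: super_hom JF0 VJ g by fact
          have "(\<lambda>S. g (?e S)) = napoly_eval EnvJ (\<lambda>x S. g (v x S)) f"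
            by (rule g.env.hom_napoly_eval) (use v in blast)
          also have "\<dots> = \<zero>\<^bsub>EnvJ\<^esub>"
            by (rule f[unfolded nonassoc_algebra.identities_iff[OF vjordan.nonassoc_algebra_env], THEN spec, THEN mp], rule allI, rule g.env.hom_closed) (use v in blast)
          finally have "g (?e S) = 0" by (simp add: fun_eq_iff)
          then show ?thesis unfolding p g(2) .
        qed
        then show ?thesis unfolding p by (rule JF0_separation)
      qed
      then show "?e = \<zero>\<^bsub>grassmann_envelope JF0\<^esub>" by (simp add: fun_eq_iff)
    qed
  qed
qed

lemma identities_plus_A0_JV0: "identities (plus_algebra A0) = (JV0 :: (nat, 'k::field_char_0) napoly set)"
  unfolding JV0_def identities_EnvJF0 identities_EnvJ by (rule identities_plus_A0)

theorem proposition9p1: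
  fixes \<X> :: "'x set"
    and F :: "('k::field_char_0, ('x, 'k) napoly set) module"
    and J :: "('k, ('x, 'k) napoly set) module"
  defines "F \<equiv> relatively_free V0 \<X>"
    and "J \<equiv> subalgebra_gen (plus_algebra F) (relatively_free_gen V0 \<X> ` \<X>)"
  assumes "countable \<X>" and "infinite \<X>"
  shows "alg_isomorphic J (relatively_free JV0 \<X> :: ('k, ('x, 'k) napoly set) module)"
proof -
  have "\<X> \<noteq> {}" using \<open>infinite \<X>\<close> by auto
  then show ?thesis
    unfolding F_def J_def V0_def identities_plus_A0_JV0[symmetric]
    by (rule plus_subalgebra_isomorphic[OF A0.nonassoc_algebra_axioms \<open>countable \<X>\<close>])
qed

end
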